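(* Let $\rho:\pi_1(M)\to\mathrm{PGL}(3,\mathbb{C})$ be a decorated representation of the fundamental group of a cusped hyperbolic $3$-manifold $M$ of finite volume. Let $\rho^*:\pi_1(M)\to\mathrm{PGL}(3,\mathbb{C})$ be the dual decorated representation (transpose inverse). Then $\beta(\rho)=\beta(\rho^* )$ in $\mathcal{P}(\mathbb{C})$.
   Context: Flags. Let $V=\mathbb{C}^3$ with its standard basis. A flag of $\mathbb{P}(V)=\mathbb{CP}^2$ is a pair $([x],[f])\in\mathbb{P}(V)\times\mathbb{P}(V^* )$ with $f(x)=0$; $\mathrm{PGL}(3,\mathbb{C})$ acts by $A([x],[f])=([Ax],[f\circ A^{-1}])$, and configurations are orbits of ordered tuples of flags. A configuration $T=([x_i],[f_i])_{1\le i\le 4}$ is a generic tetrahedron of flags if $f_i(x_j)\ne0$ for $i\ne j$ and no three of the $[x_i]$ are collinear. The dual of a flag $([x],[f])$ is $([f],[x])$ (identifying $V^*$ with $V$ through the dual basis). Coordinates. For $i\neq j$, with $k,l$ such that $(1,2,3,4)\mapsto(i,j,k,l)$ is even, $z_{ij}(T)=\frac{f_i(x_k)\det(x_i,x_j,x_l)}{f_i(x_l)\det(x_i,x_j,x_k)}\in\mathbb{C}\setminus\{0,1\}$. For distinct $i,j,k$, $z_{ijk}(T)=\frac{f_i(x_j)f_j(x_k)f_k(x_i)}{f_i(x_k)f_j(x_i)f_k(x_j)}$. Decorated representations. A decorated representation $\rho:\pi_1(M)\to\mathrm{PGL}(3,\mathbb{C})$ is a representation together with an assignment of a flag to each cusp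 such that each boundary holonomy preserves that flag (equivalently, a $\rho$-equivariant assignment of flags to the lifts of the cusps in the universal cover). The dual decorated representation $\rho^*$ is $\gamma\mapsto(\rho(\gamma)^{T})^{-1}$ with the dual flags at the cusps. Triangulations and parabolic decorations. An ideal triangulation $K=\bigcup_{\nu=1}^N T_\nu$ is a finite union of oriented $3$-simplices with faces identified in pairs by orientation-reversing simplicial maps (identifications on the boundary of a single simplex are allowed). Here $|K|$ is $M$ with each cusp compactified by one point; these points are vertices of $K$, and $K$ may have further vertices in $M$. The vertices of each $T_\nu$ are ordered as $1,2,3,4$ compatibly with its orientation. A generic parabolic decoration $(K,z)$ assigns flags to the vertices of each $T_\nu$, forming a generic tetrahedron of flags (also denoted $T_\nu$) with coordinates $z_{ij}(T_\nu)$, such that the following hold. - Face equations: if $T,T'$ share a face $(ijk)$, oriented as a boundary face of $T$, then $z_{ijk}(T)z_{ikj}(T')=1$. - Edge equations: for each edge $e$ of $|K|$, if $T_{\nu_1},\dots,T_{\nu_n}$ are the simplices (with multiplicity) containing an edge $ij$ that projects to $e$ (with a consistent orientation), then $z_{ij}(T_{\nu_1})\cdots z_{ij}(T_{\nu_n})=z_{ji}(T_{\nu_1})\cdots z_{ji}(T_{\nu_n})=1$. Developing the tetrahedra of flags over the lifted triangulation of the universal cover (matching flags along common faces by elements of $\mathrm{PGL}(3,\mathbb{C})$) gives an assignment of flags to the lifted vertices, equivariant with respect to a representation of $\pi_1(M)$, called the holonomy of $(K,z)$. The invariant. $\mathcal{P}(\mathbb{C})$ is the quotient of $\mathbb{Z}[\mathbb{C}\setminus\{0,1\}]$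 by the subgroup generated by $[x]-[y]+[\frac yx]-[\frac{1-x^{-1}}{1-y^{-1}}]+[\frac{1-x}{1-y}]$, $x\ne y$. For a parabolic decoration, $\beta(K,z)=\sum_{\nu=1}^N\big([z_{12}(T_\nu)]+[z_{21}(T_\nu)]+[z_{34}(T_\nu)]+[z_{43}(T_\nu)]\big)$. For every decorated representation $\rho$ there is an ideal triangulation $K$ of $M$ (sufficiently fine) and a generic parabolic decoration $(K,z)$ whose holonomy is the given decorated representation (a result recalled by the paper from the literature). One defines $\beta(\rho)=\beta(K,z)\in\mathcal{P}(\mathbb{C})$, which does not depend on the choice of $(K,z)$. *)

theory Defs
  imports
    "HOL-Analysis.Analysis"
    "HOL-Algebra.Free_Abelian_Groups"
    "HOL-Combinatorics.Permutations"
begin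

section \<open>Projective spaces and projective linear groups\<close>

text \<open>A point of \<open>P(C^n)\<close> is the set of nonzero multiples of a nonzero vector; an element of
  \<open>PGL(n,C)\<close> is a coset of the scalar matrices, hence itself a set of matrices.\<close>

definition proj_point :: "complex^'n \<Rightarrow> (complex^'n) set" where
  "proj_point x = {c *s x |c. c \<noteq> 0}"

definition proj_space :: "(complex^'n) set set" where
  "proj_space = {proj_point x |x. x \<noteq> 0}"

definition GL :: "(complex^'n^'n) monoid" where
  "GL = \<lparr>carrier = {A. invertible A}, mult = (\<lambda>A B. A ** B), one = mat 1\<rparr>"

definition scalars :: "(complex^'n^'n) set" where
  "scalars = {mat c |c. c \<noteq> 0}"

definition PGL :: "(complex^'n^'n) set monoid" where
  "PGL = GL Mod scalars"

text \<open>\<open>[A][x] = [Ax]\<close>; as \<open>[A]\<close> and \<open>[x]\<close> are sets, all representatives are used at once.\<close>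

definition proj_act :: "(complex^'n^'n) set \<Rightarrow> (complex^'n) set \<Rightarrow> (complex^'n) set" where
  "proj_act g X = {A *v x |A x. A \<in> g \<and> x \<in> X}"

text \<open>Linear forms are identified with vectors through the dual basis,
  \<open>f(x) = scalar_product f x\<close>; then \<open>f \<circ> A\<^sup>-\<^sup>1\<close> is the row vector \<open>f v* A\<^sup>-\<^sup>1\<close>.\<close>

definition dual_proj_act :: "(complex^'n^'n) set \<Rightarrow> (complex^'n) set \<Rightarrow> (complex^'n) set" where
  "dual_proj_act g F = {f v* matrix_inv A |A f. A \<in> g \<and> f \<in> F}"

text \<open>The class of \<open>(A\<^sup>T)\<^sup>-\<^sup>1\<close>, for \<open>g\<close> the class of \<open>A\<close>.\<close>

definition transpose_inverse :: "(complex^'n^'n) set \<Rightarrow> (complex^'n^'n) set" where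
  "transpose_inverse g = (\<lambda>A. matrix_inv (transpose A)) ` g"


section \<open>Flags and tetrahedra of flags\<close>

type_synonym flag = "(complex^3) set \<times> (complex^3) set"

definition flags :: "flag set" where
  "flags = {(proj_point x, proj_point f) |x f. x \<noteq> 0 \<and> f \<noteq> 0 \<and> scalar_product f x = 0}"

definition flag_act :: "(complex^3^3) set \<Rightarrow> flag \<Rightarrow> flag" where
  "flag_act g \<phi> = (proj_act g (fst \<phi>), dual_proj_act g (snd \<phi>))"

definition dual_flag :: "flag \<Rightarrow> flag" where
  "dual_flag \<phi> = (snd \<phi>, fst \<phi>)"

text \<open>The vertex labels \<open>1,2,3,4\<close> are the four elements of the numeral type \<open>4\<close>
  (in which \<open>4 = 0\<close>).
  The functions \<open>xvec\<close> and \<open>fvec\<close> pick representatives of the point and of the line; the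
  conditions and coordinates below do not depend on them.\<close>

type_synonym tetrahedron = "4 \<Rightarrow> flag"

definition xvec :: "tetrahedron \<Rightarrow> 4 \<Rightarrow> complex^3" where
  "xvec T i = (SOME x. x \<in> fst (T i))"

definition fvec :: "tetrahedron \<Rightarrow> 4 \<Rightarrow> complex^3" where
  "fvec T i = (SOME f. f \<in> snd (T i))"

definition det3 :: "complex^3 \<Rightarrow> complex^3 \<Rightarrow> complex^3 \<Rightarrow> complex" where
  "det3 x y z = det (vector [x, y, z] :: complex^3^3)"

definition generic_tetrahedron :: "tetrahedron \<Rightarrow> bool" where
  "generic_tetrahedron T \<longleftrightarrow>
     (\<forall>i. T i \<in> flags) \<and>
     (\<forall>i j. i \<noteq> j \<longrightarrow> scalar_product (fvec T i) (xvec T j) \<noteq> 0) \<and>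
     (\<forall>i j k. distinct [i, j, k] \<longrightarrow> det3 (xvec T i) (xvec T j) (xvec T k) \<noteq> 0)"

definition even_completion :: "4 \<Rightarrow> 4 \<Rightarrow> 4 \<Rightarrow> 4" where
  "even_completion i j = (THE \<sigma>. \<sigma> permutes UNIV \<and> evenperm \<sigma> \<and> \<sigma> 1 = i \<and> \<sigma> 2 = j)"

definition edge_coord :: "tetrahedron \<Rightarrow> 4 \<Rightarrow> 4 \<Rightarrow> complex" where
  "edge_coord T i j =
    (let k = even_completion i j 3; l = even_completion i j 4 in
      (scalar_product (fvec T i) (xvec T k) * det3 (xvec T i) (xvec T j) (xvec T l)) /
      (scalar_product (fvec T i) (xvec T l) * det3 (xvec T i) (xvec T j) (xvec T k)))"

definition face_coord :: "tetrahedron \<Rightarrow> 4 \<Rightarrow> 4 \<Rightarrow> 4 \<Rightarrow> complex" where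
  "face_coord T i j k =
     (scalar_product (fvec T i) (xvec T j) * scalar_product (fvec T j) (xvec T k) *
      scalar_product (fvec T k) (xvec T i)) /
     (scalar_product (fvec T i) (xvec T k) * scalar_product (fvec T j) (xvec T i) *
      scalar_product (fvec T k) (xvec T j))"


section \<open>The pre-Bloch group\<close>

definition five_term_subgroup :: "(complex \<Rightarrow>\<^sub>0 int) set" where
  "five_term_subgroup = generate (free_Abelian_group (- {0, 1}))
     {frag_of x - frag_of y + frag_of (y / x) - frag_of ((1 - inverse x) / (1 - inverse y))
        + frag_of ((1 - x) / (1 - y)) |x y. x \<notin> {0, 1} \<and> y \<notin> {0, 1} \<and> x \<noteq> y}"

definition pre_Bloch_group :: "(complex \<Rightarrow>\<^sub>0 int) set monoid" where
  "pre_Bloch_group = free_Abelian_group (- {0, 1}) Mod five_term_subgroup"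

definition pre_Bloch_class :: "(complex \<Rightarrow>\<^sub>0 int) \<Rightarrow> (complex \<Rightarrow>\<^sub>0 int) set" where
  "pre_Bloch_class c = five_term_subgroup #>\<^bsub>free_Abelian_group (- {0, 1})\<^esub> c"


section \<open>Hyperbolic 3-space with its ideal boundary\<close>

text \<open>Upper half-space model: the point \<open>(z, t)\<close> with \<open>t > 0\<close>. The action of \<open>PGL(2,C)\<close> is the
  Poincare extension, here in the form which is invariant under rescaling the matrix.\<close>

definition hyp3 :: "(complex \<times> real) set" where
  "hyp3 = {(z, t). t > 0}"

definition hyp_act_mat :: "complex^2^2 \<Rightarrow> complex \<times> real \<Rightarrow> complex \<times> real" where
  "hyp_act_mat A = (\<lambda>(z, t).
    let a = A$1$1; b = A$1$2; c = A$2$1; d = A$2$2;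
        r = (cmod (c * z + d))\<^sup>2 + (cmod c)\<^sup>2 * t\<^sup>2
    in (((a * z + b) * cnj (c * z + d) + a * cnj c * of_real (t\<^sup>2)) / of_real r,
        cmod (det A) * t / r))"

definition hyp_act :: "(complex^2^2) set \<Rightarrow> complex \<times> real \<Rightarrow> complex \<times> real" where
  "hyp_act g p = the_elem ((\<lambda>A. hyp_act_mat A p) ` g)"

definition hyp_volume :: "(complex \<times> real) set \<Rightarrow> ennreal" where
  "hyp_volume S = (\<integral>\<^sup>+p\<in>S. ennreal (1 / (snd p) ^ 3) \<partial>lborel)"

text \<open>Horoballs based at the ideal point \<open>[v1 : v2]\<close> (that is, \<open>v1/v2\<close> in the Riemann sphere).
  For \<open>v = (1, 0)\<close> this is \<open>t > s\<close>; for \<open>v = (a, 1)\<close> it is \<open>t > s (|a - z|\<^sup>2 + t\<^sup>2)\<close>,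
  the ball tangent to the boundary plane at \<open>a\<close>.\<close>

definition horoball :: "complex^2 \<Rightarrow> real \<Rightarrow> (complex \<times> real) set" where
  "horoball v s = {(z, t). t > 0 \<and>
     t / ((cmod (v$1 - v$2 * z))\<^sup>2 + (cmod (v$2))\<^sup>2 * t\<^sup>2) > s}"


section \<open>Cusped hyperbolic 3-manifolds\<close>

text \<open>The oriented complete hyperbolic manifold \<open>M\<close> is presented as the quotient of its universal
  cover \<open>hyp3\<close> by the group \<open>\<Gamma> \<le> PGL(2,C)\<close> of deck transformations, which is \<open>\<pi>\<^sub>1(M)\<close>.
  Fixed points of parabolic elements of \<open>\<Gamma>\<close> are the lifts of the cusps of \<open>M\<close>
  to the universal cover.\<close>

definition parabolic :: "(complex^2^2) set \<Rightarrow> bool" where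
  "parabolic g \<longleftrightarrow> g \<in> carrier PGL \<and> g \<noteq> \<one>\<^bsub>PGL\<^esub> \<and> (\<forall>A\<in>g. (trace A)\<^sup>2 = 4 * det A)"

definition lifted_cusps :: "(complex^2^2) set set \<Rightarrow> (complex^2) set set" where
  "lifted_cusps \<Gamma> = {\<xi> \<in> proj_space. \<exists>g\<in>\<Gamma>. parabolic g \<and> proj_act g \<xi> = \<xi>}"

text \<open>The third conjunct says that the action is properly discontinuous, the fourth that it is free,
  so that the quotient is a manifold covered by \<open>hyp3\<close>. The volume of the quotient is
  the volume of any Borel set containing exactly one point of every orbit. For finite
  volume, having a cusp is equivalent to being noncompact.\<close>

definition cusped_hyperbolic_manifold :: "(complex^2^2) set set \<Rightarrow> bool" where
  "cusped_hyperbolic_manifold \<Gamma> \<longleftrightarrow>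
     subgroup \<Gamma> PGL \<and>
     lifted_cusps \<Gamma> \<noteq> {} \<and>
     (\<forall>C. compact C \<and> C \<subseteq> hyp3 \<longrightarrow> finite {g \<in> \<Gamma>. hyp_act g ` C \<inter> C \<noteq> {}}) \<and>
     (\<forall>g\<in>\<Gamma>. \<forall>p\<in>hyp3. hyp_act g p = p \<longrightarrow> g = \<one>\<^bsub>PGL\<^esub>) \<and>
     (\<exists>S. S \<in> sets borel \<and> S \<subseteq> hyp3 \<and> (\<forall>p\<in>hyp3. \<exists>!q. q \<in> S \<and> (\<exists>g\<in>\<Gamma>. q = hyp_act g p)) \<and>
          hyp_volume S < \<infinity>)"

text \<open>The universal cover together with the lifted cusps. A set is open if it meets \<open>hyp3\<close>
  in an open set and contains a horoball around each of its ideal points.\<close>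

type_synonym ext_point = "(complex \<times> real) + (complex^2) set"

definition ext_hyp3 :: "(complex^2^2) set set \<Rightarrow> ext_point set" where
  "ext_hyp3 \<Gamma> = Inl ` hyp3 \<union> Inr ` lifted_cusps \<Gamma>"

definition ext_topology :: "(complex^2^2) set set \<Rightarrow> ext_point topology" where
  "ext_topology \<Gamma> = topology (\<lambda>U. U \<subseteq> ext_hyp3 \<Gamma> \<and> open {p. Inl p \<in> U} \<and>
     (\<forall>\<xi>. Inr \<xi> \<in> U \<longrightarrow> (\<exists>v\<in>\<xi>. \<exists>s>0. Inl ` horoball v s \<subseteq> U)))"

definition ext_act :: "(complex^2^2) set \<Rightarrow> ext_point \<Rightarrow> ext_point" where
  "ext_act g p = map_sum (hyp_act g) (proj_act g) p"

definition orbit_rel :: "(complex^2^2) set set \<Rightarrow> (ext_point \<times> ext_point) set" where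
  "orbit_rel \<Gamma> = {(p, ext_act g p) |p g. p \<in> ext_hyp3 \<Gamma> \<and> g \<in> \<Gamma>}"

definition quotient_topology :: "'a topology \<Rightarrow> ('a \<times> 'a) set \<Rightarrow> 'a set topology" where
  "quotient_topology X r = topology (\<lambda>U. U \<subseteq> topspace X // r \<and> openin X (\<Union>U))"

text \<open>\<open>M\<close> with each cusp compactified by one point:\<close>

definition compactified_manifold :: "(complex^2^2) set set \<Rightarrow> ext_point set topology" where
  "compactified_manifold \<Gamma> = quotient_topology (ext_topology \<Gamma>) (orbit_rel \<Gamma>)"


section \<open>Ideal triangulations\<close>

definition simplex3 :: "(real^4) set" where
  "simplex3 = {p. (\<forall>i. p$i \<ge> 0) \<and> (\<Sum>i\<in>UNIV. p$i) = 1}"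

abbreviation vertex :: "4 \<Rightarrow> real^4" where
  "vertex i \<equiv> axis i 1"

text \<open>The simplices are numbered by \<open>\<nu> < tet_count K\<close>, with face \<open>i\<close> opposite to vertex \<open>i\<close>.
  If \<open>pairing K \<nu> i = (\<mu>, \<pi>)\<close>, then face \<open>i\<close> of \<open>\<nu>\<close> is glued to face \<open>\<pi> i\<close> of \<open>\<mu>\<close> by the simplicial
  map sending vertex \<open>j\<close> to vertex \<open>\<pi> j\<close> for \<open>j \<noteq> i\<close>.
  The map \<open>lifted_simplex K \<nu>\<close> is a lift to the universal cover (completed by the lifted cusps) of the
  characteristic map of the simplex \<open>\<nu>\<close>; the simplices of the lifted triangulation are the
  translates of these lifts by \<open>\<Gamma>\<close>.\<close>

record triangulation =
  tet_count :: nat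
  pairing :: "nat \<Rightarrow> 4 \<Rightarrow> nat \<times> (4 \<Rightarrow> 4)"
  lifted_simplex :: "nat \<Rightarrow> real^4 \<Rightarrow> ext_point"

text \<open>Extending the gluing map of two oriented simplices by sending opposite vertex to opposite vertex,
  it reverses the orientations induced on the faces iff the resulting permutation is odd.\<close>

definition valid_pairing :: "triangulation \<Rightarrow> bool" where
  "valid_pairing K \<longleftrightarrow> (\<forall>\<nu><tet_count K. \<forall>i. \<forall>\<mu> \<pi>. pairing K \<nu> i = (\<mu>, \<pi>) \<longrightarrow>
     \<mu> < tet_count K \<and> \<pi> permutes UNIV \<and> \<not> evenperm \<pi> \<and> (\<mu>, \<pi> i) \<noteq> (\<nu>, i) \<and>
     pairing K \<mu> (\<pi> i) = (\<nu>, inv_into UNIV \<pi>))"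

definition simplex_points :: "triangulation \<Rightarrow> (nat \<times> (real^4)) set" where
  "simplex_points K = {..<tet_count K} \<times> simplex3"

definition gluing_step :: "triangulation \<Rightarrow> ((nat \<times> (real^4)) \<times> (nat \<times> (real^4))) set" where
  "gluing_step K = {((\<nu>, p), (\<mu>, q)). \<nu> < tet_count K \<and> p \<in> simplex3 \<and>
     (\<exists>i \<pi>. p$i = 0 \<and> pairing K \<nu> i = (\<mu>, \<pi>) \<and> (\<forall>j. q$(\<pi> j) = p$j))}"

definition gluing_rel :: "triangulation \<Rightarrow> ((nat \<times> (real^4)) \<times> (nat \<times> (real^4))) set" where
  "gluing_rel K = (gluing_step K)\<^sup>* \<inter> (simplex_points K \<times> simplex_points K)"

definition realization :: "triangulation \<Rightarrow> (nat \<times> (real^4)) set topology" where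
  "realization K =
     quotient_topology (sum_topology (\<lambda>_. top_of_set simplex3) {..<tet_count K}) (gluing_rel K)"

text \<open>Local degree one at every point, for an injective continuous map on an open subset of a
  3-dimensional space: a self-map of the 2-sphere has degree one iff it is homotopic to the
  identity.\<close>

definition orientation_preserving ::
  "(complex \<times> real) set \<Rightarrow> (complex \<times> real \<Rightarrow> complex \<times> real) \<Rightarrow> bool" where
  "orientation_preserving U h \<longleftrightarrow> (\<forall>p\<in>U. \<forall>e>0. cball p e \<subseteq> U \<longrightarrow>
     homotopic_with_canon (\<lambda>_. True) (sphere 0 1) (sphere 0 1)
       (\<lambda>u. sgn (h (p + e *\<^sub>R u) - h p)) id)"

text \<open>The interior of the simplex in the positively oriented affine chart with frame
  \<open>(v2 - v1, v3 - v1, v4 - v1)\<close>.\<close>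

definition open_chart_simplex :: "(complex \<times> real) set" where
  "open_chart_simplex = {(z, t). Re z > 0 \<and> Im z > 0 \<and> t > 0 \<and> Re z + Im z + t < 1}"

definition chart_to_simplex :: "complex \<times> real \<Rightarrow> real^4" where
  "chart_to_simplex = (\<lambda>(z, t).
     (1 - Re z - Im z - t) *\<^sub>R vertex 1 + Re z *\<^sub>R vertex 2 + Im z *\<^sub>R vertex 3 + t *\<^sub>R vertex 4)"

text \<open>The homeomorphism \<open>\<Phi>\<close> from the realization to the compactified manifold is the one
  induced by the (lifts of the) characteristic maps. The manifold carries the orientation of
  \<open>C \<times> R\<close>.\<close>

definition ideal_triangulation :: "(complex^2^2) set set \<Rightarrow> triangulation \<Rightarrow> bool" where
  "ideal_triangulation \<Gamma> K \<longleftrightarrow>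
     valid_pairing K \<and>
     (\<forall>\<nu><tet_count K. continuous_map (top_of_set simplex3) (ext_topology \<Gamma>) (lifted_simplex K \<nu>)) \<and>
     (\<exists>\<Phi>. homeomorphic_map (realization K) (compactified_manifold \<Gamma>) \<Phi> \<and>
        (\<forall>\<nu><tet_count K. \<forall>p\<in>simplex3.
           \<Phi> (gluing_rel K `` {(\<nu>, p)}) = orbit_rel \<Gamma> `` {lifted_simplex K \<nu> p})) \<and>
     (\<forall>\<nu><tet_count K. \<forall>p\<in>simplex3. \<forall>\<xi>. lifted_simplex K \<nu> p = Inr \<xi> \<longrightarrow> p \<in> range vertex) \<and>
     (\<forall>\<nu><tet_count K. orientation_preserving open_chart_simplex
        (\<lambda>q. projl (lifted_simplex K \<nu> (chart_to_simplex q))))"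

definition lifted_vertices :: "(complex^2^2) set set \<Rightarrow> triangulation \<Rightarrow> ext_point set" where
  "lifted_vertices \<Gamma> K =
     {ext_act g (lifted_simplex K \<nu> (vertex i)) |g \<nu> i. g \<in> \<Gamma> \<and> \<nu> < tet_count K}"


section \<open>Parabolic decorations\<close>

text \<open>In a permutation \<open>\<sigma>\<close> below, \<open>\<sigma> 1\<close> is the vertex opposite to the face; the triple
  \<open>\<sigma> 2, \<sigma> 3, \<sigma> 4\<close> carries the boundary orientation of the face iff \<open>\<sigma>\<close> is even.\<close>

definition face_equations :: "triangulation \<Rightarrow> (nat \<Rightarrow> tetrahedron) \<Rightarrow> bool" where
  "face_equations K T \<longleftrightarrow> (\<forall>\<nu><tet_count K. \<forall>\<sigma>. \<sigma> permutes UNIV \<and> evenperm \<sigma> \<longrightarrow>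
     (\<forall>\<mu> \<pi>. pairing K \<nu> (\<sigma> 1) = (\<mu>, \<pi>) \<longrightarrow>
        face_coord (T \<nu>) (\<sigma> 2) (\<sigma> 3) (\<sigma> 4) * face_coord (T \<mu>) (\<pi> (\<sigma> 2)) (\<pi> (\<sigma> 4)) (\<pi> (\<sigma> 3)) = 1))"

text \<open>An oriented edge of the realization is a class of oriented edges \<open>(\<nu>, i, j)\<close> of the simplices
  under the face gluings; a simplex occurs in it with its multiplicity.\<close>

definition edge_step :: "triangulation \<Rightarrow> ((nat \<times> 4 \<times> 4) \<times> (nat \<times> 4 \<times> 4)) set" where
  "edge_step K = {((\<nu>, i, j), (\<mu>, \<pi> i, \<pi> j)) |\<nu> i j \<mu> \<pi>. \<exists>l. l \<noteq> i \<and> l \<noteq> j \<and> pairing K \<nu> l = (\<mu>, \<pi>)}"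

definition edge_class :: "triangulation \<Rightarrow> nat \<times> 4 \<times> 4 \<Rightarrow> (nat \<times> 4 \<times> 4) set" where
  "edge_class K e = (edge_step K)\<^sup>* `` {e}"

definition edge_equations :: "triangulation \<Rightarrow> (nat \<Rightarrow> tetrahedron) \<Rightarrow> bool" where
  "edge_equations K T \<longleftrightarrow> (\<forall>\<nu><tet_count K. \<forall>i j. i \<noteq> j \<longrightarrow>
     (\<Prod>(\<mu>, k, l)\<in>edge_class K (\<nu>, i, j). edge_coord (T \<mu>) k l) = 1 \<and>
     (\<Prod>(\<mu>, k, l)\<in>edge_class K (\<nu>, i, j). edge_coord (T \<mu>) l k) = 1)"

definition parabolic_decoration :: "triangulation \<Rightarrow> (nat \<Rightarrow> tetrahedron) \<Rightarrow> bool" where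
  "parabolic_decoration K T \<longleftrightarrow>
     (\<forall>\<nu><tet_count K. generic_tetrahedron (T \<nu>)) \<and> face_equations K T \<and> edge_equations K T"

definition beta_decoration :: "triangulation \<Rightarrow> (nat \<Rightarrow> tetrahedron) \<Rightarrow> (complex \<Rightarrow>\<^sub>0 int) set" where
  "beta_decoration K T = pre_Bloch_class (\<Sum>\<nu><tet_count K.
     frag_of (edge_coord (T \<nu>) 1 2) + frag_of (edge_coord (T \<nu>) 2 1) +
     frag_of (edge_coord (T \<nu>) 3 4) + frag_of (edge_coord (T \<nu>) 4 3))"


section \<open>Decorated representations and their invariant\<close>

definition decorated_representation ::
  "(complex^2^2) set set \<Rightarrow> ((complex^2^2) set \<Rightarrow> (complex^3^3) set) \<Rightarrow> ((complex^2) set \<Rightarrow> flag) \<Rightarrow> bool"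
where
  "decorated_representation \<Gamma> \<rho> F \<longleftrightarrow>
     \<rho> \<in> hom (PGL\<lparr>carrier := \<Gamma>\<rparr>) PGL \<and>
     (\<forall>\<xi>\<in>lifted_cusps \<Gamma>. F \<xi> \<in> flags) \<and>
     (\<forall>g\<in>\<Gamma>. \<forall>\<xi>\<in>lifted_cusps \<Gamma>. F (proj_act g \<xi>) = flag_act (\<rho> g) (F \<xi>))"

text \<open>\<open>D\<close> is the assignment of flags to the lifted vertices obtained by developing: it gives every
  simplex of the lifted triangulation the configuration prescribed by \<open>T\<close>.\<close>

definition has_holonomy ::
  "(complex^2^2) set set \<Rightarrow> triangulation \<Rightarrow> (nat \<Rightarrow> tetrahedron) \<Rightarrow>
   ((complex^2^2) set \<Rightarrow> (complex^3^3) set) \<Rightarrow> ((complex^2) set \<Rightarrow> flag) \<Rightarrow> bool" where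
  "has_holonomy \<Gamma> K T \<rho> F \<longleftrightarrow> (\<exists>D.
     (\<forall>g\<in>\<Gamma>. \<forall>\<nu><tet_count K. \<exists>A\<in>carrier PGL. \<forall>i.
        D (ext_act g (lifted_simplex K \<nu> (vertex i))) = flag_act A (T \<nu> i)) \<and>
     (\<forall>g\<in>\<Gamma>. \<forall>v\<in>lifted_vertices \<Gamma> K. D (ext_act g v) = flag_act (\<rho> g) (D v)) \<and>
     (\<forall>\<xi>\<in>lifted_cusps \<Gamma>. D (Inr \<xi>) = F \<xi>))"

text \<open>The common value of \<open>beta_decoration\<close> on all generic parabolic decorations of ideal
  triangulations whose holonomy is the given decorated representation; such decorations
  exist and the value does not depend on the choice.\<close>

definition beta ::
  "(complex^2^2) set set \<Rightarrow> ((complex^2^2) set \<Rightarrow> (complex^3^3) set) \<Rightarrow> ((complex^2) set \<Rightarrow> flag) \<Rightarrow>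
   (complex \<Rightarrow>\<^sub>0 int) set" where
  "beta \<Gamma> \<rho> F = (THE b. \<exists>K T. ideal_triangulation \<Gamma> K \<and> parabolic_decoration K T \<and>
     has_holonomy \<Gamma> K T \<rho> F \<and> b = beta_decoration K T)"

definition dual_rep ::
  "((complex^2^2) set \<Rightarrow> (complex^3^3) set) \<Rightarrow> (complex^2^2) set \<Rightarrow> (complex^3^3) set" where
  "dual_rep \<rho> g = transpose_inverse (\<rho> g)"

definition dual_decoration :: "((complex^2) set \<Rightarrow> flag) \<Rightarrow> (complex^2) set \<Rightarrow> flag" where
  "dual_decoration F \<xi> = dual_flag (F \<xi>)"

end

theory Submission
  imports Defs
begin

text \<open>
  Let \<open>T\<close> be a tetrahedron of flags whose dual is generic as well. The coordinates of \<open>T\<close> and of its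
  dual are computed from the rows and from the columns of the matrix of pairings \<open>f\<^sub>i(x\<^sub>j)\<close>. Scaling
  rows and columns by the coefficients of the linear relations among the four points and the four
  lines, one obtains a matrix with vanishing diagonal, row sums and column sums, and for such matrices
  six five-term relations show that the chains of \<open>T\<close> and of its dual differ by \<open>\<Sum> [z/(1+z)]\<close>, where
  \<open>z\<close> runs over the face coordinates \<open>z\<^sub>i\<^sub>j\<^sub>k\<close> of the four positively oriented faces
  (\<open>bloch_duality_matrix\<close>, \<open>beta_chain_dual\<close>). The face equations say that the two coordinates at a
  glued face are \<open>z\<close> and \<open>1/z\<close>, and \<open>[z/(1+z)] + [1/(1+z)] = [u] + [1-u] = 0\<close> (\<open>face_term_cancel\<close>). Hence
  summing over all tetrahedra gives the same class for a decoration and for its dual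
  (\<open>beta_decoration_dual\<close>).

  The obstacle is that the dual of a generic tetrahedron need not be generic: its face coordinates
  may be \<open>-1\<close>, the three lines of the face being concurrent. So a decoration is first replaced by one
  of a finer triangulation with the same holonomy and the same invariant. Every simplex is cut into
  twelve by its center and the centers of its faces, and these new vertices receive flags, chosen
  equivariantly, that are generic with respect to the old ones. Three things have to be shown.
  The finer complex is again an ideal triangulation of the same manifold (\<open>subdivision_ideal\<close>).
  A developing map that is generic on every simplex always yields a parabolic decoration
  (\<open>parabolic\<close>), because face and edge coordinates are quotients of functions of the flags at the
  lifted vertices; this applies to the refined developing map (\<open>refinement\<close>) and to its dual.
  Finally the invariant does not change: subdividing a tetrahedron at one further flag is additive in
  the pre-Bloch group (\<open>beta_chain_subdivide\<close>), and the superfluous terms, which belong to the old faces,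
  cancel in pairs (\<open>good_refinement\<close>).

  Consequently the values of \<open>\<beta>(K, z)\<close> on the decorations for \<open>\<rho>\<close> are among those for \<open>\<rho>\<^sup>*\<close>
  (\<open>dual_decoration_exists\<close>), and conversely, since duality is an involution. As \<open>\<beta>(\<rho>)\<close> is described by
  this set of values, \<open>\<beta>(\<rho>) = \<beta>(\<rho>\<^sup>*)\<close>.
\<close>

section \<open>Relations in the pre-Bloch group\<close>

definition bloch_eq :: "(complex \<Rightarrow>\<^sub>0 int) \<Rightarrow> (complex \<Rightarrow>\<^sub>0 int) \<Rightarrow> bool" (infix "\<approx>\<^sub>B" 50) where
  "c \<approx>\<^sub>B d \<longleftrightarrow> c - d \<in> five_term_subgroup"

lemma five_term_subgroup_subgroup: "subgroup five_term_subgroup (free_Abelian_group (- {0, 1}))"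
  unfolding five_term_subgroup_def
proof (rule group.generate_is_subgroup[OF group_free_Abelian_group], rule subsetI)
  fix c :: "complex \<Rightarrow>\<^sub>0 int"
  assume "c \<in> {frag_of x - frag_of y + frag_of (y / x) - frag_of ((1 - inverse x) / (1 - inverse y))
        + frag_of ((1 - x) / (1 - y)) |x y. x \<notin> {0, 1} \<and> y \<notin> {0, 1} \<and> x \<noteq> y}"
  then obtain x y where xy: "x \<notin> {0,1}" "y \<notin> {0,1}" "x \<noteq> y"
    and c: "c = frag_of x - frag_of y + frag_of (y / x) - frag_of ((1 - inverse x) / (1 - inverse y))
        + frag_of ((1 - x) / (1 - y))" by blast
  have "y / x \<in> - {0,1}" "(1 - inverse x) / (1 - inverse y) \<in> - {0,1}"
    "(1 - x) / (1 - y) \<in> - {0,1}" "x \<in> - {0,1}" "y \<in> - {0,1}"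
    using xy by (auto simp: field_simps)
  then have *: "frag_of x \<in> carrier (free_Abelian_group (- {0,1}))"
    "frag_of y \<in> carrier (free_Abelian_group (- {0,1}))"
    "frag_of (y / x) \<in> carrier (free_Abelian_group (- {0,1}))"
    "frag_of ((1 - inverse x) / (1 - inverse y)) \<in> carrier (free_Abelian_group (- {0,1}))"
    "frag_of ((1 - x) / (1 - y)) \<in> carrier (free_Abelian_group (- {0,1}))"
    by simp_all
  have add: "u + v \<in> carrier (free_Abelian_group (- {0,1}))"
    and diff: "u - v \<in> carrier (free_Abelian_group (- {0,1}))"
    if "u \<in> carrier (free_Abelian_group (- {0,1::complex}))" "v \<in> carrier (free_Abelian_group (- {0,1}))" for u v
    using that keys_add[of u v] keys_diff[of u v] by auto
  show "c \<in> carrier (free_Abelian_group (- {0,1}))"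
    unfolding c by (rule add[OF diff[OF add[OF diff]]] *)+
qed

lemma five_term_subgroup_zero: "0 \<in> five_term_subgroup"
  using subgroup.one_closed[OF five_term_subgroup_subgroup] by simp

lemma five_term_subgroup_add:
  "c \<in> five_term_subgroup \<Longrightarrow> d \<in> five_term_subgroup \<Longrightarrow> c + d \<in> five_term_subgroup"
  using subgroup.m_closed[OF five_term_subgroup_subgroup] by simp

lemma five_term_subgroup_minus:
  assumes "c \<in> five_term_subgroup" shows "- c \<in> five_term_subgroup"
  using subgroup.m_inv_closed[OF five_term_subgroup_subgroup assms]
    subgroup.mem_carrier[OF five_term_subgroup_subgroup assms] by simp

lemma bloch_eq_refl [simp]: "c \<approx>\<^sub>B c"
  by (simp add: bloch_eq_def five_term_subgroup_zero)

lemma bloch_eq_sym: "c \<approx>\<^sub>B d \<Longrightarrow> d \<approx>\<^sub>B c"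
  unfolding bloch_eq_def using five_term_subgroup_minus by fastforce

lemma bloch_eq_trans [trans]: "c \<approx>\<^sub>B d \<Longrightarrow> d \<approx>\<^sub>B e \<Longrightarrow> c \<approx>\<^sub>B e"
  unfolding bloch_eq_def using five_term_subgroup_add by fastforce

lemma bloch_eq_add: "c \<approx>\<^sub>B d \<Longrightarrow> c' \<approx>\<^sub>B d' \<Longrightarrow> c + c' \<approx>\<^sub>B d + d'"
  unfolding bloch_eq_def using five_term_subgroup_add[of "c - d" "c' - d'"] by (simp add: algebra_simps)

lemma bloch_eq_minus: "c \<approx>\<^sub>B d \<Longrightarrow> - c \<approx>\<^sub>B - d"
  unfolding bloch_eq_def using five_term_subgroup_minus[of "c - d"] by (simp add: algebra_simps)

lemma bloch_eq_diff: "c \<approx>\<^sub>B d \<Longrightarrow> c' \<approx>\<^sub>B d' \<Longrightarrow> c - c' \<approx>\<^sub>B d - d'"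
  using bloch_eq_add[OF _ bloch_eq_minus, of c d c' d'] by simp

lemma bloch_eq_sum: "(\<And>i. i \<in> I \<Longrightarrow> c i \<approx>\<^sub>B d i) \<Longrightarrow> sum c I \<approx>\<^sub>B sum d I"
  by (induction I rule: infinite_finite_induct) (auto intro: bloch_eq_add)

lemma pre_Bloch_class_cong:
  assumes "c \<approx>\<^sub>B d" shows "pre_Bloch_class c = pre_Bloch_class d"
proof -
  have "{h + c |h. h \<in> five_term_subgroup} = {h + d |h. h \<in> five_term_subgroup}" if "c \<approx>\<^sub>B d" for c d
  proof -
    have "\<exists>k. h + c = k + d \<and> k \<in> five_term_subgroup"
      if "h \<in> five_term_subgroup" "c \<approx>\<^sub>B d" for h c d
      using five_term_subgroup_add[OF that(1), of "c - d"] that(2)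
      by (intro exI[of _ "h + (c - d)"]) (simp add: bloch_eq_def algebra_simps)
    then show ?thesis using \<open>c \<approx>\<^sub>B d\<close> bloch_eq_sym by fastforce
  qed
  then show ?thesis using assms
    by (simp add: pre_Bloch_class_def r_coset_def Setcompr_eq_image UNION_singleton_eq_range)
qed

lemma five_term:
  assumes "x \<notin> {0,1}" "y \<notin> {0,1}" "x \<noteq> y"
  shows "frag_of x - frag_of y + frag_of (y / x) - frag_of ((1 - inverse x) / (1 - inverse y))
        + frag_of ((1 - x) / (1 - y)) \<approx>\<^sub>B 0"
  unfolding bloch_eq_def five_term_subgroup_def using assms by (auto intro!: generate.incl)

text \<open>Adding the relations for \<open>(x, y)\<close> and \<open>(y, x)\<close> shows that \<open>[u] + [1/u]\<close> is multiplicative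
  in \<open>u\<close>; being also invariant under \<open>u \<mapsto> 1/u\<close>, it is killed by two, hence vanishes at squares.
  This is where algebraic closedness enters.\<close>

lemma bloch_eq_inverse_sum:
  assumes "x \<notin> {0,1}"
  shows "frag_of x + frag_of (inverse x) \<approx>\<^sub>B 0"
proof -
  define s where "s u = frag_of u + frag_of (inverse u)" for u :: complex
  have mult: "s u + s v \<approx>\<^sub>B s (u * v)" if "u \<notin> {0,1}" "v \<notin> {0,1}" "u * v \<noteq> 1" for u v
  proof -
    define x y where "x = (1 - v) / (1 - u * v)" and "y = u * x"
    have n: "1 - u * v \<noteq> 0" "1 - v \<noteq> 0" "1 - u \<noteq> 0" "u \<noteq> 0" "v \<noteq> 0" using that by auto
    have x1: "1 - x = v * (1 - u) / (1 - u * v)" and y1: "1 - y = (1 - u) / (1 - u * v)"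
      using n by (auto simp: x_def y_def divide_simps) (auto simp: algebra_simps)
    have x: "x \<notin> {0,1}" "y \<notin> {0,1}" "x \<noteq> y"
      using n x1 y1 by (auto simp: x_def y_def)
    have u: "y / x = u" using x by (simp add: y_def)
    have v: "(1 - x) / (1 - y) = v" using n unfolding x1 y1 by simp
    have "(1 - inverse x) / (1 - inverse y) = (y / x) * ((1 - x) / (1 - y))"
      using x by (auto simp: divide_simps) (auto simp: algebra_simps)
    then have uv: "(1 - inverse x) / (1 - inverse y) = u * v"
      unfolding u v .
    have "(frag_of x - frag_of y + frag_of u - frag_of (u * v) + frag_of v)
        + (frag_of y - frag_of x + frag_of (inverse u) - frag_of (inverse (u * v)) + frag_of (inverse v)) \<approx>\<^sub>B 0 + 0"
    proof (rule bloch_eq_add)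
      show "frag_of x - frag_of y + frag_of u - frag_of (u * v) + frag_of v \<approx>\<^sub>B 0"
        using five_term[OF x] unfolding u v uv .
      have i: "x / y = inverse u" "(1 - inverse y) / (1 - inverse x) = inverse (u * v)"
          "(1 - y) / (1 - x) = inverse v"
        unfolding uv[symmetric] unfolding u[symmetric] v[symmetric] by (simp_all only: inverse_divide)
      show "frag_of y - frag_of x + frag_of (inverse u) - frag_of (inverse (u * v)) + frag_of (inverse v) \<approx>\<^sub>B 0"
        using five_term[OF x(2,1) x(3)[symmetric]] unfolding i .
    qed
    then show ?thesis by (simp add: bloch_eq_def s_def algebra_simps)
  qed
  have double: "s v + s v \<approx>\<^sub>B 0" if v: "v \<notin> {0,1}" for v
  proof -
    have "finite {0, 1, inverse v, 1 / v}" by simp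
    then obtain u where u: "u \<notin> {0, 1, inverse v, 1 / v}"
      using infinite_UNIV_char_0 ex_new_if_finite by metis
    have uv: "u * v \<noteq> 1" "u * v \<noteq> 0" using u v by (auto simp: field_simps)
    have "s u + s v \<approx>\<^sub>B s (u * v)" using mult u v uv by auto
    moreover have "s (u * v) + s (inverse v) \<approx>\<^sub>B s u"
      using mult[of "u * v" "inverse v"] u v uv by (auto simp: mult.assoc)
    moreover have "s (inverse v) = s v" by (simp add: s_def add.commute)
    ultimately show ?thesis
      using bloch_eq_add[of "s u + s v" "s (u * v)" "s (u * v) + s v" "s u"]
      by (simp add: bloch_eq_def algebra_simps)
  qed
  have w: "csqrt x \<notin> {0,1}" using assms by auto
  have "csqrt x * csqrt x = x" using power2_csqrt[of x] by (simp add: power2_eq_square)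
  then have "s (csqrt x) + s (csqrt x) \<approx>\<^sub>B s x" using mult[OF w w] assms by auto
  then show ?thesis using double[OF w] bloch_eq_sym bloch_eq_trans unfolding s_def by blast
qed

lemma bloch_eq_inverse:
  "x \<notin> {0,1} \<Longrightarrow> frag_of (inverse x) \<approx>\<^sub>B - frag_of x"
  using bloch_eq_inverse_sum[of x] by (simp add: bloch_eq_def algebra_simps)

text \<open>The relations for \<open>(x, y)\<close> and \<open>(1 - y, 1 - x)\<close> have the same last three arguments, so
  \<open>[x] + [1 - x]\<close> does not depend on \<open>x\<close>. At a primitive sixth root of unity, where \<open>1 - x = 1/x\<close>,
  it vanishes.\<close>

lemma bloch_eq_one_minus:
  assumes "x \<notin> {0,1}"
  shows "frag_of (1 - x) \<approx>\<^sub>B - frag_of x"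
proof -
  define y where "y = Complex (1/2) (sqrt 3 / 2)"
  have y: "y \<notin> {0,1}" "1 - y = inverse y"
  proof -
    show "y \<notin> {0,1}" by (auto simp: y_def complex_eq_iff)
    have "y * (1 - y) = 1" by (simp add: y_def complex_eq_iff algebra_simps)
    then show "1 - y = inverse y" by (metis inverse_unique)
  qed
  have yy: "frag_of y + frag_of (1 - y) \<approx>\<^sub>B 0" using bloch_eq_inverse_sum[OF y(1)] y(2) by simp
  show ?thesis
  proof (cases "x = y")
    case True then show ?thesis using yy by (simp add: bloch_eq_def algebra_simps)
  next
    case False
    have x: "x \<noteq> 0" "x \<noteq> 1" "y \<noteq> 0" "y \<noteq> 1" "1 - y \<notin> {0,1}" "1 - x \<notin> {0,1}" "1 - y \<noteq> 1 - x"
      using assms y False by auto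
    have e: "(1 - inverse (1 - y)) / (1 - inverse (1 - x)) = (1 - inverse x) / (1 - inverse y)"
    proof -
      have "1 - inverse (1 - y) = - y / (1 - y)" "1 - inverse (1 - x) = - x / (1 - x)"
        "1 - inverse x = - (1 - x) / x" "1 - inverse y = - (1 - y) / y"
        using x by (auto simp: field_simps)
      then show ?thesis using x by (simp only:) (simp add: divide_simps, simp add: algebra_simps)
    qed
    have "(frag_of x - frag_of y + frag_of (y / x) - frag_of ((1 - inverse x) / (1 - inverse y))
        + frag_of ((1 - x) / (1 - y)))
       - (frag_of (1 - y) - frag_of (1 - x) + frag_of ((1 - x) / (1 - y))
        - frag_of ((1 - inverse x) / (1 - inverse y)) + frag_of (y / x)) \<approx>\<^sub>B 0 - 0"
      using five_term[OF assms y(1) False] five_term[OF x(5-7)]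
      unfolding e by (intro bloch_eq_diff) (simp_all add: add.commute)
    from bloch_eq_add[OF this yy] show ?thesis
      by (simp add: bloch_eq_def algebra_simps)
  qed
qed

lemma bloch_eq_rotate:
  assumes "x \<notin> {0,1}"
  shows "frag_of (inverse (1 - x)) \<approx>\<^sub>B frag_of x"
proof -
  have "frag_of (inverse (1 - x)) \<approx>\<^sub>B - frag_of (1 - x)"
    using assms by (intro bloch_eq_inverse) auto
  also have "\<dots> \<approx>\<^sub>B - (- frag_of x)" by (intro bloch_eq_minus bloch_eq_one_minus assms)
  finally show ?thesis by simp
qed

text \<open>The five-term relation with its five-fold symmetry made visible: every \<open>1 - a\<close> is the product
  of the two neighbours of \<open>a\<close> in the cyclic order \<open>a, r, b, t, s\<close>.\<close>

lemma bloch_pentagon: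
  assumes "a \<notin> {0,1}" "b \<notin> {0,1}" "r \<noteq> 0" "1 - r = a * b" "1 - a = s * r" "1 - b = t * r"
  shows "frag_of a + frag_of b + frag_of r + frag_of s + frag_of t \<approx>\<^sub>B 0"
proof -
  have r: "r = 1 - a * b" using assms(4) by (simp add: algebra_simps)
  have x: "a * b \<notin> {0,1}" "a \<noteq> a * b" using assms r by auto
  have s: "(1 - a) / (1 - a * b) = s" and t: "t = (1 - b) / (1 - a * b)"
    using assms(3,5,6) unfolding r by auto
  have "(1 - inverse a) / (1 - inverse (a * b)) = 1 - t"
  proof -
    have "1 - inverse a = - (1 - a) / a" "1 - inverse (a * b) = - r / (a * b)"
      using assms(1,2) unfolding r by (auto simp: divide_simps)
    then have "(1 - inverse a) / (1 - inverse (a * b)) = (1 - a) * b / r"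
      using assms(1-3) by (simp only:) (simp add: divide_simps, simp add: algebra_simps)
    also have "\<dots> = 1 - t" using assms(3) unfolding t r by (simp add: field_simps)
    finally show ?thesis .
  qed
  then have *: "frag_of a - frag_of (a * b) + frag_of b - frag_of (1 - t) + frag_of s \<approx>\<^sub>B 0"
    using five_term[OF assms(1) x] assms(1) unfolding s by simp
  have "t \<notin> {0,1}"
  proof -
    have "1 - t = (1 - a) * b / r" using assms(3) unfolding t r by (simp add: field_simps)
    then show ?thesis using assms by auto
  qed
  then have "frag_of (1 - t) \<approx>\<^sub>B - frag_of t" by (rule bloch_eq_one_minus)
  moreover have "frag_of r \<approx>\<^sub>B - frag_of (a * b)" unfolding r by (rule bloch_eq_one_minus[OF x(1)])
  ultimately have "(frag_of a - frag_of (a * b) + frag_of b - frag_of (1 - t) + frag_of s)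
     + frag_of (1 - t) + frag_of r \<approx>\<^sub>B 0 + - frag_of t + - frag_of (a * b)"
    using * by (intro bloch_eq_add)
  then show ?thesis by (simp add: bloch_eq_def algebra_simps)
qed

lemma bloch_eq_inverse_one_minus:
  assumes "x \<notin> {0,1}"
  shows "frag_of (1 - inverse x) \<approx>\<^sub>B frag_of x"
proof -
  have "frag_of (1 - inverse x) \<approx>\<^sub>B - frag_of (inverse x)"
    using assms by (intro bloch_eq_one_minus) auto
  also have "\<dots> \<approx>\<^sub>B - (- frag_of x)" by (intro bloch_eq_minus bloch_eq_inverse assms)
  finally show ?thesis by simp
qed

lemma bloch_eq_reflect:
  assumes "x \<notin> {0,1}"
  shows "frag_of (x / (x - 1)) \<approx>\<^sub>B - frag_of x"
proof -
  have "x / (x - 1) = inverse (1 - inverse x)" using assms by (auto simp: field_simps)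
  moreover have "frag_of (inverse (1 - inverse x)) \<approx>\<^sub>B - frag_of (1 - inverse x)"
    using assms by (intro bloch_eq_inverse) auto
  moreover have "- frag_of (1 - inverse x) \<approx>\<^sub>B - frag_of x"
    by (intro bloch_eq_minus bloch_eq_inverse_one_minus assms)
  ultimately show ?thesis using bloch_eq_trans by metis
qed

text \<open>The classical five-term relation for the cross-ratios of five points of the projective line;
  \<open>aij\<close> is the determinant of representatives of the \<open>i\<close>-th and \<open>j\<close>-th point, and the
  hypotheses are Pluecker relations.\<close>

lemma bloch_five_points:
  fixes a01 a02 a03 a04 a12 a13 a14 a23 a24 a34 :: complex
  assumes nz: "a01 \<noteq> 0" "a02 \<noteq> 0" "a03 \<noteq> 0" "a04 \<noteq> 0" "a12 \<noteq> 0" "a13 \<noteq> 0" "a14 \<noteq> 0"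
      "a23 \<noteq> 0" "a24 \<noteq> 0" "a34 \<noteq> 0"
    and p0: "a12 * a34 - a13 * a24 + a14 * a23 = 0"
    and p1: "a02 * a34 - a03 * a24 + a04 * a23 = 0"
    and p2: "a01 * a34 - a03 * a14 + a04 * a13 = 0"
    and p4: "a01 * a23 - a02 * a13 + a03 * a12 = 0"
    and p3: "a01 * a24 - a02 * a14 + a04 * a12 = 0"
  shows "frag_of (a13 * a24 / (a14 * a23)) - frag_of (a03 * a24 / (a04 * a23))
     + frag_of (a03 * a14 / (a04 * a13)) - frag_of (a02 * a14 / (a04 * a12))
     + frag_of (a02 * a13 / (a03 * a12)) \<approx>\<^sub>B 0"
proof -
  define a b r s t where "a = a13 * a24 / (a14 * a23)" and "b = a03 * a14 / (a04 * a13)"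
    and "r = - a02 * a34 / (a04 * a23)" and "s = a12 * a04 / (a14 * a02)"
    and "t = a01 * a23 / (a02 * a13)"
  have 1: "1 - a = - a12 * a34 / (a14 * a23)" "1 - b = - a01 * a34 / (a04 * a13)"
    "1 - r = a03 * a24 / (a04 * a23)" "1 - s = a01 * a24 / (a14 * a02)"
    "1 - t = a03 * a12 / (a02 * a13)"
    using nz p0 p1 p2 p3 p4 unfolding a_def b_def r_def s_def t_def
    by (simp_all add: divide_simps) (simp_all add: algebra_simps)
  have "a \<noteq> 1" "b \<noteq> 1" "r \<noteq> 1" "s \<noteq> 1" "t \<noteq> 1"
    using 1 nz by (metis (no_types) diff_self divide_eq_0_iff mult_eq_0_iff neg_equal_0_iff_equal)+
  then have n: "a \<notin> {0,1}" "b \<notin> {0,1}" "r \<notin> {0,1}" "s \<notin> {0,1}" "t \<notin> {0,1}"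
    using nz by (auto simp: a_def b_def r_def s_def t_def)
  have "frag_of a + frag_of b + frag_of r + frag_of s + frag_of t \<approx>\<^sub>B 0"
  proof (rule bloch_pentagon[OF n(1,2)])
    show "r \<noteq> 0" using n by auto
    show "1 - r = a * b" "1 - a = s * r" "1 - b = t * r"
      using nz unfolding 1 unfolding a_def b_def r_def s_def t_def by (simp_all add: divide_simps)
  qed
  moreover have "frag_of (a03 * a24 / (a04 * a23)) \<approx>\<^sub>B - frag_of r"
    using bloch_eq_one_minus[OF n(3)] unfolding 1 .
  moreover have "frag_of (a02 * a14 / (a04 * a12)) \<approx>\<^sub>B - frag_of s"
    using bloch_eq_inverse[OF n(4)] by (simp add: s_def mult.commute)
  moreover have "frag_of (a02 * a13 / (a03 * a12)) \<approx>\<^sub>B frag_of t"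
    using bloch_eq_rotate[OF n(5)] unfolding 1 by simp
  ultimately have "(frag_of a + frag_of b + frag_of r + frag_of s + frag_of t)
     - frag_of (a03 * a24 / (a04 * a23)) - frag_of (a02 * a14 / (a04 * a12))
     + frag_of (a02 * a13 / (a03 * a12)) \<approx>\<^sub>B 0 - (- frag_of r) - (- frag_of s) + frag_of t"
    by (intro bloch_eq_add bloch_eq_diff)
  then show ?thesis unfolding a_def[symmetric] b_def[symmetric]
    by (simp add: bloch_eq_def algebra_simps)
qed

lemma bloch_pentagon_cycle:
  fixes a b r s t :: complex
  assumes "a \<noteq> 0" "b \<noteq> 0" "r \<noteq> 0" "1 - a \<noteq> 0" "1 - b \<noteq> 0"
    and "1 - r = a * b" "1 - a = s * r" "1 - b = t * r"
  shows "b \<notin> {0,1}" "a \<notin> {0,1}" "s \<notin> {0,1}" "t \<notin> {0,1}" "r \<notin> {0,1}"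
    "frag_of a + frag_of b + frag_of r + frag_of s + frag_of t \<approx>\<^sub>B 0"
proof -
  show a: "a \<notin> {0,1}" and b: "b \<notin> {0,1}" using assms by auto
  have "(1 - s) * r = (1 - b) * a" "(1 - t) * r = (1 - a) * b"
    using assms(6-8) by (simp_all add: algebra_simps)
  then show "s \<notin> {0,1}" "t \<notin> {0,1}" "r \<notin> {0,1}" using assms by auto
  show "frag_of a + frag_of b + frag_of r + frag_of s + frag_of t \<approx>\<^sub>B 0"
    by (rule bloch_pentagon[OF a b assms(3,6-8)])
qed

section \<open>The duality relation\<close>

text \<open>The rows of the matrix \<open>q\<close>, whose diagonal vanishes, give the coordinates of a tetrahedron of
  flags, its columns those of the dual one. All principal \<open>3 \<times> 3\<close> minors of a matrix with vanishing
  row and column sums agree; here their common value \<open>C\<close> is, for each face, the sum of the two cyclic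
  products of entries, so that the four terms on the right belong to the faces. The identity is a
  signed sum of six five-term relations; in these, every term that does not occur in the
  conclusion meets a second one, equal to it or related to it by \<open>x \<mapsto> 1 - x\<close> and \<open>x \<mapsto> 1/x\<close>, and cancels.
  The \<open>2 \<times> 2\<close> minor \<open>D\<close> enters through the denominators of such intermediate terms.\<close>

lemma bloch_duality_matrix:
  fixes q12 q13 q14 q21 q23 q24 q31 q32 q34 q41 q42 q43 :: complex
  assumes nz: "q12 \<noteq> 0" "q13 \<noteq> 0" "q14 \<noteq> 0" "q21 \<noteq> 0" "q23 \<noteq> 0" "q24 \<noteq> 0"
      "q31 \<noteq> 0" "q32 \<noteq> 0" "q34 \<noteq> 0" "q41 \<noteq> 0" "q42 \<noteq> 0" "q43 \<noteq> 0"
    and rows: "q12 + q13 + q14 = 0" "q21 + q23 + q24 = 0" "q31 + q32 + q34 = 0" "q41 + q42 + q43 = 0"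
    and cols: "q21 + q31 + q41 = 0" "q12 + q32 + q42 = 0" "q13 + q23 + q43 = 0" "q14 + q24 + q34 = 0"
    and C: "q12 * q23 * q31 + q13 * q32 * q21 = C" "C \<noteq> 0"
    and D: "q21 * q43 - q41 * q23 = D" "D \<noteq> 0"
  shows "(frag_of (- q13 / q14) + frag_of (- q24 / q23) + frag_of (- q31 / q32) + frag_of (- q42 / q41))
     - (frag_of (- q31 / q41) + frag_of (- q42 / q32) + frag_of (- q13 / q23) + frag_of (- q24 / q14))
    \<approx>\<^sub>B frag_of (q23 * q34 * q42 / C) + frag_of (q14 * q43 * q31 / C)
      + frag_of (q41 * q12 * q24 / C) + frag_of (q32 * q21 * q13 / C)"
proof -
  \<comment> \<open>The row and column sums leave five free entries.\<close>
  have e: "q14 = - q12 - q13" "q24 = - q21 - q23" "q34 = q12 + q13 + q21 + q23" "q31 = - q21 - q41"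
    "q32 = - q12 - q13 - q23 + q41" "q42 = q13 + q23 - q41" "q43 = - q13 - q23"
    using rows cols by algebra+
  have D': "D = q23 * q31 - q13 * q21" "D = q13 * q41 - q31 * q43" "D = q24 * q41 - q21 * q42"
    "D = q23 * q42 - q24 * q43"
    unfolding D(1)[symmetric] e by algebra+
  have C': "C = q12 * D - q13 * q21 * q42" "C = - q32 * D - q23 * q31 * q42"
    "C = - q14 * D - q13 * q24 * q41" "C = q34 * D - q24 * q31 * q43"
    "C = q12 * q24 * q41 + q14 * q42 * q21" "C = q13 * q34 * q41 + q14 * q43 * q31"
    "C = q23 * q34 * q42 + q24 * q43 * q32"
    unfolding C(1)[symmetric] D(1)[symmetric] e by algebra+
  \<comment> \<open>In each of the six pentagons the three quantities \<open>1 - a\<close>, \<open>1 - b\<close>, \<open>1 - r\<close> are monomials in the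
    entries, \<open>C\<close> and \<open>D\<close>, by one of the relations just listed or by a row or column sum.\<close>
  define a1 b1 r1 s1 t1 where "a1 = - q12 / q42" and "b1 = q13 * q21 * q42 / (q12 * D)"
    and "r1 = q23 * q31 / D" and "s1 = - q32 * D / (q23 * q31 * q42)" and "t1 = C / (q12 * q23 * q31)"
  define a2 b2 r2 s2 t2 where "a2 = - q13 / q43" and "b2 = q31 * q43 / (q13 * q41)"
    and "r2 = - q21 / q41" and "s2 = q23 * q41 / (q21 * q43)" and "t2 = - D / (q13 * q21)"
  define a3 b3 r3 s3 t3 where "a3 = - q12 / q14" and "b3 = - q14 * q21 * q42 / (q12 * q24 * q41)"
    and "r3 = D / (q24 * q41)" and "s3 = - q13 * q24 * q41 / (q14 * D)" and "t3 = C / (q12 * D)"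
  define a4 b4 r4 s4 t4 where "a4 = - q14 / q34" and "b4 = - q13 * q34 * q41 / (q14 * q31 * q43)"
    and "r4 = - D / (q31 * q43)" and "s4 = q24 * q31 * q43 / (q34 * D)" and "t4 = - C / (q14 * D)"
  define a5 b5 r5 s5 t5 where "a5 = - q21 / q24" and "b5 = q24 * q41 / (q21 * q42)"
    and "r5 = - q43 / q42" and "s5 = q23 * q42 / (q24 * q43)" and "t5 = D / (q21 * q43)"
  define a6 b6 r6 s6 t6 where "a6 = - q31 / q34" and "b6 = q34 * D / (q24 * q31 * q43)"
    and "r6 = q23 * q42 / (q24 * q43)" and "s6 = - q24 * q32 * q43 / (q23 * q34 * q42)"
    and "t6 = - C / (q23 * q31 * q42)"
  note nz' = nz C(2) D(2)
  note defs = a1_def b1_def r1_def s1_def t1_def a2_def b2_def r2_def s2_def t2_def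
    a3_def b3_def r3_def s3_def t3_def a4_def b4_def r4_def s4_def t4_def
    a5_def b5_def r5_def s5_def t5_def a6_def b6_def r6_def s6_def t6_def
  have ma1: "1 - a1 = - q32 / q42"
    using nz' unfolding a1_def by (simp add: divide_simps) (use cols(2) in algebra)
  have mb1: "1 - b1 = C / (q12 * D)"
    using nz' unfolding b1_def by (simp add: divide_simps) (use C'(1) in algebra)
  have mr1: "1 - r1 = - q13 * q21 / D"
    using nz' unfolding r1_def by (simp add: divide_simps) (use D'(1) in algebra)
  have p1: "a1 \<noteq> 0" "b1 \<noteq> 0" "r1 \<noteq> 0" "1 - a1 \<noteq> 0" "1 - b1 \<noteq> 0"
      "1 - r1 = a1 * b1" "1 - a1 = s1 * r1" "1 - b1 = t1 * r1"
    unfolding ma1 mb1 mr1 unfolding defs using nz' by (simp_all add: divide_simps)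
  note n1 = bloch_pentagon_cycle(1,2)[OF p1] and q1 = bloch_pentagon_cycle(3-5)[OF p1]
    and pen1 = bloch_pentagon_cycle(6)[OF p1]
  have ma2: "1 - a2 = - q23 / q43"
    using nz' unfolding a2_def by (simp add: divide_simps) (use cols(3) in algebra)
  have mb2: "1 - b2 = D / (q13 * q41)"
    using nz' unfolding b2_def by (simp add: divide_simps) (use D'(2) in algebra)
  have mr2: "1 - r2 = - q31 / q41"
    using nz' unfolding r2_def by (simp add: divide_simps) (use cols(1) in algebra)
  have p2: "a2 \<noteq> 0" "b2 \<noteq> 0" "r2 \<noteq> 0" "1 - a2 \<noteq> 0" "1 - b2 \<noteq> 0"
      "1 - r2 = a2 * b2" "1 - a2 = s2 * r2" "1 - b2 = t2 * r2"
    unfolding ma2 mb2 mr2 unfolding defs using nz' by (simp_all add: divide_simps)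
  note n2 = bloch_pentagon_cycle(1,2)[OF p2] and q2 = bloch_pentagon_cycle(3-5)[OF p2]
    and pen2 = bloch_pentagon_cycle(6)[OF p2]
  have ma3: "1 - a3 = - q13 / q14"
    using nz' unfolding a3_def by (simp add: divide_simps) (use rows(1) in algebra)
  have mb3: "1 - b3 = C / (q12 * q24 * q41)"
    using nz' unfolding b3_def by (simp add: divide_simps) (use C'(5) in algebra)
  have mr3: "1 - r3 = q21 * q42 / (q24 * q41)"
    using nz' unfolding r3_def by (simp add: divide_simps) (use D'(3) in algebra)
  have p3: "a3 \<noteq> 0" "b3 \<noteq> 0" "r3 \<noteq> 0" "1 - a3 \<noteq> 0" "1 - b3 \<noteq> 0"
      "1 - r3 = a3 * b3" "1 - a3 = s3 * r3" "1 - b3 = t3 * r3"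
    unfolding ma3 mb3 mr3 unfolding defs using nz' by (simp_all add: divide_simps)
  note n3 = bloch_pentagon_cycle(1,2)[OF p3] and q3 = bloch_pentagon_cycle(3-5)[OF p3]
    and pen3 = bloch_pentagon_cycle(6)[OF p3]
  have ma4: "1 - a4 = - q24 / q34"
    using nz' unfolding a4_def by (simp add: divide_simps) (use cols(4) in algebra)
  have mb4: "1 - b4 = C / (q14 * q31 * q43)"
    using nz' unfolding b4_def by (simp add: divide_simps) (use C'(6) in algebra)
  have mr4: "1 - r4 = q13 * q41 / (q31 * q43)"
    using nz' unfolding r4_def by (simp add: divide_simps) (use D'(2) in algebra)
  have p4: "a4 \<noteq> 0" "b4 \<noteq> 0" "r4 \<noteq> 0" "1 - a4 \<noteq> 0" "1 - b4 \<noteq> 0"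
      "1 - r4 = a4 * b4" "1 - a4 = s4 * r4" "1 - b4 = t4 * r4"
    unfolding ma4 mb4 mr4 unfolding defs using nz' by (simp_all add: divide_simps)
  note n4 = bloch_pentagon_cycle(1,2)[OF p4] and q4 = bloch_pentagon_cycle(3-5)[OF p4]
    and pen4 = bloch_pentagon_cycle(6)[OF p4]
  have ma5: "1 - a5 = - q23 / q24"
    using nz' unfolding a5_def by (simp add: divide_simps) (use rows(2) in algebra)
  have mb5: "1 - b5 = - D / (q21 * q42)"
    using nz' unfolding b5_def by (simp add: divide_simps) (use D'(3) in algebra)
  have mr5: "1 - r5 = - q41 / q42"
    using nz' unfolding r5_def by (simp add: divide_simps) (use rows(4) in algebra)
  have p5: "a5 \<noteq> 0" "b5 \<noteq> 0" "r5 \<noteq> 0" "1 - a5 \<noteq> 0" "1 - b5 \<noteq> 0"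
      "1 - r5 = a5 * b5" "1 - a5 = s5 * r5" "1 - b5 = t5 * r5"
    unfolding ma5 mb5 mr5 unfolding defs using nz' by (simp_all add: divide_simps)
  note n5 = bloch_pentagon_cycle(1,2)[OF p5] and q5 = bloch_pentagon_cycle(3-5)[OF p5]
    and pen5 = bloch_pentagon_cycle(6)[OF p5]
  have ma6: "1 - a6 = - q32 / q34"
    using nz' unfolding a6_def by (simp add: divide_simps) (use rows(3) in algebra)
  have mb6: "1 - b6 = - C / (q24 * q31 * q43)"
    using nz' unfolding b6_def by (simp add: divide_simps) (use C'(4) in algebra)
  have mr6: "1 - r6 = - D / (q24 * q43)"
    using nz' unfolding r6_def by (simp add: divide_simps) (use D'(4) in algebra)
  have p6: "a6 \<noteq> 0" "b6 \<noteq> 0" "r6 \<noteq> 0" "1 - a6 \<noteq> 0" "1 - b6 \<noteq> 0"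
      "1 - r6 = a6 * b6" "1 - a6 = s6 * r6" "1 - b6 = t6 * r6"
    unfolding ma6 mb6 mr6 unfolding defs using nz' by (simp_all add: divide_simps)
  note n6 = bloch_pentagon_cycle(1,2)[OF p6] and q6 = bloch_pentagon_cycle(3-5)[OF p6]
    and pen6 = bloch_pentagon_cycle(6)[OF p6]
  \<comment> \<open>Pairs of terms from different pentagons that cancel.\<close>
  have k1: "frag_of t3 + frag_of b1 \<approx>\<^sub>B 0"
    using bloch_eq_one_minus[OF n1(1)] unfolding mb1 t3_def[symmetric] by (simp add: bloch_eq_def)
  have k2: "frag_of t2 - frag_of r1 \<approx>\<^sub>B 0"
  proof -
    have "inverse t2 = 1 - r1" unfolding mr1 by (simp add: defs)
    then show ?thesis
      using bloch_eq_diff[OF bloch_eq_one_minus[OF q1(3)] bloch_eq_inverse[OF q2(2)], THEN bloch_eq_minus]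
      by (simp add: bloch_eq_def)
  qed
  have k3: "frag_of b2 - frag_of r4 \<approx>\<^sub>B 0"
  proof -
    have "inverse b2 = 1 - r4" unfolding mr4 by (simp add: defs)
    then show ?thesis
      using bloch_eq_diff[OF bloch_eq_one_minus[OF q4(3)] bloch_eq_inverse[OF n2(1)], THEN bloch_eq_minus]
      by (simp add: bloch_eq_def)
  qed
  have k4: "frag_of t5 + frag_of s2 \<approx>\<^sub>B 0"
  proof -
    have "t5 = 1 - s2" using nz' unfolding defs by (simp add: divide_simps) (use D(1) in algebra)
    then show ?thesis using bloch_eq_one_minus[OF q2(1)] by (simp add: bloch_eq_def)
  qed
  have k5: "frag_of b5 - frag_of r3 \<approx>\<^sub>B 0"
  proof -
    have "inverse b5 = 1 - r3" unfolding mr3 by (simp add: defs)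
    then show ?thesis
      using bloch_eq_diff[OF bloch_eq_one_minus[OF q3(3)] bloch_eq_inverse[OF n5(1)], THEN bloch_eq_minus]
      by (simp add: bloch_eq_def)
  qed
  have k6: "frag_of s3 + frag_of t4 \<approx>\<^sub>B 0"
  proof -
    have "s3 = 1 - t4" using nz' unfolding defs by (simp add: divide_simps) (use C'(3) in algebra)
    then show ?thesis using bloch_eq_one_minus[OF q4(2)] by (simp add: bloch_eq_def)
  qed
  have k7: "frag_of s4 + frag_of b6 \<approx>\<^sub>B 0"
    using bloch_eq_inverse[OF n6(1)] by (simp add: bloch_eq_def s4_def b6_def)
  have k8: "s5 = r6" unfolding s5_def r6_def ..
  have k9: "frag_of s1 + frag_of t6 \<approx>\<^sub>B 0"
  proof -
    have "s1 = 1 - t6" using nz' unfolding defs by (simp add: divide_simps) (use C'(2) in algebra)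
    then show ?thesis using bloch_eq_one_minus[OF q6(2)] by (simp add: bloch_eq_def)
  qed
  have F1: "frag_of (q23 * q34 * q42 / C) \<approx>\<^sub>B frag_of s6"
  proof -
    have "q23 * q34 * q42 / C = inverse (1 - s6)" using nz' unfolding s6_def by (simp add: divide_simps) (use C'(7) in algebra)
    then show ?thesis using bloch_eq_rotate[OF q6(1)] by simp
  qed
  have F2: "frag_of (q14 * q43 * q31 / C) \<approx>\<^sub>B frag_of b4"
  proof -
    have "q14 * q43 * q31 / C = inverse (1 - b4)" unfolding mb4 by simp
    then show ?thesis using bloch_eq_rotate[OF n4(1)] by simp
  qed
  have F3: "frag_of (q41 * q12 * q24 / C) \<approx>\<^sub>B frag_of b3"
  proof -
    have "q41 * q12 * q24 / C = inverse (1 - b3)" unfolding mb3 by simp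
    then show ?thesis using bloch_eq_rotate[OF n3(1)] by simp
  qed
  have F4: "frag_of (q32 * q21 * q13 / C) \<approx>\<^sub>B frag_of t1"
  proof -
    have "q32 * q21 * q13 / C = 1 - inverse t1" using nz' unfolding t1_def by (simp add: divide_simps) (use C(1) in algebra)
    then show ?thesis using bloch_eq_inverse_one_minus[OF q1(2)] by simp
  qed
  have z1: "frag_of (- q13 / q14) \<approx>\<^sub>B - frag_of a3"
  proof -
    have "- q13 / q14 = 1 - a3" unfolding ma3 by simp
    then show ?thesis using bloch_eq_one_minus[OF n3(2)] by simp
  qed
  have z2: "frag_of (- q24 / q23) \<approx>\<^sub>B frag_of a5"
  proof -
    have "- q24 / q23 = inverse (1 - a5)" unfolding ma5 by simp
    then show ?thesis using bloch_eq_rotate[OF n5(2)] by simp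
  qed
  have z3: "frag_of (- q31 / q32) \<approx>\<^sub>B - frag_of a6"
  proof -
    have X: "a6 - 1 = q32 / q34" using arg_cong[OF ma6, of uminus] by simp
    have "- q31 / q32 = a6 / (a6 - 1)" using nz' unfolding X by (simp add: a6_def)
    then show ?thesis using bloch_eq_reflect[OF n6(2)] by simp
  qed
  have z4: "frag_of (- q42 / q41) \<approx>\<^sub>B frag_of r5"
  proof -
    have "- q42 / q41 = inverse (1 - r5)" unfolding mr5 by simp
    then show ?thesis using bloch_eq_rotate[OF q5(3)] by simp
  qed
  have w1: "frag_of (- q31 / q41) \<approx>\<^sub>B - frag_of r2"
  proof -
    have "- q31 / q41 = 1 - r2" unfolding mr2 by simp
    then show ?thesis using bloch_eq_one_minus[OF q2(3)] by simp
  qed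
  have w2: "frag_of (- q42 / q32) \<approx>\<^sub>B frag_of a1"
  proof -
    have "- q42 / q32 = inverse (1 - a1)" unfolding ma1 by simp
    then show ?thesis using bloch_eq_rotate[OF n1(2)] by simp
  qed
  have w3: "frag_of (- q13 / q23) \<approx>\<^sub>B - frag_of a2"
  proof -
    have X: "a2 - 1 = q23 / q43" using arg_cong[OF ma2, of uminus] by simp
    have "- q13 / q23 = a2 / (a2 - 1)" using nz' unfolding X by (simp add: a2_def)
    then show ?thesis using bloch_eq_reflect[OF n2(2)] by simp
  qed
  have w4: "frag_of (- q24 / q14) \<approx>\<^sub>B frag_of a4"
  proof -
    have "- q24 / q14 = 1 - inverse a4" using nz' unfolding a4_def by (simp add: divide_simps) (use cols(4) in algebra)
    then show ?thesis using bloch_eq_inverse_one_minus[OF n4(2)] by simp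
  qed
  have "((frag_of (- q13 / q14) + frag_of (- q24 / q23) + frag_of (- q31 / q32) + frag_of (- q42 / q41))
     - (frag_of (- q31 / q41) + frag_of (- q42 / q32) + frag_of (- q13 / q23) + frag_of (- q24 / q14)))
     - (frag_of (q23 * q34 * q42 / C) + frag_of (q14 * q43 * q31 / C)
      + frag_of (q41 * q12 * q24 / C) + frag_of (q32 * q21 * q13 / C))
   \<approx>\<^sub>B ((- frag_of a3 + frag_of a5 + - frag_of a6 + frag_of r5)
       - (- frag_of r2 + frag_of a1 + - frag_of a2 + frag_of a4))
       - (frag_of s6 + frag_of b4 + frag_of b3 + frag_of t1)" (is "?L \<approx>\<^sub>B ?R")
    by (intro bloch_eq_add bloch_eq_diff z1 z2 z3 z4 w1 w2 w3 w4 F1 F2 F3 F4)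
  moreover have "(frag_of a2 + frag_of b2 + frag_of r2 + frag_of s2 + frag_of t2)
      + (frag_of a5 + frag_of b5 + frag_of r5 + frag_of s5 + frag_of t5)
      - (frag_of a1 + frag_of b1 + frag_of r1 + frag_of s1 + frag_of t1)
      - (frag_of a3 + frag_of b3 + frag_of r3 + frag_of s3 + frag_of t3)
      - (frag_of a4 + frag_of b4 + frag_of r4 + frag_of s4 + frag_of t4)
      - (frag_of a6 + frag_of b6 + frag_of r6 + frag_of s6 + frag_of t6)
      + (frag_of t3 + frag_of b1) - (frag_of t2 - frag_of r1) + (frag_of s1 + frag_of t6)
      - (frag_of b2 - frag_of r4) - (frag_of t5 + frag_of s2) - (frag_of b5 - frag_of r3)
      + (frag_of s3 + frag_of t4) + (frag_of s4 + frag_of b6)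
    \<approx>\<^sub>B 0 + 0 - 0 - 0 - 0 - 0 + 0 - 0 + 0 - 0 - 0 - 0 + 0 + 0"
    by (intro bloch_eq_add bloch_eq_diff pen1 pen2 pen3 pen4 pen5 pen6 k1 k2 k3 k4 k5 k6 k7 k9)
  then have "?R \<approx>\<^sub>B 0" by (simp add: k8 algebra_simps)
  ultimately have "?L \<approx>\<^sub>B 0" by (rule bloch_eq_trans)
  then show ?thesis by (simp add: bloch_eq_def)
qed

section \<open>Projective linear groups acting on flags\<close>

lemma matrix_inv_works:
  fixes A :: "complex^'n^'n"
  assumes "invertible A"
  shows "A ** matrix_inv A = mat 1" "matrix_inv A ** A = mat 1"
  using assms someI_ex[of "\<lambda>A'. A ** A' = mat 1 \<and> A' ** A = mat 1"]
  unfolding invertible_def matrix_inv_def by auto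

lemma matrix_inv_unique:
  fixes A :: "complex^'n^'n"
  assumes "A ** B = mat 1" "B ** A = mat 1"
  shows "matrix_inv A = B"
proof -
  have "invertible A" using assms invertible_def by blast
  then show ?thesis
    using assms matrix_inv_works by (metis matrix_mul_assoc matrix_mul_lid matrix_mul_rid)
qed

lemma invertible_matrix_inv:
  fixes A :: "complex^'n^'n"
  assumes "invertible A" shows "invertible (matrix_inv A)"
  using matrix_inv_works[OF assms] invertible_def by blast

lemma invertible_compose:
  fixes A B :: "complex^'n^'n"
  assumes "invertible A" "invertible B" shows "invertible (A ** B)"
proof -
  have "A ** B ** (matrix_inv B ** matrix_inv A) = A ** (B ** matrix_inv B) ** matrix_inv A"
    "matrix_inv B ** matrix_inv A ** (A ** B) = matrix_inv B ** (matrix_inv A ** A) ** B"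
    by (simp_all only: matrix_mul_assoc)
  then show ?thesis unfolding invertible_def by (auto simp: assms matrix_inv_works)
qed

lemma matrix_inv_compose:
  fixes A B :: "complex^'n^'n"
  assumes "invertible A" "invertible B" shows "matrix_inv (A ** B) = matrix_inv B ** matrix_inv A"
proof -
  have "A ** B ** (matrix_inv B ** matrix_inv A) = A ** (B ** matrix_inv B) ** matrix_inv A"
    "matrix_inv B ** matrix_inv A ** (A ** B) = matrix_inv B ** (matrix_inv A ** A) ** B"
    by (simp_all only: matrix_mul_assoc)
  then show ?thesis by (intro matrix_inv_unique) (simp_all add: assms matrix_inv_works)
qed

lemma mat_matrix_mult: "mat c ** (A :: complex^'n^'n) = (\<chi> i j. c * A$i$j)"
  by (simp add: vec_eq_iff matrix_matrix_mult_def mat_def if_distrib[of "\<lambda>x. x * _"] sum.delta' cong: if_cong)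

lemma matrix_mult_mat: "(A :: complex^'n^'n) ** mat c = mat c ** A"
  unfolding mat_matrix_mult
  by (simp add: vec_eq_iff matrix_matrix_mult_def mat_def if_distrib[of "\<lambda>x. _ * x"] sum.delta mult.commute cong: if_cong)

lemma mat_mult_mat: "mat c ** mat d = (mat (c * d) :: complex^'n^'n)"
  unfolding mat_matrix_mult by (simp add: vec_eq_iff mat_def)

lemma mat_vector_mult: "mat c *v (x :: complex^'n) = c *s x"
  by (simp add: vec_eq_iff matrix_vector_mult_def mat_def if_distrib[of "\<lambda>x. x * _"] sum.delta cong: if_cong)

lemma vector_mat_mult: "(x :: complex^'n) v* mat c = c *s x"
  using mat_vector_mult[of c x] by (metis transpose_mat transpose_matrix_vector)

lemma invertible_mat: "c \<noteq> 0 \<Longrightarrow> invertible (mat c :: complex^'n^'n)"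
  unfolding invertible_def by (rule exI[of _ "mat (inverse c)"]) (simp add: mat_mult_mat)

lemma matrix_inv_mat: "c \<noteq> 0 \<Longrightarrow> matrix_inv (mat c :: complex^'n^'n) = mat (inverse c)"
  by (rule matrix_inv_unique) (simp_all add: mat_mult_mat)

definition pgl :: "complex^'n^'n \<Rightarrow> (complex^'n^'n) set" where
  "pgl A = {mat c ** A |c. c \<noteq> 0}"

lemma pgl_self: "A \<in> pgl A"
  unfolding pgl_def using zero_neq_one by (metis (mono_tags, lifting) matrix_mul_lid mem_Collect_eq)

lemma group_GL: "group (GL :: (complex^'n^'n) monoid)"
proof (rule groupI)
  fix A :: "complex^'n^'n" assume "A \<in> carrier GL"
  then show "\<exists>B\<in>carrier GL. B \<otimes>\<^bsub>GL\<^esub> A = \<one>\<^bsub>GL\<^esub>"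
    using matrix_inv_works invertible_matrix_inv unfolding GL_def by auto
qed (auto simp: GL_def invertible_compose matrix_mul_assoc invertible_mat)

lemma normal_scalars: "scalars \<lhd> (GL :: (complex^'n^'n) monoid)"
proof -
  interpret group "GL :: (complex^'n^'n) monoid" by (rule group_GL)
  have "subgroup scalars (GL :: (complex^'n^'n) monoid)"
  proof (rule subgroupI)
    fix a :: "complex^'n^'n" assume "a \<in> scalars"
    then obtain c where c: "c \<noteq> 0" "a = mat c" unfolding scalars_def by auto
    have "inv\<^bsub>GL\<^esub> a = mat (inverse c)"
      by (rule inv_equality) (use c in \<open>auto simp: GL_def mat_mult_mat invertible_mat\<close>)
    then show "inv\<^bsub>GL\<^esub> a \<in> scalars" using c unfolding scalars_def by auto
  next
    fix a b :: "complex^'n^'n" assume "a \<in> scalars" "b \<in> scalars"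
    then show "a \<otimes>\<^bsub>GL\<^esub> b \<in> scalars" unfolding scalars_def GL_def by (auto simp: mat_mult_mat)
  qed (auto simp: scalars_def GL_def invertible_mat intro: exI[of _ 1])
  then show ?thesis
    unfolding normal_def normal_axioms_def
    by (auto simp: is_group r_coset_def l_coset_def) (auto simp: GL_def scalars_def matrix_mult_mat)
qed

lemma group_PGL: "group PGL"
  unfolding PGL_def by (rule normal.factorgroup_is_group[OF normal_scalars])

lemma r_coset_scalars: "scalars #>\<^bsub>GL\<^esub> A = pgl A"
  by (auto simp: r_coset_def GL_def scalars_def pgl_def)

lemma carrier_PGL: "carrier PGL = {pgl A |A. invertible A}"
  unfolding PGL_def FactGroup_def RCOSETS_def by (auto simp: r_coset_scalars) (auto simp: GL_def)

lemma one_PGL: "\<one>\<^bsub>PGL\<^esub> = pgl (mat 1)"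
  unfolding PGL_def FactGroup_def by (simp add: scalars_def pgl_def)

lemma mult_PGL:
  assumes "invertible A" "invertible B" shows "pgl A \<otimes>\<^bsub>PGL\<^esub> pgl B = pgl (A ** B)"
  using normal.rcos_sum[OF normal_scalars, of A B] assms
  unfolding r_coset_scalars by (simp add: PGL_def FactGroup_def) (simp add: GL_def)

lemma proj_point_eq_iff:
  assumes "x \<noteq> 0" shows "proj_point x = proj_point y \<longleftrightarrow> (\<exists>c. c \<noteq> 0 \<and> y = c *s x)"
proof
  assume "proj_point x = proj_point y"
  moreover have "y \<in> proj_point y" unfolding proj_point_def by (auto intro: exI[of _ 1])
  ultimately show "\<exists>c. c \<noteq> 0 \<and> y = c *s x" unfolding proj_point_def by auto
next
  assume "\<exists>c. c \<noteq> 0 \<and> y = c *s x"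
  then obtain c where c: "c \<noteq> 0" "y = c *s x" by auto
  have "d *s x = (d / c) *s y" for d using c by (simp add: vector_smult_assoc)
  moreover have "d *s y = (d * c) *s x" for d using c by (simp add: vector_smult_assoc)
  ultimately show "proj_point x = proj_point y"
    unfolding proj_point_def using c(1) by (metis (no_types, opaque_lifting) divide_eq_0_iff mult_eq_0_iff)
qed

lemma proj_point_smult: "c \<noteq> 0 \<Longrightarrow> proj_point (c *s x) = proj_point x"
proof -
  assume c: "c \<noteq> 0"
  have "d *s x = (d / c) *s (c *s x)" for d using c by (simp add: vector_smult_assoc)
  moreover have "d *s (c *s x) = (d * c) *s x" for d using c by (simp add: vector_smult_assoc)
  ultimately show ?thesis
    unfolding proj_point_def using c by (metis (no_types, opaque_lifting) divide_eq_0_iff mult_eq_0_iff)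
qed

lemma proj_point_self: "x \<in> proj_point x"
  unfolding proj_point_def by (auto intro: exI[of _ 1])

lemma matrix_vector_smult: "(A :: complex^'n^'n) *v (c *s x) = c *s (A *v x)"
  by (metis mat_vector_mult matrix_mult_mat matrix_vector_mul_assoc)

lemma proj_act_pgl: "proj_act (pgl A) (proj_point x) = proj_point (A *v x)"
proof -
  have "mat c ** A *v (d *s x) = (c * d) *s (A *v x)" for c d
    by (simp add: matrix_vector_smult mat_vector_mult vector_smult_assoc mult.commute flip: matrix_vector_mul_assoc)
  then show ?thesis unfolding proj_act_def pgl_def proj_point_def
    by (auto 0 3) (metis mult.right_neutral zero_neq_one)
qed

lemma dual_proj_act_pgl:
  assumes "invertible A"
  shows "dual_proj_act (pgl A) (proj_point f) = proj_point (f v* matrix_inv A)"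
proof -
  have "(d *s f) v* matrix_inv (mat c ** A) = (d / c) *s (f v* matrix_inv A)" if "c \<noteq> 0" for c d
  proof -
    have "(d *s f) v* matrix_inv (mat c ** A) = f v* (mat d ** (matrix_inv A ** mat (inverse c)))"
      using that assms by (simp add: matrix_inv_compose invertible_mat matrix_inv_mat vector_mat_mult
        flip: vector_matrix_mul_assoc)
    also have "mat d ** (matrix_inv A ** mat (inverse c)) = matrix_inv A ** (mat d ** mat (inverse c))"
      by (simp only: matrix_mul_assoc matrix_mult_mat[of "matrix_inv A" d])
    also have "mat d ** mat (inverse c) = (mat (d / c) :: complex^'a^'a)"
      by (simp add: mat_mult_mat divide_inverse)
    finally show ?thesis by (simp add: vector_mat_mult flip: vector_matrix_mul_assoc)
  qed
  note eq = this
  have "c *s (f v* matrix_inv A) = (c *s f) v* matrix_inv (mat 1 ** A)" for c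
    using eq[of 1 c] by simp
  then have "c *s (f v* matrix_inv A) \<in> {f v* matrix_inv B |B f. B \<in> pgl A \<and> f \<in> proj_point f'}"
    if "c \<noteq> 0" "f' = f" for c f'
    using that pgl_self[of A] unfolding proj_point_def by fastforce
  then show ?thesis unfolding dual_proj_act_def
    by (auto simp: proj_point_def) (auto simp: pgl_def eq)
qed

lemma invertible_mult_nonzero:
  fixes A :: "complex^'n^'n"
  assumes "invertible A" "x \<noteq> 0" shows "A *v x \<noteq> 0" "x v* A \<noteq> 0"
proof -
  show "A *v x \<noteq> 0"
    using matrix_inv_works[OF assms(1)] assms(2)
    by (metis matrix_vector_mul_assoc matrix_vector_mul_lid matrix_vector_mult_0_right)
  show "x v* A \<noteq> 0"
    using matrix_inv_works[OF assms(1)] assms(2)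
    by (metis vector_matrix_mul_assoc vector_matrix_mul_rid vector_matrix_mult_0)
qed

lemma scalar_product_vector_matrix:
  "scalar_product (f v* A) (x :: complex^'n) = scalar_product f (A *v x)"
proof -
  have "(\<Sum>i\<in>UNIV. (\<Sum>j\<in>UNIV. A$j$i * f$j) * x$i) = (\<Sum>i\<in>UNIV. \<Sum>j\<in>UNIV. f$j * (A$j$i * x$i))"
    by (simp add: sum_distrib_right mult.assoc mult.left_commute)
  also have "\<dots> = (\<Sum>j\<in>UNIV. f$j * (\<Sum>i\<in>UNIV. A$j$i * x$i))"
    by (subst sum.swap) (simp add: sum_distrib_left)
  finally show ?thesis
    by (simp add: scalar_product_def vector_matrix_mult_def matrix_vector_mult_def ac_simps)
qed

lemma flag_act_pgl:
  "invertible A \<Longrightarrow> flag_act (pgl A) (proj_point x, proj_point f) = (proj_point (A *v x), proj_point (f v* matrix_inv A))"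
  by (simp add: flag_act_def proj_act_pgl dual_proj_act_pgl)

lemma flagsI: "x \<noteq> 0 \<Longrightarrow> f \<noteq> 0 \<Longrightarrow> scalar_product f x = 0 \<Longrightarrow> (proj_point x, proj_point f) \<in> flags"
  unfolding flags_def by blast

lemma flag_act_in_flags:
  assumes "g \<in> carrier PGL" "\<phi> \<in> flags" shows "flag_act g \<phi> \<in> flags"
proof -
  obtain A x f where "invertible A" "g = pgl A" "\<phi> = (proj_point x, proj_point f)" "x \<noteq> 0" "f \<noteq> 0"
    "scalar_product f x = 0"
    using assms unfolding carrier_PGL flags_def by auto
  moreover from this have "scalar_product (f v* matrix_inv A) (A *v x) = 0"
    by (simp add: scalar_product_vector_matrix matrix_vector_mul_assoc matrix_inv_works)
  ultimately show ?thesis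
    by (simp add: flag_act_pgl flagsI invertible_mult_nonzero invertible_matrix_inv)
qed

lemma flag_act_mult:
  assumes "g \<in> carrier PGL" "h \<in> carrier PGL" "\<phi> \<in> flags"
  shows "flag_act (g \<otimes>\<^bsub>PGL\<^esub> h) \<phi> = flag_act g (flag_act h \<phi>)"
  using assms unfolding carrier_PGL flags_def
  by (auto simp: mult_PGL flag_act_pgl invertible_compose matrix_inv_compose matrix_vector_mul_assoc
      vector_matrix_mul_assoc)

lemma flag_act_one: "\<phi> \<in> flags \<Longrightarrow> flag_act \<one>\<^bsub>PGL\<^esub> \<phi> = \<phi>"
  unfolding flags_def by (auto simp: one_PGL flag_act_pgl invertible_mat matrix_inv_mat)

lemma invertible_transpose:
  fixes A :: "complex^'n^'n"
  assumes "invertible A" shows "invertible (transpose A)"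
  unfolding invertible_def
  by (rule exI[of _ "transpose (matrix_inv A)"]) (simp add: assms matrix_inv_works flip: matrix_transpose_mul)

lemma transpose_inverse_pgl:
  assumes "invertible A" shows "transpose_inverse (pgl A) = pgl (matrix_inv (transpose A))"
proof -
  have tA: "invertible (transpose A)" using assms by (simp add: invertible_transpose)
  have "matrix_inv (transpose (mat c ** A)) = mat (inverse c) ** matrix_inv (transpose A)" if "c \<noteq> 0" for c
    using that tA by (simp add: matrix_transpose_mul matrix_inv_compose invertible_mat matrix_inv_mat)
  then have "transpose_inverse (pgl A) = {mat (inverse c) ** matrix_inv (transpose A) |c. c \<noteq> 0}"
    unfolding transpose_inverse_def pgl_def by (force simp: image_iff)
  also have "\<dots> = pgl (matrix_inv (transpose A))"
    unfolding pgl_def by (metis (no_types, opaque_lifting) inverse_inverse_eq inverse_zero)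
  finally show ?thesis .
qed

lemma transpose_inverse_in_PGL: "g \<in> carrier PGL \<Longrightarrow> transpose_inverse g \<in> carrier PGL"
  unfolding carrier_PGL
  by (auto simp: transpose_inverse_pgl) (metis invertible_matrix_inv invertible_transpose)

lemma transpose_matrix_inv:
  fixes A :: "complex^'n^'n"
  assumes "invertible A" shows "matrix_inv (transpose A) = transpose (matrix_inv A)"
  by (rule matrix_inv_unique)
    (metis assms matrix_inv_works matrix_transpose_mul transpose_mat)+

lemma matrix_inv_inv: "invertible A \<Longrightarrow> matrix_inv (matrix_inv A) = (A :: complex^'n^'n)"
  by (rule matrix_inv_unique) (auto simp: matrix_inv_works)

lemma transpose_inverse_involution:
  "g \<in> carrier PGL \<Longrightarrow> transpose_inverse (transpose_inverse g) = g"
  unfolding carrier_PGL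
  by (auto simp: transpose_inverse_pgl transpose_matrix_inv invertible_transpose invertible_matrix_inv matrix_inv_inv)

lemma scalar_product_commute: "scalar_product x y = scalar_product y (x :: complex^'n)"
  by (simp add: scalar_product_def mult.commute)

lemma dual_flag_in_flags: "\<phi> \<in> flags \<Longrightarrow> dual_flag \<phi> \<in> flags"
proof -
  assume "\<phi> \<in> flags"
  then obtain x f where "\<phi> = (proj_point x, proj_point f)" "x \<noteq> 0" "f \<noteq> 0" "scalar_product f x = 0"
    unfolding flags_def by auto
  then show ?thesis by (simp add: dual_flag_def flagsI scalar_product_commute)
qed

lemma dual_flag_act:
  assumes "g \<in> carrier PGL" "\<phi> \<in> flags"
  shows "dual_flag (flag_act g \<phi>) = flag_act (transpose_inverse g) (dual_flag \<phi>)"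
proof -
  obtain A x f where *: "invertible A" "g = pgl A" "\<phi> = (proj_point x, proj_point f)"
    using assms unfolding carrier_PGL flags_def by auto
  then have "invertible (transpose A)" "invertible (transpose (matrix_inv A))"
    using invertible_transpose invertible_matrix_inv by blast+
  then show ?thesis using *
    by (simp add: dual_flag_def flag_act_pgl transpose_inverse_pgl invertible_matrix_inv matrix_inv_inv transpose_matrix_inv)
qed

section \<open>Coordinates of tetrahedra of flags\<close>

text \<open>Arbitrary representatives of the point and of the line of a flag; below they enter only through
  nonvanishing conditions and through ratios in which their scale cancels.\<close>

definition flag_point :: "flag \<Rightarrow> complex^3" where
  "flag_point \<phi> = (SOME x. x \<in> fst \<phi>)"

definition flag_line :: "flag \<Rightarrow> complex^3" where
  "flag_line \<phi> = (SOME f. f \<in> snd \<phi>)"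

definition flag_pairing :: "flag \<Rightarrow> flag \<Rightarrow> complex" where
  "flag_pairing \<phi> \<psi> = scalar_product (flag_line \<phi>) (flag_point \<psi>)"

definition flag_det :: "flag \<Rightarrow> flag \<Rightarrow> flag \<Rightarrow> complex" where
  "flag_det \<phi> \<psi> \<theta> = det3 (flag_point \<phi>) (flag_point \<psi>) (flag_point \<theta>)"

text \<open>The cross-ratio of four lines through the point of \<open>\<phi>\<close>: the line of the flag \<open>\<phi>\<close> itself, and the
  lines joining its point to the points of \<open>\<psi>\<close>, \<open>\<theta>\<close>, \<open>\<omega>\<close>.\<close>

definition edge_ratio :: "flag \<Rightarrow> flag \<Rightarrow> flag \<Rightarrow> flag \<Rightarrow> complex" where
  "edge_ratio \<phi> \<psi> \<theta> \<omega> =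
    (flag_pairing \<phi> \<theta> * flag_det \<phi> \<psi> \<omega>) / (flag_pairing \<phi> \<omega> * flag_det \<phi> \<psi> \<theta>)"

text \<open>The triple ratio of three flags.\<close>

definition face_ratio :: "flag \<Rightarrow> flag \<Rightarrow> flag \<Rightarrow> complex" where
  "face_ratio \<phi> \<psi> \<theta> =
    (flag_pairing \<phi> \<psi> * flag_pairing \<psi> \<theta> * flag_pairing \<theta> \<phi>) /
    (flag_pairing \<phi> \<theta> * flag_pairing \<psi> \<phi> * flag_pairing \<theta> \<psi>)"

lemma xvec_flag_point: "xvec T i = flag_point (T i)"
  by (simp add: xvec_def flag_point_def)

lemma fvec_flag_line: "fvec T i = flag_line (T i)"
  by (simp add: fvec_def flag_line_def)

lemma generic_tetrahedron_iff:
  "generic_tetrahedron T \<longleftrightarrow> (\<forall>i. T i \<in> flags) \<and>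
     (\<forall>i j. i \<noteq> j \<longrightarrow> flag_pairing (T i) (T j) \<noteq> 0) \<and>
     (\<forall>i j k. distinct [i, j, k] \<longrightarrow> flag_det (T i) (T j) (T k) \<noteq> 0)"
  by (simp add: generic_tetrahedron_def xvec_flag_point fvec_flag_line flag_pairing_def flag_det_def)

lemma face_coord_ratio: "face_coord T i j k = face_ratio (T i) (T j) (T k)"
  by (simp add: face_coord_def face_ratio_def flag_pairing_def xvec_flag_point fvec_flag_line)

lemma some_in_proj_point: "\<exists>c. c \<noteq> 0 \<and> (SOME y. y \<in> proj_point x) = c *s x"
proof -
  have "(SOME y. y \<in> proj_point x) \<in> proj_point x" by (rule someI[of _ x]) (rule proj_point_self)
  then show ?thesis unfolding proj_point_def by auto
qed

lemma flag_point_proj_point: "\<exists>c. c \<noteq> 0 \<and> flag_point (proj_point x, F) = c *s x"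
  and flag_line_proj_point: "\<exists>c. c \<noteq> 0 \<and> flag_line (X, proj_point f) = c *s f"
  unfolding flag_point_def flag_line_def using some_in_proj_point by simp_all

lemma scalar_product_smult:
  "scalar_product (c *s f) x = c * scalar_product f (x :: complex^'n)"
  "scalar_product f (c *s x) = c * scalar_product f (x :: complex^'n)"
  by (simp_all add: scalar_product_def sum_distrib_left ac_simps)

lemma flag_rep:
  assumes "\<phi> \<in> flags"
  shows "flag_point \<phi> \<noteq> 0" "flag_line \<phi> \<noteq> 0" "flag_pairing \<phi> \<phi> = 0"
    "\<phi> = (proj_point (flag_point \<phi>), proj_point (flag_line \<phi>))"
proof -
  obtain x f where \<phi>: "\<phi> = (proj_point x, proj_point f)" "x \<noteq> 0" "f \<noteq> 0" "scalar_product f x = 0"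
    using assms unfolding flags_def by auto
  obtain c d where "c \<noteq> 0" "d \<noteq> 0" "flag_point \<phi> = c *s x" "flag_line \<phi> = d *s f"
    unfolding \<phi>(1) using flag_point_proj_point flag_line_proj_point by metis
  then show "flag_point \<phi> \<noteq> 0" "flag_line \<phi> \<noteq> 0" "flag_pairing \<phi> \<phi> = 0"
    "\<phi> = (proj_point (flag_point \<phi>), proj_point (flag_line \<phi>))"
    using \<phi> by (auto simp: flag_pairing_def scalar_product_smult proj_point_smult)
qed

lemma flag_act_rep:
  assumes "g \<in> carrier PGL"
  obtains A a b where "invertible A" "\<And>\<phi>. \<phi> \<in> flags \<Longrightarrow> a \<phi> \<noteq> 0 \<and> b \<phi> \<noteq> 0 \<and>
    flag_point (flag_act g \<phi>) = a \<phi> *s (A *v flag_point \<phi>) \<and>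
    flag_line (flag_act g \<phi>) = b \<phi> *s (flag_line \<phi> v* matrix_inv A)"
proof -
  obtain A where A: "invertible A" "g = pgl A" using assms unfolding carrier_PGL by auto
  have "\<forall>\<phi>\<in>flags. \<exists>c d. c \<noteq> 0 \<and> d \<noteq> 0 \<and> flag_point (flag_act g \<phi>) = c *s (A *v flag_point \<phi>) \<and>
    flag_line (flag_act g \<phi>) = d *s (flag_line \<phi> v* matrix_inv A)"
  proof
    fix \<phi> assume "\<phi> \<in> flags"
    then have "flag_act g \<phi> = (proj_point (A *v flag_point \<phi>), proj_point (flag_line \<phi> v* matrix_inv A))"
      using flag_rep(4)[of \<phi>] A flag_act_pgl by metis
    then show "\<exists>c d. c \<noteq> 0 \<and> d \<noteq> 0 \<and> flag_point (flag_act g \<phi>) = c *s (A *v flag_point \<phi>) \<and>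
      flag_line (flag_act g \<phi>) = d *s (flag_line \<phi> v* matrix_inv A)"
      using flag_point_proj_point flag_line_proj_point by metis
  qed
  then show ?thesis using A(1) that by metis
qed

lemma det3_expand:
  "det3 x y z = x$1 * (y$2 * z$3 - y$3 * z$2) - x$2 * (y$1 * z$3 - y$3 * z$1) + x$3 * (y$1 * z$2 - y$2 * z$1)"
  by (simp add: det3_def det_3 algebra_simps)

lemma det3_smult: "det3 (a *s x) (b *s y) (c *s z) = a * b * c * det3 x y z"
  by (simp add: det3_expand algebra_simps)

lemma det3_matrix: "det3 (A *v x) (A *v y) (A *v z) = det A * det3 x y z"
proof -
  have "vector [A *v x, A *v y, A *v z] = (vector [x, y, z] :: complex^3^3) ** transpose A"
    by (simp add: vec_eq_iff forall_3 matrix_matrix_mult_def transpose_def matrix_vector_mult_def mult.commute)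
  then show ?thesis unfolding det3_def by (simp add: det_mul)
qed

lemma flag_ratios_invariant:
  assumes "g \<in> carrier PGL" "\<phi> \<in> flags" "\<psi> \<in> flags" "\<theta> \<in> flags" "\<omega> \<in> flags"
  shows "edge_ratio (flag_act g \<phi>) (flag_act g \<psi>) (flag_act g \<theta>) (flag_act g \<omega>) = edge_ratio \<phi> \<psi> \<theta> \<omega>"
    "face_ratio (flag_act g \<phi>) (flag_act g \<psi>) (flag_act g \<theta>) = face_ratio \<phi> \<psi> \<theta>"
    "flag_pairing (flag_act g \<phi>) (flag_act g \<psi>) = 0 \<longleftrightarrow> flag_pairing \<phi> \<psi> = 0"
    "flag_det (flag_act g \<phi>) (flag_act g \<psi>) (flag_act g \<theta>) = 0 \<longleftrightarrow> flag_det \<phi> \<psi> \<theta> = 0"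
proof -
  obtain A a b where A: "invertible A" "\<And>\<phi>. \<phi> \<in> flags \<Longrightarrow> a \<phi> \<noteq> 0 \<and> b \<phi> \<noteq> 0 \<and>
    flag_point (flag_act g \<phi>) = a \<phi> *s (A *v flag_point \<phi>) \<and>
    flag_line (flag_act g \<phi>) = b \<phi> *s (flag_line \<phi> v* matrix_inv A)"
    using flag_act_rep[OF assms(1)] by metis
  have p: "flag_pairing (flag_act g \<phi>) (flag_act g \<psi>) = b \<phi> * a \<psi> * flag_pairing \<phi> \<psi>"
    if "\<phi> \<in> flags" "\<psi> \<in> flags" for \<phi> \<psi>
    using A that by (simp add: flag_pairing_def scalar_product_smult scalar_product_vector_matrix
        matrix_vector_mul_assoc matrix_inv_works)
  have d: "flag_det (flag_act g \<phi>) (flag_act g \<psi>) (flag_act g \<theta>) = a \<phi> * a \<psi> * a \<theta> * det A * flag_det \<phi> \<psi> \<theta>"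
    if "\<phi> \<in> flags" "\<psi> \<in> flags" "\<theta> \<in> flags" for \<phi> \<psi> \<theta>
    using A that by (simp add: flag_det_def det3_smult det3_matrix)
  have nz: "a \<phi> \<noteq> 0" "b \<phi> \<noteq> 0" "a \<psi> \<noteq> 0" "b \<psi> \<noteq> 0" "a \<theta> \<noteq> 0" "b \<theta> \<noteq> 0" "a \<omega> \<noteq> 0" "b \<omega> \<noteq> 0" "det A \<noteq> 0"
    using A assms invertible_det_nz by auto
  show "edge_ratio (flag_act g \<phi>) (flag_act g \<psi>) (flag_act g \<theta>) (flag_act g \<omega>) = edge_ratio \<phi> \<psi> \<theta> \<omega>"
    unfolding edge_ratio_def using assms nz by (simp add: p d)
  show "face_ratio (flag_act g \<phi>) (flag_act g \<psi>) (flag_act g \<theta>) = face_ratio \<phi> \<psi> \<theta>"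
    unfolding face_ratio_def using assms nz by (simp add: p mult.assoc)
  show "flag_pairing (flag_act g \<phi>) (flag_act g \<psi>) = 0 \<longleftrightarrow> flag_pairing \<phi> \<psi> = 0"
    using p assms nz by simp
  show "flag_det (flag_act g \<phi>) (flag_act g \<psi>) (flag_act g \<theta>) = 0 \<longleftrightarrow> flag_det \<phi> \<psi> \<theta> = 0"
    using d assms nz by simp
qed

lemmas edge_ratio_act = flag_ratios_invariant(1)
lemma face_ratio_act:
  "g \<in> carrier PGL \<Longrightarrow> \<phi> \<in> flags \<Longrightarrow> \<psi> \<in> flags \<Longrightarrow> \<theta> \<in> flags \<Longrightarrow>
    face_ratio (flag_act g \<phi>) (flag_act g \<psi>) (flag_act g \<theta>) = face_ratio \<phi> \<psi> \<theta>"
  by (rule flag_ratios_invariant(2)[of g \<phi> \<psi> \<theta> \<phi>])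

lemma flag_pairing_act:
  "g \<in> carrier PGL \<Longrightarrow> \<phi> \<in> flags \<Longrightarrow> \<psi> \<in> flags \<Longrightarrow>
    flag_pairing (flag_act g \<phi>) (flag_act g \<psi>) = 0 \<longleftrightarrow> flag_pairing \<phi> \<psi> = 0"
  by (rule flag_ratios_invariant(3)[of g \<phi> \<psi> \<phi> \<phi>])

lemma flag_det_act:
  "g \<in> carrier PGL \<Longrightarrow> \<phi> \<in> flags \<Longrightarrow> \<psi> \<in> flags \<Longrightarrow> \<theta> \<in> flags \<Longrightarrow>
    flag_det (flag_act g \<phi>) (flag_act g \<psi>) (flag_act g \<theta>) = 0 \<longleftrightarrow> flag_det \<phi> \<psi> \<theta> = 0"
  by (rule flag_ratios_invariant(4)[of g \<phi> \<psi> \<theta> \<phi>])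

lemma generic_tetrahedron_act:
  assumes "g \<in> carrier PGL" "generic_tetrahedron T"
  shows "generic_tetrahedron (\<lambda>i. flag_act g (T i))"
  using assms unfolding generic_tetrahedron_iff
  by (simp add: flag_act_in_flags flag_pairing_act flag_det_act)

subsection \<open>Even permutations of the four vertices\<close>

abbreviation transp :: "4 \<Rightarrow> 4 \<Rightarrow> 4 \<Rightarrow> 4" where
  "transp \<equiv> Transposition.transpose"

abbreviation even4 :: "(4 \<Rightarrow> 4) \<Rightarrow> bool" where
  "even4 \<sigma> \<equiv> \<sigma> permutes UNIV \<and> evenperm \<sigma>"

lemma permutation_4: "\<sigma> permutes (UNIV :: 4 set) \<Longrightarrow> permutation \<sigma>"
  unfolding permutation_permutes using finite by blast

lemma evenperm_comp_4:
  "\<sigma> permutes (UNIV :: 4 set) \<Longrightarrow> \<tau> permutes UNIV \<Longrightarrow> evenperm (\<sigma> \<circ> \<tau>) \<longleftrightarrow> evenperm \<sigma> = evenperm \<tau>"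
  by (intro evenperm_comp permutation_4)

lemma compose_transp:
  assumes "\<sigma> permutes UNIV" "a \<noteq> b"
  shows "\<sigma> \<circ> transp a b permutes UNIV" "evenperm (\<sigma> \<circ> transp a b) \<longleftrightarrow> \<not> evenperm \<sigma>"
  using evenperm_comp_4[OF assms(1) permutes_swap_id[of a UNIV b]] assms
  by (auto simp: evenperm_swap intro!: permutes_compose permutes_swap_id)

lemma distinct_4: "(1::4) \<noteq> 2" "(1::4) \<noteq> 3" "(1::4) \<noteq> 4" "(2::4) \<noteq> 3" "(2::4) \<noteq> 4" "(3::4) \<noteq> 4"
  by simp_all

lemma permutes_4_distinct: "\<sigma> permutes (UNIV :: 4 set) \<Longrightarrow> \<sigma> i = \<sigma> j \<longleftrightarrow> i = j"
  using permutes_inj by (metis injD)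

lemma even4_unique:
  assumes "even4 \<sigma>" "even4 \<tau>" "\<sigma> 1 = \<tau> 1" "\<sigma> 2 = \<tau> 2"
  shows "\<sigma> = \<tau>"
proof -
  define p where "p = inv_into UNIV \<sigma> \<circ> \<tau>"
  have p: "p permutes UNIV" unfolding p_def using assms by (intro permutes_compose permutes_inv) auto
  have "evenperm p"
    unfolding p_def using assms by (subst evenperm_comp_4) (auto intro: permutes_inv simp: evenperm_inv permutation_4)
  have p12: "p 1 = 1" "p 2 = 2"
    unfolding p_def using assms by (metis comp_apply permutes_inverses(2))+
  have inj: "p i = p j \<longleftrightarrow> i = j" for i j using permutes_4_distinct[OF p] .
  have "p 3 \<noteq> 1" "p 3 \<noteq> 2" "p 4 \<noteq> 1" "p 4 \<noteq> 2" "p 3 \<noteq> p 4"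
    using inj distinct_4 p12 by metis+
  moreover have "p 3 = 1 \<or> p 3 = 2 \<or> p 3 = 3 \<or> p 3 = 4" "p 4 = 1 \<or> p 4 = 2 \<or> p 4 = 3 \<or> p 4 = 4"
    using exhaust_4 by blast+
  ultimately consider "p 3 = 3" "p 4 = 4" | "p 3 = 4" "p 4 = 3" by metis
  then have "p = id"
  proof cases
    case 1
    then have "\<forall>i. p i = id i" unfolding forall_4 using p12 by simp
    then show ?thesis by blast
  next
    case 2
    have "\<forall>i. p i = transp 3 4 i" unfolding forall_4 using p12 2 distinct_4
      by (metis transpose_apply_first transpose_apply_other transpose_apply_second)
    then have "p = transp 3 4" by blast
    then show ?thesis using \<open>evenperm p\<close> evenperm_swap distinct_4(6) by metis
  qed
  then have "\<sigma> \<circ> p = \<sigma>" by simp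
  then show ?thesis unfolding p_def
    using assms by (metis comp_assoc id_comp permutes_inv_o(1))
qed

lemma even_completion_eq:
  assumes "even4 \<sigma>" shows "even_completion (\<sigma> 1) (\<sigma> 2) = \<sigma>"
  unfolding even_completion_def using assms even4_unique by (intro the_equality) auto

lemma even4_exists:
  assumes "i \<noteq> j"
  obtains \<sigma> where "even4 \<sigma>" "\<sigma> 1 = i" "\<sigma> 2 = j"
proof -
  define t where "t = transp 1 i"
  define p where "p = transp (t 2) j \<circ> t"
  have t: "t permutes UNIV" and p: "p permutes UNIV"
    unfolding p_def t_def by (auto intro!: permutes_compose permutes_swap_id)
  have "t 1 = i" unfolding t_def by simp
  moreover have "t 2 \<noteq> i" using permutes_4_distinct[OF t] \<open>t 1 = i\<close> distinct_4 by metis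
  ultimately have p12: "p 1 = i" "p 2 = j" unfolding p_def using assms by auto
  define q where "q = (if evenperm p then p else p \<circ> transp 3 4)"
  have "q permutes UNIV" unfolding q_def using p by (auto intro!: permutes_compose permutes_swap_id)
  moreover have "evenperm q"
    unfolding q_def using compose_transp(2)[OF p distinct_4(6)] by auto
  moreover have "q 1 = i" "q 2 = j" unfolding q_def using p12 distinct_4
    by (auto simp: transpose_apply_other)
  ultimately show ?thesis using that by blast
qed

lemma edge_coord_even:
  "even4 \<sigma> \<Longrightarrow> edge_coord T (\<sigma> 1) (\<sigma> 2) = edge_ratio (T (\<sigma> 1)) (T (\<sigma> 2)) (T (\<sigma> 3)) (T (\<sigma> 4))"
  by (simp only: edge_coord_def even_completion_eq edge_ratio_def flag_pairing_def flag_det_def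
      xvec_flag_point fvec_flag_line Let_def)

lemma edge_ratio_inverse: "edge_ratio \<phi> \<psi> \<omega> \<theta> = inverse (edge_ratio \<phi> \<psi> \<theta> \<omega>)"
  by (simp add: edge_ratio_def)

lemma edge_coord_odd:
  assumes "\<sigma> permutes UNIV" "\<not> evenperm \<sigma>"
  shows "edge_coord T (\<sigma> 1) (\<sigma> 2) = edge_ratio (T (\<sigma> 1)) (T (\<sigma> 2)) (T (\<sigma> 4)) (T (\<sigma> 3))"
proof -
  let ?\<tau> = "\<sigma> \<circ> transp 3 4"
  have "even4 ?\<tau>" using compose_transp[OF assms(1) distinct_4(6)] assms(2) by simp
  from edge_coord_even[OF this, of T] show ?thesis
    using distinct_4 by (auto simp: transpose_apply_other)
qed

lemma edge_coord_compose:
  assumes "\<pi> permutes UNIV" "i \<noteq> j"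
  shows "edge_coord (T \<circ> \<pi>) i j =
    (if evenperm \<pi> then edge_coord T (\<pi> i) (\<pi> j) else inverse (edge_coord T (\<pi> i) (\<pi> j)))"
proof -
  obtain \<sigma> where s: "even4 \<sigma>" "\<sigma> 1 = i" "\<sigma> 2 = j" using even4_exists[OF assms(2)] by metis
  have c: "\<pi> \<circ> \<sigma> permutes UNIV" "evenperm (\<pi> \<circ> \<sigma>) = evenperm \<pi>"
    using s assms evenperm_comp_4[of \<pi> \<sigma>] by (auto intro: permutes_compose)
  show ?thesis
    using edge_coord_even[OF s(1), of "T \<circ> \<pi>"] edge_coord_even[of "\<pi> \<circ> \<sigma>" T] edge_coord_odd[of "\<pi> \<circ> \<sigma>" T] c
      edge_ratio_inverse[of "T (\<pi> i)" "T (\<pi> j)" "T (\<pi> (\<sigma> 3))" "T (\<pi> (\<sigma> 4))"]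
    by (cases "evenperm \<pi>") (simp_all add: s)
qed

section \<open>The Bloch chain of a tetrahedron\<close>

definition beta_chain :: "tetrahedron \<Rightarrow> complex \<Rightarrow>\<^sub>0 int" where
  "beta_chain T = frag_of (edge_coord T 1 2) + frag_of (edge_coord T 2 1) +
     frag_of (edge_coord T 3 4) + frag_of (edge_coord T 4 3)"

lemma beta_decoration_chain:
  "beta_decoration K T = pre_Bloch_class (\<Sum>\<nu><tet_count K. beta_chain (T \<nu>))"
  by (simp add: beta_decoration_def beta_chain_def)

text \<open>Expanding the pairing of the line of \<open>\<phi>\<close> with the linear relation among four points; the term with
  \<open>\<phi>\<close> itself vanishes. This is a Pluecker relation for the four lines of \<open>edge_ratio\<close>.\<close>

lemma flag_pairing_sum:
  assumes "\<phi> \<in> flags"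
  shows "flag_pairing \<phi> \<psi> * flag_det \<phi> \<theta> \<omega> - flag_pairing \<phi> \<theta> * flag_det \<phi> \<psi> \<omega>
    + flag_pairing \<phi> \<omega> * flag_det \<phi> \<psi> \<theta> = 0"
proof -
  have "flag_pairing \<phi> \<psi> * flag_det \<phi> \<theta> \<omega> - flag_pairing \<phi> \<theta> * flag_det \<phi> \<psi> \<omega>
    + flag_pairing \<phi> \<omega> * flag_det \<phi> \<psi> \<theta> = flag_pairing \<phi> \<phi> * flag_det \<psi> \<theta> \<omega>"
    by (simp add: flag_pairing_def flag_det_def det3_expand scalar_product_def sum_3 algebra_simps)
  then show ?thesis using flag_rep(3)[OF assms] by simp
qed

lemma edge_ratio_complement:
  assumes "\<phi> \<in> flags" "flag_pairing \<phi> \<omega> \<noteq> 0" "flag_det \<phi> \<psi> \<theta> \<noteq> 0"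
  shows "1 - edge_ratio \<phi> \<psi> \<theta> \<omega> = - (flag_pairing \<phi> \<psi> * flag_det \<phi> \<theta> \<omega>) / (flag_pairing \<phi> \<omega> * flag_det \<phi> \<psi> \<theta>)"
proof -
  have "flag_pairing \<phi> \<psi> * flag_det \<phi> \<theta> \<omega> =
      flag_pairing \<phi> \<theta> * flag_det \<phi> \<psi> \<omega> - flag_pairing \<phi> \<omega> * flag_det \<phi> \<psi> \<theta>"
    using flag_pairing_sum[OF assms(1), of \<psi> \<theta> \<omega>] by (simp add: algebra_simps add_eq_0_iff)
  then show ?thesis unfolding edge_ratio_def using assms(2,3) by (simp add: divide_simps)
qed

lemma det3_swap: "det3 y x z = - det3 x y z" "det3 x z y = - det3 x y z"
  by (simp_all add: det3_expand algebra_simps)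

lemma flag_det_swap: "flag_det \<psi> \<phi> \<theta> = - flag_det \<phi> \<psi> \<theta>" "flag_det \<phi> \<theta> \<psi> = - flag_det \<phi> \<psi> \<theta>"
  unfolding flag_det_def by (rule det3_swap)+

text \<open>The three coordinates at one vertex are the cross-ratios of the same four lines in the pencil
  through \<open>x\<^sub>i\<close> under cyclic rotations, hence equal in the pre-Bloch group.\<close>

lemma edge_ratio_rotate:
  assumes "\<phi> \<in> flags" "flag_pairing \<phi> \<psi> \<noteq> 0" "flag_pairing \<phi> \<omega> \<noteq> 0" "flag_det \<phi> \<psi> \<theta> \<noteq> 0" "flag_det \<phi> \<theta> \<omega> \<noteq> 0"
  shows "edge_ratio \<phi> \<theta> \<omega> \<psi> = inverse (1 - edge_ratio \<phi> \<psi> \<theta> \<omega>)"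
  unfolding edge_ratio_complement[OF assms(1,3,4)]
  using assms flag_det_swap(2)[of \<phi> \<psi> \<theta>] by (simp add: edge_ratio_def)

lemma edge_ratio_range:
  assumes "\<phi> \<in> flags" "flag_pairing \<phi> \<psi> \<noteq> 0" "flag_pairing \<phi> \<theta> \<noteq> 0" "flag_pairing \<phi> \<omega> \<noteq> 0"
    "flag_det \<phi> \<psi> \<theta> \<noteq> 0" "flag_det \<phi> \<psi> \<omega> \<noteq> 0" "flag_det \<phi> \<theta> \<omega> \<noteq> 0"
  shows "edge_ratio \<phi> \<psi> \<theta> \<omega> \<notin> {0,1}"
proof -
  have "1 - edge_ratio \<phi> \<psi> \<theta> \<omega> \<noteq> 0"
    unfolding edge_ratio_complement[OF assms(1,4,5)] using assms by simp
  then show ?thesis using assms by (auto simp: edge_ratio_def)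
qed

lemma generic_edge_ratio_range:
  assumes "generic_tetrahedron T" "distinct [i,j,k,l]"
  shows "edge_ratio (T i) (T j) (T k) (T l) \<notin> {0,1}"
  using assms unfolding generic_tetrahedron_iff by (intro edge_ratio_range) auto

lemma even4_distinct:
  assumes "\<sigma> permutes (UNIV::4 set)" shows "distinct [\<sigma> 1, \<sigma> 2, \<sigma> 3, \<sigma> 4]"
  using permutes_4_distinct[OF assms] distinct_4 by auto

lemma edge_coord_range:
  assumes "generic_tetrahedron T" "i \<noteq> j" shows "edge_coord T i j \<notin> {0,1}"
proof -
  obtain \<sigma> where s: "even4 \<sigma>" "\<sigma> 1 = i" "\<sigma> 2 = j" using even4_exists[OF assms(2)] by metis
  have "distinct [\<sigma> 1, \<sigma> 2, \<sigma> 3, \<sigma> 4]" using s(1) even4_distinct by blast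
  from generic_edge_ratio_range[OF assms(1) this] show ?thesis
    using edge_coord_even[OF s(1), of T] s(2,3) by simp
qed

lemma even4_rotate:
  assumes "even4 \<sigma>"
  obtains \<tau> where "even4 \<tau>" "\<tau> 1 = \<sigma> 1" "\<tau> 2 = \<sigma> 3" "\<tau> 3 = \<sigma> 4" "\<tau> 4 = \<sigma> 2"
proof
  let ?\<tau> = "\<sigma> \<circ> transp 2 3 \<circ> transp 3 4"
  show "even4 ?\<tau>" using compose_transp[of "\<sigma> \<circ> transp 2 3" 3 4] compose_transp[of \<sigma> 2 3] assms distinct_4 by simp
qed (simp_all add: Transposition.transpose_def)

lemma edge_coord_rotate:
  assumes "generic_tetrahedron T" "even4 \<sigma>"
  shows "frag_of (edge_coord T (\<sigma> 1) (\<sigma> 3)) \<approx>\<^sub>B frag_of (edge_coord T (\<sigma> 1) (\<sigma> 2))"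
proof -
  obtain \<tau> where t: "even4 \<tau>" "\<tau> 1 = \<sigma> 1" "\<tau> 2 = \<sigma> 3" "\<tau> 3 = \<sigma> 4" "\<tau> 4 = \<sigma> 2"
    using even4_rotate[OF assms(2)] by metis
  have d: "distinct [\<sigma> 1, \<sigma> 2, \<sigma> 3, \<sigma> 4]" using assms even4_distinct by blast
  then have "edge_ratio (T (\<sigma> 1)) (T (\<sigma> 3)) (T (\<sigma> 4)) (T (\<sigma> 2))
      = inverse (1 - edge_ratio (T (\<sigma> 1)) (T (\<sigma> 2)) (T (\<sigma> 3)) (T (\<sigma> 4)))"
    using assms(1) unfolding generic_tetrahedron_iff by (intro edge_ratio_rotate) auto
  then have "edge_coord T (\<sigma> 1) (\<sigma> 3) = inverse (1 - edge_coord T (\<sigma> 1) (\<sigma> 2))"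
    using edge_coord_even[OF t(1), of T] edge_coord_even[OF assms(2), of T] by (simp only: t)
  then show ?thesis using bloch_eq_rotate edge_coord_range[OF assms(1), of "\<sigma> 1" "\<sigma> 2"] d by simp
qed

lemma edge_coord_indep:
  assumes "generic_tetrahedron T" "i \<noteq> j" "i \<noteq> k"
  shows "frag_of (edge_coord T i j) \<approx>\<^sub>B frag_of (edge_coord T i k)"
proof -
  obtain \<sigma> where s: "even4 \<sigma>" "\<sigma> 1 = i" "\<sigma> 2 = j" using even4_exists[OF assms(2)] by metis
  obtain \<tau> where t: "even4 \<tau>" "\<tau> 1 = \<sigma> 1" "\<tau> 2 = \<sigma> 3" "\<tau> 3 = \<sigma> 4" "\<tau> 4 = \<sigma> 2"
    using even4_rotate[OF s(1)] by metis
  obtain a where a: "k = \<sigma> a" using s(1) by (metis permutes_inverses(1))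
  have e3: "frag_of (edge_coord T i j) \<approx>\<^sub>B frag_of (edge_coord T i (\<sigma> 3))"
    using edge_coord_rotate[OF assms(1) s(1), THEN bloch_eq_sym] s by simp
  also have "\<dots> \<approx>\<^sub>B frag_of (edge_coord T i (\<sigma> 4))"
    using edge_coord_rotate[OF assms(1) t(1), THEN bloch_eq_sym] t s by simp
  finally have e4: "frag_of (edge_coord T i j) \<approx>\<^sub>B frag_of (edge_coord T i (\<sigma> 4))" .
  consider "a = 2" | "a = 3" | "a = 4" using exhaust_4[of a] a s(2) assms(3) by blast
  then show ?thesis
  proof cases
    case 1 then show ?thesis using a s(3) by simp
  next
    case 2 then show ?thesis using a e3 by (simp only:)
  next
    case 3 then show ?thesis using a e4 by (simp only:)
  qed
qed

text \<open>In the pre-Bloch group a coordinate depends only on its first index, so that one coordinate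
  may be chosen freely in every row.\<close>

lemma beta_chain_rows:
  assumes "generic_tetrahedron T" "\<And>i. n i \<noteq> i"
  shows "beta_chain T \<approx>\<^sub>B (\<Sum>i\<in>UNIV. frag_of (edge_coord T i (n i)))"
proof -
  have n: "1 \<noteq> n 1" "2 \<noteq> n 2" "3 \<noteq> n 3" "4 \<noteq> n 4" using assms(2) by metis+
  show ?thesis unfolding sum_4 beta_chain_def
    by (intro bloch_eq_add edge_coord_indep assms n) simp_all
qed

text \<open>An odd relabelling permutes the coordinates and inverts each of them, and \<open>[1/z] = -[z]\<close>.\<close>

lemma beta_chain_odd:
  assumes "generic_tetrahedron T" "\<pi> permutes UNIV" "\<not> evenperm \<pi>"
  shows "beta_chain (T \<circ> \<pi>) \<approx>\<^sub>B - beta_chain T"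
proof -
  have gen: "generic_tetrahedron (T \<circ> \<pi>)"
    using assms(1) permutes_4_distinct[OF assms(2)] unfolding generic_tetrahedron_iff by auto
  have ne: "i + 1 \<noteq> i" for i :: 4 by simp
  have "beta_chain (T \<circ> \<pi>) \<approx>\<^sub>B (\<Sum>i\<in>UNIV. frag_of (edge_coord (T \<circ> \<pi>) i (i + 1)))"
    by (rule beta_chain_rows[OF gen ne])
  also have "\<dots> \<approx>\<^sub>B (\<Sum>i\<in>UNIV. - frag_of (edge_coord T (\<pi> i) (\<pi> i + 1)))"
  proof (rule bloch_eq_sum)
    fix i :: 4
    have d: "\<pi> i \<noteq> \<pi> (i + 1)" using permutes_4_distinct[OF assms(2)] by simp
    have "frag_of (edge_coord (T \<circ> \<pi>) i (i + 1)) = frag_of (inverse (edge_coord T (\<pi> i) (\<pi> (i + 1))))"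
      using edge_coord_compose[OF assms(2), of i "i + 1" T] assms(3) by simp
    also have "\<dots> \<approx>\<^sub>B - frag_of (edge_coord T (\<pi> i) (\<pi> (i + 1)))"
      by (intro bloch_eq_inverse edge_coord_range assms d)
    also have "\<dots> \<approx>\<^sub>B - frag_of (edge_coord T (\<pi> i) (\<pi> i + 1))"
      by (intro bloch_eq_minus edge_coord_indep assms d) simp
    finally show "frag_of (edge_coord (T \<circ> \<pi>) i (i + 1)) \<approx>\<^sub>B - frag_of (edge_coord T (\<pi> i) (\<pi> i + 1))" .
  qed
  also have "(\<Sum>i\<in>UNIV. - frag_of (edge_coord T (\<pi> i) (\<pi> i + 1)))
      = - (\<Sum>i\<in>UNIV. frag_of (edge_coord T i (i + 1)))"
    unfolding sum_negf using sum.reindex_bij_betw[OF permutes_imp_bij[OF assms(2)], of "\<lambda>i. frag_of (edge_coord T i (i + 1))"] by simp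
  also have "\<dots> \<approx>\<^sub>B - beta_chain T"
    by (intro bloch_eq_minus bloch_eq_sym[OF beta_chain_rows] assms ne)
  finally show ?thesis .
qed

lemma edge_coord_act:
  assumes "g \<in> carrier PGL" "\<And>i. T i \<in> flags" "i \<noteq> j"
  shows "edge_coord (\<lambda>i. flag_act g (T i)) i j = edge_coord T i j"
proof -
  obtain \<sigma> where s: "even4 \<sigma>" "\<sigma> 1 = i" "\<sigma> 2 = j" using even4_exists[OF assms(3)] by metis
  show ?thesis
    using edge_coord_even[OF s(1), of T] edge_coord_even[OF s(1), of "\<lambda>i. flag_act g (T i)"]
    by (simp add: s edge_ratio_act assms)
qed

lemma beta_chain_act:
  assumes "g \<in> carrier PGL" "\<And>i. T i \<in> flags"
  shows "beta_chain (\<lambda>i. flag_act g (T i)) = beta_chain T"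
  unfolding beta_chain_def using assms distinct_4 by (simp add: edge_coord_act)

text \<open>Every even permutation of four letters is a product of two transpositions, which makes all
  twelve coordinates explicit.\<close>

lemma edge_coord_transps:
  assumes "a \<noteq> b" "c \<noteq> d"
  defines "\<sigma> \<equiv> transp a b \<circ> transp c d"
  shows "edge_coord T (\<sigma> 1) (\<sigma> 2) = edge_ratio (T (\<sigma> 1)) (T (\<sigma> 2)) (T (\<sigma> 3)) (T (\<sigma> 4))"
proof (rule edge_coord_even)
  show "even4 \<sigma>"
    using compose_transp[OF permutes_id assms(1)] compose_transp[of "transp a b" c d] assms
    by (simp add: \<sigma>_def)
qed

lemma edge_coord_values:
  shows "edge_coord T 1 2 = edge_ratio (T 1) (T 2) (T 3) (T 4)"
    "edge_coord T 1 3 = edge_ratio (T 1) (T 3) (T 4) (T 2)"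
    "edge_coord T 1 4 = edge_ratio (T 1) (T 4) (T 2) (T 3)"
    "edge_coord T 2 1 = edge_ratio (T 2) (T 1) (T 4) (T 3)"
    "edge_coord T 2 3 = edge_ratio (T 2) (T 3) (T 1) (T 4)"
    "edge_coord T 2 4 = edge_ratio (T 2) (T 4) (T 3) (T 1)"
    "edge_coord T 3 1 = edge_ratio (T 3) (T 1) (T 2) (T 4)"
    "edge_coord T 3 2 = edge_ratio (T 3) (T 2) (T 4) (T 1)"
    "edge_coord T 3 4 = edge_ratio (T 3) (T 4) (T 1) (T 2)"
    "edge_coord T 4 1 = edge_ratio (T 4) (T 1) (T 3) (T 2)"
    "edge_coord T 4 2 = edge_ratio (T 4) (T 2) (T 1) (T 3)"
    "edge_coord T 4 3 = edge_ratio (T 4) (T 3) (T 2) (T 1)"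
proof -
  note simps = Transposition.transpose_def distinct_4 distinct_4[symmetric]
  show "edge_coord T 1 2 = edge_ratio (T 1) (T 2) (T 3) (T 4)"
    using edge_coord_transps[of 1 2 1 2 T] by (simp add: simps)
  show "edge_coord T 1 3 = edge_ratio (T 1) (T 3) (T 4) (T 2)"
    using edge_coord_transps[of 2 3 3 4 T] by (simp add: simps)
  show "edge_coord T 1 4 = edge_ratio (T 1) (T 4) (T 2) (T 3)"
    using edge_coord_transps[of 2 3 2 4 T] by (simp add: simps)
  show "edge_coord T 2 1 = edge_ratio (T 2) (T 1) (T 4) (T 3)"
    using edge_coord_transps[of 1 2 3 4 T] by (simp add: simps)
  show "edge_coord T 2 3 = edge_ratio (T 2) (T 3) (T 1) (T 4)"
    using edge_coord_transps[of 1 2 2 3 T] by (simp add: simps)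
  show "edge_coord T 2 4 = edge_ratio (T 2) (T 4) (T 3) (T 1)"
    using edge_coord_transps[of 1 2 2 4 T] by (simp add: simps)
  show "edge_coord T 3 1 = edge_ratio (T 3) (T 1) (T 2) (T 4)"
    using edge_coord_transps[of 1 2 1 3 T] by (simp add: simps)
  show "edge_coord T 3 2 = edge_ratio (T 3) (T 2) (T 4) (T 1)"
    using edge_coord_transps[of 1 3 3 4 T] by (simp add: simps)
  show "edge_coord T 3 4 = edge_ratio (T 3) (T 4) (T 1) (T 2)"
    using edge_coord_transps[of 1 3 2 4 T] by (simp add: simps)
  show "edge_coord T 4 1 = edge_ratio (T 4) (T 1) (T 3) (T 2)"
    using edge_coord_transps[of 1 2 1 4 T] by (simp add: simps)
  show "edge_coord T 4 2 = edge_ratio (T 4) (T 2) (T 1) (T 3)"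
    using edge_coord_transps[of 1 3 1 4 T] by (simp add: simps)
  show "edge_coord T 4 3 = edge_ratio (T 4) (T 3) (T 2) (T 1)"
    using edge_coord_transps[of 1 4 2 3 T] by (simp add: simps)
qed

subsection \<open>Subdividing a tetrahedron at a further flag\<close>

definition pencil_ratio :: "complex^3 \<Rightarrow> complex^3 \<Rightarrow> complex^3 \<Rightarrow> complex^3 \<Rightarrow> complex^3 \<Rightarrow> complex" where
  "pencil_ratio v a b c d = (det3 v a c * det3 v b d) / (det3 v a d * det3 v b c)"

lemma det3_pluecker:
  "det3 v a b * det3 v c d - det3 v a c * det3 v b d + det3 v a d * det3 v b c = 0"
  by (simp add: det3_expand algebra_simps)

text \<open>Projecting five points of the plane from each of them gives five quadruples of points of a
  line. By Gale duality they come from five points of one projective line (the points lie on a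
  conic), so their cross-ratios satisfy the five-term relation.\<close>

lemma pencil_five_term:
  assumes "det3 a b c \<noteq> 0" "det3 a b d \<noteq> 0" "det3 a b e \<noteq> 0" "det3 a c d \<noteq> 0" "det3 a c e \<noteq> 0"
    "det3 a d e \<noteq> 0" "det3 b c d \<noteq> 0" "det3 b c e \<noteq> 0" "det3 b d e \<noteq> 0" "det3 c d e \<noteq> 0"
  shows "frag_of (pencil_ratio a b c d e) - frag_of (pencil_ratio b a c d e) + frag_of (pencil_ratio c a b d e)
    - frag_of (pencil_ratio d a b c e) + frag_of (pencil_ratio e a b c d) \<approx>\<^sub>B 0"
proof -
  have s: "det3 b a c = - det3 a b c" "det3 b a d = - det3 a b d" "det3 b a e = - det3 a b e"
    "det3 c a b = det3 a b c" "det3 c a d = - det3 a c d" "det3 c a e = - det3 a c e"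
    "det3 c b d = - det3 b c d" "det3 c b e = - det3 b c e" "det3 d a b = det3 a b d"
    "det3 d a c = det3 a c d" "det3 d a e = - det3 a d e" "det3 d b c = det3 b c d"
    "det3 d b e = - det3 b d e" "det3 d c e = - det3 c d e" "det3 e a b = det3 a b e"
    "det3 e a c = det3 a c e" "det3 e a d = det3 a d e" "det3 e b c = det3 b c e"
    "det3 e b d = det3 b d e" "det3 e c d = det3 c d e"
    by (simp_all add: det3_expand algebra_simps)
  have "frag_of (det3 a c e * det3 a b d / (- det3 a c d * - det3 a b e))
      - frag_of (- det3 b c e * det3 a b d / (det3 b c d * - det3 a b e))
      + frag_of (- det3 b c e * - det3 a c d / (det3 b c d * det3 a c e))
      - frag_of (det3 b d e * - det3 a c d / (det3 b c d * - det3 a d e))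
      + frag_of (det3 b d e * det3 a c e / (- det3 b c e * - det3 a d e)) \<approx>\<^sub>B 0"
    \<comment> \<open>The determinant of two of the dual points is, up to sign, that of the three complementary points.\<close>
  proof (rule bloch_five_points[where ?a01.0 = "- det3 c d e" and ?a34.0 = "- det3 a b c"])
    show "- det3 a d e * - det3 a b c - det3 a c e * det3 a b d + - det3 a c d * - det3 a b e = 0"
      using det3_pluecker[of a b c d e] by (simp add: algebra_simps)
    show "det3 b d e * - det3 a b c - - det3 b c e * det3 a b d + det3 b c d * - det3 a b e = 0"
      using det3_pluecker[of b a c d e] by (simp add: s algebra_simps)
    show "- det3 c d e * - det3 a b c - - det3 b c e * - det3 a c d + det3 b c d * det3 a c e = 0"
      using det3_pluecker[of c a b d e] by (simp add: s algebra_simps)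
    show "- det3 c d e * - det3 a b e - det3 b d e * det3 a c e + - det3 b c e * - det3 a d e = 0"
      using det3_pluecker[of e a b c d] by (simp add: s algebra_simps)
    show "- det3 c d e * det3 a b d - det3 b d e * - det3 a c d + det3 b c d * - det3 a d e = 0"
      using det3_pluecker[of d a b c e] by (simp add: s algebra_simps)
  qed (use assms in simp_all)
  then show ?thesis by (simp add: pencil_ratio_def s mult.commute)
qed

abbreviation flag_pencil_ratio :: "flag \<Rightarrow> flag \<Rightarrow> flag \<Rightarrow> flag \<Rightarrow> flag \<Rightarrow> complex" where
  "flag_pencil_ratio \<phi> \<alpha> \<beta> \<gamma> \<delta> \<equiv>
    pencil_ratio (flag_point \<phi>) (flag_point \<alpha>) (flag_point \<beta>) (flag_point \<gamma>) (flag_point \<delta>)"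

text \<open>The five-term relation for the line of \<open>\<phi>\<close> and the joins of its point with four others, all of
  them lines through one point.\<close>

lemma edge_ratio_five_term:
  assumes "\<phi> \<in> flags" "flag_pairing \<phi> \<alpha> \<noteq> 0" "flag_pairing \<phi> \<beta> \<noteq> 0" "flag_pairing \<phi> \<gamma> \<noteq> 0"
    "flag_pairing \<phi> \<delta> \<noteq> 0" "flag_det \<phi> \<alpha> \<beta> \<noteq> 0" "flag_det \<phi> \<alpha> \<gamma> \<noteq> 0" "flag_det \<phi> \<alpha> \<delta> \<noteq> 0"
    "flag_det \<phi> \<beta> \<gamma> \<noteq> 0" "flag_det \<phi> \<beta> \<delta> \<noteq> 0" "flag_det \<phi> \<gamma> \<delta> \<noteq> 0"
  shows "frag_of (edge_ratio \<phi> \<alpha> \<beta> \<gamma>) + frag_of (flag_pencil_ratio \<phi> \<alpha> \<beta> \<gamma> \<delta>) \<approx>\<^sub>B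
    frag_of (edge_ratio \<phi> \<beta> \<gamma> \<delta>) + frag_of (edge_ratio \<phi> \<alpha> \<delta> \<gamma>) + frag_of (edge_ratio \<phi> \<alpha> \<beta> \<delta>)"
proof -
  have "frag_of (flag_det \<phi> \<alpha> \<gamma> * flag_det \<phi> \<beta> \<delta> / (flag_det \<phi> \<alpha> \<delta> * flag_det \<phi> \<beta> \<gamma>))
     - frag_of (flag_pairing \<phi> \<gamma> * flag_det \<phi> \<beta> \<delta> / (flag_pairing \<phi> \<delta> * flag_det \<phi> \<beta> \<gamma>))
     + frag_of (flag_pairing \<phi> \<gamma> * flag_det \<phi> \<alpha> \<delta> / (flag_pairing \<phi> \<delta> * flag_det \<phi> \<alpha> \<gamma>))
     - frag_of (flag_pairing \<phi> \<beta> * flag_det \<phi> \<alpha> \<delta> / (flag_pairing \<phi> \<delta> * flag_det \<phi> \<alpha> \<beta>))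
     + frag_of (flag_pairing \<phi> \<beta> * flag_det \<phi> \<alpha> \<gamma> / (flag_pairing \<phi> \<gamma> * flag_det \<phi> \<alpha> \<beta>)) \<approx>\<^sub>B 0"
    by (rule bloch_five_points[where ?a01.0 = "flag_pairing \<phi> \<alpha>" and ?a34.0 = "flag_det \<phi> \<gamma> \<delta>"])
      (use assms flag_pairing_sum[OF assms(1)] det3_pluecker in \<open>simp_all add: flag_det_def\<close>)
  then have 1: "frag_of (flag_pencil_ratio \<phi> \<alpha> \<beta> \<gamma> \<delta>) - frag_of (edge_ratio \<phi> \<beta> \<gamma> \<delta>)
     + frag_of (edge_ratio \<phi> \<alpha> \<gamma> \<delta>) - frag_of (edge_ratio \<phi> \<alpha> \<beta> \<delta>) + frag_of (edge_ratio \<phi> \<alpha> \<beta> \<gamma>) \<approx>\<^sub>B 0"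
    by (simp add: edge_ratio_def pencil_ratio_def flag_det_def)
  have "edge_ratio \<phi> \<alpha> \<gamma> \<delta> \<notin> {0,1}" using assms by (intro edge_ratio_range) auto
  then have "frag_of (edge_ratio \<phi> \<alpha> \<delta> \<gamma>) \<approx>\<^sub>B - frag_of (edge_ratio \<phi> \<alpha> \<gamma> \<delta>)"
    using bloch_eq_inverse[of "edge_ratio \<phi> \<alpha> \<gamma> \<delta>"] edge_ratio_inverse[of \<phi> \<alpha> \<delta> \<gamma>] by simp
  from bloch_eq_diff[OF 1 this] show ?thesis by (simp add: bloch_eq_def algebra_simps)
qed

text \<open>If a further flag \<open>B\<close> cuts the tetrahedron into four, the row of \<open>B\<close> and each old row
  contribute one five-term relation in the pencil of lines through the respective point; the
  remaining cross-ratios of lines joining the five points cancel.\<close>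

lemma beta_chain_subdivide:
  assumes T: "generic_tetrahedron T" and TB: "\<And>i. generic_tetrahedron (T(i := B))"
  shows "beta_chain T \<approx>\<^sub>B (\<Sum>i\<in>UNIV. beta_chain (T(i := B)))"
proof -
  have fl: "T i \<in> flags" "B \<in> flags" for i
    using T TB[of i] unfolding generic_tetrahedron_iff by (auto dest: spec[of _ i])
  have p: "flag_pairing (T i) (T j) \<noteq> 0" if "i \<noteq> j" for i j
    using T that unfolding generic_tetrahedron_iff by blast
  have pB: "flag_pairing (T i) B \<noteq> 0" "flag_pairing B (T i) \<noteq> 0" for i
  proof -
    have "flag_pairing ((T(i+1 := B)) i) ((T(i+1 := B)) (i+1)) \<noteq> 0"
         "flag_pairing ((T(i+1 := B)) (i+1)) ((T(i+1 := B)) i) \<noteq> 0"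
      using TB[of "i+1"] unfolding generic_tetrahedron_iff by (auto simp del: fun_upd_apply)
    then show "flag_pairing (T i) B \<noteq> 0" "flag_pairing B (T i) \<noteq> 0" by simp_all
  qed
  have d: "flag_det (T i) (T j) (T k) \<noteq> 0" if "distinct [i,j,k]" for i j k
    using T that unfolding generic_tetrahedron_iff by blast
  have dB: "flag_det (T i) (T j) B \<noteq> 0" if ij: "i \<noteq> j" for i j
  proof -
    obtain \<sigma> where s: "even4 \<sigma>" "\<sigma> 1 = i" "\<sigma> 2 = j" using even4_exists[OF ij] by metis
    have k: "\<sigma> 3 \<noteq> i" "\<sigma> 3 \<noteq> j" using even4_distinct[of \<sigma>] s by auto
    define k where "k = \<sigma> 3"
    note k = k[folded k_def]
    have "flag_det ((T(k := B)) i) ((T(k := B)) j) ((T(k := B)) k) \<noteq> 0"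
      using TB[of k] ij k unfolding generic_tetrahedron_iff by (auto simp del: fun_upd_apply)
    then show ?thesis using k by simp
  qed
  have dB': "flag_det B (T i) (T j) \<noteq> 0" if "i \<noteq> j" for i j
    using dB[OF that] flag_det_swap(1)[of B "T i" "T j"] flag_det_swap(2)[of "T i" B "T j"] by simp
  have row: "frag_of (edge_ratio (T v) (T j) (T k) (T l)) + frag_of (flag_pencil_ratio (T v) (T j) (T k) (T l) B) \<approx>\<^sub>B
    frag_of (edge_ratio (T v) (T k) (T l) B) + frag_of (edge_ratio (T v) (T j) B (T l)) + frag_of (edge_ratio (T v) (T j) (T k) B)"
    if "distinct [v,j,k,l]" for v j k l
    using that by (intro edge_ratio_five_term fl p pB d dB) auto
  have rowB: "frag_of (edge_ratio B (T 1) (T 2) (T 3)) + frag_of (flag_pencil_ratio B (T 1) (T 2) (T 3) (T 4)) \<approx>\<^sub>B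
    frag_of (edge_ratio B (T 2) (T 3) (T 4)) + frag_of (edge_ratio B (T 1) (T 4) (T 3)) + frag_of (edge_ratio B (T 1) (T 2) (T 4))"
    using distinct_4 by (intro edge_ratio_five_term fl pB dB') auto
  have "edge_ratio B (T 1) (T 2) (T 3) \<notin> {0,1}"
    using distinct_4 by (intro edge_ratio_range fl pB dB') auto
  then have "frag_of (edge_ratio B (T 1) (T 3) (T 2)) \<approx>\<^sub>B - frag_of (edge_ratio B (T 1) (T 2) (T 3))"
    using bloch_eq_inverse[of "edge_ratio B (T 1) (T 2) (T 3)"] edge_ratio_inverse[of B "T 1" "T 3" "T 2"] by simp
  note rowB = bloch_eq_diff[OF rowB this]
  have pencil: "frag_of (flag_pencil_ratio (T 1) (T 2) (T 3) (T 4) B) + frag_of (flag_pencil_ratio (T 2) (T 3) (T 1) (T 4) B)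
    + frag_of (flag_pencil_ratio (T 3) (T 1) (T 2) (T 4) B) + frag_of (flag_pencil_ratio (T 4) (T 2) (T 1) (T 3) B)
    + frag_of (flag_pencil_ratio B (T 1) (T 2) (T 3) (T 4)) \<approx>\<^sub>B 0"
  proof -
    have swap: "frag_of (flag_pencil_ratio (T v) (T j) (T i) (T k) B) \<approx>\<^sub>B - frag_of (flag_pencil_ratio (T v) (T i) (T j) (T k) B)"
      if "distinct [v,i,j,k]" for v i j k
    proof -
      let ?r = "flag_pencil_ratio (T v) (T i) (T j) (T k) B"
      have nz: "flag_det (T v) (T i) (T j) \<noteq> 0" "flag_det (T v) (T i) (T k) \<noteq> 0" "flag_det (T v) (T j) (T k) \<noteq> 0"
        "flag_det (T v) (T i) B \<noteq> 0" "flag_det (T v) (T j) B \<noteq> 0" "flag_det (T v) (T k) B \<noteq> 0"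
        using that by (auto intro!: d dB)
      have e: "1 - ?r = - (flag_det (T v) (T i) (T j) * flag_det (T v) (T k) B) / (flag_det (T v) (T i) B * flag_det (T v) (T j) (T k))"
        using nz det3_pluecker[of "flag_point (T v)" "flag_point (T i)" "flag_point (T j)" "flag_point (T k)" "flag_point B"]
        unfolding pencil_ratio_def flag_det_def by (simp add: divide_simps) (simp add: algebra_simps add_eq_0_iff)
      have "1 - ?r \<noteq> 0" unfolding e using nz by simp
      moreover have "?r \<noteq> 0" using nz unfolding pencil_ratio_def flag_det_def by simp
      ultimately have "?r \<notin> {0,1}" by auto
      moreover have "flag_pencil_ratio (T v) (T j) (T i) (T k) B = inverse ?r"
        unfolding pencil_ratio_def by (simp add: mult.commute)
      ultimately show ?thesis using bloch_eq_inverse by metis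
    qed
    have "frag_of (flag_pencil_ratio (T 1) (T 2) (T 3) (T 4) B) - frag_of (flag_pencil_ratio (T 2) (T 1) (T 3) (T 4) B)
      + frag_of (flag_pencil_ratio (T 3) (T 1) (T 2) (T 4) B) - frag_of (flag_pencil_ratio (T 4) (T 1) (T 2) (T 3) B)
      + frag_of (flag_pencil_ratio B (T 1) (T 2) (T 3) (T 4)) \<approx>\<^sub>B 0"
      using d dB distinct_4 unfolding flag_det_def by (intro pencil_five_term) auto
    from bloch_eq_add[OF bloch_eq_add[OF this swap[of 2 1 3 4]] swap[of 4 1 2 3]]
    show ?thesis using distinct_4 by (simp add: bloch_eq_def algebra_simps)
  qed
  \<comment> \<open>The choice of a coordinate in each row that turns the sixteen terms of the four parts and the
    four terms of \<open>T\<close> into the ones occurring in \<open>row\<close> and \<open>rowB\<close>.\<close>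
  define n :: "4 \<Rightarrow> 4 \<Rightarrow> 4" where "n i v =
    (if v = 1 then (if i = 1 then 2 else if i = 2 then 3 else 2)
     else if v = 2 then (if i = 2 then 1 else if i = 3 then 1 else 3)
     else if v = 3 then (if i = 1 then 2 else 1)
     else (if i = 4 then 1 else if i = 2 then 1 else 2))" for i v
  have n: "n i v \<noteq> v" for i v
    using exhaust_4[of v] distinct_4 unfolding n_def by auto
  define m :: "4 \<Rightarrow> 4" where "m v = (if v = 1 then 2 else if v = 2 then 3 else if v = 3 then 1 else 2)" for v
  have m: "m v \<noteq> v" for v using exhaust_4[of v] distinct_4 unfolding m_def by auto
  have nv: "n 1 1 = 2" "n 2 1 = 3" "n 3 1 = 2" "n 4 1 = 2" "n 2 2 = 1" "n 3 2 = 1" "n 1 2 = 3" "n 4 2 = 3"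
    "n 3 3 = 1" "n 1 3 = 2" "n 2 3 = 1" "n 4 3 = 1" "n 4 4 = 1" "n 2 4 = 1" "n 1 4 = 2" "n 3 4 = 2"
    "m 1 = 2" "m 2 = 3" "m 3 = 1" "m 4 = 2"
    using distinct_4 unfolding n_def m_def by simp_all
  note rows = beta_chain_rows[of T m, OF T m] beta_chain_rows[of "T(i := B)" "n i" for i, OF TB n]
  have "beta_chain T - (\<Sum>i\<in>UNIV. beta_chain (T(i := B))) \<approx>\<^sub>B
     (\<Sum>v\<in>UNIV. frag_of (edge_coord T v (m v))) - (\<Sum>i\<in>UNIV. \<Sum>v\<in>UNIV. frag_of (edge_coord (T(i := B)) v (n i v)))"
    by (intro bloch_eq_diff bloch_eq_sum rows)
  also have "\<dots> = (frag_of (edge_ratio (T 1) (T 2) (T 3) (T 4)) + frag_of (edge_ratio (T 2) (T 3) (T 1) (T 4))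
      + frag_of (edge_ratio (T 3) (T 1) (T 2) (T 4)) + frag_of (edge_ratio (T 4) (T 2) (T 1) (T 3)))
    - ((frag_of (edge_ratio B (T 2) (T 3) (T 4)) + frag_of (edge_ratio (T 1) (T 3) (T 4) B)
       + frag_of (edge_ratio (T 1) (T 2) B (T 4)) + frag_of (edge_ratio (T 1) (T 2) (T 3) B))
     + (frag_of (edge_ratio B (T 1) (T 4) (T 3)) + frag_of (edge_ratio (T 2) (T 1) (T 4) B)
       + frag_of (edge_ratio (T 2) (T 3) B (T 4)) + frag_of (edge_ratio (T 2) (T 3) (T 1) B))
     + (frag_of (edge_ratio B (T 1) (T 2) (T 4)) + frag_of (edge_ratio (T 3) (T 2) (T 4) B)
       + frag_of (edge_ratio (T 3) (T 1) B (T 4)) + frag_of (edge_ratio (T 3) (T 1) (T 2) B))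
     + (frag_of (edge_ratio B (T 1) (T 3) (T 2)) + frag_of (edge_ratio (T 4) (T 1) (T 3) B)
       + frag_of (edge_ratio (T 4) (T 2) B (T 3)) + frag_of (edge_ratio (T 4) (T 2) (T 1) B)))"
    unfolding sum_4 nv edge_coord_values using distinct_4 by (simp add: algebra_simps)
  also have "\<dots> \<approx>\<^sub>B 0"
  proof -
    have "frag_of (edge_ratio (T 1) (T 2) (T 3) (T 4)) + frag_of (flag_pencil_ratio (T 1) (T 2) (T 3) (T 4) B)
      + (frag_of (edge_ratio (T 2) (T 3) (T 1) (T 4)) + frag_of (flag_pencil_ratio (T 2) (T 3) (T 1) (T 4) B))
      + (frag_of (edge_ratio (T 3) (T 1) (T 2) (T 4)) + frag_of (flag_pencil_ratio (T 3) (T 1) (T 2) (T 4) B))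
      + (frag_of (edge_ratio (T 4) (T 2) (T 1) (T 3)) + frag_of (flag_pencil_ratio (T 4) (T 2) (T 1) (T 3) B))
      + (frag_of (edge_ratio B (T 1) (T 2) (T 3)) + frag_of (flag_pencil_ratio B (T 1) (T 2) (T 3) (T 4))
          - frag_of (edge_ratio B (T 1) (T 3) (T 2)))
      \<approx>\<^sub>B frag_of (edge_ratio (T 1) (T 3) (T 4) B) + frag_of (edge_ratio (T 1) (T 2) B (T 4)) + frag_of (edge_ratio (T 1) (T 2) (T 3) B)
      + (frag_of (edge_ratio (T 2) (T 1) (T 4) B) + frag_of (edge_ratio (T 2) (T 3) B (T 4)) + frag_of (edge_ratio (T 2) (T 3) (T 1) B))
      + (frag_of (edge_ratio (T 3) (T 2) (T 4) B) + frag_of (edge_ratio (T 3) (T 1) B (T 4)) + frag_of (edge_ratio (T 3) (T 1) (T 2) B))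
      + (frag_of (edge_ratio (T 4) (T 1) (T 3) B) + frag_of (edge_ratio (T 4) (T 2) B (T 3)) + frag_of (edge_ratio (T 4) (T 2) (T 1) B))
      + (frag_of (edge_ratio B (T 2) (T 3) (T 4)) + frag_of (edge_ratio B (T 1) (T 4) (T 3)) + frag_of (edge_ratio B (T 1) (T 2) (T 4))
         - - frag_of (edge_ratio B (T 1) (T 2) (T 3)))"
      using distinct_4 by (intro bloch_eq_add row rowB) auto
    from bloch_eq_diff[OF this pencil] show ?thesis by (simp add: bloch_eq_def algebra_simps)
  qed
  finally show ?thesis by (simp only: bloch_eq_def diff_zero)
qed

subsection \<open>Duality for one tetrahedron\<close>

text \<open>The permutation only fixes a positively oriented order of the face opposite to \<open>i\<close>; the second
  argument \<open>i + 1\<close> is an arbitrary first vertex, as triple ratios are invariant under rotation.\<close>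

definition face_term :: "tetrahedron \<Rightarrow> 4 \<Rightarrow> complex \<Rightarrow>\<^sub>0 int" where
  "face_term T i = (let \<sigma> = even_completion i (i + 1); z = face_coord T (\<sigma> 2) (\<sigma> 3) (\<sigma> 4)
     in frag_of (z / (1 + z)))"

lemma face_ratio_rotate: "face_ratio \<psi> \<theta> \<phi> = face_ratio \<phi> \<psi> \<theta>"
  by (simp add: face_ratio_def mult.commute mult.left_commute)

lemma face_ratio_swap: "face_ratio \<phi> \<theta> \<psi> = inverse (face_ratio \<phi> \<psi> \<theta>)"
  by (simp add: face_ratio_def mult.commute mult.left_commute)

lemma face_term_even:
  assumes "even4 \<sigma>"
  shows "face_term T (\<sigma> 1) = frag_of (face_ratio (T (\<sigma> 2)) (T (\<sigma> 3)) (T (\<sigma> 4))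
      / (1 + face_ratio (T (\<sigma> 2)) (T (\<sigma> 3)) (T (\<sigma> 4))))"
proof -
  let ?i = "\<sigma> 1"
  obtain \<tau> where t: "even4 \<tau>" "\<tau> 1 = \<sigma> 1" "\<tau> 2 = \<sigma> 3" "\<tau> 3 = \<sigma> 4" "\<tau> 4 = \<sigma> 2"
    using even4_rotate[OF assms] by metis
  obtain \<tau>' where t': "even4 \<tau>'" "\<tau>' 1 = \<tau> 1" "\<tau>' 2 = \<tau> 3" "\<tau>' 3 = \<tau> 4" "\<tau>' 4 = \<tau> 2"
    using even4_rotate[OF t(1)] by metis
  obtain a where a: "?i + 1 = \<sigma> a" using assms by (metis permutes_inverses(1))
  have "?i + 1 \<noteq> ?i" by simp
  then have "a = 2 \<or> a = 3 \<or> a = 4" using exhaust_4[of a] a by metis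
  then consider "?i + 1 = \<sigma> 2" | "?i + 1 = \<tau> 2" | "?i + 1 = \<tau>' 2" using a t t' by metis
  then show ?thesis
  proof cases
    case 1
    then show ?thesis using even_completion_eq[OF assms]
      by (simp add: face_term_def face_coord_ratio Let_def)
  next
    case 2
    have "even_completion ?i (?i + 1) = \<tau>" using even_completion_eq[OF t(1)] unfolding 2 t(2) .
    then show ?thesis using face_ratio_rotate[of "T (\<sigma> 3)" "T (\<sigma> 4)" "T (\<sigma> 2)"]
      by (simp add: face_term_def face_coord_ratio Let_def t)
  next
    case 3
    have "even_completion ?i (?i + 1) = \<tau>'" using even_completion_eq[OF t'(1)] unfolding 3 t'(2) t(2) .
    then show ?thesis using face_ratio_rotate[of "T (\<sigma> 2)" "T (\<sigma> 3)" "T (\<sigma> 4)"]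
      by (simp add: face_term_def face_coord_ratio Let_def t t')
  qed
qed

text \<open>The two sides of a face contribute inverse face coordinates \<open>z\<close> and \<open>1/z\<close>, whose terms
  \<open>[z/(1+z)]\<close> and \<open>[1/(1+z)] = [1 - z/(1+z)]\<close> cancel.\<close>

lemma face_term_cancel:
  assumes "generic_tetrahedron T" "g \<in> carrier PGL"
    and "\<pi> permutes UNIV" "\<not> evenperm \<pi>" "\<And>j. j \<noteq> i \<Longrightarrow> T' (\<pi> j) = flag_act g (T j)"
    and nz: "\<And>j k l. distinct [j,k,l] \<Longrightarrow> face_ratio (T j) (T k) (T l) \<noteq> -1"
  shows "face_term T i + face_term T' (\<pi> i) \<approx>\<^sub>B 0"
proof -
  have "i \<noteq> i + 1" by simp
  then obtain \<sigma> where s: "even4 \<sigma>" "\<sigma> 1 = i" using even4_exists by metis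
  let ?\<tau> = "\<pi> \<circ> \<sigma> \<circ> transp 3 4"
  let ?z = "face_ratio (T (\<sigma> 2)) (T (\<sigma> 3)) (T (\<sigma> 4))"
  have "\<pi> \<circ> \<sigma> permutes UNIV" "\<not> evenperm (\<pi> \<circ> \<sigma>)"
    using s assms evenperm_comp_4[of \<pi> \<sigma>] by (auto intro: permutes_compose)
  then have "even4 ?\<tau>" using compose_transp[of "\<pi> \<circ> \<sigma>" 3 4] distinct_4 by simp
  note e = face_term_even[OF this, of T']
  have d: "distinct [\<sigma> 1, \<sigma> 2, \<sigma> 3, \<sigma> 4]" using s even4_distinct by blast
  have fl: "T j \<in> flags" for j using assms(1) unfolding generic_tetrahedron_iff by blast
  have "\<sigma> 2 \<noteq> i" "\<sigma> 3 \<noteq> i" "\<sigma> 4 \<noteq> i" using d s(2) by auto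
  then have "face_ratio (T' (?\<tau> 2)) (T' (?\<tau> 3)) (T' (?\<tau> 4)) = inverse ?z"
    using assms(2) fl face_ratio_swap[of "T (\<sigma> 2)" "T (\<sigma> 4)" "T (\<sigma> 3)"]
    by (simp add: Transposition.transpose_def assms(5) face_ratio_act)
  moreover have "?\<tau> 1 = \<pi> i" using s(2) by (simp add: Transposition.transpose_def)
  ultimately have e': "face_term T' (\<pi> i) = frag_of (inverse ?z / (1 + inverse ?z))"
    using e by (simp only:)
  have z0: "?z \<noteq> 0" using assms(1) d unfolding generic_tetrahedron_iff face_ratio_def by auto
  have z1: "1 + ?z \<noteq> 0" using nz[of "\<sigma> 2" "\<sigma> 3" "\<sigma> 4"] d by (simp add: eq_neg_iff_add_eq_0 add.commute)
  have "inverse ?z / (1 + inverse ?z) = 1 - ?z / (1 + ?z)"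
    using z0 z1 by (simp add: divide_simps) (simp add: algebra_simps)
  moreover have "?z / (1 + ?z) \<notin> {0,1}" using z0 z1 by (auto simp: divide_simps)
  ultimately show ?thesis using bloch_eq_one_minus[of "?z / (1 + ?z)"] face_term_even[OF s(1), of T]
    unfolding e' s(2) by (simp add: bloch_eq_def add.commute)
qed

definition flag_codet :: "flag \<Rightarrow> flag \<Rightarrow> flag \<Rightarrow> complex" where
  "flag_codet \<phi> \<psi> \<theta> = det3 (flag_line \<phi>) (flag_line \<psi>) (flag_line \<theta>)"

lemma dual_flag_pairing: "flag_pairing (dual_flag \<phi>) (dual_flag \<psi>) = flag_pairing \<psi> \<phi>"
  unfolding flag_pairing_def dual_flag_def flag_line_def flag_point_def
  by (simp add: scalar_product_commute)

lemma dual_flag_det: "flag_det (dual_flag \<phi>) (dual_flag \<psi>) (dual_flag \<theta>) = flag_codet \<phi> \<psi> \<theta>"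
  by (simp add: flag_det_def flag_codet_def dual_flag_def flag_line_def flag_point_def)

lemma generic_dual_iff:
  "generic_tetrahedron (\<lambda>i. dual_flag (T i)) \<longleftrightarrow> (\<forall>i. dual_flag (T i) \<in> flags) \<and>
     (\<forall>i j. i \<noteq> j \<longrightarrow> flag_pairing (T i) (T j) \<noteq> 0) \<and>
     (\<forall>i j k. distinct [i, j, k] \<longrightarrow> flag_codet (T i) (T j) (T k) \<noteq> 0)"
  unfolding generic_tetrahedron_iff dual_flag_pairing dual_flag_det by metis

text \<open>The product of the two determinants is that of the matrix of pairings, whose diagonal vanishes.
  So the lines of three flags of a generic tetrahedron are concurrent iff their face coordinate
  is \<open>-1\<close>, and for a generic tetrahedron with generic dual no face coordinate is \<open>-1\<close>.\<close>

lemma flag_codet_det: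
  assumes "\<phi> \<in> flags" "\<psi> \<in> flags" "\<theta> \<in> flags"
  shows "flag_codet \<phi> \<psi> \<theta> * flag_det \<phi> \<psi> \<theta> =
    flag_pairing \<phi> \<psi> * flag_pairing \<psi> \<theta> * flag_pairing \<theta> \<phi> + flag_pairing \<phi> \<theta> * flag_pairing \<theta> \<psi> * flag_pairing \<psi> \<phi>"
proof -
  have "flag_codet \<phi> \<psi> \<theta> * flag_det \<phi> \<psi> \<theta> =
     det3 (vector [flag_pairing \<phi> \<phi>, flag_pairing \<phi> \<psi>, flag_pairing \<phi> \<theta>])
       (vector [flag_pairing \<psi> \<phi>, flag_pairing \<psi> \<psi>, flag_pairing \<psi> \<theta>])
       (vector [flag_pairing \<theta> \<phi>, flag_pairing \<theta> \<psi>, flag_pairing \<theta> \<theta>])"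
    unfolding flag_codet_def flag_det_def det3_expand flag_pairing_def scalar_product_def sum_3 vector_3
    by algebra
  then show ?thesis
    using flag_rep(3) assms unfolding det3_expand vector_3 by (simp add: algebra_simps)
qed

lemma face_term_transps:
  assumes "a \<noteq> b" "c \<noteq> d"
  defines "\<sigma> \<equiv> transp a b \<circ> transp c d"
  shows "face_term T (\<sigma> 1) = frag_of (face_ratio (T (\<sigma> 2)) (T (\<sigma> 3)) (T (\<sigma> 4))
      / (1 + face_ratio (T (\<sigma> 2)) (T (\<sigma> 3)) (T (\<sigma> 4))))"
proof (rule face_term_even)
  show "even4 \<sigma>"
    using compose_transp[OF permutes_id assms(1)] compose_transp[of "transp a b" c d] assms
    by (simp add: \<sigma>_def)
qed

lemma face_ratio_neq_minus_one:
  assumes "generic_tetrahedron T" "generic_tetrahedron (\<lambda>i. dual_flag (T i))" "distinct [i,j,k]"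
  shows "face_ratio (T i) (T j) (T k) \<noteq> -1"
proof
  assume m: "face_ratio (T i) (T j) (T k) = -1"
  have fl: "T i \<in> flags" for i using assms(1) unfolding generic_tetrahedron_iff by blast
  have p: "flag_pairing (T i) (T j) \<noteq> 0" if "i \<noteq> j" for i j
    using assms(1) that unfolding generic_tetrahedron_iff by blast
  have "flag_codet (T i) (T j) (T k) * flag_det (T i) (T j) (T k) = 0"
    unfolding flag_codet_det[OF fl fl fl] using m p[of i k] p[of j i] p[of k j] assms(3)
    unfolding face_ratio_def by (simp add: divide_simps split: if_splits)
  then show False using assms unfolding generic_dual_iff generic_tetrahedron_iff by auto
qed

lemma det3_four_term:
  "scalar_product f a * det3 b c d - scalar_product f b * det3 a c d + scalar_product f c * det3 a b d
    - scalar_product f d * det3 a b c = 0"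
  by (simp add: det3_expand scalar_product_def sum_3 algebra_simps)

lemma principal_minors_equal:
  fixes q12 q13 q14 q21 q23 q24 q31 q32 q34 q41 q42 q43 :: complex
  assumes "q12 + q13 + q14 = 0" "q21 + q23 + q24 = 0" "q31 + q32 + q34 = 0" "q41 + q42 + q43 = 0"
    and "q21 + q31 + q41 = 0" "q12 + q32 + q42 = 0" "q13 + q23 + q43 = 0" "q14 + q24 + q34 = 0"
  shows "q12 * q24 * q41 + q14 * q42 * q21 = q12 * q23 * q31 + q13 * q32 * q21"
    "q13 * q34 * q41 + q14 * q43 * q31 = q12 * q23 * q31 + q13 * q32 * q21"
    "q23 * q34 * q42 + q24 * q43 * q32 = q12 * q23 * q31 + q13 * q32 * q21"
proof -
  have "q14 = - q12 - q13" "q24 = - q21 - q23" "q34 = q12 + q13 + q21 + q23" "q31 = - q21 - q41"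
    "q32 = - q12 - q13 - q23 + q41" "q42 = q13 + q23 - q41" "q43 = - q13 - q23"
    using assms by algebra+
  note e = this
  show "q12 * q24 * q41 + q14 * q42 * q21 = q12 * q23 * q31 + q13 * q32 * q21"
    "q13 * q34 * q41 + q14 * q43 * q31 = q12 * q23 * q31 + q13 * q32 * q21"
    "q23 * q34 * q42 + q24 * q43 * q32 = q12 * q23 * q31 + q13 * q32 * q21"
    unfolding e by algebra+
qed

text \<open>Scaling the pairings \<open>f\<^sub>i(x\<^sub>j)\<close> by the coefficients of the linear relations among the points
  and among the lines produces a matrix with vanishing row and column sums. The coordinates of the
  tetrahedron are quotients of entries in the same row of this matrix, those of the dual
  tetrahedron are quotients of entries in the same column, and \<open>bloch_duality_matrix\<close> applies.\<close>

lemma beta_chain_dual: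
  assumes T: "generic_tetrahedron T" and T': "generic_tetrahedron (\<lambda>i. dual_flag (T i))"
    and minor: "flag_pairing (T 2) (T 1) * flag_pairing (T 4) (T 3) \<noteq> flag_pairing (T 4) (T 1) * flag_pairing (T 2) (T 3)"
  shows "beta_chain T - beta_chain (\<lambda>i. dual_flag (T i)) \<approx>\<^sub>B (\<Sum>i\<in>UNIV. face_term T i)"
proof -
  define m where "m i j = flag_pairing (T i) (T j)" for i j
  define a1 a2 a3 a4 where "a1 = flag_det (T 2) (T 3) (T 4)" and "a2 = - flag_det (T 1) (T 3) (T 4)"
    and "a3 = flag_det (T 1) (T 2) (T 4)" and "a4 = - flag_det (T 1) (T 2) (T 3)"
  define b1 b2 b3 b4 where "b1 = flag_codet (T 2) (T 3) (T 4)" and "b2 = - flag_codet (T 1) (T 3) (T 4)"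
    and "b3 = flag_codet (T 1) (T 2) (T 4)" and "b4 = - flag_codet (T 1) (T 2) (T 3)"
  have fl: "T i \<in> flags" for i using T unfolding generic_tetrahedron_iff by blast
  have m0: "m i i = 0" for i unfolding m_def by (rule flag_rep(3)[OF fl])
  have m: "m i j \<noteq> 0" if "i \<noteq> j" for i j using T that unfolding m_def generic_tetrahedron_iff by blast
  have dd: "flag_det (T i) (T j) (T k) \<noteq> 0" if "distinct [i,j,k]" for i j k
    using T that unfolding generic_tetrahedron_iff by blast
  have "flag_codet (T i) (T j) (T k) \<noteq> 0" if "distinct [i,j,k]" for i j k
    using T' that unfolding generic_dual_iff by blast
  note d = dd this
  have ab: "a1 \<noteq> 0" "a2 \<noteq> 0" "a3 \<noteq> 0" "a4 \<noteq> 0" "b1 \<noteq> 0" "b2 \<noteq> 0" "b3 \<noteq> 0" "b4 \<noteq> 0"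
    using d distinct_4 unfolding a1_def a2_def a3_def a4_def b1_def b2_def b3_def b4_def by simp_all
  note mm = m[OF distinct_4(1)] m[OF distinct_4(2)] m[OF distinct_4(3)] m[OF distinct_4(4)] m[OF distinct_4(5)] m[OF distinct_4(6)]
    m[OF distinct_4(1)[symmetric]] m[OF distinct_4(2)[symmetric]] m[OF distinct_4(3)[symmetric]] m[OF distinct_4(4)[symmetric]] m[OF distinct_4(5)[symmetric]] m[OF distinct_4(6)[symmetric]]
  have "m i 1 * a1 + m i 2 * a2 + m i 3 * a3 + m i 4 * a4 = 0" for i
    using det3_four_term[of "flag_line (T i)" "flag_point (T 1)" "flag_point (T 2)" "flag_point (T 3)" "flag_point (T 4)"]
    unfolding m_def flag_pairing_def a1_def a2_def a3_def a4_def flag_det_def by simp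
  then have "b * (m i 1 * a1 + m i 2 * a2 + m i 3 * a3 + m i 4 * a4) = 0" for i b by simp
  note row = this[of b1 1] this[of b2 2] this[of b3 3] this[of b4 4]
  have "m 1 i * b1 + m 2 i * b2 + m 3 i * b3 + m 4 i * b4 = 0" for i
    using det3_four_term[of "flag_point (T i)" "flag_line (T 1)" "flag_line (T 2)" "flag_line (T 3)" "flag_line (T 4)"]
    unfolding m_def flag_pairing_def b1_def b2_def b3_def b4_def flag_codet_def by (simp add: scalar_product_commute)
  then have "a * (m 1 i * b1 + m 2 i * b2 + m 3 i * b3 + m 4 i * b4) = 0" for i a by simp
  note col = this[of a1 1] this[of a2 2] this[of a3 3] this[of a4 4]
  define q12 q13 q14 q21 q23 q24 where "q12 = b1 * m 1 2 * a2" and "q13 = b1 * m 1 3 * a3" and "q14 = b1 * m 1 4 * a4"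
    and "q21 = b2 * m 2 1 * a1" and "q23 = b2 * m 2 3 * a3" and "q24 = b2 * m 2 4 * a4"
  define q31 q32 q34 q41 q42 q43 where "q31 = b3 * m 3 1 * a1" and "q32 = b3 * m 3 2 * a2" and "q34 = b3 * m 3 4 * a4"
    and "q41 = b4 * m 4 1 * a1" and "q42 = b4 * m 4 2 * a2" and "q43 = b4 * m 4 3 * a3"
  note q = q12_def q13_def q14_def q21_def q23_def q24_def q31_def q32_def q34_def q41_def q42_def q43_def
  define C where "C = q12 * q23 * q31 + q13 * q32 * q21"
  define D where "D = q21 * q43 - q41 * q23"
  have rows: "q12 + q13 + q14 = 0" "q21 + q23 + q24 = 0" "q31 + q32 + q34 = 0" "q41 + q42 + q43 = 0"
    using row unfolding q m0 by (simp_all add: algebra_simps)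
  have cols: "q21 + q31 + q41 = 0" "q12 + q32 + q42 = 0" "q13 + q23 + q43 = 0" "q14 + q24 + q34 = 0"
    using col unfolding q m0 by (simp_all add: algebra_simps)
  have qz: "q12 \<noteq> 0" "q13 \<noteq> 0" "q14 \<noteq> 0" "q21 \<noteq> 0" "q23 \<noteq> 0" "q24 \<noteq> 0"
      "q31 \<noteq> 0" "q32 \<noteq> 0" "q34 \<noteq> 0" "q41 \<noteq> 0" "q42 \<noteq> 0" "q43 \<noteq> 0"
    unfolding q using ab mm by simp_all
  have "C = (b1 * b2 * b3 * a1 * a2 * a3) * (flag_codet (T 1) (T 2) (T 3) * flag_det (T 1) (T 2) (T 3))"
    unfolding flag_codet_det[OF fl fl fl] C_def q m_def by (simp add: algebra_simps)
  then have C: "C \<noteq> 0" using ab d[of 1 2 3] distinct_4 by simp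
  have "D = (b2 * b4 * a1 * a3) * (m 2 1 * m 4 3 - m 4 1 * m 2 3)"
    unfolding D_def q by (simp add: algebra_simps)
  then have D: "D \<noteq> 0" using ab minor unfolding m_def by simp
  note minors = principal_minors_equal[OF rows cols, folded C_def]
  have f: "frag_of (x / C) = frag_of (z / (1 + z))" if "x + y = C" "z = x / y" "y \<noteq> 0" for x y z
  proof -
    have "1 + z = C / y" using that by (simp add: divide_simps) (simp add: algebra_simps)
    then show ?thesis using that(2,3) by simp
  qed
  have rot: "flag_det \<phi> \<psi> \<theta> = flag_det \<theta> \<phi> \<psi>" for \<phi> \<psi> \<theta>
    by (simp add: flag_det_def det3_expand algebra_simps)
  have corot: "flag_codet \<phi> \<psi> \<theta> = flag_codet \<theta> \<phi> \<psi>" for \<phi> \<psi> \<theta>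
    by (simp add: flag_codet_def det3_expand algebra_simps)
  have coswap: "flag_codet \<phi> \<psi> \<theta> = - flag_codet \<psi> \<phi> \<theta>" for \<phi> \<psi> \<theta>
    by (simp add: flag_codet_def det3_expand algebra_simps)
  have "(frag_of (- q13 / q14) + frag_of (- q24 / q23) + frag_of (- q31 / q32) + frag_of (- q42 / q41))
     - (frag_of (- q31 / q41) + frag_of (- q42 / q32) + frag_of (- q13 / q23) + frag_of (- q24 / q14))
    \<approx>\<^sub>B frag_of (q23 * q34 * q42 / C) + frag_of (q14 * q43 * q31 / C)
      + frag_of (q41 * q12 * q24 / C) + frag_of (q32 * q21 * q13 / C)"
    by (rule bloch_duality_matrix[OF qz rows cols C_def[symmetric] C D_def[symmetric] D])
  moreover have "edge_coord T 1 2 = - q13 / q14" "edge_coord T 2 1 = - q24 / q23"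
    "edge_coord T 3 4 = - q31 / q32" "edge_coord T 4 3 = - q42 / q41"
    unfolding edge_coord_values edge_ratio_def q m_def a1_def a2_def a3_def a4_def
    using ab flag_det_swap(1)[of "T 2" "T 1" "T 3"] flag_det_swap(1)[of "T 2" "T 1" "T 4"]
      rot[of "T 3" "T 4" "T 2"] rot[of "T 3" "T 4" "T 1"] flag_det_swap(1)[of "T 4" "T 3" "T 1"]
      flag_det_swap(1)[of "T 4" "T 3" "T 2"] by simp_all
  moreover have "edge_coord (\<lambda>i. dual_flag (T i)) 1 2 = - q31 / q41" "edge_coord (\<lambda>i. dual_flag (T i)) 2 1 = - q42 / q32"
    "edge_coord (\<lambda>i. dual_flag (T i)) 3 4 = - q13 / q23" "edge_coord (\<lambda>i. dual_flag (T i)) 4 3 = - q24 / q14"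
    unfolding edge_coord_values edge_ratio_def dual_flag_det dual_flag_pairing q m_def b1_def b2_def b3_def b4_def
    using ab coswap[of "T 2" "T 1" "T 3"] coswap[of "T 2" "T 1" "T 4"]
      corot[of "T 3" "T 4" "T 2"] corot[of "T 3" "T 4" "T 1"] coswap[of "T 4" "T 3" "T 1"]
      coswap[of "T 4" "T 3" "T 2"] by (simp_all add: mult.commute)
  moreover have "face_term T 1 = frag_of (q23 * q34 * q42 / C)" 
  proof -
    have "frag_of (q23 * q34 * q42 / C) = frag_of (face_ratio (T 2) (T 3) (T 4) / (1 + face_ratio (T 2) (T 3) (T 4)))"
      by (rule f[where y = "q24 * q43 * q32"]) (use minors ab qz in \<open>simp_all add: face_ratio_def q ac_simps flip: m_def\<close>)
    then show ?thesis using face_term_transps[of 1 2 1 2 T] by (simp add: Transposition.transpose_def)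
  qed
  moreover have "face_term T 2 = frag_of (q14 * q43 * q31 / C)"
  proof -
    have "frag_of (q14 * q43 * q31 / C) = frag_of (face_ratio (T 1) (T 4) (T 3) / (1 + face_ratio (T 1) (T 4) (T 3)))"
      by (rule f[where y = "q13 * q34 * q41"]) (use minors ab qz in \<open>simp_all add: face_ratio_def q ac_simps flip: m_def\<close>)
    then show ?thesis using face_term_transps[of 1 2 3 4 T] by (simp add: Transposition.transpose_def)
  qed
  moreover have "face_term T 3 = frag_of (q41 * q12 * q24 / C)" 
  proof -
    have "frag_of (q41 * q12 * q24 / C) = frag_of (face_ratio (T 4) (T 1) (T 2) / (1 + face_ratio (T 4) (T 1) (T 2)))"
      by (rule f[where y = "q42 * q21 * q14"]) (use minors ab qz in \<open>simp_all add: face_ratio_def q ac_simps flip: m_def\<close>)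
    then show ?thesis using face_term_transps[of 1 3 2 4 T] by (simp add: Transposition.transpose_def)
  qed
  moreover have "face_term T 4 = frag_of (q32 * q21 * q13 / C)"
  proof -
    have "frag_of (q32 * q21 * q13 / C) = frag_of (face_ratio (T 3) (T 2) (T 1) / (1 + face_ratio (T 3) (T 2) (T 1)))"
      by (rule f[where y = "q31 * q12 * q23"]) (use C_def ab qz in \<open>simp_all add: face_ratio_def q ac_simps flip: m_def\<close>)
    then show ?thesis using face_term_transps[of 1 4 2 3 T] by (simp add: Transposition.transpose_def)
  qed
  ultimately show ?thesis unfolding beta_chain_def sum_4 by simp
qed

section \<open>Hyperbolic space and horoballs\<close>

text \<open>The value of the positive Hermitian form of determinant one attached to the point \<open>p\<close>
  at the vector \<open>v\<close>. Its sublevel sets are the horoballs at \<open>v\<close>, it transforms by the modulus of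
  the determinant, and it determines \<open>p\<close>; so every fact about the action follows from facts
  about linear maps.\<close>

definition horofun :: "complex^2 \<Rightarrow> complex \<times> real \<Rightarrow> real" where
  "horofun v p = ((cmod (v$1 - v$2 * fst p))\<^sup>2 + (cmod (v$2))\<^sup>2 * (snd p)\<^sup>2) / snd p"

lemma hyp3_iff: "p \<in> hyp3 \<longleftrightarrow> snd p > 0"
  unfolding hyp3_def by auto

lemma det_2x2_nonzero: "invertible (A :: complex^2^2) \<longleftrightarrow> A$1$1 * A$2$2 - A$1$2 * A$2$1 \<noteq> 0"
  by (simp add: invertible_det_nz det_2)

lemma hyp_act_denominator_pos:
  fixes A :: "complex^2^2"
  assumes "invertible A" "t > 0"
  shows "(cmod (A$2$1 * z + A$2$2))\<^sup>2 + (cmod (A$2$1))\<^sup>2 * t\<^sup>2 > 0"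
proof (cases "A$2$1 = 0")
  case True
  then have "A$2$2 \<noteq> 0" using assms(1) unfolding det_2x2_nonzero by auto
  then show ?thesis using True by simp
next
  case False
  then have "(cmod (A$2$1))\<^sup>2 * t\<^sup>2 > 0" using assms(2) by simp
  then show ?thesis by (simp add: add_nonneg_pos)
qed

lemma hyp_act_mat_in_hyp3:
  assumes "invertible A" "p \<in> hyp3" shows "hyp_act_mat A p \<in> hyp3"
proof -
  have "snd p > 0" using assms(2) hyp3_iff by blast
  moreover have "cmod (det A) > 0" using assms(1) by (simp add: invertible_det_nz)
  ultimately show ?thesis
    using hyp_act_denominator_pos[OF assms(1), of "snd p" "fst p"]
    by (auto simp: hyp_act_mat_def hyp3_def Let_def split: prod.splits)
qed

lemma horofun_act_mat:
  assumes A: "invertible A" and p: "p \<in> hyp3"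
  shows "horofun (A *v v) (hyp_act_mat A p) = cmod (det A) * horofun v p"
proof -
  obtain z t where pzt: "p = (z, t)" by fastforce
  have t: "t > 0" using p pzt by (simp add: hyp3_iff)
  define a b c d where "a = A$1$1" and "b = A$1$2" and "c = A$2$1" and "d = A$2$2"
  define T :: complex where "T = of_real (t\<^sup>2)"
  define r where "r = (cmod (c * z + d))\<^sup>2 + (cmod c)\<^sup>2 * t\<^sup>2"
  have r: "r > 0" unfolding r_def c_def d_def by (rule hyp_act_denominator_pos[OF A t])
  define s where "s = c * z + d"
  define u where "u = v$1 - v$2 * z"
  define w1 w2 where "w1 = a * v$1 + b * v$2" and "w2 = c * v$1 + d * v$2"
  define m where "m = (a * z + b) * cnj s + a * cnj c * T"
  have D: "det A = a * d - b * c" by (simp add: det_2 a_def b_def c_def d_def)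
  have Av: "(A *v v)$1 = w1" "(A *v v)$2 = w2"
    by (simp_all add: matrix_vector_mult_def sum_2 w1_def w2_def a_def b_def c_def d_def)
  have act: "hyp_act_mat A p = (m / of_real r, cmod (det A) * t / r)"
    by (simp add: hyp_act_mat_def pzt Let_def m_def s_def T_def r_def a_def b_def c_def d_def)
  have cr: "complex_of_real r = s * cnj s + c * cnj c * T"
    by (simp only: r_def of_real_add of_real_mult complex_norm_square s_def T_def)
  have "of_real r * w1 - m * w2 = det A * (u * cnj s - v$2 * cnj c * T)"
    unfolding cr m_def w1_def w2_def D u_def s_def by algebra
  then have w: "w1 - w2 * (m / of_real r) = det A * (u * cnj s - v$2 * cnj c * T) / of_real r"
    using r by (simp add: field_simps)
  have "complex_of_real ((cmod (u * cnj s - v$2 * cnj c * T))\<^sup>2 + (cmod w2)\<^sup>2 * t\<^sup>2)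
      = (u * cnj s - v$2 * cnj c * T) * cnj (u * cnj s - v$2 * cnj c * T) + w2 * cnj w2 * T"
    by (simp only: of_real_add of_real_mult complex_norm_square T_def)
  also have "\<dots> = (u * cnj u + v$2 * cnj (v$2) * T) * (s * cnj s + c * cnj c * T)"
  proof -
    have "w2 = c * u + v$2 * s" unfolding w2_def u_def s_def by algebra
    moreover have "cnj T = T" by (simp add: T_def)
    ultimately show ?thesis by (simp add: algebra_simps)
  qed
  also have "\<dots> = complex_of_real (((cmod u)\<^sup>2 + (cmod (v$2))\<^sup>2 * t\<^sup>2) * r)"
    by (simp only: of_real_add of_real_mult cr complex_norm_square T_def)
  finally have e: "(cmod (u * cnj s - v$2 * cnj c * T))\<^sup>2 + (cmod w2)\<^sup>2 * t\<^sup>2 = ((cmod u)\<^sup>2 + (cmod (v$2))\<^sup>2 * t\<^sup>2) * r"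
    unfolding of_real_eq_iff .
  have nd: "cmod (det A) > 0" using A by (simp add: invertible_det_nz)
  have "horofun (A *v v) (hyp_act_mat A p) =
     ((cmod (det A) * cmod (u * cnj s - v$2 * cnj c * T) / r)\<^sup>2 + (cmod w2)\<^sup>2 * (cmod (det A) * t / r)\<^sup>2) / (cmod (det A) * t / r)"
    unfolding horofun_def act Av fst_conv snd_conv w using r by (simp add: norm_mult norm_divide)
  also have "\<dots> = (cmod (det A))\<^sup>2 * ((cmod (u * cnj s - v$2 * cnj c * T))\<^sup>2 + (cmod w2)\<^sup>2 * t\<^sup>2) / r\<^sup>2 / (cmod (det A) * t / r)"
    by (simp add: power_mult_distrib power_divide add_divide_distrib distrib_left mult.left_commute)
  also have "\<dots> = cmod (det A) * (((cmod u)\<^sup>2 + (cmod (v$2))\<^sup>2 * t\<^sup>2) / t)"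
    unfolding e using r t nd by (simp add: power2_eq_square)
  also have "\<dots> = cmod (det A) * horofun v p"
    by (simp add: horofun_def pzt u_def)
  finally show ?thesis .
qed

lemma horofun_determines:
  assumes "p \<in> hyp3" "q \<in> hyp3" "\<And>v. horofun v p = horofun v q"
  shows "p = q"
proof -
  obtain z t where p: "p = (z, t)" by fastforce
  obtain z' t' where q: "q = (z', t')" by fastforce
  have t: "t > 0" "t' > 0" using assms p q by (auto simp: hyp3_iff)
  have "1 / t = 1 / t'" using assms(3)[of "vector [1, 0]"] by (simp add: horofun_def p q)
  then have tt: "t' = t" using t by simp
  have h: "(cmod (a - z))\<^sup>2 = (cmod (a - z'))\<^sup>2" for a
    using assms(3)[of "vector [a, 1]"] t by (simp add: horofun_def p q tt)
  have "z = z'" using h[of z'] by simp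
  then show ?thesis using p q tt by simp
qed

lemma hyp_act_mat_compose:
  assumes "invertible A" "invertible B" "p \<in> hyp3"
  shows "hyp_act_mat (A ** B) p = hyp_act_mat A (hyp_act_mat B p)"
proof (rule horofun_determines)
  have AB: "invertible (A ** B)" using assms invertible_compose by blast
  show "hyp_act_mat (A ** B) p \<in> hyp3" "hyp_act_mat A (hyp_act_mat B p) \<in> hyp3"
    using assms AB by (auto intro: hyp_act_mat_in_hyp3)
  fix v
  have v: "v = A *v (B *v (matrix_inv (A ** B) *v v))"
    using matrix_inv_works(1)[OF AB] by (metis matrix_vector_mul_assoc matrix_vector_mul_lid)
  show "horofun v (hyp_act_mat (A ** B) p) = horofun v (hyp_act_mat A (hyp_act_mat B p))"
    using horofun_act_mat[OF AB assms(3), of "matrix_inv (A ** B) *v v"] assms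
    by (subst v, subst (2) v)
      (simp add: horofun_act_mat hyp_act_mat_in_hyp3 det_mul norm_mult flip: matrix_vector_mul_assoc)
qed

lemma hyp_act_mat_scalar:
  assumes "c \<noteq> 0" "p \<in> hyp3" shows "hyp_act_mat (mat c) p = p"
proof -
  obtain z t where p: "p = (z, t)" by fastforce
  have d: "det (mat c :: complex^2^2) = c * c" by (simp add: det_2 mat_def)
  have "c * z * cnj c / complex_of_real ((cmod c)\<^sup>2) = z"
    unfolding complex_norm_square using assms(1) by simp
  moreover have "cmod (c * c) * t / (cmod c)\<^sup>2 = t"
    using assms(1) by (simp add: norm_mult power2_eq_square)
  ultimately show ?thesis unfolding p hyp_act_mat_def d by (simp add: mat_def)
qed

lemma hyp_act_pgl:
  assumes "invertible A" "p \<in> hyp3" shows "hyp_act (pgl A) p = hyp_act_mat A p"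
proof -
  have "hyp_act_mat (mat c ** A) p = hyp_act_mat A p" if "c \<noteq> 0" for c
    using hyp_act_mat_compose[OF invertible_mat assms, of c] hyp_act_mat_scalar[OF that hyp_act_mat_in_hyp3[OF assms]] that
    by simp
  then have "(\<lambda>B. hyp_act_mat B p) ` pgl A = {hyp_act_mat A p}"
    using pgl_self[of A] by (auto simp: pgl_def)
  then show ?thesis unfolding hyp_act_def by simp
qed

lemma hyp_act_in_hyp3: "g \<in> carrier PGL \<Longrightarrow> p \<in> hyp3 \<Longrightarrow> hyp_act g p \<in> hyp3"
  unfolding carrier_PGL by (auto simp: hyp_act_pgl hyp_act_mat_in_hyp3)

lemma hyp_act_mult:
  "g \<in> carrier PGL \<Longrightarrow> h \<in> carrier PGL \<Longrightarrow> p \<in> hyp3 \<Longrightarrow> hyp_act (g \<otimes>\<^bsub>PGL\<^esub> h) p = hyp_act g (hyp_act h p)"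
  unfolding carrier_PGL
  by (auto simp: mult_PGL hyp_act_pgl hyp_act_mat_in_hyp3 hyp_act_mat_compose invertible_compose)

lemma hyp_act_one: "p \<in> hyp3 \<Longrightarrow> hyp_act \<one>\<^bsub>PGL\<^esub> p = p"
  by (simp add: one_PGL hyp_act_pgl invertible_mat hyp_act_mat_scalar)

lemma continuous_on_hyp_act:
  assumes "g \<in> carrier PGL" shows "continuous_on hyp3 (hyp_act g)"
proof -
  obtain A where A: "invertible A" "g = pgl A" using assms unfolding carrier_PGL by auto
  have nz: "(cmod (A$2$1 * fst p + A$2$2))\<^sup>2 + (cmod (A$2$1))\<^sup>2 * (snd p)\<^sup>2 \<noteq> 0" if "p \<in> hyp3" for p
    using hyp_act_denominator_pos[OF A(1), of "snd p" "fst p"] that by (simp add: hyp3_iff)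
  have "continuous_on hyp3 (hyp_act_mat A)"
    unfolding hyp_act_mat_def Let_def case_prod_unfold
    by (intro continuous_intros ballI) (simp_all only: of_real_eq_0_iff nz not_False_eq_True)
  then show ?thesis by (rule continuous_on_eq) (use A in \<open>simp add: hyp_act_pgl\<close>)
qed

lemma horofun_smult: "horofun (c *s v) p = (cmod c)\<^sup>2 * horofun v p"
proof -
  have "c * v$1 - c * v$2 * fst p = c * (v$1 - v$2 * fst p)" by (simp add: algebra_simps)
  then have "(cmod (c * v$1 - c * v$2 * fst p))\<^sup>2 = (cmod c)\<^sup>2 * (cmod (v$1 - v$2 * fst p))\<^sup>2"
    by (simp only: norm_mult power_mult_distrib)
  then show ?thesis by (simp add: horofun_def norm_mult power_mult_distrib distrib_left)
qed

lemma horofun_pos: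
  assumes "v \<noteq> 0" "p \<in> hyp3" shows "horofun v p > 0"
proof -
  have t: "snd p > 0" using assms hyp3_iff by blast
  have "(cmod (v$1 - v$2 * fst p))\<^sup>2 + (cmod (v$2))\<^sup>2 * (snd p)\<^sup>2 > 0"
  proof (cases "v$2 = 0")
    case True
    then have "v$1 \<noteq> 0" using assms(1) by (auto simp: vec_eq_iff forall_2)
    then show ?thesis using True by simp
  next
    case False
    then show ?thesis using t by (simp add: add_nonneg_pos)
  qed
  then show ?thesis unfolding horofun_def using t by simp
qed

lemma mem_horoball:
  assumes "v \<noteq> 0" shows "p \<in> horoball v s \<longleftrightarrow> p \<in> hyp3 \<and> s * horofun v p < 1"
proof (cases "p \<in> hyp3")
  case True
  have "snd p / (horofun v p * snd p) = 1 / horofun v p" using True by (simp add: hyp3_iff)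
  then have "p \<in> horoball v s \<longleftrightarrow> s < 1 / horofun v p"
    using True by (auto simp: horoball_def hyp3_def horofun_def)
  then show ?thesis using horofun_pos[OF assms True] True by (simp add: field_simps)
next
  case False then show ?thesis by (auto simp: horoball_def hyp3_def)
qed

lemma open_hyp3: "open hyp3"
proof -
  have eq: "hyp3 = {p. 0 < snd p}" using hyp3_iff by blast
  show ?thesis unfolding eq by (intro open_Collect_less continuous_intros)
qed

lemma open_horoball:
  assumes "v \<noteq> 0" shows "open (horoball v s)"
proof -
  have "continuous_on hyp3 (horofun v)"
    unfolding horofun_def by (intro continuous_intros) (auto simp: hyp3_iff)
  then have "continuous_on hyp3 (\<lambda>p. s * horofun v p)" by (intro continuous_intros)
  from continuous_open_preimage[OF this open_hyp3, of "{..<1}"]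
  have "open (hyp3 \<inter> (\<lambda>p. s * horofun v p) -` {..<1})" by simp
  moreover have "hyp3 \<inter> (\<lambda>p. s * horofun v p) -` {..<1} = horoball v s"
    using mem_horoball[OF assms] by auto
  ultimately show ?thesis by simp
qed

text \<open>The determinant on the left is nonzero for distinct ideal points, and so small horoballs based at
  them are disjoint.\<close>

lemma horofun_product:
  assumes "p \<in> hyp3"
  shows "(cmod (v$1 * w$2 - v$2 * w$1))\<^sup>2 \<le> horofun v p * horofun w p"
proof -
  define t where "t = snd p"
  have t: "t > 0" using assms by (simp add: hyp3_iff t_def)
  define x y a b where "x = cmod (v$1 - v$2 * fst p)" and "y = cmod (w$1 - w$2 * fst p)"
    and "a = cmod (v$2) * t" and "b = cmod (w$2) * t"
  have "v$1 * w$2 - v$2 * w$1 = w$2 * (v$1 - v$2 * fst p) - v$2 * (w$1 - w$2 * fst p)"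
    by (simp add: algebra_simps)
  then have "cmod (v$1 * w$2 - v$2 * w$1) \<le> cmod (w$2) * x + cmod (v$2) * y"
    using norm_triangle_ineq4[of "w$2 * (v$1 - v$2 * fst p)" "v$2 * (w$1 - w$2 * fst p)"]
    by (simp add: norm_mult x_def y_def)
  also have "\<dots> = (b * x + a * y) / t" using t by (simp add: a_def b_def field_simps)
  finally have "(cmod (v$1 * w$2 - v$2 * w$1))\<^sup>2 \<le> ((b * x + a * y) / t)\<^sup>2"
    by (intro power_mono) auto
  also have "\<dots> = (b * x + a * y)\<^sup>2 / t\<^sup>2" by (simp add: power_divide)
  also have "\<dots> \<le> (x\<^sup>2 + a\<^sup>2) * (y\<^sup>2 + b\<^sup>2) / t\<^sup>2"
  proof (rule divide_right_mono)
    have "(x\<^sup>2 + a\<^sup>2) * (y\<^sup>2 + b\<^sup>2) - (b * x + a * y)\<^sup>2 = (x * y - a * b)\<^sup>2"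
      by (simp add: power2_eq_square algebra_simps)
    then show "(b * x + a * y)\<^sup>2 \<le> (x\<^sup>2 + a\<^sup>2) * (y\<^sup>2 + b\<^sup>2)"
      using zero_le_power2[of "x * y - a * b"] by linarith
  qed simp
  also have "\<dots> = horofun v p * horofun w p"
    by (simp add: horofun_def x_def y_def a_def b_def t_def power_mult_distrib)
      (simp add: power2_eq_square)
  finally show ?thesis .
qed

lemma horofun_act:
  assumes "invertible A" "p \<in> hyp3"
  shows "horofun (A *v v) (hyp_act (pgl A) p) = cmod (det A) * horofun v p"
  using assms by (simp add: hyp_act_pgl horofun_act_mat)

section \<open>The lifted triangulation\<close>

text \<open>The two properties of the group of deck transformations on which the developing argument rests.\<close>

locale kleinian =
  fixes \<Gamma> :: "(complex^2^2) set set"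
  assumes subgroup: "subgroup \<Gamma> PGL"
    and proper: "compact C \<Longrightarrow> C \<subseteq> hyp3 \<Longrightarrow> finite {g \<in> \<Gamma>. hyp_act g ` C \<inter> C \<noteq> {}}"
    and free: "g \<in> \<Gamma> \<Longrightarrow> p \<in> hyp3 \<Longrightarrow> hyp_act g p = p \<Longrightarrow> g = \<one>\<^bsub>PGL\<^esub>"

lemma cusped_kleinian: "cusped_hyperbolic_manifold \<Gamma> \<Longrightarrow> kleinian \<Gamma>"
  unfolding cusped_hyperbolic_manifold_def by (intro kleinian.intro) (elim conjE, blast)+

context kleinian
begin

lemma in_PGL: "g \<in> \<Gamma> \<Longrightarrow> g \<in> carrier PGL"
  using subgroup.mem_carrier[OF subgroup] .

lemma one_in: "\<one>\<^bsub>PGL\<^esub> \<in> \<Gamma>"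
  using subgroup.one_closed[OF subgroup] .

lemma mult_in: "g \<in> \<Gamma> \<Longrightarrow> h \<in> \<Gamma> \<Longrightarrow> g \<otimes>\<^bsub>PGL\<^esub> h \<in> \<Gamma>"
  using subgroup.m_closed[OF subgroup] .

lemma inv_in: "g \<in> \<Gamma> \<Longrightarrow> inv\<^bsub>PGL\<^esub> g \<in> \<Gamma>"
  using subgroup.m_inv_closed[OF subgroup] .

lemma hyp_act_inj:
  assumes "g \<in> \<Gamma>" "h \<in> \<Gamma>" "p \<in> hyp3" "hyp_act g p = hyp_act h p" shows "g = h"
proof -
  interpret group "PGL :: (complex^2^2) set monoid" by (rule group_PGL)
  have c: "g \<in> carrier PGL" "h \<in> carrier PGL" "inv\<^bsub>PGL\<^esub> h \<in> carrier PGL" using assms in_PGL by auto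
  have "hyp_act (inv\<^bsub>PGL\<^esub> h \<otimes>\<^bsub>PGL\<^esub> g) p = hyp_act (inv\<^bsub>PGL\<^esub> h) (hyp_act h p)"
    using hyp_act_mult[OF c(3,1) assms(3)] assms(4) by simp
  also have "\<dots> = hyp_act \<one>\<^bsub>PGL\<^esub> p"
    using hyp_act_mult[OF c(3,2) assms(3)] l_inv[OF c(2)] by simp
  finally have "inv\<^bsub>PGL\<^esub> h \<otimes>\<^bsub>PGL\<^esub> g = \<one>\<^bsub>PGL\<^esub>"
    using free mult_in inv_in assms hyp_act_one by metis
  then have "inv\<^bsub>PGL\<^esub> g = inv\<^bsub>PGL\<^esub> h" using c by (rule_tac inv_equality)
  then show ?thesis using c by (metis inv_inv)
qed

lemma proj_act_mult:
  assumes "g \<in> carrier PGL" "h \<in> carrier PGL" "\<xi> \<in> proj_space"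
  shows "proj_act (g \<otimes>\<^bsub>PGL\<^esub> h) \<xi> = proj_act g (proj_act h \<xi>)"
  using assms unfolding carrier_PGL proj_space_def
  by (auto simp: mult_PGL proj_act_pgl matrix_vector_mul_assoc)

lemma ext_act_mult:
  assumes "g \<in> \<Gamma>" "h \<in> \<Gamma>" "x \<in> ext_hyp3 \<Gamma>"
  shows "ext_act (g \<otimes>\<^bsub>PGL\<^esub> h) x = ext_act g (ext_act h x)"
  using assms in_PGL by (auto simp: ext_hyp3_def ext_act_def lifted_cusps_def hyp_act_mult proj_act_mult)

lemma ext_act_one: "x \<in> ext_hyp3 \<Gamma> \<Longrightarrow> ext_act \<one>\<^bsub>PGL\<^esub> x = x"
  by (auto simp: ext_hyp3_def ext_act_def lifted_cusps_def proj_space_def hyp_act_one one_PGL proj_act_pgl)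
    (simp_all add: hyp_act_one flip: one_PGL)

lemma ext_act_inverse:
  assumes "g \<in> \<Gamma>" "x \<in> ext_hyp3 \<Gamma>" shows "ext_act (inv\<^bsub>PGL\<^esub> g) (ext_act g x) = x"
proof -
  interpret G: group "PGL :: (complex^2^2) set monoid" by (rule group_PGL)
  show ?thesis
    using ext_act_mult[OF inv_in[OF assms(1)] assms] G.l_inv[OF in_PGL[OF assms(1)]] ext_act_one[OF assms(2)] by simp
qed

lemma orbit_rel_self: "x \<in> ext_hyp3 \<Gamma> \<Longrightarrow> x \<in> orbit_rel \<Gamma> `` {x}"
  unfolding orbit_rel_def using ext_act_one[of x] one_in by (auto intro!: exI[of _ "\<one>\<^bsub>PGL\<^esub>"])

lemma orbit_eq_obtain:
  assumes "orbit_rel \<Gamma> `` {x} = orbit_rel \<Gamma> `` {y}" "y \<in> ext_hyp3 \<Gamma>"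
  obtains g where "g \<in> \<Gamma>" "y = ext_act g x"
proof -
  have "y \<in> orbit_rel \<Gamma> `` {x}" using orbit_rel_self[OF assms(2)] assms(1) by simp
  then show ?thesis using that unfolding orbit_rel_def by auto
qed

text \<open>By proper discontinuity only finitely many elements of \<open>\<Gamma>\<close> can relate points of two
  compact paths, so the element relating corresponding points is locally constant.\<close>

lemma path_lift_constant:
  fixes \<alpha> \<beta> :: "real \<Rightarrow> complex \<times> real"
  assumes cont: "continuous_on {0..b} \<alpha>" "continuous_on {0..b} \<beta>"
    and hyp: "\<And>t. t \<in> {0..b} \<Longrightarrow> \<alpha> t \<in> hyp3"
    and rel: "\<And>t. t \<in> {0..b} \<Longrightarrow> \<exists>g\<in>\<Gamma>. \<beta> t = hyp_act g (\<alpha> t)"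
    and h: "h \<in> \<Gamma>" "\<beta> 0 = hyp_act h (\<alpha> 0)" and t: "t \<in> {0..b}"
  shows "\<beta> t = hyp_act h (\<alpha> t)"
proof -
  have \<beta>hyp: "\<beta> t \<in> hyp3" if "t \<in> {0..b}" for t
    using rel[OF that] hyp[OF that] in_PGL hyp_act_in_hyp3 by metis
  define C where "C = \<alpha> ` {0..b} \<union> \<beta> ` {0..b}"
  have "compact C" "C \<subseteq> hyp3"
    unfolding C_def using cont hyp \<beta>hyp by (auto intro!: compact_Un compact_continuous_image)
  then have fin: "finite {g \<in> \<Gamma>. hyp_act g ` C \<inter> C \<noteq> {}}" (is "finite ?G") by (rule proper)
  define S where "S g = {t \<in> {0..b}. \<beta> t = hyp_act g (\<alpha> t)}" for g
  have closed: "closed (S g)" if "g \<in> \<Gamma>" for g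
  proof -
    have "continuous_on {0..b} (\<lambda>t. hyp_act g (\<alpha> t))"
      by (rule continuous_on_compose2[OF continuous_on_hyp_act[OF in_PGL[OF that]] cont(1)]) (use hyp in auto)
    then have "continuous_on {0..b} (\<lambda>t. \<beta> t - hyp_act g (\<alpha> t))" using cont(2) by (intro continuous_intros)
    from continuous_closed_preimage[OF this closed_atLeastAtMost, of "{0}"]
    have "closed ({0..b} \<inter> (\<lambda>t. \<beta> t - hyp_act g (\<alpha> t)) -` {0})" by simp
    moreover have "{0..b} \<inter> (\<lambda>t. \<beta> t - hyp_act g (\<alpha> t)) -` {0} = S g" unfolding S_def by auto
    ultimately show ?thesis by simp
  qed
  have inG: "g \<in> ?G" if "g \<in> \<Gamma>" "t \<in> S g" for g t
  proof -
    have "hyp_act g (\<alpha> t) \<in> hyp_act g ` C \<inter> C"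
      using that unfolding S_def C_def by (metis (mono_tags, lifting) Int_iff UnCI imageI mem_Collect_eq)
    then show ?thesis using that by blast
  qed
  define R where "R = (\<Union>g\<in>?G - {h}. S g)"
  have "closed R" unfolding R_def using fin closed by (intro closed_UN) auto
  moreover have "closed (S h)" using closed h by blast
  moreover have cover: "{0..b} \<subseteq> S h \<union> R"
  proof
    fix t assume t: "t \<in> {0..b}"
    then obtain g where "g \<in> \<Gamma>" "t \<in> S g" using rel unfolding S_def by auto
    then show "t \<in> S h \<union> R" using inG unfolding R_def by (cases "g = h") auto
  qed
  moreover have "S h \<inter> R \<inter> {0..b} = {}"
  proof -
    have eq: "g = h" if "t \<in> S h" "t \<in> S g" "g \<in> \<Gamma>" for g t
    proof (rule hyp_act_inj[OF that(3) h(1)])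
      show "\<alpha> t \<in> hyp3" using that hyp by (simp add: S_def)
      show "hyp_act g (\<alpha> t) = hyp_act h (\<alpha> t)" using that by (simp add: S_def)
    qed
    have False if th: "t \<in> S h" and tR: "t \<in> R" for t
    proof -
      obtain g where "g \<in> \<Gamma>" "g \<noteq> h" "t \<in> S g" using tR unfolding R_def by auto
      then show False using eq th by metis
    qed
    then show ?thesis by blast
  qed
  moreover have "S h \<inter> {0..b} \<noteq> {}" using h t unfolding S_def by auto
  ultimately have "R \<inter> {0..b} = {}"
    using connected_Icc[of 0 b] unfolding connected_closed by blast
  then have "t \<in> S h" using cover t by blast
  then show ?thesis by (simp add: S_def)
qed

lemma lifted_cusp_rep:
  assumes "\<xi> \<in> lifted_cusps \<Gamma>" "v \<in> \<xi>" shows "v \<noteq> 0" "\<xi> = proj_point v"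
proof -
  obtain x c where x: "x \<noteq> 0" "\<xi> = proj_point x" "c \<noteq> 0" "v = c *s x"
    using assms unfolding lifted_cusps_def proj_space_def proj_point_def by auto
  then show "v \<noteq> 0" "\<xi> = proj_point v" by (auto simp: proj_point_smult)
qed

text \<open>The defining family of sets is closed under intersection because horoballs at one ideal point
  are nested.\<close>

lemma openin_ext_topology:
  "openin (ext_topology \<Gamma>) U \<longleftrightarrow> U \<subseteq> ext_hyp3 \<Gamma> \<and> open {p. Inl p \<in> U} \<and>
     (\<forall>\<xi>. Inr \<xi> \<in> U \<longrightarrow> (\<exists>v\<in>\<xi>. \<exists>s>0. Inl ` horoball v s \<subseteq> U))"
proof -
  let ?P = "\<lambda>U. U \<subseteq> ext_hyp3 \<Gamma> \<and> open {p. Inl p \<in> U} \<and>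
     (\<forall>\<xi>. Inr \<xi> \<in> U \<longrightarrow> (\<exists>v\<in>\<xi>. \<exists>s>0. Inl ` horoball v s \<subseteq> U))"
  have "istopology ?P"
    unfolding istopology_def
  proof (intro conjI allI impI)
    fix U V assume U: "?P U" and V: "?P V"
    show "U \<inter> V \<subseteq> ext_hyp3 \<Gamma>" using U by blast
    have "{p. Inl p \<in> U \<inter> V} = {p. Inl p \<in> U} \<inter> {p. Inl p \<in> V}" by auto
    then show "open {p. Inl p \<in> U \<inter> V}" using U V by (metis open_Int)
    fix \<xi> assume \<xi>: "Inr \<xi> \<in> U \<inter> V"
    then obtain v s w r where v: "v \<in> \<xi>" "s > 0" "Inl ` horoball v s \<subseteq> U" and w: "w \<in> \<xi>" "r > 0" "Inl ` horoball w r \<subseteq> V"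
      using U V by (metis IntD1 IntD2)
    have cusp: "\<xi> \<in> lifted_cusps \<Gamma>" using \<xi> U unfolding ext_hyp3_def by auto
    have v0: "v \<noteq> 0" and w0: "w \<noteq> 0" using lifted_cusp_rep[OF cusp] v w by auto
    obtain c where c: "c \<noteq> 0" "w = c *s v"
      using lifted_cusp_rep(2)[OF cusp v(1)] w(1) unfolding proj_point_def by auto
    define m where "m = max s (r * (cmod c)\<^sup>2)"
    have "p \<in> horoball v s" "p \<in> horoball w r" if "p \<in> horoball v m" for p
    proof -
      have p: "p \<in> hyp3" "m * horofun v p < 1" using that mem_horoball[OF v0] by auto
      have pos: "horofun v p > 0" using horofun_pos[OF v0 p(1)] .
      have "s * horofun v p \<le> m * horofun v p" "r * (cmod c)\<^sup>2 * horofun v p \<le> m * horofun v p"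
        using pos unfolding m_def by (auto intro!: mult_right_mono)
      then show "p \<in> horoball v s" "p \<in> horoball w r"
        using p mem_horoball[OF v0] mem_horoball[OF w0] c by (auto simp: horofun_smult mult.assoc)
    qed
    moreover have "m > 0" using v unfolding m_def by simp
    ultimately show "\<exists>v\<in>\<xi>. \<exists>s>0. Inl ` horoball v s \<subseteq> U \<inter> V" using v w by blast
  next
    fix \<U> assume P: "\<forall>U\<in>\<U>. ?P U"
    show "\<Union>\<U> \<subseteq> ext_hyp3 \<Gamma>" using P by blast
    have "{p. Inl p \<in> \<Union>\<U>} = (\<Union>U\<in>\<U>. {p. Inl p \<in> U})" by auto
    then show "open {p. Inl p \<in> \<Union>\<U>}" using P by (metis (no_types, lifting) open_UN)
    fix \<xi> assume "Inr \<xi> \<in> \<Union>\<U>"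
    then show "\<exists>v\<in>\<xi>. \<exists>s>0. Inl ` horoball v s \<subseteq> \<Union>\<U>" using P by (meson Sup_upper UnionE order_trans)
  qed
  then show ?thesis unfolding ext_topology_def by (simp add: topology_inverse')
qed

lemma openin_hyp3_part: "open W \<Longrightarrow> W \<subseteq> hyp3 \<Longrightarrow> openin (ext_topology \<Gamma>) (Inl ` W)"
  unfolding openin_ext_topology ext_hyp3_def by (auto simp: image_iff)

lemma openin_cusp_neighbourhood:
  assumes "\<xi> \<in> lifted_cusps \<Gamma>" "v \<in> \<xi>" "s > 0"
  shows "openin (ext_topology \<Gamma>) (insert (Inr \<xi>) (Inl ` horoball v s))"
proof -
  have v0: "v \<noteq> 0" using lifted_cusp_rep assms by blast
  have "{p. Inl p \<in> insert (Inr \<xi>) (Inl ` horoball v s)} = horoball v s" by auto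
  then show ?thesis
    unfolding openin_ext_topology using assms open_horoball[OF v0] mem_horoball[OF v0]
    by (auto simp: ext_hyp3_def)
qed

lemma topspace_ext_topology: "topspace (ext_topology \<Gamma>) \<subseteq> ext_hyp3 \<Gamma>"
  using openin_topspace openin_ext_topology by blast

lemma continuous_on_hyp_part:
  assumes "continuous_map (top_of_set X) (ext_topology \<Gamma>) f" "Y \<subseteq> X" "\<And>x. x \<in> Y \<Longrightarrow> \<exists>p. f x = Inl p"
  shows "continuous_on Y (\<lambda>x. projl (f x))"
  unfolding continuous_openin_preimage_eq
proof (intro allI impI)
  fix W :: "(complex \<times> real) set" assume "open W"
  then have "openin (ext_topology \<Gamma>) (Inl ` (W \<inter> hyp3))" using open_hyp3 by (intro openin_hyp3_part) auto
  then have "openin (top_of_set X) {x \<in> X. f x \<in> Inl ` (W \<inter> hyp3)}"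
    using assms(1) unfolding continuous_map_def by simp
  then have "openin (top_of_set Y) (Y \<inter> {x \<in> X. f x \<in> Inl ` (W \<inter> hyp3)})"
    using assms(2) by (metis (no_types, lifting) inf_commute openin_subtopology_Int_subset openin_subtopology_Int subtopology_subtopology inf.absorb_iff2)
  moreover have "Y \<inter> {x \<in> X. f x \<in> Inl ` (W \<inter> hyp3)} = Y \<inter> (\<lambda>x. projl (f x)) -` W"
  proof -
    have "f x \<in> ext_hyp3 \<Gamma>" if "x \<in> X" for x
      using assms(1) that topspace_ext_topology unfolding continuous_map_def by auto
    then show ?thesis using assms(2,3) unfolding ext_hyp3_def by force
  qed
  ultimately show "openin (top_of_set Y) (Y \<inter> (\<lambda>x. projl (f x)) -` W)" by simp
qed

end

subsection \<open>Gluing of simplices\<close>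

definition permute_point :: "(4 \<Rightarrow> 4) \<Rightarrow> real^4 \<Rightarrow> real^4" where
  "permute_point \<pi> p = (\<chi> j. p $ inv_into UNIV \<pi> j)"

lemma permute_point_nth:
  assumes "\<pi> permutes UNIV" shows "permute_point \<pi> p $ \<pi> j = p $ j"
  using assms by (simp add: permute_point_def permutes_inverses)

lemma permute_point_eqI:
  assumes "\<pi> permutes UNIV" "\<And>j. q $ \<pi> j = p $ j" shows "q = permute_point \<pi> p"
proof -
  have "q $ k = permute_point \<pi> p $ k" for k
    using assms(2)[of "inv_into UNIV \<pi> k"] assms(1) by (simp add: permute_point_def permutes_inverses)
  then show ?thesis by (simp add: vec_eq_iff)
qed

lemma permute_point_simplex:
  assumes "\<pi> permutes UNIV" "p \<in> simplex3" shows "permute_point \<pi> p \<in> simplex3"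
proof -
  have "(\<Sum>i\<in>UNIV. permute_point \<pi> p $ i) = (\<Sum>i\<in>UNIV. permute_point \<pi> p $ \<pi> i)"
    using sum.reindex_bij_betw[OF permutes_imp_bij[OF assms(1)], of "\<lambda>i. permute_point \<pi> p $ i"] by simp
  then show ?thesis
    using assms by (simp add: simplex3_def permute_point_nth) (simp add: permute_point_def)
qed

lemma permute_point_vertex:
  assumes "\<pi> permutes UNIV" shows "permute_point \<pi> (vertex j) = vertex (\<pi> j)"
  by (rule permute_point_eqI[OF assms, symmetric])
    (use permutes_4_distinct[OF assms] in \<open>simp add: axis_def\<close>)

lemma permute_point_combine:
  "permute_point \<pi> (a *\<^sub>R p + b *\<^sub>R q) = a *\<^sub>R permute_point \<pi> p + b *\<^sub>R permute_point \<pi> q"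
  by (simp add: permute_point_def vec_eq_iff)

lemma vertex_in_simplex [simp]: "vertex i \<in> simplex3"
  by (simp add: simplex3_def axis_def)

lemma convex_simplex3:
  assumes "p \<in> simplex3" "q \<in> simplex3" "0 \<le> t" "t \<le> 1"
  shows "(1 - t) *\<^sub>R p + t *\<^sub>R q \<in> simplex3"
proof -
  have "(\<Sum>i\<in>UNIV. (1 - t) * p$i + t * q$i) = (1 - t) * (\<Sum>i\<in>UNIV. p$i) + t * (\<Sum>i\<in>UNIV. q$i)"
    by (simp add: sum.distrib sum_distrib_left)
  then show ?thesis using assms by (simp add: simplex3_def)
qed

lemma not_vertexI: "p $ j \<noteq> 0 \<Longrightarrow> p $ k \<noteq> 0 \<Longrightarrow> j \<noteq> k \<Longrightarrow> p \<notin> range vertex"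
  by (auto simp: axis_def split: if_splits)

lemma valid_pairingD:
  assumes "valid_pairing K" "\<nu> < tet_count K" "pairing K \<nu> i = (\<mu>, \<pi>)"
  shows "\<mu> < tet_count K" "\<pi> permutes UNIV" "\<not> evenperm \<pi>" "(\<mu>, \<pi> i) \<noteq> (\<nu>, i)"
    "pairing K \<mu> (\<pi> i) = (\<nu>, inv_into UNIV \<pi>)"
  using assms unfolding valid_pairing_def by blast+

lemma gluing_step_iff:
  assumes "valid_pairing K"
  shows "((\<nu>, p), (\<mu>, q)) \<in> gluing_step K \<longleftrightarrow> \<nu> < tet_count K \<and> p \<in> simplex3 \<and>
    (\<exists>i \<pi>. p$i = 0 \<and> pairing K \<nu> i = (\<mu>, \<pi>) \<and> q = permute_point \<pi> p)"
proof -
  have "(\<forall>j. q $ \<pi> j = p $ j) \<longleftrightarrow> q = permute_point \<pi> p"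
    if "\<nu> < tet_count K" "pairing K \<nu> i = (\<mu>, \<pi>)" for i \<pi>
    using permute_point_nth permute_point_eqI valid_pairingD(2)[OF assms that] by blast
  then show ?thesis unfolding gluing_step_def by blast
qed

lemma gluing_step_sym:
  assumes K: "valid_pairing K" and "((\<nu>, p), (\<mu>, q)) \<in> gluing_step K"
  shows "((\<mu>, q), (\<nu>, p)) \<in> gluing_step K"
proof -
  obtain i \<pi> where \<nu>: "\<nu> < tet_count K" and p: "p \<in> simplex3" "p $ i = 0" and pr: "pairing K \<nu> i = (\<mu>, \<pi>)"
    and q: "q = permute_point \<pi> p"
    using assms gluing_step_iff by blast
  note v = valid_pairingD[OF K \<nu> pr]
  have "p = permute_point (inv_into UNIV \<pi>) q"
    by (rule permute_point_eqI[OF permutes_inv[OF v(2)]])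
      (metis q permute_point_nth[OF v(2)] permutes_inverses(1)[OF v(2)])
  moreover have "q $ \<pi> i = 0" using p q permute_point_nth[OF v(2)] by simp
  moreover have "q \<in> simplex3" using p q permute_point_simplex[OF v(2)] by simp
  ultimately show ?thesis unfolding gluing_step_iff[OF K] using v by blast
qed

lemma gluing_step_points:
  assumes "valid_pairing K" "(x, y) \<in> gluing_step K"
  shows "x \<in> simplex_points K" "y \<in> simplex_points K"
proof -
  obtain \<nu> p \<mu> q where xy: "x = (\<nu>, p)" "y = (\<mu>, q)" by fastforce
  have *: "((\<nu>, p), (\<mu>, q)) \<in> gluing_step K" "((\<mu>, q), (\<nu>, p)) \<in> gluing_step K"
    using assms(2) gluing_step_sym[OF assms(1)] unfolding xy by blast+
  show "x \<in> simplex_points K" "y \<in> simplex_points K"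
    using *[unfolded gluing_step_iff[OF assms(1)]] unfolding xy simplex_points_def by auto
qed

lemma equiv_gluing_rel:
  assumes "valid_pairing K" shows "equiv (simplex_points K) (gluing_rel K)"
proof (rule equivI)
  have "sym (gluing_step K)" using gluing_step_sym[OF assms] by (auto simp: sym_def)
  then have "sym ((gluing_step K)\<^sup>*)" by (rule sym_rtrancl)
  then show "sym (gluing_rel K)" unfolding gluing_rel_def sym_def by blast
  show "trans (gluing_rel K)" unfolding gluing_rel_def trans_def by (auto intro: rtrancl_trans)
qed (auto simp: gluing_rel_def refl_on_def)

lemma gluing_step_rel: "valid_pairing K \<Longrightarrow> (x, y) \<in> gluing_step K \<Longrightarrow> (x, y) \<in> gluing_rel K"
  using gluing_step_points unfolding gluing_rel_def by blast

text \<open>Gluings permute barycentric coordinates, so points in the interiors of faces of different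
  dimensions are never identified.\<close>

definition zero_count :: "real^4 \<Rightarrow> nat" where
  "zero_count p = card {j. p $ j = 0}"

lemma gluing_rel_zero_count:
  assumes K: "valid_pairing K" and "((\<nu>, p), (\<mu>, q)) \<in> gluing_rel K"
  shows "zero_count p = zero_count q"
proof -
  have one: "zero_count p = zero_count q" if "((\<nu>, p), (\<mu>, q)) \<in> gluing_step K" for \<nu> p \<mu> q
  proof -
    obtain i \<pi> where *: "\<nu> < tet_count K" "pairing K \<nu> i = (\<mu>, \<pi>)" "q = permute_point \<pi> p"
      using \<open>_ \<in> gluing_step K\<close> gluing_step_iff[OF K] by blast
    have \<pi>: "\<pi> permutes UNIV" using valid_pairingD(2)[OF K *(1,2)] .
    have "{j. q $ j = 0} = \<pi> ` {j. p $ j = 0}"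
    proof (intro equalityI subsetI)
      fix k assume "k \<in> {j. q $ j = 0}"
      moreover obtain j where "k = \<pi> j" using permutes_surj[OF \<pi>] by blast
      ultimately show "k \<in> \<pi> ` {j. p $ j = 0}" using *(3) permute_point_nth[OF \<pi>] by auto
    qed (use *(3) permute_point_nth[OF \<pi>] in auto)
    then show ?thesis unfolding zero_count_def using card_image permutes_inj_on[OF \<pi>] by metis
  qed
  have "zero_count (snd x) = zero_count (snd y)" if "(x, y) \<in> (gluing_step K)\<^sup>*" for x y
    using that
  proof (induction rule: rtrancl_induct)
    case (step y z)
    then show ?case using one[of "fst y" "snd y" "fst z" "snd z"] by simp
  qed simp
  moreover have "((\<nu>, p), (\<mu>, q)) \<in> (gluing_step K)\<^sup>*" using assms unfolding gluing_rel_def by blast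
  ultimately show ?thesis by fastforce
qed

definition face_center :: "4 \<Rightarrow> real^4" where
  "face_center i = (\<chi> j. if j = i then 0 else 1/3)"

lemma face_center_simplex: "face_center i \<in> simplex3"
proof -
  have "(\<Sum>j\<in>UNIV. face_center i $ j) = (\<Sum>j\<in>UNIV - {i}. 1/3)"
    by (simp add: face_center_def sum.remove[of UNIV i])
  then show ?thesis by (simp add: simplex3_def) (simp add: face_center_def)
qed

lemma face_segment_not_vertex:
  assumes "p \<in> simplex3" "0 \<le> t" "t < 1"
  shows "(1 - t) *\<^sub>R face_center i + t *\<^sub>R p \<notin> range vertex"
proof -
  have pos: "((1 - t) *\<^sub>R face_center i + t *\<^sub>R p) $ j \<noteq> 0" if "j \<noteq> i" for j
  proof -
    have "(1 - t) * (1/3) + t * p $ j > 0" using assms by (intro add_pos_nonneg) (auto simp: simplex3_def)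
    then show ?thesis using that by (simp add: face_center_def)
  qed
  have "i + 1 \<noteq> i" "i + 2 \<noteq> i" "i + 1 \<noteq> i + 2" by simp_all
  then show ?thesis using not_vertexI[OF pos pos] by blast
qed

locale triangulated = kleinian \<Gamma> for \<Gamma> +
  fixes K :: triangulation
  assumes ideal: "ideal_triangulation \<Gamma> K"
begin

abbreviation "lift \<equiv> lifted_simplex K"

lemma valid: "valid_pairing K"
  using ideal unfolding ideal_triangulation_def by blast

lemma lift_continuous: "\<nu> < tet_count K \<Longrightarrow> continuous_map (top_of_set simplex3) (ext_topology \<Gamma>) (lift \<nu>)"
  using ideal unfolding ideal_triangulation_def by blast

lemma lift_in: "\<nu> < tet_count K \<Longrightarrow> p \<in> simplex3 \<Longrightarrow> lift \<nu> p \<in> ext_hyp3 \<Gamma>"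
  using lift_continuous topspace_ext_topology unfolding continuous_map_def by auto

lemma lift_interior:
  assumes "\<nu> < tet_count K" "p \<in> simplex3" "p \<notin> range vertex"
  obtains x where "x \<in> hyp3" "lift \<nu> p = Inl x"
proof -
  have "\<And>\<xi>. lift \<nu> p \<noteq> Inr \<xi>" using ideal assms unfolding ideal_triangulation_def by blast
  then show ?thesis using lift_in[OF assms(1,2)] that unfolding ext_hyp3_def by blast
qed

lemma characteristic_homeomorphism:
  "\<exists>\<Phi>. homeomorphic_map (realization K) (compactified_manifold \<Gamma>) \<Phi> \<and>
        (\<forall>\<nu><tet_count K. \<forall>p\<in>simplex3.
           \<Phi> (gluing_rel K `` {(\<nu>, p)}) = orbit_rel \<Gamma> `` {lift \<nu> p})"
  using ideal unfolding ideal_triangulation_def by (elim conjE)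

lemma gluing_orbit:
  assumes "((\<nu>, p), (\<mu>, q)) \<in> gluing_rel K"
  shows "orbit_rel \<Gamma> `` {lift \<nu> p} = orbit_rel \<Gamma> `` {lift \<mu> q}"
proof -
  obtain \<Phi> where "\<forall>\<nu><tet_count K. \<forall>p\<in>simplex3.
      \<Phi> (gluing_rel K `` {(\<nu>, p)}) = orbit_rel \<Gamma> `` {lift \<nu> p}"
    using characteristic_homeomorphism by (elim exE conjE)
  have "gluing_rel K `` {(\<nu>, p)} = gluing_rel K `` {(\<mu>, q)}"
    using equiv_class_eq[OF equiv_gluing_rel[OF valid] assms] .
  moreover have "\<nu> < tet_count K" "p \<in> simplex3" "\<mu> < tet_count K" "q \<in> simplex3"
    using assms unfolding gluing_rel_def simplex_points_def by auto
  ultimately show ?thesis using \<open>\<forall>\<nu><tet_count K. _ \<nu>\<close> by metis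
qed

text \<open>A face pairing is realized on the whole lifted face by one element of \<open>\<Gamma>\<close>. On the
  segment from the center of the face to a point \<open>p\<close> of it this is the constancy along paths; if
  the lift of \<open>p\<close> is a cusp, the two candidates for its image have intersecting small horoballs.\<close>

lemma face_lift:
  assumes \<nu>: "\<nu> < tet_count K" and pr: "pairing K \<nu> i = (\<mu>, \<pi>)"
  obtains h where "h \<in> \<Gamma>"
    "\<And>p. p \<in> simplex3 \<Longrightarrow> p $ i = 0 \<Longrightarrow> lift \<mu> (permute_point \<pi> p) = ext_act h (lift \<nu> p)"
proof -
  note v = valid_pairingD[OF valid \<nu> pr]
  let ?c = "face_center i"
  have orbit: "\<exists>g\<in>\<Gamma>. lift \<mu> (permute_point \<pi> p) = ext_act g (lift \<nu> p)" if "p \<in> simplex3" "p $ i = 0" for p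
  proof -
    have "((\<nu>, p), (\<mu>, permute_point \<pi> p)) \<in> gluing_step K"
      using gluing_step_iff[OF valid] \<nu> pr that by blast
    then have "orbit_rel \<Gamma> `` {lift \<nu> p} = orbit_rel \<Gamma> `` {lift \<mu> (permute_point \<pi> p)}"
      using gluing_orbit gluing_step_rel[OF valid] by blast
    then show ?thesis
      using orbit_eq_obtain lift_in[OF v(1) permute_point_simplex[OF v(2) that(1)]] by metis
  qed
  have ci: "?c $ i = 0" by (simp add: face_center_def)
  obtain h where h: "h \<in> \<Gamma>" "lift \<mu> (permute_point \<pi> ?c) = ext_act h (lift \<nu> ?c)"
    using orbit[OF face_center_simplex ci] by blast
  have main: "lift \<mu> (permute_point \<pi> p) = ext_act h (lift \<nu> p)" if p: "p \<in> simplex3" "p $ i = 0" for p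
  proof -
    define seg where "seg t = (1 - t) *\<^sub>R ?c + t *\<^sub>R p" for t
    have seg: "seg t \<in> simplex3" "seg t $ i = 0" if "t \<in> {0..1}" for t
      using convex_simplex3[OF face_center_simplex p(1)] that p(2) ci unfolding seg_def by auto
    have pseg: "permute_point \<pi> (seg t) \<in> simplex3" if "t \<in> {0..1}" for t
      using permute_point_simplex[OF v(2)] seg that by blast
    have cseg: "continuous_on X seg" "continuous_on X (\<lambda>t. permute_point \<pi> (seg t))" for X
      unfolding seg_def permute_point_combine by (intro continuous_intros)+
    have path: "lift \<mu> (permute_point \<pi> (seg t)) = ext_act h (lift \<nu> (seg t))"
      if b: "b \<in> {0..1}" and inl: "\<And>t. t \<in> {0..b} \<Longrightarrow> \<exists>x. lift \<nu> (seg t) = Inl x" and t: "t \<in> {0..b}" for b t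
    proof -
      define \<alpha> \<beta> where "\<alpha> t = projl (lift \<nu> (seg t))" and "\<beta> t = projl (lift \<mu> (permute_point \<pi> (seg t)))" for t
      have \<alpha>: "lift \<nu> (seg t) = Inl (\<alpha> t)" "\<alpha> t \<in> hyp3" if "t \<in> {0..b}" for t
      proof -
        show 1: "lift \<nu> (seg t) = Inl (\<alpha> t)" using inl[OF that] by (auto simp: \<alpha>_def)
        have "lift \<nu> (seg t) \<in> ext_hyp3 \<Gamma>" using lift_in[OF \<nu>] seg that b by auto
        then show "\<alpha> t \<in> hyp3" unfolding 1 ext_hyp3_def by auto
      qed
      have rel: "\<exists>g\<in>\<Gamma>. \<beta> t = hyp_act g (\<alpha> t) \<and> lift \<mu> (permute_point \<pi> (seg t)) = Inl (\<beta> t)" if "t \<in> {0..b}" for t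
        using orbit[of "seg t"] seg[of t] that b \<alpha>[OF that] by (auto simp: \<beta>_def ext_act_def)
      have "\<beta> t = hyp_act h (\<alpha> t)"
      proof (rule path_lift_constant[OF _ _ \<alpha>(2)])
        have "continuous_on (seg ` {0..b}) (\<lambda>x. projl (lift \<nu> x))"
          by (rule continuous_on_hyp_part[OF lift_continuous[OF \<nu>]]) (use seg b inl in auto)
        then show "continuous_on {0..b} \<alpha>"
          unfolding \<alpha>_def by (rule continuous_on_compose2[OF _ cseg(1)]) auto
        have "continuous_on ((\<lambda>t. permute_point \<pi> (seg t)) ` {0..b}) (\<lambda>x. projl (lift \<mu> x))"
          by (rule continuous_on_hyp_part[OF lift_continuous[OF v(1)]]) (use pseg b rel in auto)
        then show "continuous_on {0..b} \<beta>"
          unfolding \<beta>_def by (rule continuous_on_compose2[OF _ cseg(2)]) auto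
        show "\<exists>g\<in>\<Gamma>. \<beta> t = hyp_act g (\<alpha> t)" if "t \<in> {0..b}" for t using rel[OF that] by blast
        show "h \<in> \<Gamma>" by (rule h)
        have "0 \<in> {0..b}" using b by auto
        moreover have "seg 0 = ?c" by (simp add: seg_def)
        ultimately show "\<beta> 0 = hyp_act h (\<alpha> 0)"
          using h(2) \<alpha>(1)[of 0] by (simp add: \<beta>_def ext_act_def)
      qed (use t in auto)
      then show ?thesis using rel[OF t] \<alpha>(1)[OF t] by (auto simp: ext_act_def)
    qed
    have inl: "\<exists>x. lift \<nu> (seg t) = Inl x" if "0 \<le> t" "t < 1" for t
    proof -
      have "seg t \<notin> range vertex" unfolding seg_def by (rule face_segment_not_vertex[OF p(1) that])
      moreover have "seg t \<in> simplex3" using seg(1)[of t] that by simp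
      ultimately show ?thesis using lift_interior[OF \<nu>, of "seg t"] by blast
    qed
    have seg1: "seg 1 = p" by (simp add: seg_def)
    show ?thesis
    proof (cases "lift \<nu> p")
      case (Inl x)
      have "\<exists>x. lift \<nu> (seg t) = Inl x" if "t \<in> {0..1}" for t
        using inl[of t] that Inl seg1 by (cases "t = 1") auto
      from path[of 1 1, OF _ this] show ?thesis unfolding seg1 by simp
    next
      case (Inr \<xi>)
      obtain g where g: "g \<in> \<Gamma>" "lift \<mu> (permute_point \<pi> p) = ext_act g (lift \<nu> p)" using orbit[OF p] by blast
      define \<xi>' where "\<xi>' = proj_act g \<xi>"
      have \<xi>': "lift \<mu> (permute_point \<pi> p) = Inr \<xi>'" using g(2) Inr by (simp add: ext_act_def \<xi>'_def)
      have cusp: "\<xi> \<in> lifted_cusps \<Gamma>" "\<xi>' \<in> lifted_cusps \<Gamma>"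
        using lift_in[OF \<nu> p(1)] lift_in[OF v(1) permute_point_simplex[OF v(2) p(1)]]
        unfolding Inr \<xi>' ext_hyp3_def by auto
      obtain v w where vw: "v \<in> \<xi>" "w \<in> \<xi>'"
        using cusp unfolding lifted_cusps_def proj_space_def using proj_point_self by blast
      note rep = lifted_cusp_rep[OF cusp(1) vw(1)] lifted_cusp_rep[OF cusp(2) vw(2)]
      obtain A where A: "invertible A" "h = pgl A" using in_PGL[OF h(1)] unfolding carrier_PGL by auto
      define \<delta> where "\<delta> = (cmod ((A *v v)$1 * w$2 - (A *v v)$2 * w$1))\<^sup>2"
      have "\<delta> = 0"
      proof (rule ccontr)
        assume "\<delta> \<noteq> 0"
        then have \<delta>: "\<delta> > 0" unfolding \<delta>_def by simp
        define s where "s = 1 + cmod (det A) / \<delta>"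
        have s: "s \<ge> 1" "s > 0" using \<delta> unfolding s_def by (auto simp: add_pos_nonneg)
        define U V where "U = insert (Inr \<xi>) (Inl ` horoball v s)" and "V = insert (Inr \<xi>') (Inl ` horoball w s)"
        have "openin (top_of_set simplex3) {x \<in> simplex3. lift \<nu> x \<in> U}"
          using openin_continuous_map_preimage[OF lift_continuous[OF \<nu>] openin_cusp_neighbourhood[OF cusp(1) vw(1) s(2)]]
          unfolding U_def topspace_euclidean_subtopology .
        then obtain O1 where O1: "open O1" "{x \<in> simplex3. lift \<nu> x \<in> U} = simplex3 \<inter> O1"
          unfolding openin_open by auto
        have "openin (top_of_set simplex3) {x \<in> simplex3. lift \<mu> x \<in> V}"
          using openin_continuous_map_preimage[OF lift_continuous[OF v(1)] openin_cusp_neighbourhood[OF cusp(2) vw(2) s(2)]]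
          unfolding V_def topspace_euclidean_subtopology .
        then obtain O2 where O2: "open O2" "{x \<in> simplex3. lift \<mu> x \<in> V} = simplex3 \<inter> O2"
          unfolding openin_open by auto
        have "seg 1 \<in> O1" unfolding seg1 using O1(2) p(1) Inr by (auto simp: U_def)
        moreover have "permute_point \<pi> (seg 1) \<in> O2"
          unfolding seg1 using O2(2) permute_point_simplex[OF v(2) p(1)] \<xi>' by (auto simp: V_def)
        moreover have "(seg \<longlongrightarrow> seg 1) (at_left 1)" "((\<lambda>t. permute_point \<pi> (seg t)) \<longlongrightarrow> permute_point \<pi> (seg 1)) (at_left 1)"
          using cseg[of UNIV] by (auto simp: continuous_on_def intro: tendsto_within_subset)
        ultimately have "\<forall>\<^sub>F t in at_left 1. seg t \<in> O1" "\<forall>\<^sub>F t in at_left 1. permute_point \<pi> (seg t) \<in> O2"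
          using O1(1) O2(1) topological_tendstoD by blast+
        moreover have "\<forall>\<^sub>F t in at_left (1::real). t \<in> {0<..<1}"
          by (rule eventually_at_left_real) simp
        ultimately have "\<forall>\<^sub>F t in at_left 1. seg t \<in> O1 \<and> permute_point \<pi> (seg t) \<in> O2 \<and> t \<in> {0<..<1}"
          by (intro eventually_conj)
        then obtain t where t: "seg t \<in> O1" "permute_point \<pi> (seg t) \<in> O2" "t \<in> {0<..<1}"
          using eventually_happens[of _ "at_left (1::real)"] trivial_limit_at_left_real by blast
        have t01: "t \<in> {0..1}" using t by auto
        obtain x where x: "lift \<nu> (seg t) = Inl x" using inl[of t] t by auto
        have "lift \<nu> (seg t) \<in> U" using O1(2) t(1) seg(1)[OF t01] by blast
        then have hv: "x \<in> horoball v s" unfolding x U_def by auto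
        have "lift \<mu> (permute_point \<pi> (seg t)) = ext_act h (lift \<nu> (seg t))"
          by (rule path[of t t]) (use t inl in auto)
        moreover have "lift \<mu> (permute_point \<pi> (seg t)) \<in> V" using O2(2) t(2) pseg[OF t01] by blast
        ultimately have hw: "hyp_act h x \<in> horoball w s" unfolding x V_def by (auto simp: ext_act_def)
        have xh: "x \<in> hyp3" "s * horofun v x < 1" "hyp_act h x \<in> hyp3" "s * horofun w (hyp_act h x) < 1"
          using hv hw mem_horoball rep by auto
        have "\<delta> \<le> horofun (A *v v) (hyp_act h x) * horofun w (hyp_act h x)"
          unfolding \<delta>_def by (rule horofun_product[OF xh(3)])
        also have "\<dots> = cmod (det A) * (horofun v x * horofun w (hyp_act h x))"
          unfolding A(2) using horofun_act[OF A(1) xh(1)] by simp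
        finally have "s * \<delta> \<le> s * (cmod (det A) * (horofun v x * horofun w (hyp_act h x)))"
          using s by (intro mult_left_mono) auto
        also have "\<dots> \<le> cmod (det A)"
        proof -
          have "horofun v x > 0" "horofun w (hyp_act h x) > 0" using horofun_pos rep xh by auto
          moreover from this have "horofun w (hyp_act h x) \<le> s * horofun w (hyp_act h x)"
            using mult_right_mono[of 1 s "horofun w (hyp_act h x)"] s by simp
          then have "horofun w (hyp_act h x) \<le> 1" using xh(4) by linarith
          ultimately have "s * horofun v x * horofun w (hyp_act h x) \<le> 1 * 1"
            using xh s by (intro mult_mono) auto
          then show ?thesis using mult_left_mono[of "s * horofun v x * horofun w (hyp_act h x)" 1 "cmod (det A)"]
            by (simp add: mult.left_commute mult.assoc)
        qed
        also have "cmod (det A) < s * \<delta>" using \<delta> unfolding s_def by (simp add: field_simps)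
        finally show False by simp
      qed
      then have z: "(A *v v)$1 * w$2 = (A *v v)$2 * w$1" unfolding \<delta>_def by simp
      have Av: "A *v v \<noteq> 0" using invertible_mult_nonzero A rep by blast
      have "\<exists>c. c \<noteq> 0 \<and> w = c *s (A *v v)"
      proof (cases "(A *v v)$1 = 0")
        case True
        then have "(A *v v)$2 \<noteq> 0" using Av by (auto simp: vec_eq_iff forall_2)
        then show ?thesis using z True rep(3)
          by (intro exI[of _ "w$2 / (A *v v)$2"]) (auto simp: vec_eq_iff forall_2)
      next
        case False
        then have "w$2 = w$1 / (A *v v)$1 * (A *v v)$2" using z by (simp add: field_simps)
        then show ?thesis using False rep(3)
          by (intro exI[of _ "w$1 / (A *v v)$1"]) (auto simp: vec_eq_iff forall_2)
      qed
      then have "proj_point (A *v v) = proj_point w" using proj_point_eq_iff[OF Av] by blast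
      then have "\<xi>' = proj_act h \<xi>" using rep A by (simp add: proj_act_pgl)
      then show ?thesis unfolding \<xi>' Inr by (simp add: ext_act_def)
    qed
  qed
  show thesis by (rule that[OF h(1) main])
qed

end

section \<open>Parabolic decorations from developing maps\<close>

text \<open>A developing map \<open>D\<close>. As the decoration read off from it satisfies the face and edge equations
  automatically, refined and dual decorations need only be constructed on the level of \<open>D\<close>.\<close>

locale developed = triangulated \<Gamma> K for \<Gamma> K +
  fixes \<rho> :: "(complex^2^2) set \<Rightarrow> (complex^3^3) set" and D :: "ext_point \<Rightarrow> flag"
  assumes hom: "\<rho> \<in> hom (PGL\<lparr>carrier := \<Gamma>\<rparr>) PGL"
    and equivariant: "g \<in> \<Gamma> \<Longrightarrow> x \<in> lifted_vertices \<Gamma> K \<Longrightarrow> D (ext_act g x) = flag_act (\<rho> g) (D x)"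
    and generic: "\<nu> < tet_count K \<Longrightarrow> generic_tetrahedron (\<lambda>i. D (lifted_simplex K \<nu> (vertex i)))"
begin

definition tet :: "nat \<Rightarrow> tetrahedron" where
  "tet \<nu> i = D (lift \<nu> (vertex i))"

lemma generic_tet: "\<nu> < tet_count K \<Longrightarrow> generic_tetrahedron (tet \<nu>)"
  unfolding tet_def by (rule generic)

lemma rho_in: "g \<in> \<Gamma> \<Longrightarrow> \<rho> g \<in> carrier PGL"
  using hom unfolding hom_def by auto

lemma tet_flag: "\<nu> < tet_count K \<Longrightarrow> tet \<nu> i \<in> flags"
  using generic_tet unfolding generic_tetrahedron_iff by blast

lemma lift_vertex_in: "\<nu> < tet_count K \<Longrightarrow> lift \<nu> (vertex i) \<in> ext_hyp3 \<Gamma>"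
  by (simp add: lift_in)

lemma lifted_vertex: "g \<in> \<Gamma> \<Longrightarrow> \<nu> < tet_count K \<Longrightarrow> ext_act g (lift \<nu> (vertex i)) \<in> lifted_vertices \<Gamma> K"
  unfolding lifted_vertices_def by blast

lemma lifted_vertex0: "\<nu> < tet_count K \<Longrightarrow> lift \<nu> (vertex i) \<in> lifted_vertices \<Gamma> K"
  using lifted_vertex[OF one_in] ext_act_one[OF lift_vertex_in] by metis

lemma D_translate: "g \<in> \<Gamma> \<Longrightarrow> \<nu> < tet_count K \<Longrightarrow> D (ext_act g (lift \<nu> (vertex i))) = flag_act (\<rho> g) (tet \<nu> i)"
  unfolding tet_def using equivariant lifted_vertex0 by blast

lemma tet_glue:
  assumes "\<nu> < tet_count K" "pairing K \<nu> i = (\<mu>, \<pi>)"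
  obtains g where "g \<in> carrier PGL" "\<And>j. j \<noteq> i \<Longrightarrow> tet \<mu> (\<pi> j) = flag_act g (tet \<nu> j)"
proof -
  obtain h where h: "h \<in> \<Gamma>"
    "\<And>p. p \<in> simplex3 \<Longrightarrow> p $ i = 0 \<Longrightarrow> lift \<mu> (permute_point \<pi> p) = ext_act h (lift \<nu> p)"
    using face_lift[OF assms] by metis
  have "tet \<mu> (\<pi> j) = flag_act (\<rho> h) (tet \<nu> j)" if "j \<noteq> i" for j
  proof -
    have "lift \<mu> (vertex (\<pi> j)) = ext_act h (lift \<nu> (vertex j))"
      using h(2)[OF vertex_in_simplex, of j] that permute_point_vertex[OF valid_pairingD(2)[OF valid assms]]
      by (simp add: axis_def)
    then show ?thesis using D_translate[OF h(1) assms(1)] by (simp add: tet_def)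
  qed
  then show ?thesis using that rho_in[OF h(1)] by blast
qed

lemma face_equations: "face_equations K tet"
  unfolding face_equations_def
proof (intro allI impI)
  fix \<nu> \<sigma> \<mu> \<pi>
  assume \<nu>: "\<nu> < tet_count K" and s: "even4 \<sigma>" and pr: "pairing K \<nu> (\<sigma> 1) = (\<mu>, \<pi>)"
  obtain g where g: "g \<in> carrier PGL" "\<And>j. j \<noteq> \<sigma> 1 \<Longrightarrow> tet \<mu> (\<pi> j) = flag_act g (tet \<nu> j)"
    using tet_glue[OF \<nu> pr] by metis
  have d: "distinct [\<sigma> 1, \<sigma> 2, \<sigma> 3, \<sigma> 4]" using s even4_distinct by blast
  then have n: "\<sigma> 2 \<noteq> \<sigma> 1" "\<sigma> 3 \<noteq> \<sigma> 1" "\<sigma> 4 \<noteq> \<sigma> 1" by auto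
  have "face_coord (tet \<mu>) (\<pi> (\<sigma> 2)) (\<pi> (\<sigma> 4)) (\<pi> (\<sigma> 3)) = inverse (face_coord (tet \<nu>) (\<sigma> 2) (\<sigma> 3) (\<sigma> 4))"
    using face_ratio_swap[of "tet \<nu> (\<sigma> 2)" "tet \<nu> (\<sigma> 4)" "tet \<nu> (\<sigma> 3)"]
    by (simp add: face_coord_ratio g(2)[OF n(1)] g(2)[OF n(2)] g(2)[OF n(3)] face_ratio_act[OF g(1)] tet_flag[OF \<nu>])
  moreover have "face_coord (tet \<nu>) (\<sigma> 2) (\<sigma> 3) (\<sigma> 4) \<noteq> 0"
    using generic_tet[OF \<nu>] d unfolding generic_tetrahedron_iff face_coord_ratio face_ratio_def by auto
  ultimately show "face_coord (tet \<nu>) (\<sigma> 2) (\<sigma> 3) (\<sigma> 4) * face_coord (tet \<mu>) (\<pi> (\<sigma> 2)) (\<pi> (\<sigma> 4)) (\<pi> (\<sigma> 3)) = 1"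
    by simp
qed

definition edge_point :: "4 \<Rightarrow> 4 \<Rightarrow> real \<Rightarrow> real^4" where
  "edge_point i j t = (1 - t) *\<^sub>R vertex i + t *\<^sub>R vertex j"

lemma edge_point_simplex: "t \<in> {0..1} \<Longrightarrow> edge_point i j t \<in> simplex3"
  unfolding edge_point_def by (intro convex_simplex3) auto

text \<open>Along a whole edge, and not only at its ends, the lifts of the members of its class are related
  by one deck transformation.\<close>

lemma edge_class_lift:
  assumes "\<nu> < tet_count K" "i \<noteq> j" "e \<in> edge_class K (\<nu>, i, j)"
  shows "case e of (\<mu>, k, l) \<Rightarrow> \<mu> < tet_count K \<and> k \<noteq> l \<and>
    (\<exists>g\<in>\<Gamma>. \<forall>t\<in>{0..1}. lift \<mu> (edge_point k l t) = ext_act g (lift \<nu> (edge_point i j t)))"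
proof -
  have "((\<nu>, i, j), e) \<in> (edge_step K)\<^sup>*" using assms unfolding edge_class_def by blast
  then show ?thesis
  proof (induction rule: rtrancl_induct)
    case base
    show ?case using assms(1,2) one_in ext_act_one lift_in edge_point_simplex by (auto intro!: bexI[of _ "\<one>\<^bsub>PGL\<^esub>"])
  next
    case (step e e')
    obtain \<mu> k l where e: "e = (\<mu>, k, l)" by (cases e)
    obtain \<mu>' \<pi> m where e': "e' = (\<mu>', \<pi> k, \<pi> l)" and m: "m \<noteq> k" "m \<noteq> l" "pairing K \<mu> m = (\<mu>', \<pi>)"
      using step(2) unfolding edge_step_def e by blast
    obtain g where g: "g \<in> \<Gamma>" "\<And>t. t \<in> {0..1} \<Longrightarrow> lift \<mu> (edge_point k l t) = ext_act g (lift \<nu> (edge_point i j t))"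
      and \<mu>: "\<mu> < tet_count K" and kl: "k \<noteq> l"
      using step(3) unfolding e by blast
    note v = valid_pairingD[OF valid \<mu> m(3)]
    obtain h where h: "h \<in> \<Gamma>"
      "\<And>p. p \<in> simplex3 \<Longrightarrow> p $ m = 0 \<Longrightarrow> lift \<mu>' (permute_point \<pi> p) = ext_act h (lift \<mu> p)"
      using face_lift[OF \<mu> m(3)] by metis
    have "lift \<mu>' (edge_point (\<pi> k) (\<pi> l) t) = ext_act (h \<otimes>\<^bsub>PGL\<^esub> g) (lift \<nu> (edge_point i j t))"
      if t: "t \<in> {0..1}" for t
    proof -
      have "edge_point (\<pi> k) (\<pi> l) t = permute_point \<pi> (edge_point k l t)"
        unfolding edge_point_def permute_point_combine permute_point_vertex[OF v(2)] ..
      moreover have "edge_point k l t $ m = 0" using m by (simp add: edge_point_def axis_def)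
      ultimately show ?thesis
        using h(2)[OF edge_point_simplex[OF t], of k l] g t assms(1)
        by (simp add: ext_act_mult[OF h(1) g(1)] lift_in edge_point_simplex)
    qed
    then show ?case unfolding e' using v(1) kl permutes_4_distinct[OF v(2)] mult_in[OF h(1) g(1)] by auto
  qed
qed

definition third :: "nat \<times> 4 \<times> 4 \<Rightarrow> 4" where
  "third = (\<lambda>(\<mu>, k, l). even_completion k l 3)"

definition fourth :: "nat \<times> 4 \<times> 4 \<Rightarrow> 4" where
  "fourth = (\<lambda>(\<mu>, k, l). even_completion k l 4)"

text \<open>Turning around an edge through the face opposite to the third vertex.\<close>

definition turn :: "nat \<times> 4 \<times> 4 \<Rightarrow> nat \<times> 4 \<times> 4" where
  "turn e = (case e of (\<mu>, k, l) \<Rightarrow> case pairing K \<mu> (third e) of (\<mu>', \<pi>) \<Rightarrow> (\<mu>', \<pi> k, \<pi> l))"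

lemma completion_distinct:
  assumes "k \<noteq> l" shows "distinct [k, l, third (\<mu>, k, l), fourth (\<mu>, k, l)]"
proof -
  obtain \<sigma> where s: "even4 \<sigma>" "\<sigma> 1 = k" "\<sigma> 2 = l" using even4_exists[OF assms] by metis
  then show ?thesis using even_completion_eq[OF s(1)] even4_distinct[of \<sigma>] by (simp add: third_def fourth_def)
qed

lemma completion_odd:
  assumes "k \<noteq> l" "\<pi> permutes UNIV" "\<not> evenperm \<pi>"
  shows "third (\<mu>', \<pi> k, \<pi> l) = \<pi> (fourth (\<mu>, k, l))" "fourth (\<mu>', \<pi> k, \<pi> l) = \<pi> (third (\<mu>, k, l))"
proof -
  obtain \<sigma> where s: "even4 \<sigma>" "\<sigma> 1 = k" "\<sigma> 2 = l" using even4_exists[OF assms(1)] by metis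
  let ?\<tau> = "\<pi> \<circ> \<sigma> \<circ> transp 3 4"
  have "\<pi> \<circ> \<sigma> permutes UNIV" "\<not> evenperm (\<pi> \<circ> \<sigma>)"
    using s assms evenperm_comp_4[of \<pi> \<sigma>] by (auto intro: permutes_compose)
  then have t: "even4 ?\<tau>" using compose_transp[of "\<pi> \<circ> \<sigma>" 3 4] distinct_4 by simp
  have "?\<tau> 1 = \<pi> k" "?\<tau> 2 = \<pi> l" "?\<tau> 3 = \<pi> (\<sigma> 4)" "?\<tau> 4 = \<pi> (\<sigma> 3)"
    using s by (simp_all add: Transposition.transpose_def)
  then show "third (\<mu>', \<pi> k, \<pi> l) = \<pi> (fourth (\<mu>, k, l))" "fourth (\<mu>', \<pi> k, \<pi> l) = \<pi> (third (\<mu>, k, l))"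
    using even_completion_eq[OF t] even_completion_eq[OF s(1)] s(2,3) unfolding third_def fourth_def by simp_all
qed

text \<open>The simplices around a lifted edge, moved so that they all contain one fixed lift of it, share
  the flags of their common faces. Each edge coordinate is a quotient of one function at the two
  remaining vertices, and so the product telescopes.\<close>

lemma edge_product:
  assumes \<nu>: "\<nu> < tet_count K" and ij: "i \<noteq> j"
    and w: "\<And>T k l m. generic_tetrahedron T \<Longrightarrow> distinct [k, l, m] \<Longrightarrow> w (T k) (T l) (T m) \<noteq> (0::complex)"
    and inv: "\<And>g \<phi> \<psi> \<theta> \<omega>. g \<in> carrier PGL \<Longrightarrow> \<phi> \<in> flags \<Longrightarrow> \<psi> \<in> flags \<Longrightarrow> \<theta> \<in> flags \<Longrightarrow> \<omega> \<in> flags \<Longrightarrow>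
      w (flag_act g \<phi>) (flag_act g \<psi>) (flag_act g \<theta>) / w (flag_act g \<phi>) (flag_act g \<psi>) (flag_act g \<omega>)
      = w \<phi> \<psi> \<theta> / w \<phi> \<psi> \<omega>"
  shows "(\<Prod>e\<in>edge_class K (\<nu>, i, j). case e of (\<mu>, k, l) \<Rightarrow>
    w (tet \<mu> k) (tet \<mu> l) (tet \<mu> (fourth e)) / w (tet \<mu> k) (tet \<mu> l) (tet \<mu> (third e))) = 1"
proof -
  interpret G: group "PGL :: (complex^2^2) set monoid" by (rule group_PGL)
  let ?cls = "edge_class K (\<nu>, i, j)"
  define P where "P e g \<longleftrightarrow> (case e of (\<mu>, k, l) \<Rightarrow> g \<in> \<Gamma> \<and>
    (\<forall>t\<in>{0..1}. lift \<mu> (edge_point k l t) = ext_act g (lift \<nu> (edge_point i j t))))" for e g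
  have e0: "edge_point k l 0 = vertex k" "edge_point k l 1 = vertex l" for k l
    by (simp_all add: edge_point_def)
  have cls: "\<mu> < tet_count K" "k \<noteq> l" "\<exists>g. P (\<mu>, k, l) g" if "(\<mu>, k, l) \<in> ?cls" for \<mu> k l
    using edge_class_lift[OF \<nu> ij that] unfolding P_def by auto
  have Pin: "g \<in> \<Gamma>" if "P e g" for e g using that unfolding P_def by (cases e) auto
  \<comment> \<open>The edge has an interior point in hyperbolic space, where the action is free. The vertices alone
    would not do, since cusps have stabilizers.\<close>
  have unique: "g = g'" if g: "P e g" and g': "P e g'" for e g g'
  proof -
    have "edge_point i j (1/2) \<notin> range vertex"
      by (rule not_vertexI[of _ i j]) (use ij in \<open>auto simp: edge_point_def axis_def\<close>)
    then obtain x where x: "x \<in> hyp3" "lift \<nu> (edge_point i j (1/2)) = Inl x"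
      using lift_interior[OF \<nu> edge_point_simplex[of "1/2"], of i j] by auto
    have "ext_act g (Inl x) = ext_act g' (Inl x)"
      using g g' x unfolding P_def by (cases e) (auto dest!: bspec[of _ _ "1/2"])
    then show ?thesis using hyp_act_inj[OF Pin[OF g] Pin[OF g'] x(1)] by (simp add: ext_act_def)
  qed
  define \<gamma> where "\<gamma> e = (SOME g. P e g)" for e
  have \<gamma>: "P (\<mu>, k, l) (\<gamma> (\<mu>, k, l))" if "(\<mu>, k, l) \<in> ?cls" for \<mu> k l
    unfolding \<gamma>_def by (rule someI_ex) (rule cls(3)[OF that])
  define E where "E e m = D (ext_act (inv\<^bsub>PGL\<^esub> (\<gamma> e)) (lift (fst e) (vertex m)))" for e m
  define A where "A e = w (tet \<nu> i) (tet \<nu> j) (E e (third e))" for e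
  have E: "E (\<mu>, k, l) = (\<lambda>m. flag_act (\<rho> (inv\<^bsub>PGL\<^esub> (\<gamma> (\<mu>, k, l)))) (tet \<mu> m))"
      "inv\<^bsub>PGL\<^esub> (\<gamma> (\<mu>, k, l)) \<in> \<Gamma>" "E (\<mu>, k, l) k = tet \<nu> i" "E (\<mu>, k, l) l = tet \<nu> j"
    if e: "(\<mu>, k, l) \<in> ?cls" for \<mu> k l
  proof -
    let ?g = "\<gamma> (\<mu>, k, l)"
    have g: "?g \<in> \<Gamma>" by (rule Pin[OF \<gamma>[OF e]])
    show gi: "inv\<^bsub>PGL\<^esub> ?g \<in> \<Gamma>" by (rule inv_in[OF g])
    show "E (\<mu>, k, l) = (\<lambda>m. flag_act (\<rho> (inv\<^bsub>PGL\<^esub> ?g)) (tet \<mu> m))"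
      unfolding E_def using D_translate[OF gi cls(1)[OF e]] by simp
    have "lift \<mu> (edge_point k l t) = ext_act ?g (lift \<nu> (edge_point i j t))" if "t \<in> {0..1}" for t
      using \<gamma>[OF e] that unfolding P_def by auto
    from this[of 0] this[of 1] show "E (\<mu>, k, l) k = tet \<nu> i" "E (\<mu>, k, l) l = tet \<nu> j"
      unfolding E_def tet_def e0 using ext_act_inverse[OF g lift_vertex_in[OF \<nu>]] by simp_all
  qed
  have turn: "turn (\<mu>, k, l) \<in> ?cls \<and> E (turn (\<mu>, k, l)) (third (turn (\<mu>, k, l))) = E (\<mu>, k, l) (fourth (\<mu>, k, l))
      \<and> (\<exists>\<pi>. turn (\<mu>, k, l) = (fst (turn (\<mu>, k, l)), \<pi> k, \<pi> l) \<and>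
          pairing K (fst (turn (\<mu>, k, l))) (fourth (turn (\<mu>, k, l))) = (\<mu>, inv_into UNIV \<pi>) \<and> \<pi> permutes UNIV)"
    if e: "(\<mu>, k, l) \<in> ?cls" for \<mu> k l
  proof -
    let ?e = "(\<mu>, k, l)"
    note c = cls[OF e]
    obtain \<mu>' \<pi> where pr: "pairing K \<mu> (third ?e) = (\<mu>', \<pi>)" by fastforce
    note v = valid_pairingD[OF valid c(1) pr]
    have t: "turn ?e = (\<mu>', \<pi> k, \<pi> l)" by (simp add: turn_def pr)
    note d = completion_distinct[OF c(2), of \<mu>]
    note odd = completion_odd[OF c(2) v(2,3), of \<mu>' \<mu>]
    have "(?e, turn ?e) \<in> edge_step K"
      unfolding t edge_step_def using d pr by auto metis
    then have in_cls: "turn ?e \<in> ?cls" using e unfolding edge_class_def by (auto intro: rtrancl_into_rtrancl)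
    obtain h where h: "h \<in> \<Gamma>"
      "\<And>p. p \<in> simplex3 \<Longrightarrow> p $ third ?e = 0 \<Longrightarrow> lift \<mu>' (permute_point \<pi> p) = ext_act h (lift \<mu> p)"
      using face_lift[OF c(1) pr] by metis
    let ?g = "\<gamma> ?e"
    have g: "?g \<in> \<Gamma>" by (rule Pin[OF \<gamma>[OF e]])
    have "lift \<mu>' (edge_point (\<pi> k) (\<pi> l) s) = ext_act (h \<otimes>\<^bsub>PGL\<^esub> ?g) (lift \<nu> (edge_point i j s))" if s: "s \<in> {0..1}" for s
    proof -
      have "edge_point (\<pi> k) (\<pi> l) s = permute_point \<pi> (edge_point k l s)"
        unfolding edge_point_def permute_point_combine permute_point_vertex[OF v(2)] ..
      moreover have "edge_point k l s $ third ?e = 0" using d by (auto simp: edge_point_def axis_def)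
      moreover have "lift \<mu> (edge_point k l s) = ext_act ?g (lift \<nu> (edge_point i j s))"
        using \<gamma>[OF e] s unfolding P_def by auto
      ultimately show ?thesis
        using h(2)[OF edge_point_simplex[OF s], of k l] ext_act_mult[OF h(1) g lift_in[OF \<nu> edge_point_simplex[OF s]]] by simp
    qed
    then have "P (turn ?e) (h \<otimes>\<^bsub>PGL\<^esub> ?g)" unfolding t P_def using mult_in[OF h(1) g] by auto
    moreover have "P (turn ?e) (\<gamma> (turn ?e))" using \<gamma> in_cls unfolding t by blast
    ultimately have gt: "\<gamma> (turn ?e) = h \<otimes>\<^bsub>PGL\<^esub> ?g" using unique by blast
    have "inv\<^bsub>PGL\<^esub> (h \<otimes>\<^bsub>PGL\<^esub> ?g) \<otimes>\<^bsub>PGL\<^esub> h = inv\<^bsub>PGL\<^esub> ?g"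
      using in_PGL[OF h(1)] in_PGL[OF g] by (simp add: G.inv_mult_group G.m_assoc)
    moreover have "lift \<mu>' (vertex (\<pi> (fourth ?e))) = ext_act h (lift \<mu> (vertex (fourth ?e)))"
      using h(2)[OF vertex_in_simplex, of "fourth ?e"] d permute_point_vertex[OF v(2)] by (auto simp: axis_def)
    ultimately have "E (turn ?e) (third (turn ?e)) = E ?e (fourth ?e)"
      using ext_act_mult[OF inv_in[OF mult_in[OF h(1) g]] h(1) lift_vertex_in[OF c(1)], of "fourth ?e"]
      unfolding E_def gt unfolding t odd by simp
    moreover have "pairing K \<mu>' (fourth (turn ?e)) = (\<mu>, inv_into UNIV \<pi>)" unfolding t odd by (rule v(5))
    ultimately show ?thesis using in_cls v(2) t by auto
  qed
  have fin: "finite ?cls"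
  proof (rule finite_subset)
    show "?cls \<subseteq> {..<tet_count K} \<times> UNIV \<times> UNIV" using cls(1) by auto
  qed simp
  have "inj_on turn ?cls"
  proof (rule inj_onI)
    fix x y assume x: "x \<in> ?cls" and y: "y \<in> ?cls" and xy: "turn x = turn y"
    obtain \<mu> k l \<mu>' k' l' where e: "x = (\<mu>, k, l)" "y = (\<mu>', k', l')" by (metis prod_cases3)
    obtain \<pi> where p: "turn x = (fst (turn x), \<pi> k, \<pi> l)" "pairing K (fst (turn x)) (fourth (turn x)) = (\<mu>, inv_into UNIV \<pi>)" "\<pi> permutes UNIV"
      using turn x unfolding e by blast
    obtain \<pi>' where p': "turn y = (fst (turn y), \<pi>' k', \<pi>' l')" "pairing K (fst (turn y)) (fourth (turn y)) = (\<mu>', inv_into UNIV \<pi>')" "\<pi>' permutes UNIV"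
      using turn y unfolding e by blast
    have "\<mu> = \<mu>'" "inv_into UNIV \<pi> = inv_into UNIV \<pi>'"
      using p(2) p'(2) xy by auto
    moreover have "\<pi> k = \<pi>' k'" "\<pi> l = \<pi>' l'"
      using p(1) p'(1) xy by (metis prod.inject)+
    ultimately show "x = y" unfolding e using p(3) p'(3) by (metis permutes_inverses(2))
  qed
  moreover have "turn ` ?cls \<subseteq> ?cls" using turn by auto
  ultimately have bij: "bij_betw turn ?cls ?cls"
    using endo_inj_surj[OF fin] by (simp add: bij_betw_def)
  have A0: "A e \<noteq> 0" if "e \<in> ?cls" for e
  proof -
    obtain \<mu> k l where e: "e = (\<mu>, k, l)" by (cases e)
    have "generic_tetrahedron (E e)"
      using that unfolding e by (simp add: E(1) generic_tetrahedron_act rho_in E(2) generic_tet cls(1))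
    moreover have "distinct [k, l, third e]" using completion_distinct[OF cls(2)] that unfolding e by auto
    ultimately have "w (E e k) (E e l) (E e (third e)) \<noteq> 0" by (rule w)
    then show ?thesis using E(3,4) that unfolding A_def e by simp
  qed
  have "(\<Prod>e\<in>?cls. case e of (\<mu>, k, l) \<Rightarrow>
      w (tet \<mu> k) (tet \<mu> l) (tet \<mu> (fourth e)) / w (tet \<mu> k) (tet \<mu> l) (tet \<mu> (third e)))
    = (\<Prod>e\<in>?cls. A (turn e) / A e)"
  proof (rule prod.cong[OF refl])
    fix e assume e: "e \<in> ?cls"
    obtain \<mu> k l where ekl: "e = (\<mu>, k, l)" by (cases e)
    note f = tet_flag[OF cls(1)[OF e[unfolded ekl]]]
    have "w (tet \<mu> k) (tet \<mu> l) (tet \<mu> (fourth e)) / w (tet \<mu> k) (tet \<mu> l) (tet \<mu> (third e))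
      = w (E e k) (E e l) (E e (fourth e)) / w (E e k) (E e l) (E e (third e))"
      using inv[OF rho_in[OF E(2)[OF e[unfolded ekl]]] f f f f] E(1)[OF e[unfolded ekl]] unfolding ekl by simp
    also have "\<dots> = A (turn e) / A e"
      using turn[OF e[unfolded ekl]] E(3,4)[OF e[unfolded ekl]] unfolding A_def ekl by simp
    finally show "(case e of (\<mu>, k, l) \<Rightarrow>
      w (tet \<mu> k) (tet \<mu> l) (tet \<mu> (fourth e)) / w (tet \<mu> k) (tet \<mu> l) (tet \<mu> (third e))) = A (turn e) / A e"
      unfolding ekl by simp
  qed
  also have "\<dots> = (\<Prod>e\<in>?cls. A (turn e)) / (\<Prod>e\<in>?cls. A e)" by (rule prod_dividef)
  also have "(\<Prod>e\<in>?cls. A (turn e)) = (\<Prod>e\<in>?cls. A e)" by (rule prod.reindex_bij_betw[OF bij])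
  finally show ?thesis using A0 fin by simp
qed

lemma edge_equations: "edge_equations K tet"
  unfolding edge_equations_def
proof (intro allI impI conjI)
  fix \<nu> i j assume \<nu>: "\<nu> < tet_count K" and ij: "i \<noteq> (j :: 4)"
  let ?cls = "edge_class K (\<nu>, i, j)"
  have coords: "edge_coord (tet \<mu>) k l = (flag_det (tet \<mu> k) (tet \<mu> l) (tet \<mu> (fourth (\<mu>, k, l))) / flag_pairing (tet \<mu> k) (tet \<mu> (fourth (\<mu>, k, l))))
        / (flag_det (tet \<mu> k) (tet \<mu> l) (tet \<mu> (third (\<mu>, k, l))) / flag_pairing (tet \<mu> k) (tet \<mu> (third (\<mu>, k, l))))"
    "edge_coord (tet \<mu>) l k = inverse ((flag_det (tet \<mu> l) (tet \<mu> k) (tet \<mu> (fourth (\<mu>, k, l))) / flag_pairing (tet \<mu> l) (tet \<mu> (fourth (\<mu>, k, l))))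
        / (flag_det (tet \<mu> l) (tet \<mu> k) (tet \<mu> (third (\<mu>, k, l))) / flag_pairing (tet \<mu> l) (tet \<mu> (third (\<mu>, k, l)))))"
    if "(\<mu>, k, l) \<in> ?cls" for \<mu> k l
  proof -
    have kl: "k \<noteq> l" using edge_class_lift[OF \<nu> ij that] by simp
    obtain \<sigma> where s: "even4 \<sigma>" "\<sigma> 1 = k" "\<sigma> 2 = l" using even4_exists[OF kl] by metis
    then have c: "third (\<mu>, k, l) = \<sigma> 3" "fourth (\<mu>, k, l) = \<sigma> 4"
      using even_completion_eq[OF s(1)] by (simp_all add: third_def fourth_def)
    show "edge_coord (tet \<mu>) k l = (flag_det (tet \<mu> k) (tet \<mu> l) (tet \<mu> (fourth (\<mu>, k, l))) / flag_pairing (tet \<mu> k) (tet \<mu> (fourth (\<mu>, k, l))))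
        / (flag_det (tet \<mu> k) (tet \<mu> l) (tet \<mu> (third (\<mu>, k, l))) / flag_pairing (tet \<mu> k) (tet \<mu> (third (\<mu>, k, l))))"
      using edge_coord_even[OF s(1), of "tet \<mu>"] unfolding c s(2,3) edge_ratio_def by (simp add: mult.commute)
    have t: "\<sigma> \<circ> transp 1 2 permutes UNIV" "\<not> evenperm (\<sigma> \<circ> transp 1 2)"
      using compose_transp[of \<sigma> 1 2] s(1) distinct_4 by auto
    show "edge_coord (tet \<mu>) l k = inverse ((flag_det (tet \<mu> l) (tet \<mu> k) (tet \<mu> (fourth (\<mu>, k, l))) / flag_pairing (tet \<mu> l) (tet \<mu> (fourth (\<mu>, k, l))))
        / (flag_det (tet \<mu> l) (tet \<mu> k) (tet \<mu> (third (\<mu>, k, l))) / flag_pairing (tet \<mu> l) (tet \<mu> (third (\<mu>, k, l)))))"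
      using edge_coord_odd[OF t, of "tet \<mu>"] s(2,3) unfolding c edge_ratio_def
      by (simp add: Transposition.transpose_def mult.commute)
  qed
  have nz: "flag_det (T k) (T l) (T m) / flag_pairing (T k) (T m) \<noteq> 0"
    "flag_det (T l) (T k) (T m) / flag_pairing (T l) (T m) \<noteq> 0"
    if "generic_tetrahedron T" "distinct [k, l, m]" for T k l m
    using that unfolding generic_tetrahedron_iff by auto
  have inv: "(flag_det (flag_act g \<phi>) (flag_act g \<psi>) (flag_act g \<theta>) / flag_pairing (flag_act g \<phi>) (flag_act g \<theta>))
      / (flag_det (flag_act g \<phi>) (flag_act g \<psi>) (flag_act g \<omega>) / flag_pairing (flag_act g \<phi>) (flag_act g \<omega>))
      = (flag_det \<phi> \<psi> \<theta> / flag_pairing \<phi> \<theta>) / (flag_det \<phi> \<psi> \<omega> / flag_pairing \<phi> \<omega>)"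
    if "g \<in> carrier PGL" "\<phi> \<in> flags" "\<psi> \<in> flags" "\<theta> \<in> flags" "\<omega> \<in> flags" for g \<phi> \<psi> \<theta> \<omega>
    using edge_ratio_act[OF that(1,2,3,5,4)] unfolding edge_ratio_def by (simp add: mult.commute)
  have "(\<Prod>e\<in>?cls. case e of (\<mu>, k, l) \<Rightarrow> edge_coord (tet \<mu>) k l) =
    (\<Prod>e\<in>?cls. case e of (\<mu>, k, l) \<Rightarrow>
      (flag_det (tet \<mu> k) (tet \<mu> l) (tet \<mu> (fourth e)) / flag_pairing (tet \<mu> k) (tet \<mu> (fourth e)))
      / (flag_det (tet \<mu> k) (tet \<mu> l) (tet \<mu> (third e)) / flag_pairing (tet \<mu> k) (tet \<mu> (third e))))"
    by (rule prod.cong[OF refl]) (auto simp: coords(1))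
  also have "\<dots> = 1"
    by (rule edge_product[OF \<nu> ij, where w = "\<lambda>\<phi> \<psi> \<theta>. flag_det \<phi> \<psi> \<theta> / flag_pairing \<phi> \<theta>"]) (use nz inv in auto)
  finally show "(\<Prod>(\<mu>, k, l)\<in>?cls. edge_coord (tet \<mu>) k l) = 1" .
  have "(\<Prod>e\<in>?cls. case e of (\<mu>, k, l) \<Rightarrow> edge_coord (tet \<mu>) l k) =
    (\<Prod>e\<in>?cls. inverse (case e of (\<mu>, k, l) \<Rightarrow>
      (flag_det (tet \<mu> l) (tet \<mu> k) (tet \<mu> (fourth e)) / flag_pairing (tet \<mu> l) (tet \<mu> (fourth e)))
      / (flag_det (tet \<mu> l) (tet \<mu> k) (tet \<mu> (third e)) / flag_pairing (tet \<mu> l) (tet \<mu> (third e)))))"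
    by (rule prod.cong[OF refl]) (auto simp: coords(2))
  also have "\<dots> = inverse (\<Prod>e\<in>?cls. case e of (\<mu>, k, l) \<Rightarrow>
      (flag_det (tet \<mu> l) (tet \<mu> k) (tet \<mu> (fourth e)) / flag_pairing (tet \<mu> l) (tet \<mu> (fourth e)))
      / (flag_det (tet \<mu> l) (tet \<mu> k) (tet \<mu> (third e)) / flag_pairing (tet \<mu> l) (tet \<mu> (third e))))"
    by (rule prod_inversef[unfolded o_def])
  also have "\<dots> = inverse 1"
    by (rule arg_cong[where f = inverse], rule edge_product[OF \<nu> ij, where w = "\<lambda>\<phi> \<psi> \<theta>. flag_det \<psi> \<phi> \<theta> / flag_pairing \<psi> \<theta>"])
      (use nz inv in auto)
  finally show "(\<Prod>(\<mu>, k, l)\<in>?cls. edge_coord (tet \<mu>) l k) = 1" by simp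
qed

lemma parabolic: "parabolic_decoration K tet"
  unfolding parabolic_decoration_def using generic_tet face_equations edge_equations by blast

lemma holonomy:
  assumes "\<And>\<xi>. \<xi> \<in> lifted_cusps \<Gamma> \<Longrightarrow> D (Inr \<xi>) = F \<xi>"
  shows "has_holonomy \<Gamma> K tet \<rho> F"
  unfolding has_holonomy_def
proof (intro exI[of _ D] conjI ballI allI impI)
  fix g \<nu> assume "g \<in> \<Gamma>" "\<nu> < tet_count K"
  then show "\<exists>A\<in>carrier PGL. \<forall>i. D (ext_act g (lift \<nu> (vertex i))) = flag_act A (tet \<nu> i)"
    using D_translate rho_in by blast
qed (use assms equivariant in auto)

end

section \<open>Subdividing a triangulation\<close>

subsection \<open>Realizations as quotients\<close>

lemma Union_classes:
  assumes "equiv A r" "U \<subseteq> A // r" shows "\<Union>U = {x \<in> A. r `` {x} \<in> U}"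
proof (intro equalityI subsetI)
  fix x assume "x \<in> \<Union>U"
  then obtain c where c: "c \<in> U" "x \<in> c" by blast
  then obtain y where "c = r `` {y}" "y \<in> A" using assms(2) by (auto elim: quotientE)
  then have "r `` {x} = c" "x \<in> A"
    using c(2) equiv_class_eq[OF assms(1)] equiv_type[OF assms(1)] by auto
  then show "x \<in> {x \<in> A. r `` {x} \<in> U}" using c(1) by simp
next
  fix x assume "x \<in> {x \<in> A. r `` {x} \<in> U}"
  then show "x \<in> \<Union>U" using equiv_class_self[OF assms(1)] by blast
qed

lemma openin_quotient_topology:
  assumes "equiv (topspace X) r"
  shows "openin (quotient_topology X r) U \<longleftrightarrow> U \<subseteq> topspace X // r \<and> openin X (\<Union>U)"
proof -
  have "istopology (\<lambda>U. U \<subseteq> topspace X // r \<and> openin X (\<Union>U))"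
    unfolding istopology_def
  proof (intro conjI allI impI)
    fix U V assume U: "U \<subseteq> topspace X // r \<and> openin X (\<Union>U)" and V: "V \<subseteq> topspace X // r \<and> openin X (\<Union>V)"
    have "\<Union>(U \<inter> V) = \<Union>U \<inter> \<Union>V"
      using U V Union_classes[OF assms, of U] Union_classes[OF assms, of V] Union_classes[OF assms, of "U \<inter> V"] by blast
    then show "openin X (\<Union>(U \<inter> V))" using U V by (metis openin_Int)
  next
    fix \<U> assume "\<forall>U\<in>\<U>. U \<subseteq> topspace X // r \<and> openin X (\<Union>U)"
    moreover have "\<Union>(\<Union>\<U>) = \<Union>(Union ` \<U>)" by blast
    ultimately show "openin X (\<Union>(\<Union>\<U>))" by (metis (no_types, lifting) imageE openin_Union)
  qed blast+
  then show ?thesis unfolding quotient_topology_def by (simp add: topology_inverse')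
qed

lemma quotient_map_classes:
  assumes "equiv (topspace X) r"
  shows "quotient_map X (quotient_topology X r) (\<lambda>x. r `` {x})"
proof -
  let ?Q = "quotient_topology X r"
  have "\<Union>(topspace X // r) = topspace X" by (rule Union_quotient[OF assms])
  then have "openin ?Q (topspace X // r)" unfolding openin_quotient_topology[OF assms] by auto
  then have top: "topspace ?Q = topspace X // r"
    using openin_subset openin_quotient_topology[OF assms] by (metis openin_topspace subset_antisym)
  show ?thesis unfolding quotient_map_def top
  proof (intro conjI allI impI)
    show "(\<lambda>x. r `` {x}) ` topspace X = topspace X // r" by (auto simp: quotient_def)
    fix U assume "U \<subseteq> topspace X // r"
    then show "openin X {x \<in> topspace X. r `` {x} \<in> U} = openin ?Q U"
      using Union_classes[OF assms, of U] openin_quotient_topology[OF assms] by simp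
  qed
qed

abbreviation simplex_sum :: "triangulation \<Rightarrow> (nat \<times> (real^4)) topology" where
  "simplex_sum K \<equiv> sum_topology (\<lambda>_. top_of_set simplex3) {..<tet_count K}"

lemma topspace_simplex_sum: "topspace (simplex_sum K) = simplex_points K"
  by (simp add: simplex_points_def o_def Sigma_def) 

lemma quotient_map_realization:
  assumes "valid_pairing K"
  shows "quotient_map (simplex_sum K) (realization K) (\<lambda>x. gluing_rel K `` {x})"
  unfolding realization_def
  by (rule quotient_map_classes) (simp only: topspace_simplex_sum equiv_gluing_rel[OF assms])

text \<open>Both realizations are then quotients of the same space by the same relation.\<close>

lemma homeomorphic_realizations:
  assumes K: "valid_pairing K" and L: "valid_pairing L"
    and s: "quotient_map (simplex_sum L) (simplex_sum K) s"
    and rel: "\<And>x y. x \<in> simplex_points L \<Longrightarrow> y \<in> simplex_points L \<Longrightarrow>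
      (x, y) \<in> gluing_rel L \<longleftrightarrow> (s x, s y) \<in> gluing_rel K"
  obtains \<Psi> where "homeomorphic_map (realization L) (realization K) \<Psi>"
    "\<And>x. x \<in> simplex_points L \<Longrightarrow> \<Psi> (gluing_rel L `` {x}) = gluing_rel K `` {s x}"
proof -
  note qK = quotient_map_realization[OF K] and qL = quotient_map_realization[OF L]
  note eK = equiv_gluing_rel[OF K] and eL = equiv_gluing_rel[OF L]
  define \<Psi> where "\<Psi> c = gluing_rel K `` {s (SOME x. x \<in> c)}" for c
  have sK: "s x \<in> simplex_points K" if "x \<in> simplex_points L" for x
    using s that unfolding quotient_map_def topspace_simplex_sum by blast
  have \<Psi>: "\<Psi> (gluing_rel L `` {x}) = gluing_rel K `` {s x}" if x: "x \<in> simplex_points L" for x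
  proof -
    define y where "y = (SOME y. y \<in> gluing_rel L `` {x})"
    have "y \<in> gluing_rel L `` {x}" unfolding y_def
      by (rule someI[of _ x]) (rule equiv_class_self[OF eL x])
    then have "(x, y) \<in> gluing_rel L" "y \<in> simplex_points L" using equiv_type[OF eL] by auto
    then have "(s x, s y) \<in> gluing_rel K" using rel x by blast
    then show ?thesis unfolding \<Psi>_def y_def[symmetric] using equiv_class_eq[OF eK] by blast
  qed
  have comp: "quotient_map (simplex_sum L) (realization K) ((\<lambda>x. gluing_rel K `` {x}) \<circ> s)"
    by (rule quotient_map_compose[OF s qK])
  have q: "quotient_map (simplex_sum L) (realization K) (\<Psi> \<circ> (\<lambda>x. gluing_rel L `` {x}))"
    by (rule quotient_map_eq[OF comp]) (simp only: topspace_simplex_sum o_def \<Psi>)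
  have "continuous_map (realization L) (realization K) \<Psi>"
    by (rule continuous_compose_quotient_map[OF qL quotient_imp_continuous_map[OF q]])
  then have "quotient_map (realization L) (realization K) \<Psi>"
    using quotient_map_from_composition[OF quotient_imp_continuous_map[OF qL] _ q] by blast
  moreover have "inj_on \<Psi> (topspace (realization L))"
  proof (rule inj_onI)
    fix c d assume "c \<in> topspace (realization L)" "d \<in> topspace (realization L)" and eq: "\<Psi> c = \<Psi> d"
    then obtain x y where xy: "x \<in> simplex_points L" "y \<in> simplex_points L" "c = gluing_rel L `` {x}" "d = gluing_rel L `` {y}"
      using qL unfolding quotient_map_def topspace_simplex_sum by (metis (no_types, lifting) imageE)
    then have "gluing_rel K `` {s x} = gluing_rel K `` {s y}" using eq \<Psi> by simp
    then have "(s x, s y) \<in> gluing_rel K" using eq_equiv_class[OF _ eK] sK xy by blast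
    then have "(x, y) \<in> gluing_rel L" using rel xy by blast
    then show "c = d" using xy equiv_class_eq[OF eL] by blast
  qed
  ultimately have "homeomorphic_map (realization L) (realization K) \<Psi>" unfolding homeomorphic_map_def by blast
  then show ?thesis using that \<Psi> by blast
qed

subsection \<open>The subsimplices\<close>

text \<open>In the subsimplex \<open>(i, j)\<close> of a simplex the vertex \<open>i\<close> is replaced by the center of the simplex
  and the vertex \<open>j\<close> by the center of the face opposite to \<open>i\<close>. Keeping the labels of the other two vertices
  turns the gluings inside the old simplex into transpositions. The point \<open>p\<close> lies in it iff \<open>p\<^sub>i\<close> is the smallest and
  \<open>p\<^sub>j\<close> the second smallest coordinate of \<open>p\<close>.\<close>

definition sub_map :: "4 \<Rightarrow> 4 \<Rightarrow> real^4 \<Rightarrow> real^4" where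
  "sub_map i j p = (\<chi> k. p$i / 4 + (if k = i then 0 else p$j / 3 + (if k = j then 0 else p$k)))"

definition sub_coords :: "4 \<Rightarrow> 4 \<Rightarrow> real^4 \<Rightarrow> real^4" where
  "sub_coords i j p = (\<chi> k. if k = i then 4 * p$i else if k = j then 3 * (p$j - p$i) else p$k - p$j)"

lemma sub_coords_sub_map: "i \<noteq> j \<Longrightarrow> sub_coords i j (sub_map i j p) = p"
  by (simp add: vec_eq_iff sub_coords_def sub_map_def)

lemma sub_map_sub_coords: "i \<noteq> j \<Longrightarrow> sub_map i j (sub_coords i j p) = p"
  by (auto simp: vec_eq_iff sub_coords_def sub_map_def field_simps)

lemma sum_4_split:
  assumes "i \<noteq> j" obtains k l where "distinct [i,j,k,l]" "\<And>f :: 4 \<Rightarrow> real. sum f UNIV = f i + f j + f k + f l"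
proof -
  obtain \<sigma> where s: "even4 \<sigma>" "\<sigma> 1 = i" "\<sigma> 2 = j" using even4_exists[OF assms] by metis
  have "sum f UNIV = f i + f j + f (\<sigma> 3) + f (\<sigma> 4)" for f :: "4 \<Rightarrow> real"
    using sum.reindex_bij_betw[OF permutes_imp_bij, of \<sigma> UNIV f] s unfolding sum_4 by simp
  then show ?thesis using that[of "\<sigma> 3" "\<sigma> 4"] even4_distinct[of \<sigma>] s by auto
qed

lemma sub_map_sum: "i \<noteq> j \<Longrightarrow> (\<Sum>k\<in>UNIV. sub_map i j p $ k) = (\<Sum>k\<in>UNIV. p $ k)"
proof -
  assume "i \<noteq> j"
  then obtain k l where kl: "distinct [i,j,k,l]" "\<And>f :: 4 \<Rightarrow> real. sum f UNIV = f i + f j + f k + f l"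
    using sum_4_split by metis
  have n: "j \<noteq> i" "k \<noteq> i" "l \<noteq> i" "k \<noteq> j" "l \<noteq> j" "k \<noteq> l" using kl(1) by auto
  show ?thesis using n unfolding kl(2) by (simp add: sub_map_def)
qed

lemma sub_map_simplex:
  assumes "i \<noteq> j" "p \<in> simplex3" shows "sub_map i j p \<in> simplex3"
  using assms(2) sub_map_sum[OF assms(1), of p] by (simp add: simplex3_def) (simp add: sub_map_def)

lemma sub_coords_simplex:
  assumes "i \<noteq> j" "p \<in> simplex3" "p$i \<le> p$j" "\<And>k. k \<noteq> i \<Longrightarrow> p$j \<le> p$k"
  shows "sub_coords i j p \<in> simplex3"
proof -
  obtain k l where kl: "distinct [i,j,k,l]" "\<And>f :: 4 \<Rightarrow> real. sum f UNIV = f i + f j + f k + f l"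
    using sum_4_split[OF assms(1)] by metis
  have n: "j \<noteq> i" "k \<noteq> i" "l \<noteq> i" "k \<noteq> j" "l \<noteq> j" "k \<noteq> l" using kl(1) by auto
  have "(\<Sum>m\<in>UNIV. sub_coords i j p $ m) = (\<Sum>m\<in>UNIV. p $ m)"
    using n unfolding kl(2) by (simp add: sub_coords_def)
  then show ?thesis using assms by (simp add: simplex3_def) (simp add: sub_coords_def)
qed

lemma sub_map_order:
  assumes "i \<noteq> j" "p \<in> simplex3"
  shows "sub_map i j p $ i \<le> sub_map i j p $ j" "k \<noteq> i \<Longrightarrow> sub_map i j p $ j \<le> sub_map i j p $ k"
  using assms by (auto simp: sub_map_def simplex3_def)

lemma sub_region_exists:
  fixes p :: "real^4"
  assumes "\<And>k. p$i \<le> p$k"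
  obtains j where "i \<noteq> j" "p$i \<le> p$j" "\<And>k. k \<noteq> i \<Longrightarrow> p$j \<le> p$k"
proof -
  have "UNIV - {i} \<noteq> {}" using distinct_4(1) by (metis Diff_eq_empty_iff UNIV_I singletonD subset_iff)
  then obtain j where "j \<in> UNIV - {i}" "\<forall>k\<in>UNIV - {i}. p$j \<le> p$k"
    using ex_is_arg_min_if_finite[of "UNIV - {i}" "\<lambda>k. p$k"] by (auto simp: is_arg_min_linorder)
  then show ?thesis using that[of j] assms by blast
qed

lemma sub_region_exists':
  fixes p :: "real^4"
  obtains i j where "i \<noteq> j" "p$i \<le> p$j" "\<And>k. k \<noteq> i \<Longrightarrow> p$j \<le> p$k"
proof -
  obtain i where "\<forall>k. p$i \<le> p$k"
    using ex_is_arg_min_if_finite[of "UNIV :: 4 set" "\<lambda>k. p$k"] by (auto simp: is_arg_min_linorder)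
  then show ?thesis using sub_region_exists[of p i] that by metis
qed

lemma continuous_on_sub_map: "continuous_on X (sub_map i j)"
proof -
  have "continuous_on X (\<lambda>p. p$i / 4 + (if k = i then 0 else p$j / 3 + (if k = j then 0 else p$k)))" for k
    by (cases "k = i"; cases "k = j"; simp) (intro continuous_intros; simp)+
  then show ?thesis unfolding sub_map_def by (intro continuous_on_vec_lambda)
qed

lemma sub_map_permute:
  assumes "\<pi> permutes UNIV"
  shows "permute_point \<pi> (sub_map i j p) = sub_map (\<pi> i) (\<pi> j) (permute_point \<pi> p)"
  by (rule permute_point_eqI[OF assms, symmetric])
    (simp add: sub_map_def permute_point_nth[OF assms] permutes_4_distinct[OF assms])

lemma permute_transp_nth: "permute_point (transp a b) p $ k = p $ transp a b k"
  using permute_point_nth[OF permutes_swap_id[of a UNIV b], of p "transp a b k"] by simp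

lemma sub_map_inner_face:
  "i \<noteq> j \<Longrightarrow> p$j = 0 \<Longrightarrow> sub_map j i (permute_point (transp i j) p) = sub_map i j p"
  by (auto simp: vec_eq_iff sub_map_def permute_transp_nth Transposition.transpose_def)

lemma sub_map_cone_face:
  "distinct [i,j,m] \<Longrightarrow> p$m = 0 \<Longrightarrow> sub_map i m (permute_point (transp j m) p) = sub_map i j p"
  by (auto simp: vec_eq_iff sub_map_def permute_transp_nth Transposition.transpose_def)

subsection \<open>Orientations\<close>

text \<open>Precomposing with an affine map whose linear part has no eigenvalue in \<open>(-\<infinity>, 0]\<close> preserves
  local degree one: the segment from a small multiple of the identity to the linear part consists of
  invertible maps.\<close>

lemma orientation_preserving_affine:
  fixes h a L :: "complex \<times> real \<Rightarrow> complex \<times> real"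
  assumes U: "open U" "convex U" and h: "continuous_on U h" "inj_on h U" "orientation_preserving U h"
    and a: "\<And>x y. a (x + y) = a x + L y" "\<And>x. x \<in> U \<Longrightarrow> a x \<in> U" and L: "linear L"
    and eigen: "\<And>u r. 0 \<le> r \<Longrightarrow> L u = - (r *\<^sub>R u) \<Longrightarrow> u = 0"
  shows "orientation_preserving U (\<lambda>x. h (a x))"
  unfolding orientation_preserving_def
proof (intro ballI allI impI)
  fix p and e :: real assume p: "p \<in> U" and e: "e > 0" and pe: "cball p e \<subseteq> U"
  define P where "P = a p"
  have PU: "P \<in> U" using a(2)[OF p] by (simp add: P_def)
  then obtain \<epsilon> where \<epsilon>: "\<epsilon> > 0" "cball P \<epsilon> \<subseteq> U" using U(1) open_contains_cball by blast
  define k where "k x = sgn (h x - h P)" for x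
  have aL: "a (p + e *\<^sub>R u) = P + e *\<^sub>R L u" for u
    using a(1)[of p "e *\<^sub>R u"] linear_scale[OF L] by (simp add: P_def)
  have "homotopic_with_canon (\<lambda>_. True) (sphere 0 1) (U - {P}) (\<lambda>u. P + \<epsilon> *\<^sub>R u) (\<lambda>u. P + e *\<^sub>R L u)"
  proof (rule homotopic_with_linear)
    show "continuous_on (sphere 0 1) (\<lambda>u. P + \<epsilon> *\<^sub>R u)" "continuous_on (sphere 0 1) (\<lambda>u. P + e *\<^sub>R L u)"
      by (intro continuous_intros linear_continuous_on_compose[OF _ L])+
    fix u :: "complex \<times> real" assume u: "u \<in> sphere 0 1"
    then have "u \<noteq> 0" by auto
    show "closed_segment (P + \<epsilon> *\<^sub>R u) (P + e *\<^sub>R L u) \<subseteq> U - {P}"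
    proof
      fix x assume "x \<in> closed_segment (P + \<epsilon> *\<^sub>R u) (P + e *\<^sub>R L u)"
      then obtain t where t: "0 \<le> t" "t \<le> 1" and x: "x = (1 - t) *\<^sub>R (P + \<epsilon> *\<^sub>R u) + t *\<^sub>R (P + e *\<^sub>R L u)"
        unfolding closed_segment_def by blast
      have "P + \<epsilon> *\<^sub>R u \<in> cball P \<epsilon>" using \<epsilon>(1) u by (simp add: dist_norm)
      then have "P + \<epsilon> *\<^sub>R u \<in> U" using \<epsilon>(2) by blast
      moreover have "P + e *\<^sub>R L u \<in> U"
        unfolding aL[symmetric] using e u by (intro a(2) subsetD[OF pe]) (simp add: dist_norm)
      ultimately have "x \<in> U" unfolding x using convexD_alt[OF U(2)] t by auto
      moreover have "x \<noteq> P"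
      proof
        assume "x = P"
        then have z: "((1 - t) * \<epsilon>) *\<^sub>R u + (t * e) *\<^sub>R L u = 0" by (simp add: x algebra_simps)
        show False
        proof (cases "t = 0")
          case True then show False using z \<epsilon> \<open>u \<noteq> 0\<close> by simp
        next
          case False
          then have te: "t * e > 0" using t e by simp
          have "(t * e) *\<^sub>R L u = - (((1 - t) * \<epsilon>) *\<^sub>R u)" using z by (simp add: eq_neg_iff_add_eq_0 add.commute)
          then have "(1 / (t * e)) *\<^sub>R ((t * e) *\<^sub>R L u) = (1 / (t * e)) *\<^sub>R (- (((1 - t) * \<epsilon>) *\<^sub>R u))" by (rule arg_cong)
          then have "L u = - (((1 - t) * \<epsilon> / (t * e)) *\<^sub>R u)" using te by (auto split: if_splits)
          moreover have "(1 - t) * \<epsilon> / (t * e) \<ge> 0" using t te \<epsilon> by simp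
          ultimately show False using eigen \<open>u \<noteq> 0\<close> by blast
        qed
      qed
      ultimately show "x \<in> U - {P}" by blast
    qed
  qed
  moreover have ne: "h x - h P \<noteq> 0" if "x \<in> U - {P}" for x
    using that PU h(2) by (auto dest: inj_onD)
  then have "continuous_on (U - {P}) k" "k \<in> U - {P} \<rightarrow> sphere 0 1"
    unfolding k_def by (auto intro!: continuous_intros continuous_on_subset[OF h(1)] simp: norm_sgn)
  ultimately have "homotopic_with_canon (\<lambda>_. True) (sphere 0 1) (sphere 0 1) (k \<circ> (\<lambda>u. P + \<epsilon> *\<^sub>R u)) (k \<circ> (\<lambda>u. P + e *\<^sub>R L u))"
    by (rule homotopic_with_compose_continuous_left)
  then have "homotopic_with_canon (\<lambda>_. True) (sphere 0 1) (sphere 0 1)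
    (\<lambda>u. sgn (h (P + \<epsilon> *\<^sub>R u) - h P)) (\<lambda>u. sgn (h (a (p + e *\<^sub>R u)) - h (a p)))"
    by (simp add: o_def k_def aL P_def[symmetric])
  moreover have "homotopic_with_canon (\<lambda>_. True) (sphere 0 1) (sphere 0 1) (\<lambda>u. sgn (h (P + \<epsilon> *\<^sub>R u) - h P)) id"
    using h(3) PU \<epsilon> unfolding orientation_preserving_def by blast
  ultimately show "homotopic_with_canon (\<lambda>_. True) (sphere 0 1) (sphere 0 1) (\<lambda>u. sgn (h (a (p + e *\<^sub>R u)) - h (a p))) id"
    using homotopic_with_symD homotopic_with_trans by blast
qed

definition simplex_to_chart :: "real^4 \<Rightarrow> complex \<times> real" where
  "simplex_to_chart p = (Complex (p$2) (p$3), p$4)"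

lemma chart_to_simplex_nth:
  "chart_to_simplex q $ 1 = 1 - Re (fst q) - Im (fst q) - snd q"
  "chart_to_simplex q $ 2 = Re (fst q)" "chart_to_simplex q $ 3 = Im (fst q)" "chart_to_simplex q $ 4 = snd q"
  by (simp_all add: chart_to_simplex_def case_prod_unfold axis_def)

lemma simplex_to_chart_inverse: "simplex_to_chart (chart_to_simplex q) = q"
  by (cases q) (simp only: simplex_to_chart_def chart_to_simplex_nth fst_conv snd_conv complex_surj)

lemma chart_to_simplex_inverse:
  assumes "(\<Sum>i\<in>UNIV. p$i) = 1" shows "chart_to_simplex (simplex_to_chart p) = p"
proof -
  have "\<forall>i. chart_to_simplex (simplex_to_chart p) $ i = p $ i"
    using assms unfolding forall_4 sum_4 chart_to_simplex_nth simplex_to_chart_def fst_conv snd_conv complex.sel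
    by simp
  then show ?thesis by (simp add: vec_eq_iff)
qed

lemma chart_sum: "(\<Sum>i\<in>UNIV. chart_to_simplex q $ i) = 1"
  unfolding sum_4 chart_to_simplex_nth by simp

lemma open_chart_iff: "q \<in> open_chart_simplex \<longleftrightarrow> (\<forall>i. chart_to_simplex q $ i > 0)"
  unfolding forall_4 chart_to_simplex_nth open_chart_simplex_def by auto

lemma chart_in_simplex: "q \<in> open_chart_simplex \<Longrightarrow> chart_to_simplex q \<in> simplex3"
  using chart_sum unfolding open_chart_iff simplex3_def by (auto simp: less_imp_le)

lemma open_open_chart: "open open_chart_simplex"
proof -
  have eq: "open_chart_simplex = {q. 0 < Re (fst q)} \<inter> {q. 0 < Im (fst q)} \<inter> {q. 0 < snd q} \<inter> {q. Re (fst q) + Im (fst q) + snd q < 1}"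
    unfolding open_chart_simplex_def by auto
  show ?thesis unfolding eq by (intro open_Int open_Collect_less continuous_intros)
qed

lemma convex_open_chart: "convex open_chart_simplex"
proof (rule convexI)
  fix x y :: "complex \<times> real" and u v :: real
  assume x: "x \<in> open_chart_simplex" and y: "y \<in> open_chart_simplex" and uv: "0 \<le> u" "0 \<le> v" "u + v = 1"
  have u: "u = 1 - v" using uv(3) by simp
  have "\<forall>i. chart_to_simplex (u *\<^sub>R x + v *\<^sub>R y) $ i = u * chart_to_simplex x $ i + v * chart_to_simplex y $ i"
    unfolding forall_4 chart_to_simplex_nth u by (simp add: algebra_simps)
  moreover have "u * a + v * b > 0" if "a > 0" "b > 0" for a b :: real
  proof (cases "v = 0")
    case True then show ?thesis using that u by simp
  next
    case False
    then have "v * b > 0" "u * a \<ge> 0" using that uv by auto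
    then show ?thesis by linarith
  qed
  ultimately show "u *\<^sub>R x + v *\<^sub>R y \<in> open_chart_simplex"
    using x y unfolding open_chart_iff by simp
qed

lemma continuous_on_chart: "continuous_on X chart_to_simplex"
  unfolding chart_to_simplex_def case_prod_unfold by (intro continuous_intros)

lemma sub_map_add: "sub_map i j (p + q) = sub_map i j p + sub_map i j q"
  by (simp add: vec_eq_iff sub_map_def add_divide_distrib)

lemma sub_map_scale: "sub_map i j (r *\<^sub>R p) = r *\<^sub>R sub_map i j p"
  by (simp add: vec_eq_iff sub_map_def algebra_simps)

text \<open>In barycentric coordinates the inclusion of a subsimplex is triangular with eigenvalues
  \<open>1/4\<close>, \<open>1/3\<close>, \<open>1\<close>, \<open>1\<close>.\<close>

lemma orientation_preserving_sub_map:
  assumes ij: "i \<noteq> j" and h: "continuous_on open_chart_simplex (\<lambda>q. f (chart_to_simplex q))"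
      "inj_on (\<lambda>q. f (chart_to_simplex q)) open_chart_simplex"
      "orientation_preserving open_chart_simplex (\<lambda>q. f (chart_to_simplex q))"
  shows "orientation_preserving open_chart_simplex (\<lambda>q. f (sub_map i j (chart_to_simplex q)))"
proof -
  define a where "a q = simplex_to_chart (sub_map i j (chart_to_simplex q))" for q
  define v where "v q = chart_to_simplex q - chart_to_simplex 0" for q
  define L where "L q = simplex_to_chart (sub_map i j (v q))" for q
  have ca: "chart_to_simplex (a q) = sub_map i j (chart_to_simplex q)" for q
    unfolding a_def by (rule chart_to_simplex_inverse) (simp add: sub_map_sum[OF ij] chart_sum)
  have v_nth: "v q $ 1 = - Re (fst q) - Im (fst q) - snd q" "v q $ 2 = Re (fst q)" "v q $ 3 = Im (fst q)" "v q $ 4 = snd q" for q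
    unfolding v_def vector_minus_component chart_to_simplex_nth by simp_all
  have v_add: "v (x + y) = v x + v y" and v_scale: "v (r *\<^sub>R x) = r *\<^sub>R v x" for x y r
    by (simp_all only: vec_eq_iff forall_4 vector_add_component vector_scaleR_component v_nth) (simp_all add: algebra_simps)
  have chart_add: "chart_to_simplex (x + y) = chart_to_simplex x + v y" for x y
    by (simp only: vec_eq_iff forall_4 vector_add_component v_nth chart_to_simplex_nth) simp
  have stc_add: "simplex_to_chart (p + q) = simplex_to_chart p + simplex_to_chart q"
    and stc_scale: "simplex_to_chart (r *\<^sub>R p) = r *\<^sub>R simplex_to_chart p" for p q r
    by (simp_all add: simplex_to_chart_def complex_eq_iff)
  have v_sum: "(\<Sum>k\<in>UNIV. v q $ k) = 0" for q unfolding sum_4 v_nth by simp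
  have v_stc: "v (simplex_to_chart p) = p" if "(\<Sum>k\<in>UNIV. p $ k) = 0" for p
  proof -
    have "\<forall>k. v (simplex_to_chart p) $ k = p $ k"
      using that unfolding forall_4 sum_4 v_nth simplex_to_chart_def fst_conv snd_conv complex.sel by simp
    then show ?thesis by (simp add: vec_eq_iff)
  qed
  have "orientation_preserving open_chart_simplex (\<lambda>q. f (chart_to_simplex (a q)))"
  proof (rule orientation_preserving_affine[OF open_open_chart convex_open_chart h])
    show "a (x + y) = a x + L y" for x y
      unfolding a_def L_def by (simp add: chart_add sub_map_add stc_add)
    show "a x \<in> open_chart_simplex" if "x \<in> open_chart_simplex" for x
      using that unfolding open_chart_iff ca by (auto simp: sub_map_def add_pos_pos)
    show "linear L"
      by (rule linearI) (simp_all add: L_def v_add v_scale sub_map_add sub_map_scale stc_add stc_scale)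
    fix u r assume r: "0 \<le> r" and u: "L u = - (r *\<^sub>R u)"
    have "sub_map i j (v u) = v (L u)"
      unfolding L_def by (rule v_stc[symmetric]) (simp add: sub_map_sum[OF ij] v_sum)
    also have "\<dots> = - r *\<^sub>R v u" unfolding u using v_scale[of "- r" u] by simp
    finally have s: "sub_map i j (v u) $ k = - r * v u $ k" for k by simp
    have "v u $ i / 4 = - r * v u $ i" using s[of i] by (simp add: sub_map_def)
    then have "(1 / 4 + r) * v u $ i = 0" by (simp add: algebra_simps)
    then have i: "v u $ i = 0" using r by simp
    have "v u $ j / 3 = - r * v u $ j" using s[of j] ij i by (simp add: sub_map_def)
    then have "(1 / 3 + r) * v u $ j = 0" by (simp add: algebra_simps)
    then have j: "v u $ j = 0" using r by simp
    have "v u $ k = 0" if "k \<noteq> i" "k \<noteq> j" for k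
    proof -
      have "v u $ k = - r * v u $ k" using s[of k] that i j by (simp add: sub_map_def)
      then have "(1 + r) * v u $ k = 0" by (simp add: algebra_simps)
      then show ?thesis using r by simp
    qed
    then have "v u = 0" using i j by (metis vec_eq_iff zero_index)
    then have "Re (fst u) = 0" "Im (fst u) = 0" "snd u = 0" using v_nth(2-4)[of u] by simp_all
    then show "u = 0" by (simp add: prod_eq_iff complex_eq_iff)
  qed
  then show ?thesis unfolding ca .
qed

subsection \<open>The subdivided triangulation\<close>

definition sub_index :: "triangulation \<Rightarrow> (nat \<times> 4 \<times> 4) set" where
  "sub_index K = {..<tet_count K} \<times> {(i, j). i \<noteq> j}"

text \<open>An arbitrary enumeration: the simplices of a triangulation have to be numbered.\<close>

definition sub_code :: "triangulation \<Rightarrow> nat \<Rightarrow> nat \<times> 4 \<times> 4" where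
  "sub_code K = (SOME h. bij_betw h {0..<card (sub_index K)} (sub_index K))"

definition sub_number :: "triangulation \<Rightarrow> nat \<times> 4 \<times> 4 \<Rightarrow> nat" where
  "sub_number K = inv_into {0..<card (sub_index K)} (sub_code K)"

text \<open>Face \<open>i\<close> of the subsimplex \<open>(i, j)\<close> lies in face \<open>i\<close> of the old simplex and inherits its gluing. Face \<open>j\<close>,
  opposite to the face center, is shared with \<open>(j, i)\<close>, and every other face \<open>m\<close> with \<open>(i, m)\<close>.\<close>

definition subdivision :: "triangulation \<Rightarrow> triangulation" where
  "subdivision K = \<lparr>tet_count = card (sub_index K),
     pairing = (\<lambda>e m. case sub_code K e of (\<nu>, i, j) \<Rightarrow>
       if m = i then (case pairing K \<nu> i of (\<mu>, \<pi>) \<Rightarrow> (sub_number K (\<mu>, \<pi> i, \<pi> j), \<pi>))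
       else if m = j then (sub_number K (\<nu>, j, i), transp i j)
       else (sub_number K (\<nu>, i, m), transp j m)),
     lifted_simplex = (\<lambda>e p. case sub_code K e of (\<nu>, i, j) \<Rightarrow> lifted_simplex K \<nu> (sub_map i j p))\<rparr>"

lemma sub_index_iff: "(\<nu>, i, j) \<in> sub_index K \<longleftrightarrow> \<nu> < tet_count K \<and> i \<noteq> j"
  by (auto simp: sub_index_def)

lemma finite_sub_index: "finite (sub_index K)"
  unfolding sub_index_def by simp

lemma bij_sub_code: "bij_betw (sub_code K) {0..<card (sub_index K)} (sub_index K)"
  unfolding sub_code_def
  by (rule someI_ex[of "\<lambda>h. bij_betw h {0..<card (sub_index K)} (sub_index K)"])
    (rule ex_bij_betw_nat_finite[OF finite_sub_index])

lemma sub_code_number: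
  assumes "x \<in> sub_index K"
  shows "sub_number K x < tet_count (subdivision K)" "sub_code K (sub_number K x) = x"
  using bij_betw_inv_into_right[OF bij_sub_code assms] bij_betwE[OF bij_betw_inv_into[OF bij_sub_code, of K]] assms
  by (auto simp: sub_number_def subdivision_def)

lemma sub_number_code:
  "e < tet_count (subdivision K) \<Longrightarrow> sub_number K (sub_code K e) = e"
  using bij_betw_inv_into_left[OF bij_sub_code, of e K] by (simp add: sub_number_def subdivision_def)

lemma sub_code_cases:
  assumes "e < tet_count (subdivision K)"
  obtains \<nu> i j where "sub_code K e = (\<nu>, i, j)" "\<nu> < tet_count K" "i \<noteq> j" "e = sub_number K (\<nu>, i, j)"
proof -
  have "sub_code K e \<in> sub_index K"
    using bij_betwE[OF bij_sub_code, of K] assms by (auto simp: subdivision_def)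
  moreover obtain \<nu> i j where "sub_code K e = (\<nu>, i, j)" by (cases "sub_code K e")
  ultimately show ?thesis using that sub_number_code[OF assms] sub_index_iff by metis
qed

lemma subdivision_pairing:
  assumes "\<nu> < tet_count K" "i \<noteq> j"
  shows "pairing K \<nu> i = (\<mu>, \<pi>) \<Longrightarrow> pairing (subdivision K) (sub_number K (\<nu>, i, j)) i = (sub_number K (\<mu>, \<pi> i, \<pi> j), \<pi>)"
    "pairing (subdivision K) (sub_number K (\<nu>, i, j)) j = (sub_number K (\<nu>, j, i), transp i j)"
    "m \<noteq> i \<Longrightarrow> m \<noteq> j \<Longrightarrow> pairing (subdivision K) (sub_number K (\<nu>, i, j)) m = (sub_number K (\<nu>, i, m), transp j m)"
  using assms sub_code_number(2)[of "(\<nu>, i, j)" K] by (auto simp: subdivision_def sub_index_iff)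

lemma subdivision_lift:
  assumes "\<nu> < tet_count K" "i \<noteq> j"
  shows "lifted_simplex (subdivision K) (sub_number K (\<nu>, i, j)) p = lifted_simplex K \<nu> (sub_map i j p)"
  using assms sub_code_number(2)[of "(\<nu>, i, j)" K] by (simp add: subdivision_def sub_index_iff)

lemma sub_number_less:
  "\<nu> < tet_count K \<Longrightarrow> i \<noteq> j \<Longrightarrow> sub_number K (\<nu>, i, j) < tet_count (subdivision K)"
  using sub_code_number(1) sub_index_iff by blast

lemma sub_number_eq:
  assumes "\<nu> < tet_count K" "i \<noteq> j" "\<mu> < tet_count K" "k \<noteq> l" "sub_number K (\<nu>, i, j) = sub_number K (\<mu>, k, l)"
  shows "(\<nu>, i, j) = (\<mu>, k, l)"
  using assms sub_code_number(2) sub_index_iff by metis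

lemma odd_transp: "a \<noteq> b \<Longrightarrow> \<not> evenperm (transp a b)"
  by (simp add: evenperm_swap)

lemma transp_permutes: "transp a b permutes UNIV"
  by (rule permutes_swap_id) auto

lemma valid_subdivision:
  assumes K: "valid_pairing K" shows "valid_pairing (subdivision K)"
  unfolding valid_pairing_def
proof (intro allI impI)
  fix e m e' \<tau>
  assume e: "e < tet_count (subdivision K)" and pr: "pairing (subdivision K) e m = (e', \<tau>)"
  obtain \<nu> i j where c: "\<nu> < tet_count K" "i \<noteq> j" "e = sub_number K (\<nu>, i, j)"
    using sub_code_cases[OF e] by metis
  let ?goal = "e' < tet_count (subdivision K) \<and> \<tau> permutes UNIV \<and> \<not> evenperm \<tau> \<and> (e', \<tau> m) \<noteq> (e, m) \<and>
      pairing (subdivision K) e' (\<tau> m) = (e, inv_into UNIV \<tau>)"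
  consider "m = i" | "m = j" | "m \<noteq> i" "m \<noteq> j" by blast
  then show ?goal
  proof cases
    case 1
    obtain \<mu> \<pi> where p: "pairing K \<nu> i = (\<mu>, \<pi>)" by fastforce
    note v = valid_pairingD[OF K c(1) p]
    have e': "e' = sub_number K (\<mu>, \<pi> i, \<pi> j)" "\<tau> = \<pi>"
      using pr subdivision_pairing(1)[OF c(1,2) p] unfolding 1 c(3) by auto
    have ij: "\<pi> i \<noteq> \<pi> j" using permutes_4_distinct[OF v(2)] c(2) by simp
    have "pairing (subdivision K) e' (\<pi> i) = (e, inv_into UNIV \<pi>)"
      using subdivision_pairing(1)[OF v(1) ij v(5)] permutes_inverses(2)[OF v(2)] by (simp add: e' c(3))
    moreover have "(e', \<pi> i) \<noteq> (e, i)"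
      using sub_number_eq[OF v(1) ij c(1,2)] v(4) by (auto simp: e' c(3))
    ultimately show ?thesis using v e' sub_number_less[OF v(1) ij] 1 by simp
  next
    case 2
    have e': "e' = sub_number K (\<nu>, j, i)" "\<tau> = transp i j"
      using pr subdivision_pairing(2)[OF c(1,2)] unfolding 2 c(3) by auto
    have "pairing (subdivision K) e' i = (e, transp j i)"
      using subdivision_pairing(2)[OF c(1), of j i] c by (simp add: e')
    then show ?thesis using 2 c e' sub_number_less[OF c(1), of j i] odd_transp[OF c(2)]
      by (simp add: transp_permutes transpose_commute)
  next
    case 3
    have e': "e' = sub_number K (\<nu>, i, m)" "\<tau> = transp j m"
      using pr subdivision_pairing(3)[OF c(1,2) 3] unfolding c(3) by auto
    have "pairing (subdivision K) e' j = (e, transp m j)"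
      using subdivision_pairing(3)[OF c(1), of i m j] c 3 by (simp add: e')
    then show ?thesis using 3 c e' sub_number_less[OF c(1), of i m] odd_transp[of j m]
      by (simp add: transp_permutes transpose_commute)
  qed
qed

definition sub_point :: "triangulation \<Rightarrow> nat \<times> (real^4) \<Rightarrow> nat \<times> (real^4)" where
  "sub_point K = (\<lambda>(e, p). case sub_code K e of (\<nu>, i, j) \<Rightarrow> (\<nu>, sub_map i j p))"

lemma sub_point_number:
  "\<nu> < tet_count K \<Longrightarrow> i \<noteq> j \<Longrightarrow> sub_point K (sub_number K (\<nu>, i, j), p) = (\<nu>, sub_map i j p)"
  using sub_code_number(2)[of "(\<nu>, i, j)" K] by (simp add: sub_point_def sub_index_iff)

lemma sub_point_cases:
  assumes "x \<in> simplex_points (subdivision K)"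
  obtains \<nu> i j p where "x = (sub_number K (\<nu>, i, j), p)" "\<nu> < tet_count K" "i \<noteq> j" "p \<in> simplex3"
    "sub_point K x = (\<nu>, sub_map i j p)"
proof -
  obtain e p where e: "x = (e, p)" "e < tet_count (subdivision K)" "p \<in> simplex3"
    using assms unfolding simplex_points_def by auto
  obtain \<nu> i j where c: "\<nu> < tet_count K" "i \<noteq> j" "e = sub_number K (\<nu>, i, j)"
    using sub_code_cases[OF e(2)] by metis
  then show ?thesis using that e sub_point_number by metis
qed

lemma sub_point_in: "x \<in> simplex_points (subdivision K) \<Longrightarrow> sub_point K x \<in> simplex_points K"
  by (elim sub_point_cases) (simp add: simplex_points_def sub_map_simplex)

lemma gluing_refl: "valid_pairing K \<Longrightarrow> x \<in> simplex_points K \<Longrightarrow> (x, x) \<in> gluing_rel K"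
  unfolding gluing_rel_def by auto

lemma gluing_trans: "(x, y) \<in> gluing_rel K \<Longrightarrow> (y, z) \<in> gluing_rel K \<Longrightarrow> (x, z) \<in> gluing_rel K"
  unfolding gluing_rel_def by auto

text \<open>Inner gluings do not move the image point, outer ones are gluings of the old simplices.\<close>

lemma sub_point_gluing_step:
  assumes K: "valid_pairing K" and "(x, y) \<in> gluing_step (subdivision K)"
  shows "(sub_point K x, sub_point K y) \<in> gluing_rel K"
proof -
  note K' = valid_subdivision[OF K]
  have x: "x \<in> simplex_points (subdivision K)" and y: "y \<in> simplex_points (subdivision K)"
    using gluing_step_points[OF K' assms(2)] by auto
  obtain \<nu> i j p where c: "x = (sub_number K (\<nu>, i, j), p)" "\<nu> < tet_count K" "i \<noteq> j" "p \<in> simplex3"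
    "sub_point K x = (\<nu>, sub_map i j p)" using sub_point_cases[OF x] by metis
  obtain e' q where yq: "y = (e', q)" by fastforce
  obtain m \<tau> where m: "p $ m = 0" "pairing (subdivision K) (sub_number K (\<nu>, i, j)) m = (e', \<tau>)" "q = permute_point \<tau> p"
    using assms(2) gluing_step_iff[OF K'] unfolding c(1) yq by blast
  have same: ?thesis if "sub_point K y = sub_point K x"
    using that gluing_refl[OF K sub_point_in[OF x]] by simp
  consider "m = i" | "m = j" | "m \<noteq> i" "m \<noteq> j" by blast
  then show ?thesis
  proof cases
    case 1
    obtain \<mu> \<pi> where p: "pairing K \<nu> i = (\<mu>, \<pi>)" by fastforce
    note v = valid_pairingD[OF K c(2) p]
    have e': "e' = sub_number K (\<mu>, \<pi> i, \<pi> j)" "\<tau> = \<pi>"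
      using m(2) subdivision_pairing(1)[OF c(2,3) p] unfolding 1 by auto
    have ij: "\<pi> i \<noteq> \<pi> j" using permutes_4_distinct[OF v(2)] c(3) by simp
    have "sub_point K y = (\<mu>, permute_point \<pi> (sub_map i j p))"
      unfolding yq m(3) e' sub_point_number[OF v(1) ij] sub_map_permute[OF v(2)] ..
    moreover have "sub_map i j p $ i = 0" using m(1) 1 by (simp add: sub_map_def)
    ultimately have "(sub_point K x, sub_point K y) \<in> gluing_step K"
      unfolding c(5) using gluing_step_iff[OF K] c(2) sub_map_simplex[OF c(3,4)] p by auto
    then show ?thesis by (rule gluing_step_rel[OF K])
  next
    case 2
    have e': "e' = sub_number K (\<nu>, j, i)" "\<tau> = transp i j"
      using m(2) subdivision_pairing(2)[OF c(2,3)] unfolding 2 by auto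
    have "sub_point K y = sub_point K x"
      unfolding c(5) yq m(3) e' using sub_point_number[OF c(2), of j i] sub_map_inner_face[OF c(3), of p] c(3) m(1) 2 by simp
    then show ?thesis by (rule same)
  next
    case 3
    have e': "e' = sub_number K (\<nu>, i, m)" "\<tau> = transp j m"
      using m(2) subdivision_pairing(3)[OF c(2,3) 3] by auto
    have "sub_point K y = sub_point K x"
      unfolding c(5) yq m(3) e' using sub_point_number[OF c(2), of i m] sub_map_cone_face[of i j m p] c(3) m(1) 3 by simp
    then show ?thesis by (rule same)
  qed
qed

lemma sub_point_gluing:
  assumes K: "valid_pairing K" and "(x, y) \<in> gluing_rel (subdivision K)"
  shows "(sub_point K x, sub_point K y) \<in> gluing_rel K"
proof -
  have "x \<in> simplex_points (subdivision K)" "(x, y) \<in> (gluing_step (subdivision K))\<^sup>*"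
    using assms(2) unfolding gluing_rel_def by auto
  from this(2) show ?thesis
  proof (induction rule: rtrancl_induct)
    case base
    show ?case using gluing_refl[OF K] sub_point_in \<open>x \<in> _\<close> by blast
  next
    case (step y z)
    then show ?case using gluing_trans sub_point_gluing_step[OF K] by blast
  qed
qed

lemma cone_gluing:
  assumes K: "valid_pairing K" and \<nu>: "\<nu> < tet_count K" and d: "i \<noteq> j" "i \<noteq> k"
    and p: "p \<in> simplex3" and q: "q \<in> simplex3" and eq: "sub_map i j p = sub_map i k q"
  shows "((sub_number K (\<nu>, i, j), p), (sub_number K (\<nu>, i, k), q)) \<in> gluing_rel (subdivision K)"
proof (cases "j = k")
  case True
  then have "p = q" using eq d sub_coords_sub_map by metis
  then show ?thesis using True gluing_refl[OF valid_subdivision[OF K]] p sub_number_less[OF \<nu> d(1)]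
    by (simp add: simplex_points_def)
next
  case False
  have "sub_map i j p $ k = sub_map i j p $ j"
    using sub_map_order(2)[OF d(1) p, of k] sub_map_order(2)[OF d(2) q, of j] d by (simp add: eq)
  then have pk: "p $ k = 0" using d False by (simp add: sub_map_def)
  then have "sub_map i k (permute_point (transp j k) p) = sub_map i k q"
    using sub_map_cone_face[of i j k p] d False eq by simp
  then have "q = permute_point (transp j k) p" using d(2) sub_coords_sub_map by metis
  then show ?thesis
    using subdivision_pairing(3)[OF \<nu> d(1), of k] d False pk p sub_number_less[OF \<nu> d(1)]
    by (intro gluing_step_rel[OF valid_subdivision[OF K]])
      (auto simp: gluing_step_iff[OF valid_subdivision[OF K]])
qed

text \<open>Points of different subsimplices with the same image are identified by the new gluings:
  ties for the second smallest coordinate are resolved by the faces opposite to kept vertices, a tie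
  for the smallest one by the face opposite to the face center.\<close>

lemma sub_point_same:
  assumes K: "valid_pairing K" and x: "x \<in> simplex_points (subdivision K)" and y: "y \<in> simplex_points (subdivision K)"
    and eq: "sub_point K x = sub_point K y"
  shows "(x, y) \<in> gluing_rel (subdivision K)"
proof -
  note K' = valid_subdivision[OF K]
  obtain \<nu> i j p where c: "x = (sub_number K (\<nu>, i, j), p)" "\<nu> < tet_count K" "i \<noteq> j" "p \<in> simplex3"
    "sub_point K x = (\<nu>, sub_map i j p)" using sub_point_cases[OF x] by metis
  obtain \<nu>' k l q where c': "y = (sub_number K (\<nu>', k, l), q)" "\<nu>' < tet_count K" "k \<noteq> l" "q \<in> simplex3"
    "sub_point K y = (\<nu>', sub_map k l q)" using sub_point_cases[OF y] by metis
  have \<nu>: "\<nu>' = \<nu>" and pq: "sub_map i j p = sub_map k l q" using eq c(5) c'(5) by auto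
  define P where "P = sub_map i j p"
  have P: "P \<in> simplex3" using sub_map_simplex c P_def by simp
  have o1: "P$i \<le> P$j" "\<And>m. m \<noteq> i \<Longrightarrow> P$j \<le> P$m" unfolding P_def using sub_map_order[OF c(3,4)] by auto
  have o2: "P$k \<le> P$l" "\<And>m. m \<noteq> k \<Longrightarrow> P$l \<le> P$m" unfolding P_def pq using sub_map_order[OF c'(3,4)] by auto
  show ?thesis
  proof (cases "i = k")
    case True
    then show ?thesis using cone_gluing[OF K c(2,3) _ c(4) c'(4), of l] c'(3) pq unfolding c(1) c'(1) \<nu> by simp
  next
    case False
    have ik: "P $ i \<le> P $ m" for m using o1 by (cases "m = i") (auto intro: order_trans)
    have ki: "P $ k \<le> P $ m" for m using o2 by (cases "m = k") (auto intro: order_trans)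
    have e: "P $ i = P $ k" using ik[of k] ki[of i] by simp
    define r where "r = sub_coords i k P"
    have r: "r \<in> simplex3" unfolding r_def
      using False P ik e by (intro sub_coords_simplex) auto
    have rP: "sub_map i k r = P" unfolding r_def by (rule sub_map_sub_coords[OF False])
    define r' where "r' = permute_point (transp i k) r"
    have rk: "r $ k = 0" using False e by (simp add: r_def sub_coords_def)
    have r': "r' \<in> simplex3" unfolding r'_def by (rule permute_point_simplex[OF transp_permutes r])
    have r'P: "sub_map k i r' = P" unfolding r'_def using sub_map_inner_face[OF False rk] rP by simp
    have 1: "(x, (sub_number K (\<nu>, i, k), r)) \<in> gluing_rel (subdivision K)"
      unfolding c(1) by (rule cone_gluing[OF K c(2,3) False c(4) r]) (simp add: rP P_def)
    have 2: "((sub_number K (\<nu>, i, k), r), (sub_number K (\<nu>, k, i), r')) \<in> gluing_rel (subdivision K)"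
      using subdivision_pairing(2)[OF c(2) False] sub_number_less[OF c(2) False] r rk r'_def
      by (intro gluing_step_rel[OF K']) (auto simp: gluing_step_iff[OF K'])
    have 3: "((sub_number K (\<nu>, k, i), r'), y) \<in> gluing_rel (subdivision K)"
      unfolding c'(1) \<nu> using False by (intro cone_gluing[OF K c(2) _ c'(3) r' c'(4)]) (auto simp: r'P P_def pq)
    show ?thesis by (rule gluing_trans[OF gluing_trans[OF 1 2] 3])
  qed
qed

text \<open>A gluing of old simplices at a point of face \<open>i\<close> is induced by one of a subsimplex \<open>(i, j)\<close> containing
  that point; the choice of the subsimplex does not matter by \<open>sub_point_same\<close>.\<close>

lemma gluing_sub_point:
  assumes K: "valid_pairing K" and x: "x \<in> simplex_points (subdivision K)" and y: "y \<in> simplex_points (subdivision K)"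
    and xy: "(sub_point K x, sub_point K y) \<in> gluing_rel K"
  shows "(x, y) \<in> gluing_rel (subdivision K)"
proof -
  note K' = valid_subdivision[OF K]
  have "(sub_point K x, sub_point K y) \<in> (gluing_step K)\<^sup>*" using xy unfolding gluing_rel_def by blast
  then have "\<exists>z. sub_point K z = sub_point K y \<and> z \<in> simplex_points (subdivision K) \<and> (x, z) \<in> gluing_rel (subdivision K)"
  proof (induction rule: rtrancl_induct)
    case base
    then show ?case using x gluing_refl[OF K' x] by blast
  next
    case (step u w)
    then obtain z where z: "sub_point K z = u" "z \<in> simplex_points (subdivision K)" "(x, z) \<in> gluing_rel (subdivision K)" by blast
    obtain \<nu> P \<mu> Q where uw: "u = (\<nu>, P)" "w = (\<mu>, Q)" by fastforce
    obtain i \<pi> where s: "\<nu> < tet_count K" "P \<in> simplex3" "P $ i = 0" "pairing K \<nu> i = (\<mu>, \<pi>)" "Q = permute_point \<pi> P"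
      using step(2) unfolding uw gluing_step_iff[OF K] by blast
    note v = valid_pairingD[OF K s(1,4)]
    have "P $ i \<le> P $ k" for k using s(2,3) by (simp add: simplex3_def)
    then obtain j where j: "i \<noteq> j" "P$i \<le> P$j" "\<And>k. k \<noteq> i \<Longrightarrow> P$j \<le> P$k"
      using sub_region_exists[of P i] by metis
    define p where "p = sub_coords i j P"
    have p: "p \<in> simplex3" unfolding p_def by (rule sub_coords_simplex[OF j(1) s(2) j(2,3)])
    have pP: "sub_map i j p = P" unfolding p_def by (rule sub_map_sub_coords[OF j(1)])
    have pi: "p $ i = 0" using s(3) by (simp add: p_def sub_coords_def)
    have ij: "\<pi> i \<noteq> \<pi> j" using permutes_4_distinct[OF v(2)] j(1) by simp
    let ?a = "(sub_number K (\<nu>, i, j), p)" and ?b = "(sub_number K (\<mu>, \<pi> i, \<pi> j), permute_point \<pi> p)"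
    have "(?a, ?b) \<in> gluing_step (subdivision K)"
      unfolding gluing_step_iff[OF K']
      using sub_number_less[OF s(1) j(1)] p pi subdivision_pairing(1)[OF s(1) j(1) s(4)] by blast
    then have ab: "(?a, ?b) \<in> gluing_rel (subdivision K)" by (rule gluing_step_rel[OF K'])
    then have in': "?a \<in> simplex_points (subdivision K)" "?b \<in> simplex_points (subdivision K)"
      unfolding gluing_rel_def by auto
    have a: "sub_point K ?a = u" using sub_point_number[OF s(1) j(1)] pP uw by simp
    have b: "sub_point K ?b = w"
      using sub_point_number[OF v(1) ij] sub_map_permute[OF v(2), of i j p] pP uw s(5) by simp
    have "(z, ?a) \<in> gluing_rel (subdivision K)" by (rule sub_point_same[OF K z(2) in'(1)]) (simp add: z a)
    then have "(x, ?b) \<in> gluing_rel (subdivision K)" using z(3) ab gluing_trans by blast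
    then show ?case using b in'(2) by blast
  qed
  then obtain z where z: "sub_point K z = sub_point K y" "z \<in> simplex_points (subdivision K)" "(x, z) \<in> gluing_rel (subdivision K)"
    by blast
  then show ?thesis using sub_point_same[OF K z(2) y z(1)] gluing_trans by blast
qed

lemma compact_simplex3: "compact simplex3"
proof -
  have eq: "simplex3 = (\<Inter>i. {p. 0 \<le> p$i}) \<inter> {p. (\<Sum>i\<in>UNIV. p$i) = 1}"
    unfolding simplex3_def by auto
  have "closed simplex3"
    unfolding eq by (intro closed_Int closed_INT ballI closed_Collect_le closed_Collect_eq continuous_intros)
  moreover have "bounded simplex3"
  proof (rule bounded_subset[OF bounded_cbox[of 0 "vec 1 :: real^4"]])
    show "simplex3 \<subseteq> cbox 0 (vec 1)"
    proof
      fix p assume p: "p \<in> simplex3"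
      have "p $ i \<le> 1" for i
        using member_le_sum[of i UNIV "\<lambda>i. p$i"] p unfolding simplex3_def by auto
      then show "p \<in> cbox 0 (vec 1)" using p by (simp add: mem_box_cart simplex3_def)
    qed
  qed
  ultimately show ?thesis by (simp add: compact_eq_bounded_closed)
qed

text \<open>The subsimplices are finitely many compact sets covering the old simplices.\<close>

lemma quotient_map_sub_point: "quotient_map (simplex_sum (subdivision K)) (simplex_sum K) (sub_point K)"
proof (rule continuous_closed_imp_quotient_map)
  have slice: "{p. (e, p) \<in> topspace (simplex_sum (subdivision K)) \<and> sub_point K (e, p) \<in> V} = simplex3 \<inter> sub_map i j -` {p. (\<nu>, p) \<in> V}"
    if "e < tet_count (subdivision K)" "sub_code K e = (\<nu>, i, j)" for e \<nu> i j V
    using that by (auto simp: sub_point_def)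
  show "continuous_map (simplex_sum (subdivision K)) (simplex_sum K) (sub_point K)"
    unfolding continuous_map_def
  proof (intro conjI allI impI)
    show "sub_point K \<in> topspace (simplex_sum (subdivision K)) \<rightarrow> topspace (simplex_sum K)"
      unfolding topspace_simplex_sum using sub_point_in by blast
    fix V assume V: "openin (simplex_sum K) V"
    show "openin (simplex_sum (subdivision K)) {x \<in> topspace (simplex_sum (subdivision K)). sub_point K x \<in> V}"
      unfolding openin_sum_topology[of _ _ "{x \<in> _. _ x}"]
    proof (intro conjI ballI)
      show "{x \<in> topspace (simplex_sum (subdivision K)). sub_point K x \<in> V}
        \<subseteq> Sigma {..<tet_count (subdivision K)} (topspace \<circ> (\<lambda>_. top_of_set simplex3))" by auto
      fix e assume "e \<in> {..<tet_count (subdivision K)}"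
      then obtain \<nu> i j where e: "e < tet_count (subdivision K)" and c: "sub_code K e = (\<nu>, i, j)" "\<nu> < tet_count K" "i \<noteq> j"
        using sub_code_cases by (metis lessThan_iff)
      have "openin (top_of_set simplex3) {p. (\<nu>, p) \<in> V}"
        using V c(2) unfolding openin_sum_topology by simp
      then have "openin (top_of_set simplex3) (simplex3 \<inter> sub_map i j -` {p. (\<nu>, p) \<in> V})"
        by (intro continuous_openin_preimage[OF continuous_on_sub_map, of _ _ _ simplex3]) (use sub_map_simplex[OF c(3)] in auto)
      then show "openin (top_of_set simplex3) {x. (e, x) \<in> {x \<in> topspace (simplex_sum (subdivision K)). sub_point K x \<in> V}}"
        using slice[OF e c(1), of V] by simp
    qed
  qed
  show "closed_map (simplex_sum (subdivision K)) (simplex_sum K) (sub_point K)"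
    unfolding closed_map_def
  proof (intro allI impI)
    fix C assume C: "closedin (simplex_sum (subdivision K)) C"
    then have Cs: "C \<subseteq> topspace (simplex_sum (subdivision K))" by (rule closedin_subset)
    show "closedin (simplex_sum K) (sub_point K ` C)"
      unfolding closedin_sum_topology
    proof (intro conjI ballI)
      show "sub_point K ` C \<subseteq> Sigma {..<tet_count K} (topspace \<circ> (\<lambda>_. top_of_set simplex3))"
        using Cs sub_point_in unfolding topspace_simplex_sum by (force simp: simplex_points_def)
      fix \<nu> assume \<nu>: "\<nu> \<in> {..<tet_count K}"
      let ?P = "{(i, j). i \<noteq> j} :: (4 \<times> 4) set"
      have "{x. (\<nu>, x) \<in> sub_point K ` C} = (\<Union>(i, j)\<in>?P. sub_map i j ` {p. (sub_number K (\<nu>, i, j), p) \<in> C})"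
      proof (intro equalityI subsetI)
        fix x assume "x \<in> {x. (\<nu>, x) \<in> sub_point K ` C}"
        then obtain y where y: "y \<in> C" "sub_point K y = (\<nu>, x)" by auto
        then have "y \<in> simplex_points (subdivision K)" using Cs topspace_simplex_sum by blast
        then obtain \<nu>' i j p where c: "y = (sub_number K (\<nu>', i, j), p)" "i \<noteq> j" "sub_point K y = (\<nu>', sub_map i j p)"
          using sub_point_cases by metis
        then show "x \<in> (\<Union>(i, j)\<in>?P. sub_map i j ` {p. (sub_number K (\<nu>, i, j), p) \<in> C})" using y by auto
      next
        fix x assume "x \<in> (\<Union>(i, j)\<in>?P. sub_map i j ` {p. (sub_number K (\<nu>, i, j), p) \<in> C})"
        then obtain i j p where c: "i \<noteq> j" "(sub_number K (\<nu>, i, j), p) \<in> C" "x = sub_map i j p" by auto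
        then have "(\<nu>, x) = sub_point K (sub_number K (\<nu>, i, j), p)" using sub_point_number \<nu> by simp
        then show "x \<in> {x. (\<nu>, x) \<in> sub_point K ` C}" using c(2) by blast
      qed
      moreover have "compact (sub_map i j ` {p. (sub_number K (\<nu>, i, j), p) \<in> C})" if "i \<noteq> j" for i j
      proof (rule compact_continuous_image[OF continuous_on_sub_map])
        have "closedin (top_of_set simplex3) {p. (sub_number K (\<nu>, i, j), p) \<in> C}"
          using C sub_number_less[of \<nu> K i j] \<nu> that unfolding closedin_sum_topology by simp
        then show "compact {p. (sub_number K (\<nu>, i, j), p) \<in> C}" using closedin_compact compact_simplex3 by blast
      qed
      then have "compact (\<Union>(i, j)\<in>?P. sub_map i j ` {p. (sub_number K (\<nu>, i, j), p) \<in> C})"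
        by (intro compact_UN) auto
      moreover have "{x. (\<nu>, x) \<in> sub_point K ` C} \<subseteq> simplex3"
        using Cs sub_point_in unfolding topspace_simplex_sum by (force simp: simplex_points_def)
      ultimately show "closedin (top_of_set simplex3) {x. (\<nu>, x) \<in> sub_point K ` C}"
        by (simp add: closed_subset compact_imp_closed)
    qed
  qed
  show "sub_point K ` topspace (simplex_sum (subdivision K)) = topspace (simplex_sum K)"
    unfolding topspace_simplex_sum
  proof (intro equalityI subsetI)
    fix y assume "y \<in> simplex_points K"
    then obtain \<nu> P where y: "y = (\<nu>, P)" "\<nu> < tet_count K" "P \<in> simplex3" unfolding simplex_points_def by auto
    obtain i j where ij: "i \<noteq> j" "P$i \<le> P$j" "\<And>k. k \<noteq> i \<Longrightarrow> P$j \<le> P$k" using sub_region_exists' by metis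
    have "y = sub_point K (sub_number K (\<nu>, i, j), sub_coords i j P)"
      using sub_point_number[OF y(2) ij(1)] sub_map_sub_coords[OF ij(1)] y(1) by simp
    moreover have "(sub_number K (\<nu>, i, j), sub_coords i j P) \<in> simplex_points (subdivision K)"
      using sub_number_less[OF y(2) ij(1)] sub_coords_simplex[OF ij(1) y(3) ij(2,3)] by (simp add: simplex_points_def)
    ultimately show "y \<in> sub_point K ` simplex_points (subdivision K)" by blast
  qed (use sub_point_in in auto)
qed

context triangulated
begin

lemma orbit_gluing:
  assumes "\<nu> < tet_count K" "p \<in> simplex3" "\<mu> < tet_count K" "q \<in> simplex3"
    "orbit_rel \<Gamma> `` {lift \<nu> p} = orbit_rel \<Gamma> `` {lift \<mu> q}"
  shows "((\<nu>, p), (\<mu>, q)) \<in> gluing_rel K"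
proof -
  obtain \<Phi> where \<Phi>: "homeomorphic_map (realization K) (compactified_manifold \<Gamma>) \<Phi>"
      "\<forall>\<nu><tet_count K. \<forall>p\<in>simplex3. \<Phi> (gluing_rel K `` {(\<nu>, p)}) = orbit_rel \<Gamma> `` {lift \<nu> p}"
    using characteristic_homeomorphism by (elim exE conjE)
  have pts: "(\<nu>, p) \<in> simplex_points K" "(\<mu>, q) \<in> simplex_points K" using assms by (auto simp: simplex_points_def)
  then have "gluing_rel K `` {(\<nu>, p)} \<in> topspace (realization K)" "gluing_rel K `` {(\<mu>, q)} \<in> topspace (realization K)"
    using quotient_map_realization[OF valid] unfolding quotient_map_def topspace_simplex_sum by blast+
  moreover have "\<Phi> (gluing_rel K `` {(\<nu>, p)}) = \<Phi> (gluing_rel K `` {(\<mu>, q)})" using \<Phi>(2) assms by simp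
  moreover have "inj_on \<Phi> (topspace (realization K))" using \<Phi>(1) unfolding homeomorphic_map_def by blast
  ultimately have "gluing_rel K `` {(\<nu>, p)} = gluing_rel K `` {(\<mu>, q)}" by (metis inj_onD)
  then show ?thesis using eq_equiv_class[OF _ equiv_gluing_rel[OF valid] pts(2)] by simp
qed

text \<open>Interior points of a simplex are glued to no other point, and the characteristic maps induce an
  injective map on the realization.\<close>

lemma interior_injective:
  assumes "\<nu> < tet_count K" "p \<in> simplex3" "q \<in> simplex3" "\<And>i. p $ i \<noteq> 0" "lift \<nu> p = lift \<nu> q"
  shows "p = q"
proof -
  have "((\<nu>, p), (\<nu>, q)) \<in> (gluing_step K)\<^sup>*"
    using orbit_gluing[of \<nu> p \<nu> q] assms unfolding gluing_rel_def by auto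
  then show ?thesis
  proof (cases rule: converse_rtranclE)
    case (step y)
    then show ?thesis using assms(4) unfolding gluing_step_def by auto
  qed simp
qed

lemma subdivision_ideal: "ideal_triangulation \<Gamma> (subdivision K)"
  unfolding ideal_triangulation_def
proof (intro conjI allI impI ballI)
  show K': "valid_pairing (subdivision K)" by (rule valid_subdivision[OF valid])
  fix e assume e: "e < tet_count (subdivision K)"
  obtain \<nu> i j where c: "\<nu> < tet_count K" "i \<noteq> j" "e = sub_number K (\<nu>, i, j)"
    using sub_code_cases[OF e] by metis
  have l: "lifted_simplex (subdivision K) e = (\<lambda>p. lift \<nu> (sub_map i j p))"
    using subdivision_lift[OF c(1,2)] c(3) by auto
  have "continuous_map (top_of_set simplex3) (top_of_set simplex3) (sub_map i j)"
    using continuous_on_sub_map sub_map_simplex[OF c(2)] by (auto simp: continuous_map_in_subtopology)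
  from continuous_map_compose[OF this lift_continuous[OF c(1)]]
  show "continuous_map (top_of_set simplex3) (ext_topology \<Gamma>) (lifted_simplex (subdivision K) e)"
    unfolding l by (simp add: o_def)
  show "p \<in> range vertex" if p: "p \<in> simplex3" and \<xi>: "lifted_simplex (subdivision K) e p = Inr \<xi>" for p \<xi>
  proof -
    have "sub_map i j p \<in> range vertex"
      using lift_interior[OF c(1) sub_map_simplex[OF c(2) p]] \<xi> unfolding l by fastforce
    then obtain k where k: "sub_map i j p = vertex k" by auto
    have "sub_map i j p $ i \<le> sub_map i j p $ j" "sub_map i j p $ j \<le> sub_map i j p $ m" if "m \<noteq> i" for m
      using sub_map_order[OF c(2) p] that by auto
    note o = this[unfolded k]
    obtain a b where ab: "distinct [i, j, a, b]" using sum_4_split[OF c(2)] by metis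
    have "k \<noteq> i" using o(1)[of j] c(2) by (auto simp: axis_def)
    moreover have "k \<noteq> j" using o(2)[of a] ab by (auto simp: axis_def)
    ultimately have "sub_coords i j (vertex k) = vertex k"
      by (auto simp: vec_eq_iff sub_coords_def axis_def)
    then have "p = vertex k" using sub_coords_sub_map[OF c(2), of p] k by simp
    then show ?thesis by blast
  qed
  show "orientation_preserving open_chart_simplex (\<lambda>q. projl (lifted_simplex (subdivision K) e (chart_to_simplex q)))"
    unfolding l
  proof (rule orientation_preserving_sub_map[OF c(2), where f = "\<lambda>p. projl (lift \<nu> p)"])
    have inl: "\<exists>x. lift \<nu> p = Inl x" if "p \<in> simplex3" "\<And>i. p $ i \<noteq> 0" for p
      using lift_interior[OF c(1) that(1)] not_vertexI[of p i j, OF that(2) that(2) c(2)] by metis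
    have pos: "chart_to_simplex q $ i \<noteq> 0" if "q \<in> open_chart_simplex" for q i
      using that unfolding open_chart_iff by (metis less_irrefl)
    have "continuous_on (chart_to_simplex ` open_chart_simplex) (\<lambda>p. projl (lift \<nu> p))"
      by (rule continuous_on_hyp_part[OF lift_continuous[OF c(1)]]) (use chart_in_simplex inl pos in auto)
    then show "continuous_on open_chart_simplex (\<lambda>q. projl (lift \<nu> (chart_to_simplex q)))"
      by (rule continuous_on_compose2[OF _ continuous_on_chart]) auto
    show "inj_on (\<lambda>q. projl (lift \<nu> (chart_to_simplex q))) open_chart_simplex"
    proof (rule inj_onI)
      fix x y assume x: "x \<in> open_chart_simplex" and y: "y \<in> open_chart_simplex"
        and eq: "projl (lift \<nu> (chart_to_simplex x)) = projl (lift \<nu> (chart_to_simplex y))"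
      have "lift \<nu> (chart_to_simplex x) = lift \<nu> (chart_to_simplex y)"
        using inl[OF chart_in_simplex[OF x] pos[OF x]] inl[OF chart_in_simplex[OF y] pos[OF y]] eq by auto
      then have "chart_to_simplex x = chart_to_simplex y"
        by (intro interior_injective[OF c(1) chart_in_simplex[OF x] chart_in_simplex[OF y] pos[OF x]])
      then show "x = y" using simplex_to_chart_inverse by metis
    qed
    show "orientation_preserving open_chart_simplex (\<lambda>q. projl (lift \<nu> (chart_to_simplex q)))"
      using ideal c(1) unfolding ideal_triangulation_def by (elim conjE) blast
  qed
next
  obtain \<Psi> where \<Psi>: "homeomorphic_map (realization (subdivision K)) (realization K) \<Psi>"
    "\<And>x. x \<in> simplex_points (subdivision K) \<Longrightarrow> \<Psi> (gluing_rel (subdivision K) `` {x}) = gluing_rel K `` {sub_point K x}"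
    using homeomorphic_realizations[OF valid valid_subdivision[OF valid] quotient_map_sub_point]
      sub_point_gluing[OF valid] gluing_sub_point[OF valid] by metis
  obtain \<Phi> where \<Phi>: "homeomorphic_map (realization K) (compactified_manifold \<Gamma>) \<Phi>"
      "\<forall>\<nu><tet_count K. \<forall>p\<in>simplex3. \<Phi> (gluing_rel K `` {(\<nu>, p)}) = orbit_rel \<Gamma> `` {lift \<nu> p}"
    using characteristic_homeomorphism by (elim exE conjE)
  have "(\<Phi> \<circ> \<Psi>) (gluing_rel (subdivision K) `` {(e, p)}) = orbit_rel \<Gamma> `` {lifted_simplex (subdivision K) e p}"
    if e: "e < tet_count (subdivision K)" and p: "p \<in> simplex3" for e p
  proof -
    obtain \<nu> i j where c: "\<nu> < tet_count K" "i \<noteq> j" "e = sub_number K (\<nu>, i, j)"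
      using sub_code_cases[OF e] by metis
    have "\<Psi> (gluing_rel (subdivision K) `` {(e, p)}) = gluing_rel K `` {(\<nu>, sub_map i j p)}"
      using \<Psi>(2)[of "(e, p)"] e p sub_point_number[OF c(1,2)] c(3) by (simp add: simplex_points_def)
    then show ?thesis using \<Phi>(2) c(1) sub_map_simplex[OF c(2) p] subdivision_lift[OF c(1,2)] c(3) by simp
  qed
  then show "\<exists>\<Phi>. homeomorphic_map (realization (subdivision K)) (compactified_manifold \<Gamma>) \<Phi> \<and>
      (\<forall>\<nu><tet_count (subdivision K). \<forall>p\<in>simplex3.
         \<Phi> (gluing_rel (subdivision K) `` {(\<nu>, p)}) = orbit_rel \<Gamma> `` {lifted_simplex (subdivision K) \<nu> p})"
    using homeomorphic_map_compose[OF \<Psi>(1) \<Phi>(1)] by blast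
qed

end

section \<open>Generic flags\<close>

text \<open>All the nondegeneracy conditions on a new flag are linear in its point or in its line, and so
  it suffices to avoid finitely many planes in each of the two spaces.\<close>

definition generic_flags :: "flag set \<Rightarrow> bool" where
  "generic_flags S \<longleftrightarrow> (\<exists>X Y. finite X \<and> finite Y \<and> 0 \<notin> X \<and> 0 \<notin> Y \<and>
     (\<forall>\<phi>\<in>flags. (\<forall>x\<in>X. scalar_product x (flag_point \<phi>) \<noteq> 0) \<and> (\<forall>y\<in>Y. scalar_product y (flag_line \<phi>) \<noteq> 0) \<longrightarrow> \<phi> \<in> S))"

lemma generic_flagsE:
  assumes "generic_flags S"
  obtains X Y where "finite X" "finite Y" "0 \<notin> X" "0 \<notin> Y"
    "\<And>\<phi>. \<phi> \<in> flags \<Longrightarrow> (\<forall>x\<in>X. scalar_product x (flag_point \<phi>) \<noteq> 0) \<Longrightarrow>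
      (\<forall>y\<in>Y. scalar_product y (flag_line \<phi>) \<noteq> 0) \<Longrightarrow> \<phi> \<in> S"
  using assms unfolding generic_flags_def by blast

lemma generic_flags_mono: "generic_flags S \<Longrightarrow> (\<And>\<phi>. \<phi> \<in> flags \<Longrightarrow> \<phi> \<in> S \<Longrightarrow> \<phi> \<in> S') \<Longrightarrow> generic_flags S'"
proof -
  assume S: "generic_flags S" and sub: "\<And>\<phi>. \<phi> \<in> flags \<Longrightarrow> \<phi> \<in> S \<Longrightarrow> \<phi> \<in> S'"
  obtain X Y where X: "finite X" "finite Y" "0 \<notin> X" "0 \<notin> Y"
     "\<And>\<phi>. \<phi> \<in> flags \<Longrightarrow> (\<forall>x\<in>X. scalar_product x (flag_point \<phi>) \<noteq> 0) \<Longrightarrow> (\<forall>y\<in>Y. scalar_product y (flag_line \<phi>) \<noteq> 0) \<Longrightarrow> \<phi> \<in> S"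
    by (rule generic_flagsE[OF S]) blast
  show "generic_flags S'" unfolding generic_flags_def
    by (rule exI[of _ X], rule exI[of _ Y]) (use X sub in auto)
qed

lemma generic_flags_point:
  assumes "v \<noteq> 0" shows "generic_flags {\<phi>. scalar_product v (flag_point \<phi>) \<noteq> 0}"
  unfolding generic_flags_def by (rule exI[of _ "{v}"], rule exI[of _ "{}"]) (use assms in auto)

lemma generic_flags_line:
  assumes "v \<noteq> 0" shows "generic_flags {\<phi>. scalar_product v (flag_line \<phi>) \<noteq> 0}"
  unfolding generic_flags_def by (rule exI[of _ "{}"], rule exI[of _ "{v}"]) (use assms in auto)

lemma generic_flags_UNIV: "generic_flags UNIV"
  unfolding generic_flags_def by (rule exI[of _ "{}"], rule exI[of _ "{}"]) auto

lemma generic_flags_Int: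
  assumes "generic_flags S" "generic_flags S'" shows "generic_flags (S \<inter> S')"
proof -
  obtain X Y where X: "finite X" "finite Y" "0 \<notin> X" "0 \<notin> Y"
     "\<And>\<phi>. \<phi> \<in> flags \<Longrightarrow> (\<forall>x\<in>X. scalar_product x (flag_point \<phi>) \<noteq> 0) \<Longrightarrow> (\<forall>y\<in>Y. scalar_product y (flag_line \<phi>) \<noteq> 0) \<Longrightarrow> \<phi> \<in> S"
    by (rule generic_flagsE[OF assms(1)]) blast
  obtain X' Y' where X': "finite X'" "finite Y'" "0 \<notin> X'" "0 \<notin> Y'"
     "\<And>\<phi>. \<phi> \<in> flags \<Longrightarrow> (\<forall>x\<in>X'. scalar_product x (flag_point \<phi>) \<noteq> 0) \<Longrightarrow> (\<forall>y\<in>Y'. scalar_product y (flag_line \<phi>) \<noteq> 0) \<Longrightarrow> \<phi> \<in> S'"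
    by (rule generic_flagsE[OF assms(2)]) blast
  show ?thesis unfolding generic_flags_def
    by (rule exI[of _ "X \<union> X'"], rule exI[of _ "Y \<union> Y'"]) (use X X' in auto)
qed

lemma generic_flags_INT:
  "finite I \<Longrightarrow> (\<And>i. i \<in> I \<Longrightarrow> generic_flags (S i)) \<Longrightarrow> generic_flags (\<Inter>i\<in>I. S i)"
  by (induction I rule: finite_induct) (auto intro: generic_flags_UNIV generic_flags_Int)

lemma generic_flags_conj:
  "generic_flags {\<phi>. P \<phi>} \<Longrightarrow> generic_flags {\<phi>. Q \<phi>} \<Longrightarrow> generic_flags {\<phi>. P \<phi> \<and> Q \<phi>}"
  using generic_flags_Int[of "{\<phi>. P \<phi>}" "{\<phi>. Q \<phi>}"] by (simp add: Collect_conj_eq)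

lemma generic_flags_all:
  fixes P :: "'i::finite \<Rightarrow> flag \<Rightarrow> bool"
  assumes "\<And>i. generic_flags {\<phi>. P i \<phi>}" shows "generic_flags {\<phi>. \<forall>i. P i \<phi>}"
proof -
  have "generic_flags (\<Inter>i\<in>UNIV. {\<phi>. P i \<phi>})" using assms by (intro generic_flags_INT) auto
  moreover have "(\<Inter>i\<in>UNIV. {\<phi>. P i \<phi>}) = {\<phi>. \<forall>i. P i \<phi>}" by auto
  ultimately show ?thesis by simp
qed

lemma generic_flags_imp: "(Q \<Longrightarrow> generic_flags {\<phi>. P \<phi>}) \<Longrightarrow> generic_flags {\<phi>. Q \<longrightarrow> P \<phi>}"
  using generic_flags_UNIV by (cases Q) (auto simp: UNIV_def[symmetric])

text \<open>A generic flag exists already among the osculating flags of a conic.\<close>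

lemma generic_flags_nonempty:
  assumes "generic_flags S" obtains \<phi> where "\<phi> \<in> flags" "\<phi> \<in> S"
proof -
  obtain X Y where X: "finite X" "finite Y" "0 \<notin> X" "0 \<notin> Y"
     "\<And>\<phi>. \<phi> \<in> flags \<Longrightarrow> (\<forall>x\<in>X. scalar_product x (flag_point \<phi>) \<noteq> 0) \<Longrightarrow> (\<forall>y\<in>Y. scalar_product y (flag_line \<phi>) \<noteq> 0) \<Longrightarrow> \<phi> \<in> S"
    by (rule generic_flagsE[OF assms]) blast
  define x f :: "complex \<Rightarrow> complex^3" where "x t = vector [1, t, t\<^sup>2]" and "f t = vector [t\<^sup>2, - 2 * t, 1]" for t
  have fin: "finite {t. a + b * t + c * t\<^sup>2 = 0}" if "a \<noteq> 0 \<or> b \<noteq> 0 \<or> c \<noteq> 0" for a b c :: complex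
  proof -
    have "[:a, b, c:] \<noteq> 0" using that by auto
    then have "finite {t. poly [:a, b, c:] t = 0}" by (rule poly_roots_finite)
    then show ?thesis by (simp add: algebra_simps power2_eq_square)
  qed
  have "finite (\<Union>v\<in>X. {t. scalar_product v (x t) = 0})"
  proof (intro finite_UN_I X)
    fix v assume "v \<in> X"
    then have "v \<noteq> 0" using X by auto
    then have "v$1 \<noteq> 0 \<or> v$2 \<noteq> 0 \<or> v$3 \<noteq> 0" by (auto simp: vec_eq_iff forall_3)
    then show "finite {t. scalar_product v (x t) = 0}"
      using fin by (simp add: scalar_product_def sum_3 x_def)
  qed
  moreover have "finite (\<Union>v\<in>Y. {t. scalar_product v (f t) = 0})"
  proof (intro finite_UN_I X)
    fix v assume "v \<in> Y"
    then have "v \<noteq> 0" using X by auto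
    then have "v$3 \<noteq> 0 \<or> - 2 * v$2 \<noteq> 0 \<or> v$1 \<noteq> 0" by (auto simp: vec_eq_iff forall_3)
    from fin[OF this] show "finite {t. scalar_product v (f t) = 0}"
      by (rule back_subst[of finite]) (auto simp: scalar_product_def sum_3 f_def algebra_simps)
  qed
  ultimately have "finite ((\<Union>v\<in>X. {t. scalar_product v (x t) = 0}) \<union> (\<Union>v\<in>Y. {t. scalar_product v (f t) = 0}))"
    by simp
  then obtain t where t: "t \<notin> (\<Union>v\<in>X. {t. scalar_product v (x t) = 0}) \<union> (\<Union>v\<in>Y. {t. scalar_product v (f t) = 0})"
    using ex_new_if_finite[OF infinite_UNIV_char_0] by blast
  have xf: "x t \<noteq> 0" "f t \<noteq> 0" "scalar_product (f t) (x t) = 0"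
    by (auto simp: x_def f_def vec_eq_iff forall_3 scalar_product_def sum_3 power2_eq_square)
  define \<phi> where "\<phi> = (proj_point (x t), proj_point (f t))"
  have "\<phi> \<in> flags" unfolding \<phi>_def by (rule flagsI[OF xf])
  moreover obtain a b where "a \<noteq> 0" "flag_point \<phi> = a *s x t" "b \<noteq> 0" "flag_line \<phi> = b *s f t"
    unfolding \<phi>_def using flag_point_proj_point flag_line_proj_point by metis
  then have "\<phi> \<in> S" using t by (intro X(5)[OF \<open>\<phi> \<in> flags\<close>]) (auto simp: scalar_product_smult)
  ultimately show ?thesis using that by blast
qed

lemma generic_flags_act:
  assumes g: "g \<in> carrier PGL" and S: "generic_flags S"
  shows "generic_flags {\<phi>. flag_act g \<phi> \<in> S}"
proof -
  obtain A a b where A: "invertible A" "\<And>\<phi>. \<phi> \<in> flags \<Longrightarrow> a \<phi> \<noteq> 0 \<and> b \<phi> \<noteq> 0 \<and>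
    flag_point (flag_act g \<phi>) = a \<phi> *s (A *v flag_point \<phi>) \<and>
    flag_line (flag_act g \<phi>) = b \<phi> *s (flag_line \<phi> v* matrix_inv A)"
    using flag_act_rep[OF g] by metis
  obtain X Y where X: "finite X" "finite Y" "0 \<notin> X" "0 \<notin> Y"
     "\<And>\<phi>. \<phi> \<in> flags \<Longrightarrow> (\<forall>x\<in>X. scalar_product x (flag_point \<phi>) \<noteq> 0) \<Longrightarrow> (\<forall>y\<in>Y. scalar_product y (flag_line \<phi>) \<noteq> 0) \<Longrightarrow> \<phi> \<in> S"
    by (rule generic_flagsE[OF S]) blast
  have "0 \<notin> (\<lambda>v. v v* A) ` X"
  proof
    assume "0 \<in> (\<lambda>v. v v* A) ` X"
    then obtain v where "0 = v v* A" "v \<in> X" by (rule imageE)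
    then show False using invertible_mult_nonzero(2)[OF A(1), of v] X(3) by fastforce
  qed
  moreover have "0 \<notin> (\<lambda>v. matrix_inv A *v v) ` Y"
  proof
    assume "0 \<in> (\<lambda>v. matrix_inv A *v v) ` Y"
    then obtain v where "0 = matrix_inv A *v v" "v \<in> Y" by (rule imageE)
    then show False using invertible_mult_nonzero(1)[OF invertible_matrix_inv[OF A(1)], of v] X(4) by fastforce
  qed
  moreover have "flag_act g \<phi> \<in> S" if \<phi>: "\<phi> \<in> flags"
    "\<forall>x\<in>(\<lambda>v. v v* A) ` X. scalar_product x (flag_point \<phi>) \<noteq> 0"
    "\<forall>y\<in>(\<lambda>v. matrix_inv A *v v) ` Y. scalar_product y (flag_line \<phi>) \<noteq> 0" for \<phi>
  proof (rule X(5)[OF flag_act_in_flags[OF g \<phi>(1)]])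
    show "\<forall>x\<in>X. scalar_product x (flag_point (flag_act g \<phi>)) \<noteq> 0"
      using A(2)[OF \<phi>(1)] \<phi>(2) by (auto simp: scalar_product_smult scalar_product_vector_matrix)
    show "\<forall>y\<in>Y. scalar_product y (flag_line (flag_act g \<phi>)) \<noteq> 0"
    proof
      fix y assume "y \<in> Y"
      then have "scalar_product (matrix_inv A *v y) (flag_line \<phi>) \<noteq> 0" using \<phi>(3) by blast
      then have "scalar_product (flag_line \<phi> v* matrix_inv A) y \<noteq> 0"
        unfolding scalar_product_vector_matrix scalar_product_commute[of "flag_line \<phi>"] .
      then show "scalar_product y (flag_line (flag_act g \<phi>)) \<noteq> 0"
        using A(2)[OF \<phi>(1)] unfolding scalar_product_commute[of y] by (simp add: scalar_product_smult)
    qed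
  qed
  ultimately show ?thesis unfolding generic_flags_def
    by (intro exI[of _ "(\<lambda>v. v v* A) ` X"] exI[of _ "(\<lambda>v. matrix_inv A *v v) ` Y"]) (use X(1,2) in auto)
qed

lemma dual_flag_rep: "flag_point (dual_flag \<phi>) = flag_line \<phi>" "flag_line (dual_flag \<phi>) = flag_point \<phi>"
  by (simp_all add: dual_flag_def flag_point_def flag_line_def)

lemma dual_dual_flag [simp]: "dual_flag (dual_flag \<phi>) = \<phi>"
  by (simp add: dual_flag_def)

lemma generic_flags_dual:
  assumes "generic_flags {\<phi>. P \<phi>}" shows "generic_flags {\<phi>. P (dual_flag \<phi>)}"
proof -
  obtain X Y where X: "finite X" "finite Y" "0 \<notin> X" "0 \<notin> Y"
     "\<And>\<phi>. \<phi> \<in> flags \<Longrightarrow> (\<forall>x\<in>X. scalar_product x (flag_point \<phi>) \<noteq> 0) \<Longrightarrow> (\<forall>y\<in>Y. scalar_product y (flag_line \<phi>) \<noteq> 0) \<Longrightarrow> P \<phi>"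
    by (rule generic_flagsE[OF assms]) blast
  show ?thesis unfolding generic_flags_def
    by (rule exI[of _ Y], rule exI[of _ X]) (use X dual_flag_in_flags dual_flag_rep in auto)
qed

lemma generic_flags_pairing:
  assumes "\<psi> \<in> flags"
  shows "generic_flags {\<phi>. flag_pairing \<psi> \<phi> \<noteq> 0}" "generic_flags {\<phi>. flag_pairing \<phi> \<psi> \<noteq> 0}"
  using generic_flags_point[OF flag_rep(2)[OF assms]] generic_flags_line[OF flag_rep(1)[OF assms]]
  by (simp_all add: flag_pairing_def scalar_product_commute)

lemma points_independent:
  assumes "\<phi> \<in> flags" "flag_pairing \<phi> \<psi> \<noteq> 0" "a \<noteq> 0"
  shows "a *s flag_point \<phi> - b *s flag_point \<psi> \<noteq> 0"
proof
  assume z: "a *s flag_point \<phi> - b *s flag_point \<psi> = 0"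
  have "scalar_product (flag_line \<phi>) (a *s flag_point \<phi> - b *s flag_point \<psi>) = a * flag_pairing \<phi> \<phi> - b * flag_pairing \<phi> \<psi>"
    by (simp add: flag_pairing_def scalar_product_def sum_3 algebra_simps)
  then have "b = 0" using flag_rep(3)[OF assms(1)] assms(2) z by (simp add: scalar_product_def)
  then have "a *s flag_point \<phi> = 0" using z by simp
  then show False using flag_rep(1)[OF assms(1)] assms(3) by simp
qed

text \<open>If the point of \<open>\<theta>\<close> is not on the line of \<open>\<psi>\<close>, it differs from the point of \<open>\<psi>\<close>.\<close>

lemma generic_flags_det:
  assumes "\<psi> \<in> flags" "flag_pairing \<psi> \<theta> \<noteq> 0"
  shows "generic_flags {\<phi>. flag_det \<psi> \<theta> \<phi> \<noteq> 0}"
proof -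
  let ?x = "flag_point \<psi>" and ?y = "flag_point \<theta>" and ?f = "flag_line \<psi>"
  define c :: "complex^3" where "c = vector [?x$2 * ?y$3 - ?x$3 * ?y$2, ?x$3 * ?y$1 - ?x$1 * ?y$3, ?x$1 * ?y$2 - ?x$2 * ?y$1]"
  have e: "flag_det \<psi> \<theta> \<phi> = scalar_product c (flag_point \<phi>)" for \<phi>
    by (simp add: flag_det_def det3_expand c_def scalar_product_def sum_3 algebra_simps)
  have "c \<noteq> 0"
  proof
    assume "c = 0"
    then have z: "?x$2 * ?y$3 = ?x$3 * ?y$2" "?x$3 * ?y$1 = ?x$1 * ?y$3" "?x$1 * ?y$2 = ?x$2 * ?y$1"
      by (auto simp: c_def vec_eq_iff forall_3)
    have xx: "?f$1 * ?x$1 + ?f$2 * ?x$2 + ?f$3 * ?x$3 = 0"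
      using flag_rep(3)[OF assms(1)] by (simp add: flag_pairing_def scalar_product_def sum_3)
    have xy: "flag_pairing \<psi> \<theta> = ?f$1 * ?y$1 + ?f$2 * ?y$2 + ?f$3 * ?y$3"
      by (simp add: flag_pairing_def scalar_product_def sum_3)
    have "?x$1 * flag_pairing \<psi> \<theta> = ?y$1 * (?f$1 * ?x$1 + ?f$2 * ?x$2 + ?f$3 * ?x$3)"
      "?x$2 * flag_pairing \<psi> \<theta> = ?y$2 * (?f$1 * ?x$1 + ?f$2 * ?x$2 + ?f$3 * ?x$3)"
      "?x$3 * flag_pairing \<psi> \<theta> = ?y$3 * (?f$1 * ?x$1 + ?f$2 * ?x$2 + ?f$3 * ?x$3)"
      unfolding xy using z by algebra+
    then have "?x$1 = 0" "?x$2 = 0" "?x$3 = 0" using xx assms(2) by auto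
    then show False using flag_rep(1)[OF assms(1)] by (simp add: vec_eq_iff forall_3)
  qed
  then show ?thesis unfolding e by (rule generic_flags_point)
qed

lemma generic_flags_tetrahedron:
  assumes fl: "\<And>m. m \<noteq> j \<Longrightarrow> T m \<in> flags"
    and p: "\<And>m n. m \<noteq> j \<Longrightarrow> n \<noteq> j \<Longrightarrow> m \<noteq> n \<Longrightarrow> flag_pairing (T m) (T n) \<noteq> 0"
    and d: "\<And>m n k. m \<noteq> j \<Longrightarrow> n \<noteq> j \<Longrightarrow> k \<noteq> j \<Longrightarrow> distinct [m, n, k] \<Longrightarrow> flag_det (T m) (T n) (T k) \<noteq> 0"
  shows "generic_flags {\<phi>. generic_tetrahedron (T(j := \<phi>))}"
proof -
  have "generic_flags {\<phi>. (\<forall>m. m \<noteq> j \<longrightarrow> flag_pairing (T m) \<phi> \<noteq> 0) \<and> (\<forall>m. m \<noteq> j \<longrightarrow> flag_pairing \<phi> (T m) \<noteq> 0) \<and>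
     (\<forall>m n. m \<noteq> j \<and> n \<noteq> j \<and> m \<noteq> n \<longrightarrow> flag_det (T m) (T n) \<phi> \<noteq> 0)}"
    by (intro generic_flags_conj generic_flags_all generic_flags_imp generic_flags_pairing generic_flags_det fl p) auto
  then show ?thesis
  proof (rule generic_flags_mono)
    fix \<phi> assume \<phi>: "\<phi> \<in> flags" "\<phi> \<in> {\<phi>. (\<forall>m. m \<noteq> j \<longrightarrow> flag_pairing (T m) \<phi> \<noteq> 0) \<and> (\<forall>m. m \<noteq> j \<longrightarrow> flag_pairing \<phi> (T m) \<noteq> 0) \<and>
     (\<forall>m n. m \<noteq> j \<and> n \<noteq> j \<and> m \<noteq> n \<longrightarrow> flag_det (T m) (T n) \<phi> \<noteq> 0)}"
    have D: "flag_det (T m) (T n) \<phi> \<noteq> 0" "flag_det (T m) \<phi> (T n) \<noteq> 0" "flag_det \<phi> (T m) (T n) \<noteq> 0"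
      if "m \<noteq> j" "n \<noteq> j" "m \<noteq> n" for m n
    proof -
      show 1: "flag_det (T m) (T n) \<phi> \<noteq> 0" using \<phi>(2) that by blast
      then show "flag_det (T m) \<phi> (T n) \<noteq> 0" using flag_det_swap(2)[of "T m" \<phi> "T n"] by simp
      then show "flag_det \<phi> (T m) (T n) \<noteq> 0" using flag_det_swap(1)[of \<phi> "T m" "T n"] by simp
    qed
    show "\<phi> \<in> {\<phi>. generic_tetrahedron (T(j := \<phi>))}"
      unfolding generic_tetrahedron_iff using \<phi> fl p d D by (auto simp: fun_upd_def)
  qed
qed

text \<open>The hypotheses of \<open>beta_chain_dual\<close>, with the nonvanishing minor required for all choices of two
  rows and two complementary columns, so as to be independent of the labelling.\<close>

definition good_tetrahedron :: "tetrahedron \<Rightarrow> bool" where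
  "good_tetrahedron T \<longleftrightarrow> generic_tetrahedron T \<and> generic_tetrahedron (\<lambda>i. dual_flag (T i)) \<and>
    (\<forall>i j k l. distinct [i, j, k, l] \<longrightarrow>
      flag_pairing (T i) (T k) * flag_pairing (T j) (T l) \<noteq> flag_pairing (T j) (T k) * flag_pairing (T i) (T l))"

lemma generic_flags_row_minor:
  assumes "\<phi> \<in> flags" "flag_pairing \<phi> \<psi> \<noteq> 0" "a \<noteq> 0"
  shows "generic_flags {\<theta>. flag_pairing \<theta> \<phi> * a \<noteq> flag_pairing \<theta> \<psi> * b}"
proof -
  have "scalar_product (a *s flag_point \<phi> - b *s flag_point \<psi>) (flag_line \<theta>) = flag_pairing \<theta> \<phi> * a - flag_pairing \<theta> \<psi> * b" for \<theta>
    by (simp add: flag_pairing_def scalar_product_def sum_3 algebra_simps)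
  with generic_flags_line[OF points_independent[OF assms, of b]] show ?thesis by simp
qed

lemma generic_flags_column_minor:
  assumes "\<phi> \<in> flags" "flag_pairing \<psi> \<phi> \<noteq> 0" "a \<noteq> 0"
  shows "generic_flags {\<theta>. flag_pairing \<phi> \<theta> * a \<noteq> flag_pairing \<psi> \<theta> * b}"
proof -
  have "flag_pairing (dual_flag \<phi>) (dual_flag \<psi>) \<noteq> 0" using assms(2) by (simp add: dual_flag_pairing)
  from generic_flags_dual[OF generic_flags_row_minor[OF dual_flag_in_flags[OF assms(1)] this assms(3), of b]]
  show ?thesis by (simp add: dual_flag_pairing)
qed

text \<open>The faces that contain the new vertex impose no condition on the old flags beyond the
  nonvanishing of their pairings; the opposite face has to be nondegenerate already.\<close>

lemma generic_flags_good:
  assumes fl: "\<And>m. m \<noteq> j \<Longrightarrow> T m \<in> flags"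
    and p: "\<And>m n. m \<noteq> j \<Longrightarrow> n \<noteq> j \<Longrightarrow> m \<noteq> n \<Longrightarrow> flag_pairing (T m) (T n) \<noteq> 0"
    and d: "\<And>m n k. m \<noteq> j \<Longrightarrow> n \<noteq> j \<Longrightarrow> k \<noteq> j \<Longrightarrow> distinct [m, n, k] \<Longrightarrow> flag_det (T m) (T n) (T k) \<noteq> 0"
    and c: "\<And>m n k. m \<noteq> j \<Longrightarrow> n \<noteq> j \<Longrightarrow> k \<noteq> j \<Longrightarrow> distinct [m, n, k] \<Longrightarrow> flag_codet (T m) (T n) (T k) \<noteq> 0"
  shows "generic_flags {\<phi>. good_tetrahedron (T(j := \<phi>))}"
proof -
  have upd: "(\<lambda>i. dual_flag (T i))(j := dual_flag \<phi>) = (\<lambda>i. dual_flag ((T(j := \<phi>)) i))" for \<phi> by auto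
  have "generic_flags {\<phi>. generic_tetrahedron ((\<lambda>i. dual_flag (T i))(j := \<phi>))}"
    by (rule generic_flags_tetrahedron) (auto simp: dual_flag_in_flags fl dual_flag_pairing p dual_flag_det c)
  from generic_flags_dual[OF this]
  have dual: "generic_flags {\<phi>. generic_tetrahedron (\<lambda>i. dual_flag ((T(j := \<phi>)) i))}" unfolding upd .
  have minor: "generic_flags {\<phi>. flag_pairing ((T(j:=\<phi>)) i) ((T(j:=\<phi>)) k) * flag_pairing ((T(j:=\<phi>)) h) ((T(j:=\<phi>)) l) \<noteq>
      flag_pairing ((T(j:=\<phi>)) h) ((T(j:=\<phi>)) k) * flag_pairing ((T(j:=\<phi>)) i) ((T(j:=\<phi>)) l)}"
    if "distinct [i, h, k, l]" for i h k l
  proof -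
    have ne: "i \<noteq> h" "i \<noteq> k" "i \<noteq> l" "h \<noteq> k" "h \<noteq> l" "k \<noteq> l" using that by auto
    note ne = ne ne[symmetric]
    have "{i, h, k, l} = UNIV" by (rule card_eq_UNIV_imp_eq_UNIV) (use that in auto)
    then consider "j = i" | "j = h" | "j = k" | "j = l" by blast
    then show ?thesis
    proof cases
      case 1
      from generic_flags_row_minor[OF fl p p, of k l h l "flag_pairing (T h) (T k)"] show ?thesis
        by (simp add: ne 1 mult.commute)
    next
      case 2
      from generic_flags_row_minor[OF fl p p, of l k i k "flag_pairing (T i) (T l)"] show ?thesis
        by (simp add: ne 2 mult.commute eq_commute[of "flag_pairing (T i) (T k) * _"])
    next
      case 3
      from generic_flags_column_minor[OF fl p p, of i h h l "flag_pairing (T i) (T l)"] show ?thesis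
        by (simp add: ne 3 mult.commute)
    next
      case 4
      from generic_flags_column_minor[OF fl p p, of h i i k "flag_pairing (T h) (T k)"] show ?thesis
        by (simp add: ne 4 mult.commute eq_commute[of "flag_pairing (T i) _ * _"])
    qed
  qed
  show ?thesis unfolding good_tetrahedron_def
    by (intro generic_flags_conj generic_flags_all generic_flags_imp generic_flags_tetrahedron fl p d dual minor)
qed

text \<open>This secures, for a new flag, the condition on the face opposite to the next one.\<close>

lemma generic_flags_codet:
  assumes "\<psi> \<in> flags" "flag_pairing \<theta> \<psi> \<noteq> 0"
  shows "generic_flags {\<phi>. flag_codet \<psi> \<theta> \<phi> \<noteq> 0}"
proof -
  have "flag_pairing (dual_flag \<psi>) (dual_flag \<theta>) \<noteq> 0" using assms(2) by (simp add: dual_flag_pairing)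
  from generic_flags_dual[OF generic_flags_det[OF dual_flag_in_flags[OF assms(1)] this]]
  show ?thesis by (simp add: dual_flag_det)
qed

section \<open>Generic decorations of the subdivision\<close>

subsection \<open>Equivariant choices of flags\<close>

definition simplex_center :: "real^4" where
  "simplex_center = (\<chi> k. 1/4)"

lemma simplex_center_simplex: "simplex_center \<in> simplex3"
  by (simp add: simplex3_def simplex_center_def)

lemma sub_map_vertices:
  assumes "i \<noteq> j"
  shows "sub_map i j (vertex i) = simplex_center" "sub_map i j (vertex j) = face_center i"
    "k \<noteq> i \<Longrightarrow> k \<noteq> j \<Longrightarrow> sub_map i j (vertex k) = vertex k"
  using assms by (auto simp: sub_map_def simplex_center_def face_center_def axis_def vec_eq_iff)

lemma interior_points: "simplex_center \<notin> range vertex" "face_center i \<notin> range vertex"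
proof -
  show "simplex_center \<notin> range vertex" by (rule not_vertexI[of _ 1 2]) (auto simp: simplex_center_def)
  have "i + 1 \<noteq> i" "i + 2 \<noteq> i" "i + 1 \<noteq> i + 2" by simp_all
  then show "face_center i \<notin> range vertex" by (intro not_vertexI[of _ "i + 1" "i + 2"]) (auto simp: face_center_def)
qed

lemma zero_counts: "zero_count simplex_center = 0" "zero_count (face_center i) = 1" "zero_count (vertex i) = 3"
proof -
  show "zero_count simplex_center = 0" by (simp add: zero_count_def simplex_center_def)
  have "{j. face_center i $ j = 0} = {i}" by (auto simp: face_center_def)
  then show "zero_count (face_center i) = 1" by (simp add: zero_count_def)
  have "{j. vertex i $ j = 0} = UNIV - {i}" by (auto simp: axis_def)
  then show "zero_count (vertex i) = 3" by (simp add: zero_count_def card_Diff_singleton)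
qed

lemma permute_face_center:
  assumes "\<pi> permutes UNIV" shows "permute_point \<pi> (face_center i) = face_center (\<pi> i)"
  by (rule permute_point_eqI[OF assms, symmetric])
    (use permutes_4_distinct[OF assms] in \<open>auto simp: face_center_def\<close>)

text \<open>Deck transformations act freely, so the flags at chosen points of distinct orbits can be
  prescribed arbitrarily. A condition at a further point of an orbit is a condition on the flag at
  the chosen one, and it is still generic.\<close>

lemma (in developed) equivariant_flags:
  assumes I: "finite I" and y: "\<And>k. k \<in> I \<Longrightarrow> y k \<in> hyp3" and S: "\<And>k. k \<in> I \<Longrightarrow> generic_flags (S k)"
  obtains E where "\<And>k. k \<in> I \<Longrightarrow> E (y k) \<in> S k" "\<And>x. x \<in> hyp3 \<Longrightarrow> E x \<in> flags"
    "\<And>g x. g \<in> \<Gamma> \<Longrightarrow> x \<in> hyp3 \<Longrightarrow> E (hyp_act g x) = flag_act (\<rho> g) (E x)"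
proof -
  interpret G: group "PGL :: (complex^2^2) set monoid" by (rule group_PGL)
  define r where "r x = (SOME z. z \<in> (\<lambda>g. hyp_act g x) ` \<Gamma>)" for x
  define \<gamma> where "\<gamma> x = (SOME g. g \<in> \<Gamma> \<and> x = hyp_act g (r x))" for x
  have r: "r x \<in> hyp3" "\<gamma> x \<in> \<Gamma>" "x = hyp_act (\<gamma> x) (r x)" if x: "x \<in> hyp3" for x
  proof -
    have "\<exists>z. z \<in> (\<lambda>g. hyp_act g x) ` \<Gamma>" using one_in by blast
    then have "r x \<in> (\<lambda>g. hyp_act g x) ` \<Gamma>" unfolding r_def by (rule someI_ex)
    then obtain g where g: "g \<in> \<Gamma>" "r x = hyp_act g x" by blast
    show "r x \<in> hyp3" unfolding g(2) using hyp_act_in_hyp3[OF in_PGL[OF g(1)] x] .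
    have "hyp_act (inv\<^bsub>PGL\<^esub> g) (r x) = x"
      unfolding g(2) using hyp_act_mult[OF in_PGL[OF inv_in[OF g(1)]] in_PGL[OF g(1)] x] G.l_inv[OF in_PGL[OF g(1)]]
        hyp_act_one[OF x] by simp
    then have "\<exists>g. g \<in> \<Gamma> \<and> x = hyp_act g (r x)" using inv_in[OF g(1)] by metis
    then have "\<gamma> x \<in> \<Gamma> \<and> x = hyp_act (\<gamma> x) (r x)" unfolding \<gamma>_def by (rule someI_ex)
    then show "\<gamma> x \<in> \<Gamma>" "x = hyp_act (\<gamma> x) (r x)" by blast+
  qed
  have r_act: "r (hyp_act g x) = r x" if g: "g \<in> \<Gamma>" and x: "x \<in> hyp3" for g x
  proof -
    have "(\<lambda>h. hyp_act h (hyp_act g x)) ` \<Gamma> = (\<lambda>h. hyp_act h x) ` \<Gamma>" (is "?L = ?R")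
    proof
      show "?L \<subseteq> ?R"
      proof (rule image_subsetI)
        fix h assume h: "h \<in> \<Gamma>"
        show "hyp_act h (hyp_act g x) \<in> ?R"
          using hyp_act_mult[OF in_PGL[OF h] in_PGL[OF g] x] mult_in[OF h g] by (metis image_eqI)
      qed
      show "?R \<subseteq> ?L"
      proof (rule image_subsetI)
        fix h assume h: "h \<in> \<Gamma>"
        let ?h = "h \<otimes>\<^bsub>PGL\<^esub> inv\<^bsub>PGL\<^esub> g"
        have m: "?h \<in> \<Gamma>" using mult_in[OF h inv_in[OF g]] .
        have "hyp_act ?h (hyp_act g x) = hyp_act (?h \<otimes>\<^bsub>PGL\<^esub> g) x"
          using hyp_act_mult[OF in_PGL[OF m] in_PGL[OF g] x] by simp
        also have "?h \<otimes>\<^bsub>PGL\<^esub> g = h"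
          using G.m_assoc[OF in_PGL[OF h] in_PGL[OF inv_in[OF g]] in_PGL[OF g]] G.l_inv[OF in_PGL[OF g]]
            G.r_one[OF in_PGL[OF h]] by simp
        finally show "hyp_act h x \<in> ?L" using m by (metis image_eqI)
      qed
    qed
    then show ?thesis unfolding r_def by simp
  qed
  have \<gamma>_act: "\<gamma> (hyp_act g x) = g \<otimes>\<^bsub>PGL\<^esub> \<gamma> x" if g: "g \<in> \<Gamma>" and x: "x \<in> hyp3" for g x
  proof -
    note gx = hyp_act_in_hyp3[OF in_PGL[OF g] x]
    have "hyp_act (\<gamma> (hyp_act g x)) (r x) = hyp_act g x" using r(3)[OF gx] r_act[OF g x] by simp
    also have "\<dots> = hyp_act g (hyp_act (\<gamma> x) (r x))" using r(3)[OF x] by simp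
    also have "\<dots> = hyp_act (g \<otimes>\<^bsub>PGL\<^esub> \<gamma> x) (r x)"
      using hyp_act_mult[OF in_PGL[OF g] in_PGL[OF r(2)[OF x]] r(1)[OF x]] by simp
    finally show ?thesis by (rule hyp_act_inj[OF r(2)[OF gx] mult_in[OF g r(2)[OF x]] r(1)[OF x]])
  qed
  have "\<exists>\<phi>. \<phi> \<in> flags \<and> (\<forall>k\<in>I. r (y k) = z \<longrightarrow> flag_act (\<rho> (\<gamma> (y k))) \<phi> \<in> S k)" for z
  proof -
    have "generic_flags (\<Inter>k\<in>{k\<in>I. r (y k) = z}. {\<phi>. flag_act (\<rho> (\<gamma> (y k))) \<phi> \<in> S k})"
      using I S y r(2) rho_in by (intro generic_flags_INT generic_flags_act) auto
    then obtain \<phi> where "\<phi> \<in> flags" "\<phi> \<in> (\<Inter>k\<in>{k\<in>I. r (y k) = z}. {\<phi>. flag_act (\<rho> (\<gamma> (y k))) \<phi> \<in> S k})"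
      by (rule generic_flags_nonempty)
    then show ?thesis by blast
  qed
  then obtain e where e: "\<And>z. e z \<in> flags" "\<And>z k. k \<in> I \<Longrightarrow> r (y k) = z \<Longrightarrow> flag_act (\<rho> (\<gamma> (y k))) (e z) \<in> S k"
    by metis
  define E where "E x = flag_act (\<rho> (\<gamma> x)) (e (r x))" for x
  show ?thesis
  proof
    show "E (y k) \<in> S k" if "k \<in> I" for k unfolding E_def using e(2)[OF that] by blast
    show "E x \<in> flags" if "x \<in> hyp3" for x
      unfolding E_def by (rule flag_act_in_flags[OF rho_in[OF r(2)[OF that]] e(1)])
    show "E (hyp_act g x) = flag_act (\<rho> g) (E x)" if "g \<in> \<Gamma>" "x \<in> hyp3" for g x
    proof -
      have "\<rho> (g \<otimes>\<^bsub>PGL\<^esub> \<gamma> x) = \<rho> g \<otimes>\<^bsub>PGL\<^esub> \<rho> (\<gamma> x)"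
        using hom that(1) r(2)[OF that(2)] unfolding hom_def by simp
      then show ?thesis unfolding E_def
        using \<gamma>_act[OF that] r_act[OF that] flag_act_mult[OF rho_in[OF that(1)] rho_in[OF r(2)[OF that(2)]] e(1)] by simp
    qed
  qed
qed

lemma (in kleinian) orbit_rel_translate:
  assumes g: "g \<in> \<Gamma>" and x: "x \<in> ext_hyp3 \<Gamma>" "ext_act g x \<in> ext_hyp3 \<Gamma>"
  shows "orbit_rel \<Gamma> `` {ext_act g x} = orbit_rel \<Gamma> `` {x}"
proof -
  have image: "orbit_rel \<Gamma> `` {z} = (\<lambda>h. ext_act h z) ` \<Gamma>" if "z \<in> ext_hyp3 \<Gamma>" for z
    using that unfolding orbit_rel_def by auto
  have sub: "(\<lambda>h. ext_act h (ext_act k z)) ` \<Gamma> \<subseteq> (\<lambda>h. ext_act h z) ` \<Gamma>" if "k \<in> \<Gamma>" "z \<in> ext_hyp3 \<Gamma>" for k z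
  proof (rule image_subsetI)
    fix h assume h: "h \<in> \<Gamma>"
    show "ext_act h (ext_act k z) \<in> (\<lambda>h. ext_act h z) ` \<Gamma>"
      using ext_act_mult[OF h that] mult_in[OF h that(1)] by (metis image_eqI)
  qed
  show ?thesis
    unfolding image[OF x(1)] image[OF x(2)]
    using sub[OF g x(1)] sub[OF inv_in[OF g] x(2)] unfolding ext_act_inverse[OF g x(1)] by (rule subset_antisym)
qed

text \<open>Deck transformations preserve the dimension of the face whose interior contains a point.\<close>

lemma (in triangulated) orbit_zero_count:
  assumes g: "g \<in> \<Gamma>" "h \<in> \<Gamma>" and \<nu>: "\<nu> < tet_count K" "\<mu> < tet_count K" and p: "p \<in> simplex3" "q \<in> simplex3"
    and eq: "ext_act g (lift \<nu> p) = ext_act h (lift \<mu> q)"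
  shows "zero_count p = zero_count q"
proof -
  note x = lift_in[OF \<nu>(1) p(1)] and y = lift_in[OF \<nu>(2) p(2)]
  let ?k = "inv\<^bsub>PGL\<^esub> h \<otimes>\<^bsub>PGL\<^esub> g"
  have k: "ext_act ?k (lift \<nu> p) = lift \<mu> q"
    unfolding ext_act_mult[OF inv_in[OF g(2)] g(1) x] eq by (rule ext_act_inverse[OF g(2) y])
  have "orbit_rel \<Gamma> `` {lift \<nu> p} = orbit_rel \<Gamma> `` {lift \<mu> q}"
    using orbit_rel_translate[OF mult_in[OF inv_in[OF g(2)] g(1)] x] y unfolding k by simp
  then show ?thesis using gluing_rel_zero_count[OF valid] orbit_gluing[OF \<nu>(1) p(1) \<nu>(2) p(2)] by blast
qed

lemma (in developed) rho_mult: "g \<in> \<Gamma> \<Longrightarrow> h \<in> \<Gamma> \<Longrightarrow> \<rho> (g \<otimes>\<^bsub>PGL\<^esub> h) = \<rho> g \<otimes>\<^bsub>PGL\<^esub> \<rho> h"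
  using hom unfolding hom_def by simp

lemma (in developed) rho_one: "\<rho> \<one>\<^bsub>PGL\<^esub> = \<one>\<^bsub>PGL\<^esub>"
proof -
  interpret G: group "PGL :: (complex^2^2) set monoid" by (rule group_PGL)
  interpret H: group "PGL :: (complex^3^3) set monoid" by (rule group_PGL)
  have "\<rho> \<one>\<^bsub>PGL\<^esub> \<otimes>\<^bsub>PGL\<^esub> \<rho> \<one>\<^bsub>PGL\<^esub> = \<rho> (\<one>\<^bsub>PGL\<^esub> \<otimes>\<^bsub>PGL\<^esub> \<one>\<^bsub>PGL\<^esub>)"
    using rho_mult[OF one_in one_in] by (rule sym)
  then have "\<rho> \<one>\<^bsub>PGL\<^esub> \<otimes>\<^bsub>PGL\<^esub> \<rho> \<one>\<^bsub>PGL\<^esub> = \<rho> \<one>\<^bsub>PGL\<^esub>" using G.l_one[OF G.one_closed] by simp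
  then show ?thesis using rho_in[OF one_in] by (metis H.l_cancel_one' H.r_cancel_one)
qed

subsection \<open>The refined developing map\<close>

lemma distinct_3_cases: "distinct [m, n, k] \<Longrightarrow> m \<noteq> j \<Longrightarrow> n \<noteq> j \<Longrightarrow> k \<noteq> j \<Longrightarrow> i \<noteq> j \<Longrightarrow> i = m \<or> i = n \<or> i = (k :: 4)"
proof (rule ccontr)
  assume *: "distinct [m, n, k]" "m \<noteq> j" "n \<noteq> j" "k \<noteq> j" "i \<noteq> j" "\<not> (i = m \<or> i = n \<or> i = k)"
  then have "card {m, n, k, j, i} = 5" by auto
  moreover have "card {m, n, k, j, i} \<le> CARD(4)" by (rule card_mono) auto
  ultimately show False by simp
qed

text \<open>The center of every simplex receives a flag that is generic with respect to the simplex, and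
  the center of every face one that is generic with respect to the simplex with and without its
  center.\<close>

lemma (in developed) refinement:
  obtains D' B C where
    "developed \<Gamma> (subdivision K) \<rho> D'" "\<And>\<xi>. D' (Inr \<xi>) = D (Inr \<xi>)"
    "\<And>\<nu> i j. \<nu> < tet_count K \<Longrightarrow> i \<noteq> j \<Longrightarrow>
      (\<lambda>m. D' (lifted_simplex (subdivision K) (sub_number K (\<nu>, i, j)) (vertex m))) = (tet \<nu>)(i := B \<nu>, j := C \<nu> i)"
    "\<And>\<nu> i. \<nu> < tet_count K \<Longrightarrow> generic_tetrahedron ((tet \<nu>)(i := B \<nu>))"
    "\<And>\<nu> i. \<nu> < tet_count K \<Longrightarrow> generic_tetrahedron ((tet \<nu>)(i := C \<nu> i))"
    "\<And>\<nu> i j. \<nu> < tet_count K \<Longrightarrow> i \<noteq> j \<Longrightarrow> good_tetrahedron ((tet \<nu>)(i := B \<nu>, j := C \<nu> i))"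
    "\<And>\<nu> i \<mu> \<pi>. \<nu> < tet_count K \<Longrightarrow> pairing K \<nu> i = (\<mu>, \<pi>) \<Longrightarrow>
      \<exists>g\<in>carrier PGL. C \<mu> (\<pi> i) = flag_act g (C \<nu> i) \<and> (\<forall>j. j \<noteq> i \<longrightarrow> tet \<mu> (\<pi> j) = flag_act g (tet \<nu> j))"
proof -
  define b where "b \<nu> = projl (lift \<nu> simplex_center)" for \<nu>
  define c where "c = (\<lambda>(\<nu>, i). projl (lift \<nu> (face_center i)))"
  have b: "b \<nu> \<in> hyp3" "lift \<nu> simplex_center = Inl (b \<nu>)" if "\<nu> < tet_count K" for \<nu>
    using lift_interior[OF that simplex_center_simplex interior_points(1)] unfolding b_def by (metis sum.sel(1))+
  have c: "c (\<nu>, i) \<in> hyp3" "lift \<nu> (face_center i) = Inl (c (\<nu>, i))" if "\<nu> < tet_count K" for \<nu> i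
    using lift_interior[OF that face_center_simplex interior_points(2)] unfolding c_def prod.case by (metis sum.sel(1))+
  have p: "flag_pairing (tet \<nu> m) (tet \<nu> n) \<noteq> 0" if "\<nu> < tet_count K" "m \<noteq> n" for \<nu> m n
    using generic_tet that unfolding generic_tetrahedron_iff by blast
  have d: "flag_det (tet \<nu> m) (tet \<nu> n) (tet \<nu> k) \<noteq> 0" if "\<nu> < tet_count K" "distinct [m, n, k]" for \<nu> m n k
    using generic_tet that unfolding generic_tetrahedron_iff by blast
  have add_vertex: "generic_flags {\<phi>. generic_tetrahedron ((tet \<nu>)(i := \<phi>))}" if "\<nu> < tet_count K" for \<nu> i
    by (rule generic_flags_tetrahedron) (use that tet_flag p d in auto)
  \<comment> \<open>The flags at the centers of the simplices are chosen first; the conditions on those at the centers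
    of the faces depend on them. Nonzero determinants of lines prepare for the dual conditions.\<close>
  define SB where "SB \<nu> = {\<phi>. (\<forall>i. generic_tetrahedron ((tet \<nu>)(i := \<phi>))) \<and>
     (\<forall>m n. m \<noteq> n \<longrightarrow> flag_codet (tet \<nu> m) (tet \<nu> n) \<phi> \<noteq> 0)}" for \<nu>
  have "generic_flags (SB \<nu>)" if "\<nu> \<in> {..<tet_count K}" for \<nu>
    unfolding SB_def using that
    by (intro generic_flags_conj generic_flags_all generic_flags_imp add_vertex generic_flags_codet tet_flag p) auto
  then obtain E where E: "\<And>\<nu>. \<nu> \<in> {..<tet_count K} \<Longrightarrow> E (b \<nu>) \<in> SB \<nu>" "\<And>x. x \<in> hyp3 \<Longrightarrow> E x \<in> flags"
    "\<And>g x. g \<in> \<Gamma> \<Longrightarrow> x \<in> hyp3 \<Longrightarrow> E (hyp_act g x) = flag_act (\<rho> g) (E x)"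
    using equivariant_flags[of "{..<tet_count K}" b SB] b(1) by blast
  define B where "B \<nu> = E (b \<nu>)" for \<nu>
  have B: "generic_tetrahedron ((tet \<nu>)(i := B \<nu>))" "m \<noteq> n \<Longrightarrow> flag_codet (tet \<nu> m) (tet \<nu> n) (B \<nu>) \<noteq> 0"
    if "\<nu> < tet_count K" for \<nu> i m n
    using E(1)[of \<nu>] that unfolding SB_def B_def by auto
  define SC where "SC = (\<lambda>(\<nu>, i). {\<phi>. generic_tetrahedron ((tet \<nu>)(i := \<phi>)) \<and>
     (\<forall>j. i \<noteq> j \<longrightarrow> good_tetrahedron ((tet \<nu>)(i := B \<nu>, j := \<phi>)))})"
  have good: "generic_flags {\<phi>. good_tetrahedron ((tet \<nu>)(i := B \<nu>, j := \<phi>))}"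
    if \<nu>: "\<nu> < tet_count K" and ij: "i \<noteq> j" for \<nu> i j
  proof (rule generic_flags_good)
    note g = B(1)[OF \<nu>, of i, unfolded generic_tetrahedron_iff]
    show "((tet \<nu>)(i := B \<nu>)) m \<in> flags" for m using g by blast
    show "flag_pairing (((tet \<nu>)(i := B \<nu>)) m) (((tet \<nu>)(i := B \<nu>)) n) \<noteq> 0" if "m \<noteq> n" for m n
      using g that by blast
    fix m n k assume mnk: "m \<noteq> j" "n \<noteq> j" "k \<noteq> j" "distinct [m, n, k]"
    then show "flag_det (((tet \<nu>)(i := B \<nu>)) m) (((tet \<nu>)(i := B \<nu>)) n) (((tet \<nu>)(i := B \<nu>)) k) \<noteq> 0"
      using g by blast
    have r: "flag_codet \<psi> \<theta> \<phi> = flag_codet \<phi> \<psi> \<theta>" "flag_codet \<psi> \<phi> \<theta> = - flag_codet \<phi> \<psi> \<theta>" for \<phi> \<psi> \<theta>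
      by (simp_all add: flag_codet_def det3_expand algebra_simps)
    from distinct_3_cases[OF mnk(4,1,2,3) ij] consider "i = m" | "i = n" | "i = k" by blast
    then show "flag_codet (((tet \<nu>)(i := B \<nu>)) m) (((tet \<nu>)(i := B \<nu>)) n) (((tet \<nu>)(i := B \<nu>)) k) \<noteq> 0"
    proof cases
      case 1
      then show ?thesis using mnk(4) B(2)[OF \<nu>, of n k] r(1)[of "tet \<nu> n" "tet \<nu> k" "B \<nu>"] by auto
    next
      case 2
      then show ?thesis using mnk(4) B(2)[OF \<nu>, of m k] r(1)[of "tet \<nu> m" "tet \<nu> k" "B \<nu>"] r(2)[of "tet \<nu> m" "B \<nu>" "tet \<nu> k"] by auto
    next
      case 3
      then show ?thesis using mnk(4) B(2)[OF \<nu>, of m n] by auto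
    qed
  qed
  have gSC: "generic_flags (SC k)" if "k \<in> {..<tet_count K} \<times> UNIV" for k
    using that unfolding SC_def
    by (cases k) (auto intro!: generic_flags_conj generic_flags_all generic_flags_imp add_vertex good)
  have cI: "c k \<in> hyp3" if "k \<in> {..<tet_count K} \<times> UNIV" for k using c(1) that by (cases k) auto
  have "finite ({..<tet_count K} \<times> (UNIV :: 4 set))" by simp
  then obtain F where F: "\<And>k. k \<in> {..<tet_count K} \<times> UNIV \<Longrightarrow> F (c k) \<in> SC k" "\<And>x. x \<in> hyp3 \<Longrightarrow> F x \<in> flags"
    "\<And>g x. g \<in> \<Gamma> \<Longrightarrow> x \<in> hyp3 \<Longrightarrow> F (hyp_act g x) = flag_act (\<rho> g) (F x)"
    using equivariant_flags[of "{..<tet_count K} \<times> UNIV" c SC] cI gSC by blast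
  define C where "C \<nu> i = F (c (\<nu>, i))" for \<nu> i
  have C: "generic_tetrahedron ((tet \<nu>)(i := C \<nu> i))" "i \<noteq> j \<Longrightarrow> good_tetrahedron ((tet \<nu>)(i := B \<nu>, j := C \<nu> i))"
    if "\<nu> < tet_count K" for \<nu> i j
    using F(1)[of "(\<nu>, i)"] that unfolding SC_def C_def by auto
  \<comment> \<open>Centers of simplices, centers of faces and vertices lie in different orbits, because they have
    different numbers of vanishing coordinates, so that \<open>D'\<close> can be defined by cases.\<close>
  define over where "over X x \<longleftrightarrow> (\<exists>g \<nu> p. g \<in> \<Gamma> \<and> \<nu> < tet_count K \<and> p \<in> X \<and> x = ext_act g (lift \<nu> p))" for X x
  define D' where "D' x = (case x of Inr \<xi> \<Rightarrow> D (Inr \<xi>) | Inl y \<Rightarrow>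
     if over {simplex_center} x then E y else if over (range face_center) x then F y else D x)" for x
  have over_zero: "zero_count p = n" if o: "over X (ext_act g (lift \<nu> p))" and h: "g \<in> \<Gamma>" "\<nu> < tet_count K" "p \<in> simplex3"
      and X: "\<And>q. q \<in> X \<Longrightarrow> q \<in> simplex3 \<and> zero_count q = n" for X g \<nu> p n
  proof -
    obtain g' \<mu> q where "g' \<in> \<Gamma>" "\<mu> < tet_count K" "q \<in> X" "ext_act g (lift \<nu> p) = ext_act g' (lift \<mu> q)"
      using o unfolding over_def by blast
    then show ?thesis using orbit_zero_count[OF h(1) _ h(2) _ h(3), of g' \<mu> q] X by simp
  qed
  have D'_center: "D' (ext_act g (lift \<nu> simplex_center)) = flag_act (\<rho> g) (B \<nu>)" if "g \<in> \<Gamma>" "\<nu> < tet_count K" for g \<nu>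
  proof -
    have "over {simplex_center} (ext_act g (lift \<nu> simplex_center))" unfolding over_def using that by blast
    then show ?thesis using b[OF that(2)] E(3)[OF that(1)] by (simp add: D'_def ext_act_def B_def)
  qed
  have D'_face: "D' (ext_act g (lift \<nu> (face_center i))) = flag_act (\<rho> g) (C \<nu> i)" if "g \<in> \<Gamma>" "\<nu> < tet_count K" for g \<nu> i
  proof -
    have "over (range face_center) (ext_act g (lift \<nu> (face_center i)))" unfolding over_def using that by blast
    moreover have "\<not> over {simplex_center} (ext_act g (lift \<nu> (face_center i)))"
      using over_zero[OF _ that face_center_simplex, of "{simplex_center}" i 0] simplex_center_simplex zero_counts by auto
    ultimately show ?thesis using c[OF that(2), of i] F(3)[OF that(1)] by (simp add: D'_def ext_act_def C_def)
  qed
  have D'_vertex: "D' (ext_act g (lift \<nu> (vertex i))) = flag_act (\<rho> g) (tet \<nu> i)" if "g \<in> \<Gamma>" "\<nu> < tet_count K" for g \<nu> i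
  proof -
    have "\<not> over {simplex_center} (ext_act g (lift \<nu> (vertex i)))"
      using over_zero[OF _ that vertex_in_simplex, of "{simplex_center}" i 0] simplex_center_simplex zero_counts by auto
    moreover have "\<not> over (range face_center) (ext_act g (lift \<nu> (vertex i)))"
      using over_zero[OF _ that vertex_in_simplex, of "range face_center" i 1] face_center_simplex zero_counts by auto
    ultimately show ?thesis
      using D_translate[OF that, of i] by (cases "ext_act g (lift \<nu> (vertex i))") (simp_all add: D'_def)
  qed
  have B_flag: "B \<nu> \<in> flags" and C_flag: "C \<nu> i \<in> flags" if "\<nu> < tet_count K" for \<nu> i
    unfolding B_def C_def using E(2)[OF b(1)[OF that]] F(2)[OF c(1)[OF that]] .
  define sub where "sub \<nu> i j = (tet \<nu>)(i := B \<nu>, j := C \<nu> i)" for \<nu> i j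
  have D'_sub: "D' (ext_act g (lifted_simplex (subdivision K) (sub_number K (\<nu>, i, j)) (vertex m))) = flag_act (\<rho> g) (sub \<nu> i j m)"
    if "g \<in> \<Gamma>" "\<nu> < tet_count K" "i \<noteq> j" for g \<nu> i j m
  proof -
    consider "m = i" | "m = j" | "m \<noteq> i" "m \<noteq> j" by blast
    then show ?thesis
      unfolding subdivision_lift[OF that(2,3)] sub_def
      by cases (use that in \<open>auto simp: sub_map_vertices D'_center D'_face D'_vertex\<close>)
  qed
  have sub_flag: "sub \<nu> i j m \<in> flags" if "\<nu> < tet_count K" for \<nu> i j m
    using that B_flag C_flag tet_flag by (simp add: sub_def)
  interpret S: triangulated \<Gamma> "subdivision K" by unfold_locales (rule subdivision_ideal)
  have D'_sub1: "D' (lifted_simplex (subdivision K) (sub_number K (\<nu>, i, j)) (vertex m)) = sub \<nu> i j m"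
    if \<nu>: "\<nu> < tet_count K" "i \<noteq> j" for \<nu> i j m
  proof -
    have "\<rho> \<one>\<^bsub>PGL\<^esub> = \<one>\<^bsub>PGL\<^esub>" by (rule rho_one)
    then show ?thesis
      using D'_sub[OF one_in \<nu>, of m] ext_act_one[OF S.lift_in[OF sub_number_less[OF \<nu>] vertex_in_simplex]] flag_act_one[OF sub_flag[OF \<nu>(1)]]
      by simp
  qed
  have "developed \<Gamma> (subdivision K) \<rho> D'"
  proof unfold_locales
    show "\<rho> \<in> hom (PGL\<lparr>carrier := \<Gamma>\<rparr>) PGL" by (rule hom)
    fix e assume "e < tet_count (subdivision K)"
    then obtain \<nu> i j where s: "\<nu> < tet_count K" "i \<noteq> j" "e = sub_number K (\<nu>, i, j)" using sub_code_cases by metis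
    show "generic_tetrahedron (\<lambda>m. D' (lifted_simplex (subdivision K) e (vertex m)))"
      using C(2)[OF s(1,2)] unfolding s(3) D'_sub1[OF s(1,2)] sub_def good_tetrahedron_def by blast
  next
    fix g x assume g: "g \<in> \<Gamma>" and "x \<in> lifted_vertices \<Gamma> (subdivision K)"
    then obtain h e m where h: "h \<in> \<Gamma>" and e: "e < tet_count (subdivision K)"
      and x: "x = ext_act h (lifted_simplex (subdivision K) e (vertex m))"
      unfolding lifted_vertices_def by blast
    obtain \<nu> i j where s: "\<nu> < tet_count K" "i \<noteq> j" "e = sub_number K (\<nu>, i, j)" using sub_code_cases[OF e] by metis
    have "ext_act g x = ext_act (g \<otimes>\<^bsub>PGL\<^esub> h) (lifted_simplex (subdivision K) e (vertex m))"
      unfolding x using ext_act_mult[OF g h S.lift_in[OF e vertex_in_simplex]] by simp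
    then have "D' (ext_act g x) = flag_act (\<rho> (g \<otimes>\<^bsub>PGL\<^esub> h)) (sub \<nu> i j m)"
      using D'_sub[OF mult_in[OF g h] s(1,2)] s(3) by simp
    also have "\<rho> (g \<otimes>\<^bsub>PGL\<^esub> h) = \<rho> g \<otimes>\<^bsub>PGL\<^esub> \<rho> h" by (rule rho_mult[OF g h])
    also have "flag_act \<dots> (sub \<nu> i j m) = flag_act (\<rho> g) (flag_act (\<rho> h) (sub \<nu> i j m))"
      by (rule flag_act_mult[OF rho_in[OF g] rho_in[OF h] sub_flag[OF s(1)]])
    also have "flag_act (\<rho> h) (sub \<nu> i j m) = D' x" unfolding x s(3) by (rule D'_sub[OF h s(1,2), symmetric])
    finally show "D' (ext_act g x) = flag_act (\<rho> g) (D' x)" .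
  qed
  moreover have "\<exists>g\<in>carrier PGL. C \<mu> (\<pi> i) = flag_act g (C \<nu> i) \<and> (\<forall>j. j \<noteq> i \<longrightarrow> tet \<mu> (\<pi> j) = flag_act g (tet \<nu> j))"
    if \<nu>: "\<nu> < tet_count K" and pr: "pairing K \<nu> i = (\<mu>, \<pi>)" for \<nu> i \<mu> \<pi>
  proof -
    note v = valid_pairingD[OF valid \<nu> pr]
    obtain h where h: "h \<in> \<Gamma>"
      "\<And>p. p \<in> simplex3 \<Longrightarrow> p $ i = 0 \<Longrightarrow> lift \<mu> (permute_point \<pi> p) = ext_act h (lift \<nu> p)"
      using face_lift[OF \<nu> pr] by metis
    have "lift \<mu> (face_center (\<pi> i)) = ext_act h (lift \<nu> (face_center i))"
      using h(2)[OF face_center_simplex, of i] permute_face_center[OF v(2)] by (simp add: face_center_def)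
    then have "Inl (c (\<mu>, \<pi> i)) = (Inl (hyp_act h (c (\<nu>, i))) :: ext_point)" using c(2)[OF \<nu>] c(2)[OF v(1)] by (simp add: ext_act_def)
    then have "C \<mu> (\<pi> i) = flag_act (\<rho> h) (C \<nu> i)" unfolding C_def using F(3)[OF h(1) c(1)[OF \<nu>]] by simp
    moreover have "tet \<mu> (\<pi> j) = flag_act (\<rho> h) (tet \<nu> j)" if "j \<noteq> i" for j
    proof -
      have "lift \<mu> (vertex (\<pi> j)) = ext_act h (lift \<nu> (vertex j))"
        using h(2)[OF vertex_in_simplex, of j] that permute_point_vertex[OF v(2)] by (simp add: axis_def)
      then show ?thesis using D_translate[OF h(1) \<nu>] by (simp add: tet_def)
    qed
    ultimately show ?thesis using rho_in[OF h(1)] by blast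
  qed
  moreover have "D' (Inr \<xi>) = D (Inr \<xi>)" for \<xi> by (simp add: D'_def)
  ultimately show ?thesis using that[of D' B C] B(1) C D'_sub1 unfolding sub_def by presburger
qed

section \<open>Invariance under subdivision and duality\<close>

lemma bloch_sum_involution:
  assumes "finite X" "\<And>x. x \<in> X \<Longrightarrow> h x \<in> X" "\<And>x. x \<in> X \<Longrightarrow> h (h x) = x" "\<And>x. x \<in> X \<Longrightarrow> h x \<noteq> x"
    and "\<And>x. x \<in> X \<Longrightarrow> c x + c (h x) \<approx>\<^sub>B 0"
  shows "sum c X \<approx>\<^sub>B 0"
  using assms
proof (induction "card X" arbitrary: X rule: less_induct)
  case less
  show ?case
  proof (cases "X = {}")
    case False
    then obtain x where x: "x \<in> X" by blast
    let ?Y = "X - {x, h x}"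
    have hx: "h x \<in> X" "h x \<noteq> x" "h (h x) = x" using less.prems x by auto
    have "sum c ?Y \<approx>\<^sub>B 0"
    proof (rule less.hyps)
      show "card ?Y < card X" using x less.prems(1) by (intro psubset_card_mono) auto
      show "h y \<in> ?Y" if "y \<in> ?Y" for y using less.prems(2,3)[of y] hx that by auto
    qed (use less.prems in auto)
    moreover have "sum c X = (c x + c (h x)) + sum c ?Y"
      using sum.subset_diff[of "{x, h x}" X c] less.prems(1) x hx by (simp add: add.commute)
    ultimately show ?thesis using bloch_eq_add[OF less.prems(5)[OF x]] by fastforce
  qed simp
qed

text \<open>The faces of a triangulation come in pairs.\<close>

lemma bloch_sum_faces:
  assumes K: "valid_pairing K"
    and c: "\<And>\<nu> i \<mu> \<pi>. \<nu> < tet_count K \<Longrightarrow> pairing K \<nu> i = (\<mu>, \<pi>) \<Longrightarrow> c \<nu> i + c \<mu> (\<pi> i) \<approx>\<^sub>B 0"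
  shows "(\<Sum>\<nu><tet_count K. \<Sum>i\<in>UNIV. c \<nu> i) \<approx>\<^sub>B 0"
proof -
  define h where "h = (\<lambda>(\<nu>, i). case pairing K \<nu> i of (\<mu>, \<pi>) \<Rightarrow> (\<mu>, \<pi> i))"
  let ?X = "{..<tet_count K} \<times> (UNIV :: 4 set)"
  have h: "h x \<in> ?X \<and> h (h x) = x \<and> h x \<noteq> x \<and> case_prod c x + case_prod c (h x) \<approx>\<^sub>B 0" if x: "x \<in> ?X" for x
  proof -
    obtain \<nu> i where xi: "x = (\<nu>, i)" "\<nu> < tet_count K" using x by auto
    obtain \<mu> \<pi> where pr: "pairing K \<nu> i = (\<mu>, \<pi>)" by fastforce
    note v = valid_pairingD[OF K xi(2) pr]
    show ?thesis using v c[OF xi(2) pr] by (simp add: h_def xi(1) pr permutes_inverses[OF v(2)])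
  qed
  have "sum (case_prod c) ?X \<approx>\<^sub>B 0"
    by (rule bloch_sum_involution[where h = h]) (use h in auto)
  then show ?thesis by (simp add: sum.cartesian_product)
qed

context developed
begin

text \<open>Coning off the simplices from their centers, and the resulting simplices from the centers of
  the original faces, changes the sum only by terms for the original faces. These are odd
  under a change of orientation, and cancel in pairs.\<close>

lemma good_refinement:
  obtains K' D' where "developed \<Gamma> K' \<rho> D'" "\<And>\<xi>. D' (Inr \<xi>) = D (Inr \<xi>)"
    "\<And>e. e < tet_count K' \<Longrightarrow> good_tetrahedron (\<lambda>m. D' (lifted_simplex K' e (vertex m)))"
    "beta_decoration K' (\<lambda>e m. D' (lifted_simplex K' e (vertex m))) = beta_decoration K tet"
proof -
  obtain D' B C where R:
    "developed \<Gamma> (subdivision K) \<rho> D'" "\<And>\<xi>. D' (Inr \<xi>) = D (Inr \<xi>)"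
    "\<And>\<nu> i j. \<nu> < tet_count K \<Longrightarrow> i \<noteq> j \<Longrightarrow>
      (\<lambda>m. D' (lifted_simplex (subdivision K) (sub_number K (\<nu>, i, j)) (vertex m))) = (tet \<nu>)(i := B \<nu>, j := C \<nu> i)"
    "\<And>\<nu> i. \<nu> < tet_count K \<Longrightarrow> generic_tetrahedron ((tet \<nu>)(i := B \<nu>))"
    "\<And>\<nu> i. \<nu> < tet_count K \<Longrightarrow> generic_tetrahedron ((tet \<nu>)(i := C \<nu> i))"
    "\<And>\<nu> i j. \<nu> < tet_count K \<Longrightarrow> i \<noteq> j \<Longrightarrow> good_tetrahedron ((tet \<nu>)(i := B \<nu>, j := C \<nu> i))"
    "\<And>\<nu> i \<mu> \<pi>. \<nu> < tet_count K \<Longrightarrow> pairing K \<nu> i = (\<mu>, \<pi>) \<Longrightarrow>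
      \<exists>g\<in>carrier PGL. C \<mu> (\<pi> i) = flag_act g (C \<nu> i) \<and> (\<forall>j. j \<noteq> i \<longrightarrow> tet \<mu> (\<pi> j) = flag_act g (tet \<nu> j))"
    by (rule refinement) blast
  let ?T = "\<lambda>e m. D' (lifted_simplex (subdivision K) e (vertex m))"
  have faces: "(\<Sum>\<nu><tet_count K. \<Sum>i\<in>UNIV. beta_chain ((tet \<nu>)(i := C \<nu> i))) \<approx>\<^sub>B 0"
  proof (rule bloch_sum_faces[OF valid])
    fix \<nu> i \<mu> \<pi> assume \<nu>: "\<nu> < tet_count K" and pr: "pairing K \<nu> i = (\<mu>, \<pi>)"
    note v = valid_pairingD[OF valid \<nu> pr]
    obtain g where g: "g \<in> carrier PGL" "C \<mu> (\<pi> i) = flag_act g (C \<nu> i)" "\<And>j. j \<noteq> i \<Longrightarrow> tet \<mu> (\<pi> j) = flag_act g (tet \<nu> j)"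
      using R(7)[OF \<nu> pr] by blast
    have "((tet \<mu>)(\<pi> i := C \<mu> (\<pi> i))) \<circ> \<pi> = (\<lambda>j. flag_act g (((tet \<nu>)(i := C \<nu> i)) j))"
      using g permutes_4_distinct[OF v(2)] by (auto simp: fun_eq_iff)
    moreover have "beta_chain (\<lambda>j. flag_act g (((tet \<nu>)(i := C \<nu> i)) j)) = beta_chain ((tet \<nu>)(i := C \<nu> i))"
      by (rule beta_chain_act[OF g(1)]) (use R(5)[OF \<nu>] in \<open>auto simp: generic_tetrahedron_iff\<close>)
    ultimately have "beta_chain ((tet \<nu>)(i := C \<nu> i)) \<approx>\<^sub>B - beta_chain ((tet \<mu>)(\<pi> i := C \<mu> (\<pi> i)))"
      using beta_chain_odd[OF R(5)[OF v(1)] v(2,3), of "\<pi> i"] by simp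
    then show "beta_chain ((tet \<nu>)(i := C \<nu> i)) + beta_chain ((tet \<mu>)(\<pi> i := C \<mu> (\<pi> i))) \<approx>\<^sub>B 0"
      by (simp add: bloch_eq_def)
  qed
  have cone: "beta_chain (tet \<nu>) \<approx>\<^sub>B (\<Sum>i\<in>UNIV. beta_chain ((tet \<nu>)(i := C \<nu> i)) +
      (\<Sum>j\<in>UNIV - {i}. beta_chain ((tet \<nu>)(i := B \<nu>, j := C \<nu> i))))" if \<nu>: "\<nu> < tet_count K" for \<nu>
  proof -
    have "beta_chain (tet \<nu>) \<approx>\<^sub>B (\<Sum>i\<in>UNIV. beta_chain ((tet \<nu>)(i := B \<nu>)))"
      by (rule beta_chain_subdivide[OF generic_tet[OF \<nu>] R(4)[OF \<nu>]])
    also have "\<dots> \<approx>\<^sub>B (\<Sum>i\<in>UNIV. \<Sum>j\<in>UNIV. beta_chain ((tet \<nu>)(i := B \<nu>, j := C \<nu> i)))"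
    proof (rule bloch_eq_sum, rule beta_chain_subdivide[OF R(4)[OF \<nu>]])
      fix i j show "generic_tetrahedron ((tet \<nu>)(i := B \<nu>, j := C \<nu> i))"
        using R(5,6)[OF \<nu>, of i] unfolding good_tetrahedron_def by (cases "j = i") auto
    qed
    also have "\<dots> = (\<Sum>i\<in>UNIV. beta_chain ((tet \<nu>)(i := C \<nu> i)) +
      (\<Sum>j\<in>UNIV - {i}. beta_chain ((tet \<nu>)(i := B \<nu>, j := C \<nu> i))))"
    proof (rule sum.cong[OF refl])
      fix i
      show "(\<Sum>j\<in>UNIV. beta_chain ((tet \<nu>)(i := B \<nu>, j := C \<nu> i))) = beta_chain ((tet \<nu>)(i := C \<nu> i)) +
          (\<Sum>j\<in>UNIV - {i}. beta_chain ((tet \<nu>)(i := B \<nu>, j := C \<nu> i)))"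
        using sum.remove[of UNIV i "\<lambda>j. beta_chain ((tet \<nu>)(i := B \<nu>, j := C \<nu> i))"] by simp
    qed
    finally show ?thesis .
  qed
  have index: "sub_index K = (SIGMA \<nu>:{..<tet_count K}. SIGMA i:UNIV. UNIV - {i})" by (auto simp: sub_index_def)
  have "(\<Sum>\<nu><tet_count K. beta_chain (tet \<nu>)) \<approx>\<^sub>B
      (\<Sum>\<nu><tet_count K. \<Sum>i\<in>UNIV. beta_chain ((tet \<nu>)(i := C \<nu> i))) +
      (\<Sum>\<nu><tet_count K. \<Sum>i\<in>UNIV. \<Sum>j\<in>UNIV - {i}. beta_chain ((tet \<nu>)(i := B \<nu>, j := C \<nu> i)))"
    unfolding sum.distrib[symmetric] by (rule bloch_eq_sum, rule cone) simp
  also have "\<dots> \<approx>\<^sub>B 0 + (\<Sum>\<nu><tet_count K. \<Sum>i\<in>UNIV. \<Sum>j\<in>UNIV - {i}. beta_chain ((tet \<nu>)(i := B \<nu>, j := C \<nu> i)))"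
    by (rule bloch_eq_add[OF faces bloch_eq_refl])
  also have "\<dots> = (\<Sum>(\<nu>, i, j)\<in>sub_index K. beta_chain ((tet \<nu>)(i := B \<nu>, j := C \<nu> i)))"
    unfolding index by (simp add: sum.Sigma)
  also have "\<dots> = (\<Sum>x\<in>sub_index K. beta_chain (?T (sub_number K x)))"
    by (rule sum.cong[OF refl]) (auto simp: sub_index_iff R(3))
  also have "\<dots> = (\<Sum>e\<in>{0..<card (sub_index K)}. beta_chain (?T (sub_number K (sub_code K e))))"
    by (rule sum.reindex_bij_betw[OF bij_sub_code, symmetric])
  also have "\<dots> = (\<Sum>e<tet_count (subdivision K). beta_chain (?T e))"
    by (rule sum.cong) (auto simp: sub_number_code, auto simp: subdivision_def)
  finally have "beta_decoration (subdivision K) ?T = beta_decoration K tet"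
    unfolding beta_decoration_chain by (rule pre_Bloch_class_cong[symmetric])
  moreover have "good_tetrahedron (?T e)" if "e < tet_count (subdivision K)" for e
    using sub_code_cases[OF that] R(3,6) by metis
  ultimately show ?thesis using that[OF R(1,2)] by blast
qed

text \<open>Each tetrahedron differs from its dual by its four face terms, and these cancel in pairs.\<close>

lemma beta_decoration_dual:
  assumes good: "\<And>\<nu>. \<nu> < tet_count K \<Longrightarrow> good_tetrahedron (tet \<nu>)"
  shows "beta_decoration K (\<lambda>\<nu> i. dual_flag (tet \<nu> i)) = beta_decoration K tet"
proof -
  have "(\<Sum>\<nu><tet_count K. \<Sum>i\<in>UNIV. face_term (tet \<nu>) i) \<approx>\<^sub>B 0"
  proof (rule bloch_sum_faces[OF valid])
    fix \<nu> i \<mu> \<pi> assume \<nu>: "\<nu> < tet_count K" and pr: "pairing K \<nu> i = (\<mu>, \<pi>)"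
    obtain g where g: "g \<in> carrier PGL" "\<And>j. j \<noteq> i \<Longrightarrow> tet \<mu> (\<pi> j) = flag_act g (tet \<nu> j)"
      using tet_glue[OF \<nu> pr] by metis
    show "face_term (tet \<nu>) i + face_term (tet \<mu>) (\<pi> i) \<approx>\<^sub>B 0"
      by (rule face_term_cancel[OF generic_tet[OF \<nu>] g(1) valid_pairingD(2,3)[OF valid \<nu> pr] g(2)])
        (use face_ratio_neq_minus_one good[OF \<nu>] in \<open>auto simp: good_tetrahedron_def\<close>)
  qed
  moreover have "(\<Sum>\<nu><tet_count K. beta_chain (tet \<nu>) - beta_chain (\<lambda>i. dual_flag (tet \<nu> i)))
      \<approx>\<^sub>B (\<Sum>\<nu><tet_count K. \<Sum>i\<in>UNIV. face_term (tet \<nu>) i)"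
  proof (rule bloch_eq_sum)
    fix \<nu> assume "\<nu> \<in> {..<tet_count K}"
    then have "good_tetrahedron (tet \<nu>)" using good by simp
    then show "beta_chain (tet \<nu>) - beta_chain (\<lambda>i. dual_flag (tet \<nu> i)) \<approx>\<^sub>B (\<Sum>i\<in>UNIV. face_term (tet \<nu>) i)"
      unfolding good_tetrahedron_def using distinct_4 by (intro beta_chain_dual) auto
  qed
  ultimately have "(\<Sum>\<nu><tet_count K. beta_chain (tet \<nu>)) - (\<Sum>\<nu><tet_count K. beta_chain (\<lambda>i. dual_flag (tet \<nu> i))) \<approx>\<^sub>B 0"
    unfolding sum_subtractf by (rule bloch_eq_trans[rotated])
  then have "(\<Sum>\<nu><tet_count K. beta_chain (tet \<nu>)) \<approx>\<^sub>B (\<Sum>\<nu><tet_count K. beta_chain (\<lambda>i. dual_flag (tet \<nu> i)))"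
    by (simp add: bloch_eq_def)
  then show ?thesis unfolding beta_decoration_chain by (rule pre_Bloch_class_cong[symmetric])
qed

end

lemma transpose_inverse_mult:
  assumes "g \<in> carrier PGL" "h \<in> carrier PGL"
  shows "transpose_inverse (g \<otimes>\<^bsub>PGL\<^esub> h) = transpose_inverse g \<otimes>\<^bsub>PGL\<^esub> transpose_inverse h"
proof -
  obtain A B where *: "invertible A" "g = pgl A" "invertible B" "h = pgl B"
    using assms unfolding carrier_PGL by auto
  have t: "invertible (transpose A)" "invertible (transpose B)" using * invertible_transpose by blast+
  show ?thesis
    using * t by (simp add: mult_PGL transpose_inverse_pgl invertible_compose invertible_matrix_inv
        matrix_transpose_mul matrix_inv_compose)
qed

lemma (in developed) dual_developed:
  assumes good: "\<And>\<nu>. \<nu> < tet_count K \<Longrightarrow> good_tetrahedron (tet \<nu>)"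
    and dual: "\<And>g. g \<in> \<Gamma> \<Longrightarrow> \<rho>' g = transpose_inverse (\<rho> g)"
  shows "developed \<Gamma> K \<rho>' (\<lambda>x. dual_flag (D x))"
proof unfold_locales
  have "\<rho>' (g \<otimes>\<^bsub>PGL\<^esub> h) = \<rho>' g \<otimes>\<^bsub>PGL\<^esub> \<rho>' h" if "g \<in> \<Gamma>" "h \<in> \<Gamma>" for g h
    using that by (simp add: dual mult_in rho_mult transpose_inverse_mult rho_in)
  moreover have "\<rho>' g \<in> carrier PGL" if "g \<in> \<Gamma>" for g
    unfolding dual[OF that] by (rule transpose_inverse_in_PGL[OF rho_in[OF that]])
  ultimately show "\<rho>' \<in> hom (PGL\<lparr>carrier := \<Gamma>\<rparr>) PGL" unfolding hom_def by auto
  show "dual_flag (D (ext_act g x)) = flag_act (\<rho>' g) (dual_flag (D x))"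
    if g: "g \<in> \<Gamma>" and x: "x \<in> lifted_vertices \<Gamma> K" for g x
  proof -
    obtain h \<nu> i where "h \<in> \<Gamma>" "\<nu> < tet_count K" "x = ext_act h (lift \<nu> (vertex i))"
      using x unfolding lifted_vertices_def by blast
    then have "D x \<in> flags" using D_translate flag_act_in_flags rho_in tet_flag by simp
    then show ?thesis using equivariant[OF g x] dual_flag_act[OF rho_in[OF g]] dual[OF g] by simp
  qed
  show "generic_tetrahedron (\<lambda>i. dual_flag (D (lift \<nu> (vertex i))))" if "\<nu> < tet_count K" for \<nu>
    using good[OF that] unfolding good_tetrahedron_def tet_def by blast
qed

text \<open>Dualizing a decoration need not give a generic one, but dualizing a good refinement of it does.\<close>

lemma dual_decoration_exists:
  assumes \<Gamma>: "kleinian \<Gamma>" and K: "ideal_triangulation \<Gamma> K" and T: "parabolic_decoration K T"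
    and \<rho>: "\<rho> \<in> hom (PGL\<lparr>carrier := \<Gamma>\<rparr>) PGL" "has_holonomy \<Gamma> K T \<rho> F"
    and dual: "\<And>g. g \<in> \<Gamma> \<Longrightarrow> \<rho>' g = transpose_inverse (\<rho> g)" "\<And>\<xi>. F' \<xi> = dual_flag (F \<xi>)"
  obtains K' T' where "ideal_triangulation \<Gamma> K'" "parabolic_decoration K' T'" "has_holonomy \<Gamma> K' T' \<rho>' F'"
    "beta_decoration K' T' = beta_decoration K T"
proof -
  obtain D where D: "\<And>g \<nu>. g \<in> \<Gamma> \<Longrightarrow> \<nu> < tet_count K \<Longrightarrow> \<exists>A\<in>carrier PGL. \<forall>i.
        D (ext_act g (lifted_simplex K \<nu> (vertex i))) = flag_act A (T \<nu> i)"
     "\<And>g v. g \<in> \<Gamma> \<Longrightarrow> v \<in> lifted_vertices \<Gamma> K \<Longrightarrow> D (ext_act g v) = flag_act (\<rho> g) (D v)"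
     "\<And>\<xi>. \<xi> \<in> lifted_cusps \<Gamma> \<Longrightarrow> D (Inr \<xi>) = F \<xi>"
    using \<rho>(2) unfolding has_holonomy_def by blast
  interpret kleinian \<Gamma> by fact
  interpret triangulated \<Gamma> K by unfold_locales fact
  have T': "generic_tetrahedron (T \<nu>)" if "\<nu> < tet_count K" for \<nu> using T that unfolding parabolic_decoration_def by blast
  have move: "\<exists>A\<in>carrier PGL. (\<lambda>i. D (lift \<nu> (vertex i))) = (\<lambda>i. flag_act A (T \<nu> i))" if \<nu>: "\<nu> < tet_count K" for \<nu>
    using D(1)[OF one_in \<nu>] ext_act_one[OF lift_in[OF \<nu> vertex_in_simplex]] by auto
  interpret D: developed \<Gamma> K \<rho> D
  proof unfold_locales
    show "generic_tetrahedron (\<lambda>i. D (lift \<nu> (vertex i)))" if "\<nu> < tet_count K" for \<nu>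
      using move[OF that] generic_tetrahedron_act T'[OF that] by auto
  qed (use D \<rho>(1) in auto)
  have "beta_chain (D.tet \<nu>) = beta_chain (T \<nu>)" if \<nu>: "\<nu> < tet_count K" for \<nu>
  proof -
    obtain A where A: "A \<in> carrier PGL" "D.tet \<nu> = (\<lambda>i. flag_act A (T \<nu> i))"
      using move[OF \<nu>] unfolding D.tet_def[abs_def] by blast
    show ?thesis unfolding A(2) by (rule beta_chain_act[OF A(1)]) (use T'[OF \<nu>] in \<open>auto simp: generic_tetrahedron_iff\<close>)
  qed
  then have T_beta: "beta_decoration K D.tet = beta_decoration K T" unfolding beta_decoration_chain by simp
  obtain K' D' where R: "developed \<Gamma> K' \<rho> D'" "\<And>\<xi>. D' (Inr \<xi>) = D (Inr \<xi>)"
    "\<And>e. e < tet_count K' \<Longrightarrow> good_tetrahedron (\<lambda>m. D' (lifted_simplex K' e (vertex m)))"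
    "beta_decoration K' (\<lambda>e m. D' (lifted_simplex K' e (vertex m))) = beta_decoration K D.tet"
    by (rule D.good_refinement) blast
  interpret R: developed \<Gamma> K' \<rho> D' by (rule R(1))
  have good: "good_tetrahedron (R.tet e)" if "e < tet_count K'" for e
    using R(3)[OF that] unfolding R.tet_def[abs_def] .
  interpret S: developed \<Gamma> K' \<rho>' "\<lambda>x. dual_flag (D' x)" by (rule R.dual_developed[OF good dual(1)])
  have "S.tet = (\<lambda>\<nu> i. dual_flag (R.tet \<nu> i))" by (simp add: fun_eq_iff S.tet_def R.tet_def)
  then have "beta_decoration K' S.tet = beta_decoration K T"
    using R.beta_decoration_dual[OF good] R(4) T_beta unfolding R.tet_def[abs_def] by simp
  moreover have "has_holonomy \<Gamma> K' S.tet \<rho>' F'"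
    by (rule S.holonomy) (simp add: R(2) D(3) dual(2))
  ultimately show ?thesis using that R.ideal S.parabolic by blast
qed

theorem theorem5p4:
  fixes \<Gamma> :: "(complex^2^2) set set"
    and \<rho> :: "(complex^2^2) set \<Rightarrow> (complex^3^3) set"
    and F :: "(complex^2) set \<Rightarrow> flag"
  assumes "cusped_hyperbolic_manifold \<Gamma>"
    and "decorated_representation \<Gamma> \<rho> F"
  shows "beta \<Gamma> \<rho> F = beta \<Gamma> (dual_rep \<rho>) (dual_decoration F)"
proof -
  \<comment> \<open>The two values are described by one and the same property: duality exchanges the decorations with
    the two given holonomies up to refinement, which does not affect their invariants.\<close>
  interpret kleinian \<Gamma> by (rule cusped_kleinian[OF assms(1)])
  have hom: "\<rho> \<in> hom (PGL\<lparr>carrier := \<Gamma>\<rparr>) PGL" using assms(2) unfolding decorated_representation_def by blast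
  then have \<rho>: "\<rho> g \<in> carrier PGL" if "g \<in> \<Gamma>" for g using that unfolding hom_def by auto
  have hom': "dual_rep \<rho> \<in> hom (PGL\<lparr>carrier := \<Gamma>\<rparr>) PGL"
    using hom \<rho> unfolding hom_def by (auto simp: dual_rep_def transpose_inverse_in_PGL transpose_inverse_mult Pi_iff)
  have "(\<exists>K T. ideal_triangulation \<Gamma> K \<and> parabolic_decoration K T \<and> has_holonomy \<Gamma> K T \<rho> F \<and> b = beta_decoration K T) \<longleftrightarrow>
    (\<exists>K T. ideal_triangulation \<Gamma> K \<and> parabolic_decoration K T \<and>
       has_holonomy \<Gamma> K T (dual_rep \<rho>) (dual_decoration F) \<and> b = beta_decoration K T)" (is "?L \<longleftrightarrow> ?R") for b
  proof
    assume ?L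
    then obtain K T where *: "ideal_triangulation \<Gamma> K" "parabolic_decoration K T" "has_holonomy \<Gamma> K T \<rho> F"
      "b = beta_decoration K T" by blast
    obtain K' T' where "ideal_triangulation \<Gamma> K'" "parabolic_decoration K' T'"
      "has_holonomy \<Gamma> K' T' (dual_rep \<rho>) (dual_decoration F)" "beta_decoration K' T' = beta_decoration K T"
      by (rule dual_decoration_exists[OF kleinian_axioms *(1,2) hom *(3), of "dual_rep \<rho>" "dual_decoration F"])
        (simp_all add: dual_rep_def dual_decoration_def)
    then show ?R using *(4) by metis
  next
    assume ?R
    then obtain K T where *: "ideal_triangulation \<Gamma> K" "parabolic_decoration K T"
      "has_holonomy \<Gamma> K T (dual_rep \<rho>) (dual_decoration F)" "b = beta_decoration K T" by blast
    obtain K' T' where "ideal_triangulation \<Gamma> K'" "parabolic_decoration K' T'"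
      "has_holonomy \<Gamma> K' T' \<rho> F" "beta_decoration K' T' = beta_decoration K T"
      by (rule dual_decoration_exists[OF kleinian_axioms *(1,2) hom' *(3), of \<rho> F])
        (simp_all add: dual_rep_def dual_decoration_def transpose_inverse_involution \<rho>)
    then show ?L using *(4) by metis
  qed
  then show ?thesis unfolding beta_def by presburger
qed

end
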